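(* Let $\mathcal W=[0,1]$, let $B\in(0,\infty)$, $M\in(0,\infty)$ and $\alpha_{0,1},\alpha_{0,2}>1/2$, and let $\mathcal B=[-B,B]$. Suppose: (i) $E_{P_0}[Y|X,W]=X\beta_0+\eta_0(W)$ and $\mathrm{Var}_{P_0}[Y|X,W]=\sigma_{01}^2$ for some $(\beta_0,\eta_0,\sigma_{01}^2)\in\mathcal B\times\mathcal H\times(0,\infty)$, with $\mathcal H\subseteq L^2(\mathcal W)$, and moreover $\beta_0\in(-B,B)$. (ii) There are constants $0<\underline c<\overline c<\infty$ with $E_{P_0}[(X-m_{02}(W))^2]\in[\underline c,\overline c]$. (iii) The conditional distribution of $(Y,X)'$ given $W$ has a density $p_{0,YX|W}$ with respect to Lebesgue measure and $E_{P_0}|\log p_{0,YX|W}(Y,X|W)|\in(0,\infty)$. (iv) $E_{P_0}[(Y-m_{01}(W))^2]\in(0,\infty)$ and $E_{P_0}[(X-m_{02}(W))^4]\in(0,\infty)$. (v) $\varepsilon=(Y-m_{01}(W),X-m_{02}(W))'$ is subgaussian conditional on $W$ and its conditional distribution is continuous in $W$. (vi) The marginal distribution of $W$ has a Lebesgue density on $[0,1]$ that is bounded away from zero and infinity. (vii) $m_0=(m_{01},m_{02})\in\mathcal M_1\times\mathcal M_2$, where $\mathcal M_j=\{f\in L^2([0,1]):\|f\|_{\infty,\infty,\alpha_{0,j}}\le M\}$ for $j\in\{1,2\}$. Let the prior be $\Pi=\Pi_{\mathcal B}\otimes\Pi_{\mathcal M}$, where $\Pi_{\mathcal B}$ is the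 uniform distribution on $[-B,B]$ and $\Pi_{\mathcal M}=\Pi_{\mathcal M_1}\otimes\Pi_{\mathcal M_2}$, with $\Pi_{\mathcal M_j}$ the law of the uniform wavelet series $$m_j=\sum_{l=0}^\infty\sum_{k=0}^{2^l-1}2^{-l(\alpha_{0,j}+1/2)}\nu_{lk,j}\psi_{lk},\qquad \nu_{lk,j}\ \text{i.i.d. (across }l,k,j)\ \text{uniform on }[-M,M].$$ Then, with $$\tilde I_n(m_0)=\frac1n\sum_{i=1}^n\left(\frac{X_i-m_{02}(w_i)}{\sigma_{01}}\right)^2,\qquad \tilde\ell_n(\beta_0,m_0)=\frac1{\sigma_{01}^2}\sum_{i=1}^n(Y_i-m_{01}(w_i)-(X_i-m_{02}(w_i))\beta_0)(X_i-m_{02}(w_i))$$ and $\tilde\Delta_{n,0}=\tilde I_n(m_0)^{-1}n^{-1/2}\tilde\ell_n(\beta_0,m_0)$, for $P_{0,W}^\infty$-almost every fixed realization $\{w_i\}_{i\ge1}$ of $\{W_i\}_{i\ge1}$, as $n\to\infty$, $$\left\|\Pi(\beta\in\cdot\,|\,\{(Y_i,X_i,w_i')'\}_{i=1}^n)-\mathcal N\left(\beta_0+\frac{\tilde\Delta_{n,0}}{\sqrt n},\frac1n\tilde I_n(m_0)^{-1}\right)\right\|_{TV}\to0\quad\text{in }P_{0,YX|W}^{(n)}\text{-probability}.$$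
   Context: Data. $(Y,X,W)$ has law $P_0$, $Y,X$ real-valued, $W\in[0,1]$. The sequence $\{(Y_i,X_i,W_i)\}_{i\ge1}$ is i.i.d. from $P_0$; $P_{0,W}^\infty$ is the law of $\{W_i\}_{i\ge1}$. $L^2(\mathcal W)$ is the set of $f$ with $E_{P_0}[f^2(W)]<\infty$. $m_{01}(W)=E_{P_0}[Y|W]$, $m_{02}(W)=E_{P_0}[X|W]$, $m_0=(m_{01},m_{02})$. For a fixed realization $\{w_i\}$, $P_{0,YX|W}^{(n)}=\bigotimes_{i=1}^nP_{0,YX|w_i}$, where $P_{0,YX|w}$ is the conditional law of $(Y,X)'$ given $W=w$. Model. $\sigma_{01}^2,\sigma_{02}^2\in(0,\infty)$ are known, with $\sigma_{01}^2=\mathrm{Var}_{P_0}[Y|X,W]$ and $\sigma_{02}^2$ arbitrary fixed. Parameters $\beta\in\mathcal B$, $m=(m_1,m_2)\in\mathcal M=\mathcal M_1\times\mathcal M_2$. The (quasi-)likelihood is $L_n(\beta,m)=\prod_{i=1}^np_{\beta,m}(Y_i,X_i|W_i)$, where $p_{\beta,m}(\cdot|w)$ is the density of the bivariate normal with mean $(m_1(w),m_2(w))'$ and covariance $$V(\beta)=\begin{pmatrix}\sigma_{01}^2+\sigma_{02}^2\beta^2&\beta\sigma_{02}^2\\\beta\sigma_{02}^2&\sigma_{02}^2\end{pmatrix}$$ (the true conditional law of $(Y,X)'$ given $W$ need not be Gaussian). The posterior is $\Pi((\beta,m)\in A|\text{data})=\int_AL_n\,d\Pi/\int_{\mathcal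 B\times\mathcal M}L_n\,d\Pi$, and $\Pi(\beta\in\cdot|\text{data})$ is its $\beta$-marginal. $\|P-Q\|_{TV}=\sup_A|P(A)-Q(A)|$. Wavelets and function spaces. $\{\psi_{lk}:l\ge0,0\le k\le2^l-1\}$ is a boundary-adapted orthonormal wavelet basis of $L^2([0,1])$ (for instance the Cohen–Daubechies–Vial basis) that is sufficiently regular to characterize the Hölder–Zygmund spaces $B_{\infty,\infty}^\alpha([0,1])$ for $\alpha\in\{\alpha_{0,1},\alpha_{0,2}\}$, meaning that the norm of $B_{\infty,\infty}^\alpha([0,1])$ is $$\|f\|_{\infty,\infty,\alpha}=\sup_{l\ge0}\max_{0\le k\le2^l-1}2^{l(\alpha+1/2)}|\langle f,\psi_{lk}\rangle_2|.$$ *)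

theory Defs
  imports "HOL-Probability.Probability"
begin

section \<open>Data distribution\<close>

text \<open>An observation is a triple \<open>(Y, X, W)\<close>; its law is a measure on \<open>real \<times> real \<times> real\<close>.\<close>

abbreviation Y_of :: "real \<times> real \<times> real \<Rightarrow> real" where
  "Y_of z \<equiv> fst z"

abbreviation X_of :: "real \<times> real \<times> real \<Rightarrow> real" where
  "X_of z \<equiv> fst (snd z)"

abbreviation W_of :: "real \<times> real \<times> real \<Rightarrow> real" where
  "W_of z \<equiv> snd (snd z)"

definition cond_exp_given ::
    "'a measure \<Rightarrow> ('a \<Rightarrow> real) \<Rightarrow> ('a \<Rightarrow> 'b::topological_space) \<Rightarrow> 'a \<Rightarrow> real" where
  "cond_exp_given P U V = real_cond_exp P (vimage_algebra (space P) V borel) U"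

definition cond_var_given ::
    "'a measure \<Rightarrow> ('a \<Rightarrow> real) \<Rightarrow> ('a \<Rightarrow> 'b::topological_space) \<Rightarrow> 'a \<Rightarrow> real" where
  "cond_var_given P U V =
     cond_exp_given P (\<lambda>\<omega>. (U \<omega> - cond_exp_given P U V \<omega>)\<^sup>2) V"

text \<open>\<open>K\<close> is a version of the regular conditional law of \<open>U\<close> given \<open>V\<close>.\<close>

definition is_cond_law ::
    "'a measure \<Rightarrow> ('a \<Rightarrow> 'u::topological_space) \<Rightarrow> ('a \<Rightarrow> 'v::topological_space) \<Rightarrow>
      ('v \<Rightarrow> 'u measure) \<Rightarrow> bool" where
  "is_cond_law P U V K \<longleftrightarrow>
     K \<in> measurable borel (prob_algebra borel) \<and>
     (\<forall>A\<in>sets borel. \<forall>C\<in>sets borel.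
        emeasure P {\<omega>\<in>space P. U \<omega> \<in> A \<and> V \<omega> \<in> C}
          = (\<integral>\<^sup>+ v\<in>C. emeasure (K v) A \<partial>distr P borel V))"

text \<open>Continuity of \<open>w \<mapsto> K w\<close> for the topology of weak convergence.\<close>

definition weakly_continuous_on :: "real set \<Rightarrow> (real \<Rightarrow> (real \<times> real) measure) \<Rightarrow> bool" where
  "weakly_continuous_on S K \<longleftrightarrow>
     (\<forall>f :: real \<times> real \<Rightarrow> real. continuous_on UNIV f \<and> bounded (range f) \<longrightarrow>
        continuous_on S (\<lambda>w. \<integral>e. f e \<partial>K w))"

text \<open>Subgaussianity with a variance proxy that does not depend on the conditioning value.\<close>

definition subgaussian_on :: "real set \<Rightarrow> (real \<Rightarrow> (real \<times> real) measure) \<Rightarrow> bool" where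
  "subgaussian_on S K \<longleftrightarrow>
     (\<exists>s>0. \<forall>w\<in>S. \<forall>t :: real \<times> real.
        (\<integral>\<^sup>+ e. ennreal (exp (t \<bullet> e)) \<partial>K w) \<le> ennreal (exp (s\<^sup>2 * (norm t)\<^sup>2 / 2)))"

definition L2_W :: "(real \<times> real \<times> real) measure \<Rightarrow> (real \<Rightarrow> real) set" where
  "L2_W P = {f \<in> borel_measurable borel. integrable P (\<lambda>z. (f (W_of z))\<^sup>2)}"


section \<open>Wavelets and function spaces on the unit interval\<close>

abbreviation lborel01 :: "real measure" where
  "lborel01 \<equiv> restrict_space lborel {0..1}"

definition L2_01 :: "(real \<Rightarrow> real) set" where
  "L2_01 = {f \<in> borel_measurable lborel01. integrable lborel01 (\<lambda>x. (f x)\<^sup>2)}"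

definition inner_01 :: "(real \<Rightarrow> real) \<Rightarrow> (real \<Rightarrow> real) \<Rightarrow> real" where
  "inner_01 f g = (LINT x|lborel01. f x * g x)"

text \<open>
  A wavelet system is a family \<open>\<psi> l k\<close>, of which only the members with \<open>k < 2 ^ l\<close> matter
  (and only their values on the unit interval). The last clause is the usual localization
  property of wavelets (bounded overlap of the supports at scale \<open>2\<^sup>-\<^sup>l\<close> together with
  sup-norms of order \<open>2\<^sup>l\<^sup>/\<^sup>2\<close>). The clauses impose no dilation/translation structure, so that
  the edge functions, and the scaling functions at the coarsest level, may be enumerated in
  any way within the index set.
\<close>

definition wavelet_basis_01 :: "(nat \<Rightarrow> nat \<Rightarrow> real \<Rightarrow> real) \<Rightarrow> bool" where
  "wavelet_basis_01 \<psi> \<longleftrightarrow>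
     (\<forall>l. \<forall>k<2^l. continuous_on {0..1} (\<psi> l k)) \<and>
     (\<forall>l l'. \<forall>k<2^l. \<forall>k'<2^l'.
        inner_01 (\<psi> l k) (\<psi> l' k') = (if l = l' \<and> k = k' then 1 else 0)) \<and>
     (\<forall>f\<in>L2_01. (\<forall>l. \<forall>k<2^l. inner_01 f (\<psi> l k) = 0) \<longrightarrow> (AE x in lborel01. f x = 0)) \<and>
     (\<exists>C. \<forall>l. \<forall>x\<in>{0..1}. (\<Sum>k<2^l. \<bar>\<psi> l k x\<bar>) \<le> C * 2 powr (real l / 2))"

definition wavelet_norm ::
    "(nat \<Rightarrow> nat \<Rightarrow> real \<Rightarrow> real) \<Rightarrow> real \<Rightarrow> (real \<Rightarrow> real) \<Rightarrow> ennreal" where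
  "wavelet_norm \<psi> \<alpha> f =
     (SUP l. SUP k\<in>{..<2^l}. ennreal (2 powr (real l * (\<alpha> + 1/2)) * \<bar>inner_01 f (\<psi> l k)\<bar>))"

text \<open>
  The intrinsic Hoelder-Zygmund norm of order \<open>\<alpha> > 0\<close>, via finite differences of order
  \<open>\<lfloor>\<alpha>\<rfloor> + 1\<close> (for integer \<open>\<alpha>\<close> this is the Zygmund and not the Lipschitz condition). An element of
  \<open>L\<^sup>2\<close> is given the norm of its best representative.
\<close>

definition finite_diff :: "nat \<Rightarrow> real \<Rightarrow> (real \<Rightarrow> real) \<Rightarrow> real \<Rightarrow> real" where
  "finite_diff r h f x = (\<Sum>i\<le>r. (-1) ^ (r - i) * real (r choose i) * f (x + real i * h))"

definition hz_norm_fun :: "real \<Rightarrow> (real \<Rightarrow> real) \<Rightarrow> ennreal" where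
  "hz_norm_fun \<alpha> f =
     (let r = Suc (nat \<lfloor>\<alpha>\<rfloor>) in
       (SUP x\<in>{0..1}. ennreal \<bar>f x\<bar>) +
       (SUP (h, x)\<in>{(h, x). 0 < h \<and> 0 \<le> x \<and> x + real r * h \<le> 1}.
          ennreal (\<bar>finite_diff r h f x\<bar> / h powr \<alpha>)))"

definition hz_norm :: "real \<Rightarrow> (real \<Rightarrow> real) \<Rightarrow> ennreal" where
  "hz_norm \<alpha> f = (INF g\<in>{g\<in>L2_01. AE x in lborel01. g x = f x}. hz_norm_fun \<alpha> g)"

definition characterizes_hz :: "(nat \<Rightarrow> nat \<Rightarrow> real \<Rightarrow> real) \<Rightarrow> real \<Rightarrow> bool" where
  "characterizes_hz \<psi> \<alpha> \<longleftrightarrow>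
     (\<exists>c C :: real. 0 < c \<and> 0 < C \<and>
        (\<forall>f\<in>L2_01. ennreal c * wavelet_norm \<psi> \<alpha> f \<le> hz_norm \<alpha> f \<and>
                   hz_norm \<alpha> f \<le> ennreal C * wavelet_norm \<psi> \<alpha> f))"

definition hz_ball ::
    "(nat \<Rightarrow> nat \<Rightarrow> real \<Rightarrow> real) \<Rightarrow> real \<Rightarrow> real \<Rightarrow> (real \<Rightarrow> real) set" where
  "hz_ball \<psi> \<alpha> M = {f\<in>L2_01. wavelet_norm \<psi> \<alpha> f \<le> ennreal M}"


section \<open>Prior\<close>

text \<open>
  Random functions on the unit interval are valued in \<open>PiM {0..1} (\<lambda>_. borel)\<close>, the
  sigma-algebra generated by the point evaluations. The series converges absolutely at every
  point by the localization property.
\<close>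

definition wavelet_series_prior ::
    "(nat \<Rightarrow> nat \<Rightarrow> real \<Rightarrow> real) \<Rightarrow> real \<Rightarrow> real \<Rightarrow> (real \<Rightarrow> real) measure" where
  "wavelet_series_prior \<psi> \<alpha> M =
     distr (PiM (SIGMA l:UNIV. {..<2^l}) (\<lambda>_. uniform_measure lborel {-M..M}))
           (PiM {0..1} (\<lambda>_. borel))
           (\<lambda>\<nu>. \<lambda>x\<in>{0..1}. \<Sum>l. \<Sum>k<2^l.
              2 powr (- (real l * (\<alpha> + 1/2))) * \<nu> (l, k) * \<psi> l k x)"

type_synonym parameter = "real \<times> (real \<Rightarrow> real) \<times> (real \<Rightarrow> real)"

definition prior ::
    "(nat \<Rightarrow> nat \<Rightarrow> real \<Rightarrow> real) \<Rightarrow> real \<Rightarrow> real \<Rightarrow> real \<Rightarrow> real \<Rightarrow> parameter measure" where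
  "prior \<psi> \<alpha>1 \<alpha>2 M B =
     uniform_measure lborel {-B..B} \<Otimes>\<^sub>M
       (wavelet_series_prior \<psi> \<alpha>1 M \<Otimes>\<^sub>M wavelet_series_prior \<psi> \<alpha>2 M)"


section \<open>Quasi-likelihood and posterior\<close>

definition mvn_density :: "real^'n \<Rightarrow> real^'n^'n \<Rightarrow> real^'n \<Rightarrow> real" where
  "mvn_density \<mu> S z =
     exp (- ((z - \<mu>) \<bullet> (matrix_inv S *v (z - \<mu>))) / 2) / sqrt ((2 * pi) ^ CARD('n) * det S)"

definition V_mat :: "real \<Rightarrow> real \<Rightarrow> real \<Rightarrow> real^2^2" where
  "V_mat \<sigma>1 \<sigma>2 \<beta> =
     vector [vector [\<sigma>1\<^sup>2 + \<sigma>2\<^sup>2 * \<beta>\<^sup>2, \<beta> * \<sigma>2\<^sup>2],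
             vector [\<beta> * \<sigma>2\<^sup>2, \<sigma>2\<^sup>2]]"

text \<open>The data are \<open>z i = (Y\<^sub>i, X\<^sub>i)\<close> and \<open>w i\<close>, for \<open>i < n\<close>.\<close>

definition likelihood ::
    "real \<Rightarrow> real \<Rightarrow> nat \<Rightarrow> (nat \<Rightarrow> real) \<Rightarrow> (nat \<Rightarrow> real \<times> real) \<Rightarrow> parameter \<Rightarrow> real" where
  "likelihood \<sigma>1 \<sigma>2 n w z = (\<lambda>(\<beta>, m1, m2).
     \<Prod>i<n. mvn_density (vector [m1 (w i), m2 (w i)]) (V_mat \<sigma>1 \<sigma>2 \<beta>)
                        (vector [fst (z i), snd (z i)] :: real^2))"

definition posterior :: "'p measure \<Rightarrow> ('p \<Rightarrow> real) \<Rightarrow> 'p measure" where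
  "posterior Pr L = density Pr (\<lambda>\<theta>. ennreal (L \<theta>) / (\<integral>\<^sup>+ \<theta>'. ennreal (L \<theta>') \<partial>Pr))"

definition beta_posterior ::
    "parameter measure \<Rightarrow> real \<Rightarrow> real \<Rightarrow> nat \<Rightarrow> (nat \<Rightarrow> real) \<Rightarrow> (nat \<Rightarrow> real \<times> real) \<Rightarrow>
      real measure" where
  "beta_posterior Pr \<sigma>1 \<sigma>2 n w z = distr (posterior Pr (likelihood \<sigma>1 \<sigma>2 n w z)) borel fst"


section \<open>Limiting normal law and mode of convergence\<close>

definition info_n ::
    "real \<Rightarrow> (real \<Rightarrow> real) \<Rightarrow> nat \<Rightarrow> (nat \<Rightarrow> real) \<Rightarrow> (nat \<Rightarrow> real \<times> real) \<Rightarrow> real" where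
  "info_n \<sigma>1 m2 n w z = (1 / real n) * (\<Sum>i<n. ((snd (z i) - m2 (w i)) / \<sigma>1)\<^sup>2)"

definition score_n ::
    "real \<Rightarrow> real \<Rightarrow> (real \<Rightarrow> real) \<Rightarrow> (real \<Rightarrow> real) \<Rightarrow> nat \<Rightarrow> (nat \<Rightarrow> real) \<Rightarrow>
      (nat \<Rightarrow> real \<times> real) \<Rightarrow> real" where
  "score_n \<sigma>1 \<beta> m1 m2 n w z =
     (1 / \<sigma>1\<^sup>2) * (\<Sum>i<n. (fst (z i) - m1 (w i) - (snd (z i) - m2 (w i)) * \<beta>)
                            * (snd (z i) - m2 (w i)))"

definition Delta_n ::
    "real \<Rightarrow> real \<Rightarrow> (real \<Rightarrow> real) \<Rightarrow> (real \<Rightarrow> real) \<Rightarrow> nat \<Rightarrow> (nat \<Rightarrow> real) \<Rightarrow>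
      (nat \<Rightarrow> real \<times> real) \<Rightarrow> real" where
  "Delta_n \<sigma>1 \<beta> m1 m2 n w z =
     inverse (info_n \<sigma>1 m2 n w z) * (1 / sqrt (real n)) * score_n \<sigma>1 \<beta> m1 m2 n w z"

text \<open>The second argument is the variance, whereas \<open>normal_density\<close> takes the standard deviation.\<close>

definition normal_law :: "real \<Rightarrow> real \<Rightarrow> real measure" where
  "normal_law \<mu> v = density lborel (\<lambda>x. ennreal (normal_density \<mu> (sqrt v) x))"

definition tv_dist :: "'a measure \<Rightarrow> 'a measure \<Rightarrow> real" where
  "tv_dist P Q = (SUP A\<in>sets P. \<bar>measure P A - measure Q A\<bar>)"

text \<open>
  Outer measure is used so that the notion cannot hold for the trivial reason that
  \<open>measure\<close> is zero on non-measurable sets; for measurable \<open>f n\<close> it is the usual one.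
\<close>

definition tendsto_zero_in_prob ::
    "(nat \<Rightarrow> 'a measure) \<Rightarrow> (nat \<Rightarrow> 'a \<Rightarrow> real) \<Rightarrow> bool" where
  "tendsto_zero_in_prob P f \<longleftrightarrow>
     (\<forall>\<delta>>0. (\<lambda>n. outer_measure_of (P n) {z\<in>space (P n). \<bar>f n z\<bar> > \<delta>}) \<longlonglongrightarrow> 0)"

end

theory Submission
  imports Defs
begin

text \<open>
  Write \<open>u\<close> and \<open>\<xi>\<close> for the true residuals of \<open>X\<close> on \<open>W\<close> and of \<open>Y\<close> on \<open>(X, W)\<close>, and \<open>g\<^sub>1, g\<^sub>2\<close> for the
  deviations of \<open>m\<^sub>1, m\<^sub>2\<close> from \<open>m\<^sub>0\<close> at the design points. For fixed \<open>m\<close> the quasi-likelihood is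
  exactly Gaussian in \<open>\<beta>\<close>, so the \<open>\<beta>\<close>-posterior is a mixture over \<open>m\<close> of truncated normal laws,
  whose centre and scale agree with those of the limit up to \<open>o(n\<^sup>-\<^sup>1\<^sup>/\<^sup>2)\<close> as soon as
  \<open>Q(g\<^sub>1) + Q(g\<^sub>2) \<le> R\<close>, where \<open>Q(g) = \<Sum>\<^sub>i g(w\<^sub>i)\<^sup>2\<close> and \<open>R = o(\<surd>n)\<close>. It remains to see
  that the posterior concentrates on such \<open>m\<close>.

  Split the wavelet series at level \<open>J\<close> with \<open>2\<^sup>J \<approx> n\<^sup>1\<^sup>/\<^sup>(\<^sup>2\<^sup>\<alpha>\<^sup>+\<^sup>1\<^sup>)\<close>, and put \<open>D = 2\<^sup>J\<close>. By a chi-square bound at low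
  frequencies (an orthonormal basis of the span of the wavelets at the design points, so nothing
  is required of the design) and an \<open>l\<^sup>1\<close> bound at high frequencies, with high probability
  \<open>\<bar>\<Sum>\<^sub>i v\<^sub>i g(w\<^sub>i)\<bar> \<le> A (\<surd>(D Q(g)) + D)\<close> for \<open>v \<in> {u, \<xi>}\<close> and all \<open>g\<close> in the class simultaneously, where
  \<open>A\<close> is a multiple of \<open>J\<close>. On this event the log-likelihood ratio is at most
  \<open>-c (Q(g\<^sub>1) + Q(g\<^sub>2)) + C A\<^sup>2 D\<close>, while its normalization is at least \<open>exp (-C J D)\<close> because the uniform
  series prior puts that much mass on small balls around \<open>m\<^sub>0\<close>. Hence \<open>R = J\<^sup>3 D\<close> suffices, and
  \<open>\<alpha> > 1/2\<close> makes this \<open>o(\<surd>n)\<close>.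
\<close>

section \<open>Linear algebra and normal laws\<close>

text \<open>The normal likelihood need not be the law of the data, so arguments that treat it as the
  true density are out of reach. Conditional orthogonality replaces them: given W, both residuals
  and their product have mean zero, so the linear sums and the score are centred under the product
  law and are controlled by their variances through Markov's inequality. This gives failure
  probabilities of order 1/A, which vanish because A grows with J. For fixed m, the centre of the
  normal law in \<beta> moves by linear sums in g1, g2 and by inner products of g1 and g2, for which
  Cauchy-Schwarz offers no better bound than R; this second-order term is why R must be o(\<surd>n).
  Conversely, R has to beat in the exponent both the stochastic excess, of order J^2 D, and the cost
  of the prior mass, of order J D; hence the third power of J. Smoothness above 1/2 acts twice: the
  levels beyond J have summable expected l^1 norms, and J^3 D / \<surd>n tends to 0. If the two
  functions differ in smoothness, both are treated with the smaller exponent. The analysis concerns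
  one fixed design; its conditions hold for almost every sequence.\<close>

lemma orthonormalization:
  fixes v :: "'j \<Rightarrow> 'i \<Rightarrow> real"
  assumes "finite I" "finite S"
  shows "\<exists>C. finite C \<and> card C \<le> card S \<and>
      (\<forall>b\<in>C. \<forall>b'\<in>C. (\<Sum>i\<in>I. b i * b' i) = (if b = b' then 1 else 0)) \<and>
      (\<forall>j\<in>S. \<exists>c. \<forall>i\<in>I. v j i = (\<Sum>b\<in>C. c b * b i))"
  using assms(2)
proof (induction S rule: finite_induct)
  case empty
  show ?case by (intro exI[of _ "{}"]) auto
next
  case (insert s S)
  then obtain C where fC: "finite C" and card: "card C \<le> card S"
    and orth: "\<And>b b'. b \<in> C \<Longrightarrow> b' \<in> C \<Longrightarrow> (\<Sum>i\<in>I. b i * b' i) = (if b = b' then 1 else 0)"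
    and span: "\<And>j. j \<in> S \<Longrightarrow> \<exists>c. \<forall>i\<in>I. v j i = (\<Sum>b\<in>C. c b * b i)"
    by blast
  define a where "a b = (\<Sum>i\<in>I. v s i * b i)" for b
  \<comment> \<open>Gram-Schmidt: what remains of the new vector after projection onto the span of
    \<open>C\<close>.\<close>
  define r where "r i = v s i - (\<Sum>b\<in>C. a b * b i)" for i
  have r_orth: "(\<Sum>i\<in>I. r i * b i) = 0" if "b \<in> C" for b
  proof -
    have "(\<Sum>i\<in>I. r i * b i) = a b - (\<Sum>i\<in>I. \<Sum>b'\<in>C. a b' * (b' i * b i))"
      by (simp add: r_def a_def left_diff_distrib sum_subtractf sum_distrib_right mult.assoc)
    also have "(\<Sum>i\<in>I. \<Sum>b'\<in>C. a b' * (b' i * b i)) = (\<Sum>b'\<in>C. a b' * (\<Sum>i\<in>I. b' i * b i))"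
      by (subst sum.swap) (simp add: sum_distrib_left)
    also have "\<dots> = (\<Sum>b'\<in>C. if b' = b then a b else 0)"
      by (intro sum.cong) (auto simp: orth that)
    also have "\<dots> = a b"
      using that fC by simp
    finally show ?thesis by simp
  qed
  define N where "N = (\<Sum>i\<in>I. r i * r i)"
  have N_nonneg: "N \<ge> 0" unfolding N_def by (intro sum_nonneg) auto
  \<comment> \<open>A vector that depends on \<open>C\<close> at the points of \<open>I\<close> adds
    nothing. Families with linear dependencies are thus covered, and \<open>card C\<close> can be
    smaller than \<open>card S\<close>.\<close>
  show ?case
  proof (cases "N = 0")
    case True
    then have "r i = 0" if "i \<in> I" for i
      using sum_nonneg_eq_0_iff[OF assms(1), of "\<lambda>i. r i * r i"] that unfolding N_def by auto
    then have "\<forall>i\<in>I. v s i = (\<Sum>b\<in>C. a b * b i)"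
      by (simp add: r_def)
    then show ?thesis
      using fC card orth span insert.hyps by (intro exI[of _ C]) auto
  next
    case False
    then have N_pos: "N > 0" using N_nonneg by simp
    define b0 where "b0 i = r i / sqrt N" for i
    have b0_orth: "(\<Sum>i\<in>I. b0 i * b i) = 0" if "b \<in> C" for b
      using r_orth[OF that] by (simp add: b0_def flip: sum_divide_distrib)
    have b0_norm: "(\<Sum>i\<in>I. b0 i * b0 i) = 1"
      using N_pos by (simp add: b0_def N_def flip: sum_divide_distrib)
    \<comment> \<open>\<open>C\<close> is a set of functions, so the new vector must differ from the
      old ones: it is orthogonal to them but has norm one.\<close>
    have b0_notin: "b0 \<notin> C" using b0_orth b0_norm by auto
    have "\<exists>c. \<forall>i\<in>I. v j i = (\<Sum>b\<in>insert b0 C. c b * b i)" if j: "j \<in> insert s S" for j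
    proof (cases "j = s")
      case True
      have "v s i = (\<Sum>b\<in>insert b0 C. (a(b0 := sqrt N)) b * b i)" for i
      proof -
        have "(\<Sum>b\<in>insert b0 C. (a(b0 := sqrt N)) b * b i) = sqrt N * b0 i + (\<Sum>b\<in>C. (a(b0 := sqrt N)) b * b i)"
          using fC b0_notin by simp
        also have "(\<Sum>b\<in>C. (a(b0 := sqrt N)) b * b i) = (\<Sum>b\<in>C. a b * b i)"
          using b0_notin by (intro sum.cong) auto
        also have "sqrt N * b0 i = r i" using N_pos by (simp add: b0_def)
        finally show ?thesis by (simp add: r_def)
      qed
      then show ?thesis using True by blast
    next
      case False
      then obtain c where c: "\<forall>i\<in>I. v j i = (\<Sum>b\<in>C. c b * b i)" using span j by blast
      have "(\<Sum>b\<in>insert b0 C. (c(b0 := 0)) b * b i) = (\<Sum>b\<in>C. c b * b i)" for i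
        using fC b0_notin by (auto intro!: sum.cong)
      then show ?thesis using c by (intro exI[of _ "c(b0 := 0)"]) auto
    qed
    moreover have "(\<Sum>i\<in>I. b i * b0 i) = 0" if "b \<in> C" for b
      using b0_orth[OF that] by (simp add: mult.commute)
    ultimately show ?thesis
      using fC card orth insert.hyps b0_orth b0_norm b0_notin
      by (intro exI[of _ "insert b0 C"]) auto
  qed
qed

text \<open>The right side separates the noise \<open>x\<close> from the coefficients
  \<open>a\<close>. Its first factor is the chi-square statistic of \<open>x\<close> on an
  orthonormal basis common to all \<open>a\<close>, so a single bound on it controls the whole span.
  Coordinates in that basis turn both sums into sums over \<open>C\<close>, and Cauchy-Schwarz
  concludes.\<close>

lemma inner_linear_span_bound:
  fixes v :: "'j \<Rightarrow> 'i \<Rightarrow> real"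
  assumes "finite I" "finite S"
  shows "\<exists>C. finite C \<and> card C \<le> card S \<and> (\<forall>b\<in>C. (\<Sum>i\<in>I. (b i)\<^sup>2) = 1) \<and>
      (\<forall>x a. (\<Sum>i\<in>I. x i * (\<Sum>j\<in>S. a j * v j i))\<^sup>2
         \<le> (\<Sum>b\<in>C. (\<Sum>i\<in>I. x i * b i)\<^sup>2) * (\<Sum>i\<in>I. (\<Sum>j\<in>S. a j * v j i)\<^sup>2))"
proof -
  obtain C where fC: "finite C" and card: "card C \<le> card S"
    and orth: "\<And>b b'. b \<in> C \<Longrightarrow> b' \<in> C \<Longrightarrow> (\<Sum>i\<in>I. b i * b' i) = (if b = b' then 1 else 0)"
    and "\<forall>j\<in>S. \<exists>c. \<forall>i\<in>I. v j i = (\<Sum>b\<in>C. c b * b i)"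
    using orthonormalization[OF assms, of v] by blast
  then obtain c where c: "\<And>j i. j \<in> S \<Longrightarrow> i \<in> I \<Longrightarrow> v j i = (\<Sum>b\<in>C. c j b * b i)"
    by metis
  have "(\<Sum>i\<in>I. x i * (\<Sum>j\<in>S. a j * v j i))\<^sup>2
         \<le> (\<Sum>b\<in>C. (\<Sum>i\<in>I. x i * b i)\<^sup>2) * (\<Sum>i\<in>I. (\<Sum>j\<in>S. a j * v j i)\<^sup>2)" for x a
  proof -
    define d where "d b = (\<Sum>j\<in>S. a j * c j b)" for b
    have eq: "(\<Sum>j\<in>S. a j * v j i) = (\<Sum>b\<in>C. d b * b i)" if "i \<in> I" for i
    proof -
      have "(\<Sum>j\<in>S. a j * v j i) = (\<Sum>j\<in>S. \<Sum>b\<in>C. a j * c j b * b i)"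
        by (intro sum.cong) (auto simp: c that sum_distrib_left mult.assoc)
      then show ?thesis
        by (subst (asm) sum.swap) (simp add: d_def sum_distrib_right)
    qed
    have 1: "(\<Sum>i\<in>I. x i * (\<Sum>j\<in>S. a j * v j i)) = (\<Sum>b\<in>C. d b * (\<Sum>i\<in>I. x i * b i))"
    proof -
      have "(\<Sum>i\<in>I. x i * (\<Sum>j\<in>S. a j * v j i)) = (\<Sum>i\<in>I. \<Sum>b\<in>C. d b * (x i * b i))"
        by (intro sum.cong) (auto simp: eq sum_distrib_left mult_ac)
      then show ?thesis
        by (subst (asm) sum.swap) (simp add: sum_distrib_left)
    qed
    have 2: "(\<Sum>i\<in>I. (\<Sum>j\<in>S. a j * v j i)\<^sup>2) = (\<Sum>b\<in>C. (d b)\<^sup>2)"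
    proof -
      have "(\<Sum>i\<in>I. (\<Sum>j\<in>S. a j * v j i)\<^sup>2) = (\<Sum>i\<in>I. \<Sum>b\<in>C. \<Sum>b'\<in>C. d b * d b' * (b i * b' i))"
        by (intro sum.cong) (auto simp: eq power2_eq_square sum_product mult_ac)
      also have "\<dots> = (\<Sum>b\<in>C. \<Sum>b'\<in>C. d b * d b' * (\<Sum>i\<in>I. b i * b' i))"
        by (subst sum.swap, intro sum.cong refl, subst sum.swap) (simp add: sum_distrib_left)
      also have "\<dots> = (\<Sum>b\<in>C. \<Sum>b'\<in>C. if b = b' then d b * d b' else 0)"
        by (intro sum.cong) (auto simp: orth)
      also have "\<dots> = (\<Sum>b\<in>C. (d b)\<^sup>2)"
        using fC by (simp add: power2_eq_square)
      finally show ?thesis .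
    qed
    show ?thesis
      unfolding 1 2 using Cauchy_Schwarz_ineq_sum[of d "\<lambda>b. \<Sum>i\<in>I. x i * b i" C]
      by (simp add: mult.commute)
  qed
  moreover have "(\<Sum>i\<in>I. (b i)\<^sup>2) = 1" if "b \<in> C" for b
    using orth[OF that that] by (simp add: power2_eq_square)
  ultimately show ?thesis using fC card by blast
qed

section \<open>Total variation between normal laws through the Hellinger affinity\<close>

lemma abs_diff_squares_le:
  fixes a b c :: real
  assumes "0 < c"
  shows "\<bar>a\<^sup>2 - b\<^sup>2\<bar> \<le> ((a - b)\<^sup>2 / c + c * (a + b)\<^sup>2) / 2"
proof -
  have "0 \<le> (\<bar>a - b\<bar> - c * \<bar>a + b\<bar>)\<^sup>2" by simp
  also have "\<dots> = (a - b)\<^sup>2 + c\<^sup>2 * (a + b)\<^sup>2 - 2 * c * \<bar>a\<^sup>2 - b\<^sup>2\<bar>"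
    by (simp add: power2_diff power_mult_distrib square_diff_square_factored abs_mult algebra_simps
        flip: power2_eq_square) (simp add: power2_eq_square algebra_simps flip: abs_mult)
  finally show ?thesis
    using assms by (simp add: field_simps power2_eq_square)
qed

text \<open>\<open>|f - g|\<close> factors into the difference and the sum of the square roots,
  whose squares integrate to \<open>2 - 2 * I\<close> and \<open>2 + 2 * I\<close> with
  \<open>I\<close> the affinity. An arithmetic-geometric inequality with weight \<open>c\<close>
  replaces Cauchy-Schwarz for integrals; \<open>c = sqrt (1 - I)\<close> gives
  \<open>(2 + I) * sqrt (1 - I)\<close>, and \<open>I \<le> 1\<close> gives the constant 3.\<close>

lemma tv_normal_affinity:
  fixes \<rho> :: real
  assumes s: "0 < s" "0 < s'"
    and int: "integrable lborel (\<lambda>x. sqrt (normal_density m s x * normal_density m' s' x))"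
    and rho: "\<rho> \<le> (LINT x|lborel. sqrt (normal_density m s x * normal_density m' s' x))"
    and A: "A \<in> sets borel"
  shows "\<bar>measure (density lborel (normal_density m s)) A
          - measure (density lborel (normal_density m' s')) A\<bar> \<le> 3 * sqrt (1 - \<rho>)"
proof -
  let ?f = "normal_density m s" and ?g = "normal_density m' s'"
  interpret F: prob_space "density lborel ?f" using s by (intro prob_space_normal_density)
  interpret G: prob_space "density lborel ?g" using s by (intro prob_space_normal_density)
  define I where "I = (LINT x|lborel. sqrt (?f x * ?g x))"
  have sq: "(sqrt (?f x) - sqrt (?g x))\<^sup>2 = ?f x + ?g x - 2 * sqrt (?f x * ?g x)"
    "(sqrt (?f x) + sqrt (?g x))\<^sup>2 = ?f x + ?g x + 2 * sqrt (?f x * ?g x)" for x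
    by (simp_all add: power2_diff power2_sum real_sqrt_mult)
  have fi: "integrable lborel ?f" "integrable lborel ?g" using s by auto
  have tot: "(LINT x|lborel. ?f x) = 1" "(LINT x|lborel. ?g x) = 1" using s by auto
  have mf: "measure (density lborel ?f) A = (LINT x|lborel. ?f x * indicator A x)"
  proof -
    have "measure (density lborel ?f) A = (LINT x|density lborel ?f. indicator A x)"
      using A by simp
    then show ?thesis using A by (subst (asm) integral_density) auto
  qed
  have mg: "measure (density lborel ?g) A = (LINT x|lborel. ?g x * indicator A x)"
  proof -
    have "measure (density lborel ?g) A = (LINT x|density lborel ?g. indicator A x)"
      using A by simp
    then show ?thesis using A by (subst (asm) integral_density) auto
  qed
  have fA: "integrable lborel (\<lambda>x. ?f x * indicator A x)" "integrable lborel (\<lambda>x. ?g x * indicator A x)"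
    using fi A by (auto intro!: integrable_real_mult_indicator)
  have main: "\<bar>measure (density lborel ?f) A - measure (density lborel ?g) A\<bar>
      \<le> ((2 - 2 * I) / c + c * (2 + 2 * I)) / 2" if c: "c > 0" for c
  proof -
    have "\<bar>measure (density lborel ?f) A - measure (density lborel ?g) A\<bar>
        = \<bar>LINT x|lborel. ?f x * indicator A x - ?g x * indicator A x\<bar>"
      using fA by (simp add: mf mg)
    also have "\<dots> \<le> (LINT x|lborel. \<bar>?f x * indicator A x - ?g x * indicator A x\<bar>)"
      by (rule integral_abs_bound)
    also have "\<dots> \<le> (LINT x|lborel. ((?f x + ?g x - 2 * sqrt (?f x * ?g x)) / c
        + c * (?f x + ?g x + 2 * sqrt (?f x * ?g x))) / 2)"
    proof (intro integral_mono)
      fix x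
      have "\<bar>?f x * indicator A x - ?g x * indicator A x\<bar> \<le> \<bar>?f x - ?g x\<bar>"
        by (auto simp: indicator_def)
      also have "\<dots> = \<bar>(sqrt (?f x))\<^sup>2 - (sqrt (?g x))\<^sup>2\<bar>" by simp
      also have "\<dots> \<le> ((?f x + ?g x - 2 * sqrt (?f x * ?g x)) / c
        + c * (?f x + ?g x + 2 * sqrt (?f x * ?g x))) / 2"
        using abs_diff_squares_le[OF c, of "sqrt (?f x)" "sqrt (?g x)"] unfolding sq .
      finally show "\<bar>?f x * indicator A x - ?g x * indicator A x\<bar> \<le> \<dots>" .
    qed (use fi fA int in auto)
    also have "\<dots> = ((2 - 2 * I) / c + c * (2 + 2 * I)) / 2"
      using fi int tot by (simp add: I_def)
    finally show ?thesis .
  qed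
  have I1: "I \<le> 1"
  proof -
    have "0 \<le> (LINT x|lborel. (sqrt (?f x) - sqrt (?g x))\<^sup>2)" by simp
    also have "\<dots> = 2 - 2 * I" unfolding sq using fi int tot by (simp add: I_def)
    finally show ?thesis by simp
  qed
  show ?thesis
  proof (cases "I = 1")
    \<comment> \<open>The weight \<open>sqrt (1 - I)\<close> would be 0 here; letting
      \<open>c\<close> tend to 0 gives distance 0 instead.\<close>
    case True
    have "\<bar>measure (density lborel ?f) A - measure (density lborel ?g) A\<bar> \<le> 0"
    proof (rule field_le_epsilon)
      fix e :: real assume "e > 0"
      then show "\<bar>measure (density lborel ?f) A - measure (density lborel ?g) A\<bar> \<le> 0 + e"
        using main[of "e/2"] True by simp
    qed
    moreover have "\<rho> \<le> 1" using rho True by (simp add: I_def)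
    ultimately show ?thesis by (smt (verit) real_sqrt_ge_0_iff)
  next
    case False
    then have pos: "1 - I > 0" using I1 by simp
    have "\<bar>measure (density lborel ?f) A - measure (density lborel ?g) A\<bar>
        \<le> ((2 - 2 * I) / sqrt (1 - I) + sqrt (1 - I) * (2 + 2 * I)) / 2"
      using pos by (intro main) auto
    also have "(2 - 2 * I) / sqrt (1 - I) = 2 * sqrt (1 - I)"
      using pos by (simp add: field_simps)
    also have "(2 * sqrt (1 - I) + sqrt (1 - I) * (2 + 2 * I)) / 2 = sqrt (1 - I) * (2 + I)"
      by (simp add: field_simps)
    also have "\<dots> \<le> sqrt (1 - I) * 3" using I1 pos by (intro mult_left_mono) auto
    also have "\<dots> \<le> 3 * sqrt (1 - \<rho>)" using rho by (simp add: I_def)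
    finally show ?thesis .
  qed
qed

text \<open>The geometric mean of two normal densities of equal scale is \<open>exp (- y)\<close>
  times the one centred at the midpoint, with \<open>y = (m - m')\<^sup>2 / (8 * s\<^sup>2)\<close>.
  So the affinity is \<open>exp (- y) \<ge> 1 - y\<close>.\<close>

lemma tv_normal_shift:
  assumes "0 < s" "A \<in> sets borel"
  shows "\<bar>measure (density lborel (normal_density m s)) A
          - measure (density lborel (normal_density m' s)) A\<bar> \<le> 3 * (\<bar>m - m'\<bar> / s)"
proof -
  define y where "y = (m - m')\<^sup>2 / (8 * s\<^sup>2)"
  have eq: "sqrt (normal_density m s x * normal_density m' s x)
      = exp (- y) * normal_density ((m + m') / 2) s x" for x
  proof -
    have "normal_density m s x * normal_density m' s x
      = (exp (- y) * normal_density ((m + m') / 2) s x)\<^sup>2"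
      using assms(1)
      by (simp add: normal_density_def power_mult_distrib power_divide flip: exp_add exp_double)
         (simp add: y_def field_simps power2_eq_square)
    then show ?thesis by (simp add: real_sqrt_abs)
  qed
  have "exp (- y) \<ge> 1 - y" using exp_ge_add_one_self[of "- y"] by simp
  then have "\<bar>measure (density lborel (normal_density m s)) A
          - measure (density lborel (normal_density m' s)) A\<bar> \<le> 3 * sqrt (1 - (1 - y))"
    using assms by (intro tv_normal_affinity) (auto simp: eq)
  also have "sqrt (1 - (1 - y)) = \<bar>m - m'\<bar> / (sqrt 8 * s)"
    using assms(1) by (simp add: y_def real_sqrt_divide real_sqrt_mult)
  also have "\<dots> \<le> \<bar>m - m'\<bar> / s"
    using assms(1) by (intro divide_left_mono) auto
  finally show ?thesis by simp
qed

text \<open>The geometric mean is \<open>sqrt k\<close> times the normal density whose variance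
  \<open>t\<^sup>2\<close> is the harmonic mean of the two variances. As \<open>k \<le> 1\<close>,
  the affinity \<open>sqrt k\<close> is at least \<open>k\<close>, and \<open>1 - k\<close> is
  \<open>(s - s')\<^sup>2 / (s\<^sup>2 + s'\<^sup>2)\<close>; dropping \<open>s\<^sup>2\<close> from
  the denominator makes the bound relative to \<open>s'\<close>.\<close>

lemma tv_normal_scale:
  assumes s: "0 < s" "0 < s'" and A: "A \<in> sets borel"
  shows "\<bar>measure (density lborel (normal_density m s)) A
          - measure (density lborel (normal_density m s')) A\<bar> \<le> 3 * (\<bar>s - s'\<bar> / s')"
proof -
  define t where "t = sqrt (2 * s\<^sup>2 * s'\<^sup>2 / (s\<^sup>2 + s'\<^sup>2))"
  define k where "k = 2 * s * s' / (s\<^sup>2 + s'\<^sup>2)"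
  have pos: "s\<^sup>2 + s'\<^sup>2 > 0" using s by (simp add: add_pos_pos)
  have t: "t > 0" "t\<^sup>2 = 2 * s\<^sup>2 * s'\<^sup>2 / (s\<^sup>2 + s'\<^sup>2)" using s pos by (auto simp: t_def)
  have k: "k > 0" using s pos by (simp add: k_def)
  have eq: "sqrt (normal_density m s x * normal_density m s' x)
      = sqrt k * normal_density m t x" for x
  proof -
    have e: "exp (- ((x - m)\<^sup>2 / (2 * s\<^sup>2))) * exp (- ((x - m)\<^sup>2 / (2 * s'\<^sup>2)))
        = (exp (- ((x - m)\<^sup>2 / (2 * t\<^sup>2))))\<^sup>2"
      using s pos by (simp add: t(2) flip: exp_add exp_double)
         (simp add: field_simps power2_eq_square)
    have c: "1 / sqrt (2 * pi * s\<^sup>2) * (1 / sqrt (2 * pi * s'\<^sup>2)) = k / (2 * pi * t\<^sup>2)"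
    proof -
      have "1 / sqrt (2 * pi * s\<^sup>2) * (1 / sqrt (2 * pi * s'\<^sup>2)) = 1 / (2 * pi * s * s')"
        using s by (simp add: real_sqrt_mult field_simps)
      also have "\<dots> = k / (2 * pi * t\<^sup>2)"
        unfolding t(2) k_def using s pos by (simp add: divide_simps power2_eq_square)
      finally show ?thesis .
    qed
    have "normal_density m s x * normal_density m s' x
      = (1 / sqrt (2 * pi * s\<^sup>2) * (1 / sqrt (2 * pi * s'\<^sup>2))) *
        (exp (- ((x - m)\<^sup>2 / (2 * s\<^sup>2))) * exp (- ((x - m)\<^sup>2 / (2 * s'\<^sup>2))))"
      by (simp add: normal_density_def)
    also have "\<dots> = k / (2 * pi * t\<^sup>2) * (exp (- ((x - m)\<^sup>2 / (2 * t\<^sup>2))))\<^sup>2"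
      by (simp only: e c)
    also have "\<dots> = (sqrt k * normal_density m t x)\<^sup>2"
      using k by (simp add: normal_density_def power_mult_distrib power_divide)
    finally show ?thesis using k by (simp add: real_sqrt_abs)
  qed
  have k1: "1 - k = (s - s')\<^sup>2 / (s\<^sup>2 + s'\<^sup>2)"
  proof -
    have "1 - k = (s\<^sup>2 + s'\<^sup>2 - 2 * s * s') / (s\<^sup>2 + s'\<^sup>2)"
      using pos s by (simp add: k_def diff_divide_distrib)
    then show ?thesis by (simp add: power2_diff)
  qed
  then have "k \<le> 1" using pos by (smt (verit) divide_nonneg_pos zero_le_power2)
  then have "k \<le> sqrt k" using k
    by (smt (verit) real_le_rsqrt mult_left_le power2_eq_square)
  then have "\<bar>measure (density lborel (normal_density m s)) A
          - measure (density lborel (normal_density m s')) A\<bar> \<le> 3 * sqrt (1 - k)"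
    using s A t k by (intro tv_normal_affinity) (auto simp: eq)
  also have "sqrt (1 - k) \<le> sqrt ((s - s')\<^sup>2 / s'\<^sup>2)"
    unfolding k1 using s pos by (intro real_sqrt_le_mono divide_left_mono mult_pos_pos) auto
  also have "\<dots> = \<bar>s - s'\<bar> / s'" using s by (simp add: real_sqrt_divide)
  finally show ?thesis by simp
qed

lemma normal_chebyshev:
  assumes "0 < s" "0 < r"
  shows "measure (density lborel (normal_density m s)) {x. r \<le> \<bar>x - m\<bar>} \<le> s\<^sup>2 / r\<^sup>2"
proof -
  interpret prob_space "density lborel (normal_density m s)"
    using assms by (intro prob_space_normal_density)
  have D: "distributed (density lborel (normal_density m s)) lborel (\<lambda>x. x) (normal_density m s)"
    by (auto simp: distributed_def distr_id2)
  have E: "expectation (\<lambda>x. x) = m" "variance (\<lambda>x. x) = s\<^sup>2"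
    using normal_distributed_expectation[OF assms(1) D] normal_distributed_variance[OF assms(1) D] by auto
  have "integrable (density lborel (normal_density m s)) (\<lambda>x. x\<^sup>2)"
  proof -
    \<comment> \<open>The second moment is a combination of the central second moment, the mean and
      the total mass.\<close>
    have "integrable lborel (\<lambda>x. normal_density m s x * (x - m)^2 + 2 * m * (normal_density m s x * x) - m^2 * normal_density m s x)"
      using assms by (intro Bochner_Integration.integrable_add Bochner_Integration.integrable_diff
         integrable_mult_right integrable_normal_moment integrable_normal_moment_nz_1) auto
    also have "(\<lambda>x. normal_density m s x * (x - m)^2 + 2 * m * (normal_density m s x * x) - m^2 * normal_density m s x)
       = (\<lambda>x. normal_density m s x * x\<^sup>2)"
      by (auto simp: power2_eq_square algebra_simps)
    finally show ?thesis by (subst integrable_density) auto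
  qed
  then have "prob {x \<in> space (density lborel (normal_density m s)). r \<le> \<bar>x - expectation (\<lambda>x. x)\<bar>} \<le> variance (\<lambda>x. x) / r\<^sup>2"
    using assms by (intro Chebyshev_inequality) auto
  then show ?thesis unfolding E(2) unfolding E(1) by simp
qed

section \<open>Closed form of the bivariate normal density\<close>

lemma matrix_inv_eqI:
  fixes A B :: "real^'n^'n"
  assumes "A ** B = mat 1"
  shows "matrix_inv A = B"
proof -
  have "B ** A = mat 1" using assms by (simp add: matrix_left_right_inverse)
  then have "invertible A" using assms by (auto simp: invertible_def)
  then have "matrix_inv A ** A = mat 1"
    unfolding invertible_def matrix_inv_def by (rule someI2_ex) auto
  then have "matrix_inv A ** A ** B = B" by simp
  then show ?thesis by (simp add: assms flip: matrix_mul_assoc)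
qed

text \<open>\<open>V_mat\<close> is the covariance of \<open>(\<beta> * u + \<xi>, u)\<close> for
  independent normal \<open>\<xi>\<close> and \<open>u\<close> with variances
  \<open>\<sigma>1\<^sup>2\<close> and \<open>\<sigma>2\<^sup>2\<close>. The density therefore
  factors into that of the regression residual \<open>y - a - \<beta> * (x - b)\<close> and that of
  \<open>x - b\<close>, and the determinant of \<open>V_mat\<close> is free of
  \<open>\<beta>\<close>. This is what makes the quasi-likelihood Gaussian in
  \<open>\<beta>\<close>.\<close>

lemma mvn_density_V_mat:
  assumes "0 < \<sigma>1" "0 < \<sigma>2"
  shows "mvn_density (vector [a, b]) (V_mat \<sigma>1 \<sigma>2 \<beta>) (vector [y, x] :: real^2)
    = exp (- ((y - a - \<beta> * (x - b))\<^sup>2 / (2 * \<sigma>1\<^sup>2) + (x - b)\<^sup>2 / (2 * \<sigma>2\<^sup>2))) / (2 * pi * \<sigma>1 * \<sigma>2)"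
proof -
  define W :: "real^2^2" where "W = vector [vector [1 / \<sigma>1\<^sup>2, - \<beta> / \<sigma>1\<^sup>2],
      vector [- \<beta> / \<sigma>1\<^sup>2, 1 / \<sigma>2\<^sup>2 + \<beta>\<^sup>2 / \<sigma>1\<^sup>2]]"
  have "V_mat \<sigma>1 \<sigma>2 \<beta> ** W = mat 1"
    using assms by (simp add: W_def V_mat_def vec_eq_iff forall_2 matrix_matrix_mult_def sum_2 mat_def)
      (simp add: field_simps power2_eq_square)
  then have inv: "matrix_inv (V_mat \<sigma>1 \<sigma>2 \<beta>) = W" by (rule matrix_inv_eqI)
  have det: "det (V_mat \<sigma>1 \<sigma>2 \<beta>) = (\<sigma>1 * \<sigma>2)\<^sup>2"
    by (simp add: det_2 V_mat_def) (simp add: power2_eq_square algebra_simps)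
  have quad: "(vector [y, x] - vector [a, b] :: real^2) \<bullet> (W *v (vector [y, x] - vector [a, b]))
    = (y - a - \<beta> * (x - b))\<^sup>2 / \<sigma>1\<^sup>2 + (x - b)\<^sup>2 / \<sigma>2\<^sup>2"
    by (simp add: W_def inner_vec_def sum_2 matrix_vector_mult_def)
      (simp add: power2_eq_square algebra_simps add_divide_distrib diff_divide_distrib)
  have sq: "sqrt ((2 * pi)\<^sup>2 * (\<sigma>1 * \<sigma>2)\<^sup>2) = 2 * pi * \<sigma>1 * \<sigma>2"
  proof -
    have "(2 * pi)\<^sup>2 * (\<sigma>1 * \<sigma>2)\<^sup>2 = (2 * pi * \<sigma>1 * \<sigma>2)\<^sup>2"
      by (simp add: power_mult_distrib)
    then have "sqrt ((2 * pi)\<^sup>2 * (\<sigma>1 * \<sigma>2)\<^sup>2) = \<bar>2 * pi * \<sigma>1 * \<sigma>2\<bar>"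
      by (simp only: real_sqrt_abs)
    then show ?thesis using assms by (simp only: abs_of_pos mult_pos_pos pi_gt_zero zero_less_numeral)
  qed
  have sq': "sqrt ((2 * pi) ^ CARD(2) * (\<sigma>1 * \<sigma>2)\<^sup>2) = 2 * pi * \<sigma>1 * \<sigma>2"
    by (simp only: card_num1 card_bit0 mult_1_right nat_mult_1_right sq)
  have "mvn_density (vector [a, b]) (V_mat \<sigma>1 \<sigma>2 \<beta>) (vector [y, x] :: real^2)
    = exp (- ((y - a - \<beta> * (x - b))\<^sup>2 / \<sigma>1\<^sup>2 + (x - b)\<^sup>2 / \<sigma>2\<^sup>2) / 2) / (2 * pi * \<sigma>1 * \<sigma>2)"
    unfolding mvn_density_def inv det quad sq' ..
  also have "- ((y - a - \<beta> * (x - b))\<^sup>2 / \<sigma>1\<^sup>2 + (x - b)\<^sup>2 / \<sigma>2\<^sup>2) / 2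
    = - ((y - a - \<beta> * (x - b))\<^sup>2 / (2 * \<sigma>1\<^sup>2) + (x - b)\<^sup>2 / (2 * \<sigma>2\<^sup>2))"
    by (simp add: field_simps)
  finally show ?thesis .
qed

section \<open>Wavelet series\<close>

definition wavelet_level ::
    "(nat \<Rightarrow> nat \<Rightarrow> real \<Rightarrow> real) \<Rightarrow> real \<Rightarrow> (nat \<times> nat \<Rightarrow> real) \<Rightarrow> nat \<Rightarrow> real \<Rightarrow> real" where
  "wavelet_level \<psi> \<alpha> \<nu> l x =
     (\<Sum>k<2^l. 2 powr (- (real l * (\<alpha> + 1/2))) * \<nu> (l, k) * \<psi> l k x)"

definition wavelet_series ::
    "(nat \<Rightarrow> nat \<Rightarrow> real \<Rightarrow> real) \<Rightarrow> real \<Rightarrow> (nat \<times> nat \<Rightarrow> real) \<Rightarrow> real \<Rightarrow> real" where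
  "wavelet_series \<psi> \<alpha> \<nu> x = (\<Sum>l. wavelet_level \<psi> \<alpha> \<nu> l x)"

abbreviation wavelet_index :: "(nat \<times> nat) set" where
  "wavelet_index \<equiv> (SIGMA l:UNIV. {..<2^l})"

text \<open>The scaling \<open>2 powr (- (l * (\<alpha> + 1/2)))\<close> is kept in the series, so
  that the Hoelder-Zygmund ball and the support of the prior correspond to the same cube of
  coefficients, whatever \<alpha> is.\<close>

definition coeff_bounded :: "real \<Rightarrow> (nat \<times> nat \<Rightarrow> real) \<Rightarrow> bool" where
  "coeff_bounded N \<nu> \<longleftrightarrow> (\<forall>l. \<forall>k<2^l. \<bar>\<nu> (l, k)\<bar> \<le> N)"

definition localized :: "(nat \<Rightarrow> nat \<Rightarrow> real \<Rightarrow> real) \<Rightarrow> real \<Rightarrow> bool" where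
  "localized \<psi> C \<longleftrightarrow> 0 \<le> C \<and> (\<forall>l. \<forall>x\<in>{0..1}. (\<Sum>k<2^l. \<bar>\<psi> l k x\<bar>) \<le> C * 2 powr (real l / 2))"

lemma wavelet_basis_localized:
  assumes "wavelet_basis_01 \<psi>"
  obtains C where "localized \<psi> C"
proof -
  obtain C where C: "\<And>l x. x \<in> {0..1} \<Longrightarrow> (\<Sum>k<2^l. \<bar>\<psi> l k x\<bar>) \<le> C * 2 powr (real l / 2)"
    using assms unfolding wavelet_basis_01_def by blast
  have "0 \<le> (\<Sum>k<2^0. \<bar>\<psi> 0 k 0\<bar>)" by (intro sum_nonneg) auto
  also have "\<dots> \<le> C * 2 powr (real 0 / 2)" by (intro C) auto
  finally have "0 \<le> C" by simp
  then show ?thesis using C that unfolding localized_def by blast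
qed

lemma two_powr_level:
  fixes \<alpha> :: real
  shows "2 powr (- (real l * (\<alpha> + 1/2))) * 2 powr (real l / 2) = (2 powr (- \<alpha>)) ^ l"
proof -
  have "2 powr (- (real l * (\<alpha> + 1/2))) * 2 powr (real l / 2)
      = 2 powr (- (real l * (\<alpha> + 1/2)) + real l / 2)"
    by (simp only: powr_add)
  also have "- (real l * (\<alpha> + 1/2)) + real l / 2 = real l * (- \<alpha>)"
    by (simp add: algebra_simps)
  finally show ?thesis by (simp add: powr_power)
qed

text \<open>The coefficient scale \<open>2 powr (- (l * (\<alpha> + 1/2)))\<close> meets the
  localization bound \<open>2 powr (l / 2)\<close>; what is left is geometric in
  \<open>l\<close>.\<close>

lemma abs_wavelet_level_le:
  assumes "localized \<psi> C" "x \<in> {0..1}" "\<And>k. k < 2^l \<Longrightarrow> \<bar>\<nu> (l, k)\<bar> \<le> N" "0 \<le> N"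
  shows "\<bar>wavelet_level \<psi> \<alpha> \<nu> l x\<bar> \<le> N * C * (2 powr (- \<alpha>)) ^ l"
proof -
  have "\<bar>wavelet_level \<psi> \<alpha> \<nu> l x\<bar> \<le> (\<Sum>k<2^l. \<bar>2 powr (- (real l * (\<alpha> + 1/2))) * \<nu> (l, k) * \<psi> l k x\<bar>)"
    unfolding wavelet_level_def by (rule sum_abs)
  also have "\<dots> \<le> (\<Sum>k<2^l. 2 powr (- (real l * (\<alpha> + 1/2))) * N * \<bar>\<psi> l k x\<bar>)"
    by (intro sum_mono) (auto simp: abs_mult intro!: mult_right_mono assms)
  also have "\<dots> = 2 powr (- (real l * (\<alpha> + 1/2))) * N * (\<Sum>k<2^l. \<bar>\<psi> l k x\<bar>)"
    by (simp add: sum_distrib_left)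
  also have "\<dots> \<le> 2 powr (- (real l * (\<alpha> + 1/2))) * N * (C * 2 powr (real l / 2))"
    using assms by (intro mult_left_mono) (auto simp: localized_def)
  also have "\<dots> = N * C * (2 powr (- (real l * (\<alpha> + 1/2))) * 2 powr (real l / 2))"
    by simp
  also have "2 powr (- (real l * (\<alpha> + 1/2))) * 2 powr (real l / 2) = (2 powr (- \<alpha>)) ^ l"
    by (rule two_powr_level)
  finally show ?thesis .
qed

lemma geometric_two_powr:
  assumes "0 < (\<alpha>::real)"
  shows "summable (\<lambda>l. (2 powr (- \<alpha>)) ^ l)" "(\<Sum>l. (2 powr (- \<alpha>)) ^ l) = 1 / (1 - 2 powr (- \<alpha>))"
    "2 powr (- \<alpha>) < 1"
proof -
  show "2 powr (- \<alpha>) < 1" using assms by (simp add: powr_less_one)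
  then show "summable (\<lambda>l. (2 powr (- \<alpha>)) ^ l)" "(\<Sum>l. (2 powr (- \<alpha>)) ^ l) = 1 / (1 - 2 powr (- \<alpha>))"
    by (auto intro!: summable_geometric suminf_geometric)
qed

context
  fixes \<psi> :: "nat \<Rightarrow> nat \<Rightarrow> real \<Rightarrow> real" and \<alpha> C N :: real and \<nu> :: "nat \<times> nat \<Rightarrow> real"
  assumes loc: "localized \<psi> C" and \<alpha>: "0 < \<alpha>" and N: "0 \<le> N" and \<nu>: "coeff_bounded N \<nu>"
begin

lemma summable_abs_wavelet_level:
  assumes "x \<in> {0..1}"
  shows "summable (\<lambda>l. \<bar>wavelet_level \<psi> \<alpha> \<nu> l x\<bar>)"
proof (rule summable_comparison_test')
  show "summable (\<lambda>l. N * C * (2 powr (- \<alpha>)) ^ l)"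
    using geometric_two_powr[OF \<alpha>] by (intro summable_mult)
  show "norm \<bar>wavelet_level \<psi> \<alpha> \<nu> l x\<bar> \<le> N * C * (2 powr (- \<alpha>)) ^ l" if "l \<ge> 0" for l
    using abs_wavelet_level_le[OF loc assms, of l \<nu> N] \<nu> N by (auto simp: coeff_bounded_def)
qed

lemma summable_wavelet_level:
  assumes "x \<in> {0..1}"
  shows "summable (\<lambda>l. wavelet_level \<psi> \<alpha> \<nu> l x)"
  using summable_abs_wavelet_level[OF assms] by (rule summable_rabs_cancel)

lemma wavelet_series_tail:
  assumes "x \<in> {0..1}"
  shows "\<bar>wavelet_series \<psi> \<alpha> \<nu> x - (\<Sum>l<J. wavelet_level \<psi> \<alpha> \<nu> l x)\<bar>
     \<le> N * C * 2 powr (- (real J * \<alpha>)) / (1 - 2 powr (- \<alpha>))"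
proof -
  have s: "summable (\<lambda>l. \<bar>wavelet_level \<psi> \<alpha> \<nu> (l + J) x\<bar>)"
    using summable_abs_wavelet_level[OF assms] by (rule summable_ignore_initial_segment)
  have "wavelet_series \<psi> \<alpha> \<nu> x - (\<Sum>l<J. wavelet_level \<psi> \<alpha> \<nu> l x) = (\<Sum>l. wavelet_level \<psi> \<alpha> \<nu> (l + J) x)"
    unfolding wavelet_series_def
    by (subst suminf_split_initial_segment[OF summable_wavelet_level[OF assms], of J]) simp
  also have "\<bar>\<dots>\<bar> \<le> (\<Sum>l. \<bar>wavelet_level \<psi> \<alpha> \<nu> (l + J) x\<bar>)"
    using s by (rule summable_rabs)
  also have "\<dots> \<le> (\<Sum>l. N * C * (2 powr (- \<alpha>)) ^ J * (2 powr (- \<alpha>)) ^ l)"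
  proof (intro suminf_le s)
    show "\<bar>wavelet_level \<psi> \<alpha> \<nu> (l + J) x\<bar> \<le> N * C * (2 powr (- \<alpha>)) ^ J * (2 powr (- \<alpha>)) ^ l" for l
      using abs_wavelet_level_le[OF loc assms, of "l + J" \<nu> N] \<nu> N
      by (auto simp: coeff_bounded_def power_add mult_ac)
  qed (use geometric_two_powr[OF \<alpha>] in \<open>intro summable_mult\<close>)
  also have "\<dots> = N * C * (2 powr (- \<alpha>)) ^ J / (1 - 2 powr (- \<alpha>))"
    using geometric_two_powr[OF \<alpha>] by (subst suminf_mult) auto
  also have "(2 powr (- \<alpha>)) ^ J = 2 powr (- (real J * \<alpha>))"
    by (simp add: powr_power)
  finally show ?thesis .
qed

text \<open>Levels from \<open>J\<close> on are of order \<open>2 powr (- (J * \<alpha>))\<close> in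
  any case, by the tail bound. A sup-norm neighbourhood of that radius is thus implied by an event
  about the fewer than \<open>2 ^ J\<close> coefficients below level \<open>J\<close>; the factor 2
  adds the two parts.\<close>

lemma wavelet_series_small:
  assumes "x \<in> {0..1}"
    and small: "\<And>l k. l < J \<Longrightarrow> k < 2^l \<Longrightarrow> \<bar>\<nu> (l, k)\<bar> \<le> N * 2 powr (- (real J * \<alpha>))"
  shows "\<bar>wavelet_series \<psi> \<alpha> \<nu> x\<bar> \<le> 2 * N * C * 2 powr (- (real J * \<alpha>)) / (1 - 2 powr (- \<alpha>))"
proof -
  let ?e = "2 powr (- (real J * \<alpha>))"
  have "\<bar>\<Sum>l<J. wavelet_level \<psi> \<alpha> \<nu> l x\<bar> \<le> (\<Sum>l<J. \<bar>wavelet_level \<psi> \<alpha> \<nu> l x\<bar>)" by (rule sum_abs)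
  also have "\<dots> \<le> (\<Sum>l<J. N * ?e * C * (2 powr (- \<alpha>)) ^ l)"
    using N by (intro sum_mono abs_wavelet_level_le[OF loc assms(1)] small) auto
  also have "\<dots> = N * ?e * C * (\<Sum>l<J. (2 powr (- \<alpha>)) ^ l)"
    by (simp add: sum_distrib_left)
  also have "\<dots> \<le> N * ?e * C * (1 / (1 - 2 powr (- \<alpha>)))"
  proof (intro mult_left_mono)
    show "(\<Sum>l<J. (2 powr (- \<alpha>)) ^ l) \<le> 1 / (1 - 2 powr (- \<alpha>))"
      unfolding geometric_two_powr(2)[OF \<alpha>, symmetric]
      by (rule sum_le_suminf[OF geometric_two_powr(1)[OF \<alpha>]]) auto
  qed (use N loc in \<open>auto simp: localized_def\<close>)
  finally have "\<bar>\<Sum>l<J. wavelet_level \<psi> \<alpha> \<nu> l x\<bar> \<le> N * C * ?e / (1 - 2 powr (- \<alpha>))"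
    by (simp add: mult_ac)
  moreover have "2 * N * C * ?e / (1 - 2 powr (- \<alpha>)) = 2 * (N * C * ?e / (1 - 2 powr (- \<alpha>)))"
    by simp
  ultimately show ?thesis using wavelet_series_tail[OF assms(1), of J] by linarith
qed

end

lemma wavelet_series_diff:
  assumes "localized \<psi> C" "0 < \<alpha>" "coeff_bounded N \<nu>" "coeff_bounded N \<nu>'" "0 \<le> N" "x \<in> {0..1}"
  shows "wavelet_series \<psi> \<alpha> \<nu> x - wavelet_series \<psi> \<alpha> \<nu>' x
    = wavelet_series \<psi> \<alpha> (\<lambda>j. \<nu> j - \<nu>' j) x"
proof -
  have "wavelet_series \<psi> \<alpha> \<nu> x - wavelet_series \<psi> \<alpha> \<nu>' x
      = (\<Sum>l. wavelet_level \<psi> \<alpha> \<nu> l x - wavelet_level \<psi> \<alpha> \<nu>' l x)"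
    unfolding wavelet_series_def
    by (rule suminf_diff) (rule summable_wavelet_level[OF assms(1,2,5) _ assms(6)], fact)+
  also have "(\<lambda>l. wavelet_level \<psi> \<alpha> \<nu> l x - wavelet_level \<psi> \<alpha> \<nu>' l x)
      = (\<lambda>l. wavelet_level \<psi> \<alpha> (\<lambda>j. \<nu> j - \<nu>' j) l x)"
    by (simp add: wavelet_level_def left_diff_distrib right_diff_distrib sum_subtractf)
  finally show ?thesis unfolding wavelet_series_def .
qed

text \<open>The coefficients shrink by \<open>2 powr (- (l * (\<alpha>' - \<alpha>)))\<close> when
  the series is read with the smaller exponent. Two functions of different smoothness can then share
  one cut-off level and one rate.\<close>

lemma wavelet_series_coarsen:
  assumes "\<alpha> \<le> \<alpha>'" "coeff_bounded N \<nu>"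
  obtains \<nu>' where "coeff_bounded N \<nu>'" "wavelet_series \<psi> \<alpha>' \<nu> = wavelet_series \<psi> \<alpha> \<nu>'"
     "\<And>j. \<bar>\<nu>' j\<bar> \<le> \<bar>\<nu> j\<bar>"
proof -
  define \<nu>' where "\<nu>' = (\<lambda>(l, k). 2 powr (- (real l * (\<alpha>' - \<alpha>))) * \<nu> (l, k))"
  have le: "\<bar>\<nu>' j\<bar> \<le> \<bar>\<nu> j\<bar>" for j
  proof -
    have "2 powr (- (real (fst j) * (\<alpha>' - \<alpha>))) \<le> 2 powr 0"
      using assms(1) by (intro powr_mono) auto
    then have "2 powr (- (real (fst j) * (\<alpha>' - \<alpha>))) * \<bar>\<nu> j\<bar> \<le> 1 * \<bar>\<nu> j\<bar>"
      by (intro mult_right_mono) auto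
    then show ?thesis by (cases j) (simp add: \<nu>'_def abs_mult)
  qed
  have "2 powr (- (real l * (\<alpha>' + 1/2))) * \<nu> (l, k) = 2 powr (- (real l * (\<alpha> + 1/2))) * \<nu>' (l, k)" for l k
  proof -
    have "- (real l * (\<alpha>' + 1/2)) = - (real l * (\<alpha> + 1/2)) + - (real l * (\<alpha>' - \<alpha>))"
      by (simp add: algebra_simps)
    then have "2 powr (- (real l * (\<alpha>' + 1/2))) = 2 powr (- (real l * (\<alpha> + 1/2))) * 2 powr (- (real l * (\<alpha>' - \<alpha>)))"
      by (simp only: powr_add)
    then show ?thesis by (simp add: \<nu>'_def)
  qed
  then have "wavelet_series \<psi> \<alpha>' \<nu> = wavelet_series \<psi> \<alpha> \<nu>'"
    by (simp add: wavelet_series_def wavelet_level_def fun_eq_iff)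
  moreover have "coeff_bounded N \<nu>'"
    using assms(2) le unfolding coeff_bounded_def by (meson order_trans)
  ultimately show ?thesis using le that by blast
qed

text \<open>The largest contribution of level \<open>l + J\<close> to the inner product with
  \<open>v\<close> when the coefficients are bounded by 1: the \<open>l^1\<close> norm dual to the
  cube. The index counts levels from the cut-off \<open>J\<close>.\<close>

definition high_freq ::
    "(nat \<Rightarrow> nat \<Rightarrow> real \<Rightarrow> real) \<Rightarrow> real \<Rightarrow> nat \<Rightarrow> nat \<Rightarrow> (nat \<Rightarrow> real) \<Rightarrow> (nat \<Rightarrow> real) \<Rightarrow> nat \<Rightarrow> real" where
  "high_freq \<psi> \<alpha> J n w v l =
     2 powr (- (real (l + J) * (\<alpha> + 1/2))) * (\<Sum>k<2^(l + J). \<bar>\<Sum>i<n. v i * \<psi> (l + J) k (w i)\<bar>)"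

lemma high_freq_nonneg: "0 \<le> high_freq \<psi> \<alpha> J n w v l"
  unfolding high_freq_def by (intro mult_nonneg_nonneg sum_nonneg) auto

text \<open>A deterministic bound that ignores cancellation in \<open>v\<close>. It yields
  convergence; the actual size is a matter of expectation.\<close>

lemma summable_high_freq:
  assumes "localized \<psi> C" "0 < \<alpha>" "\<And>i. i < n \<Longrightarrow> w i \<in> {0..1}"
  shows "summable (high_freq \<psi> \<alpha> J n w v)"
proof (rule summable_comparison_test')
  let ?V = "\<Sum>i<n. \<bar>v i\<bar>"
  show "summable (\<lambda>l. C * ?V * (2 powr (- \<alpha>)) ^ J * (2 powr (- \<alpha>)) ^ l)"
    using geometric_two_powr[OF assms(2)] by (intro summable_mult)
  fix l :: nat
  have "(\<Sum>k<2^(l + J). \<bar>\<Sum>i<n. v i * \<psi> (l + J) k (w i)\<bar>)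
      \<le> (\<Sum>k<2^(l + J). \<Sum>i<n. \<bar>v i\<bar> * \<bar>\<psi> (l + J) k (w i)\<bar>)"
    by (intro sum_mono order_trans[OF sum_abs]) (simp add: abs_mult)
  also have "\<dots> = (\<Sum>i<n. \<bar>v i\<bar> * (\<Sum>k<2^(l + J). \<bar>\<psi> (l + J) k (w i)\<bar>))"
    by (subst sum.swap) (simp add: sum_distrib_left)
  also have "\<dots> \<le> (\<Sum>i<n. \<bar>v i\<bar> * (C * 2 powr (real (l + J) / 2)))"
    using assms unfolding localized_def by (intro sum_mono mult_left_mono) (auto simp del: of_nat_add)
  finally have "high_freq \<psi> \<alpha> J n w v l
      \<le> 2 powr (- (real (l + J) * (\<alpha> + 1/2))) * (\<Sum>i<n. \<bar>v i\<bar> * (C * 2 powr (real (l + J) / 2)))"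
    unfolding high_freq_def by (intro mult_left_mono) auto
  also have "\<dots> = C * ?V * (2 powr (- (real (l + J) * (\<alpha> + 1/2))) * 2 powr (real (l + J) / 2))"
    by (subst sum_distrib_right[symmetric]) (simp only: mult_ac)
  also have "2 powr (- (real (l + J) * (\<alpha> + 1/2))) * 2 powr (real (l + J) / 2) = (2 powr (- \<alpha>)) ^ (l + J)"
    by (rule two_powr_level)
  finally show "norm (high_freq \<psi> \<alpha> J n w v l) \<le> C * ?V * (2 powr (- \<alpha>)) ^ J * (2 powr (- \<alpha>)) ^ l"
    using high_freq_nonneg[of \<psi> \<alpha> J n w v l] by (simp add: power_add mult_ac)
qed

text \<open>The coefficients are replaced by their worst case at the high levels, so the last term
  is common to the whole class. The low levels keep their inner product, since there the bound has
  to reflect the size of the function.\<close>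

lemma abs_inner_wavelet_series_le:
  assumes "localized \<psi> C" "0 < \<alpha>" "coeff_bounded N \<nu>" "0 \<le> N" "\<And>i. i < n \<Longrightarrow> w i \<in> {0..1}"
  shows "\<bar>\<Sum>i<n. v i * wavelet_series \<psi> \<alpha> \<nu> (w i)\<bar>
     \<le> \<bar>\<Sum>i<n. v i * (\<Sum>l<J. wavelet_level \<psi> \<alpha> \<nu> l (w i))\<bar> + N * (\<Sum>l. high_freq \<psi> \<alpha> J n w v l)"
proof -
  define T where "T l = (\<Sum>i<n. v i * wavelet_level \<psi> \<alpha> \<nu> (l + J) (w i))" for l
  have sm: "summable (\<lambda>l. wavelet_level \<psi> \<alpha> \<nu> l (w i))" if "i < n" for i
    using assms that by (intro summable_wavelet_level) auto
  have split: "wavelet_series \<psi> \<alpha> \<nu> (w i) = (\<Sum>l<J. wavelet_level \<psi> \<alpha> \<nu> l (w i))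
      + (\<Sum>l. wavelet_level \<psi> \<alpha> \<nu> (l + J) (w i))" if "i < n" for i
    unfolding wavelet_series_def by (subst suminf_split_initial_segment[OF sm[OF that], of J]) simp
  have "(\<Sum>i<n. v i * wavelet_series \<psi> \<alpha> \<nu> (w i))
      = (\<Sum>i<n. v i * (\<Sum>l<J. wavelet_level \<psi> \<alpha> \<nu> l (w i)))
        + (\<Sum>i<n. v i * (\<Sum>l. wavelet_level \<psi> \<alpha> \<nu> (l + J) (w i)))"
    by (simp add: split ring_distribs sum.distrib)
  also have "(\<Sum>i<n. v i * (\<Sum>l. wavelet_level \<psi> \<alpha> \<nu> (l + J) (w i))) = (\<Sum>l. T l)"
  proof -
    have "(\<Sum>i<n. v i * (\<Sum>l. wavelet_level \<psi> \<alpha> \<nu> (l + J) (w i)))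
        = (\<Sum>i<n. \<Sum>l. v i * wavelet_level \<psi> \<alpha> \<nu> (l + J) (w i))"
      by (rule sum.cong[OF refl], rule suminf_mult[symmetric])
        (rule summable_ignore_initial_segment, rule sm, simp)
    also have "\<dots> = (\<Sum>l. T l)"
      unfolding T_def
      by (rule suminf_sum[symmetric], rule summable_mult, rule summable_ignore_initial_segment, rule sm, simp)
    finally show ?thesis .
  qed
  finally have eq: "(\<Sum>i<n. v i * wavelet_series \<psi> \<alpha> \<nu> (w i))
      = (\<Sum>i<n. v i * (\<Sum>l<J. wavelet_level \<psi> \<alpha> \<nu> l (w i))) + (\<Sum>l. T l)" .
  have T_le: "\<bar>T l\<bar> \<le> N * high_freq \<psi> \<alpha> J n w v l" for l
  proof -
    let ?c = "2 powr (- (real (l + J) * (\<alpha> + 1/2)))"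
    have eq: "T l = (\<Sum>k<2^(l + J). ?c * \<nu> (l + J, k) * (\<Sum>i<n. v i * \<psi> (l + J) k (w i)))"
      unfolding T_def wavelet_level_def sum_distrib_left
      by (subst sum.swap) (simp add: mult_ac)
    have "\<bar>T l\<bar> \<le> (\<Sum>k<2^(l + J). \<bar>?c * \<nu> (l + J, k) * (\<Sum>i<n. v i * \<psi> (l + J) k (w i))\<bar>)"
      unfolding eq by (rule sum_abs)
    also have "\<dots> \<le> (\<Sum>k<2^(l + J). ?c * N * \<bar>\<Sum>i<n. v i * \<psi> (l + J) k (w i)\<bar>)"
    proof (rule sum_mono)
      fix k :: nat assume "k \<in> {..<2^(l + J)}"
      then have "\<bar>\<nu> (l + J, k)\<bar> \<le> N" using assms(3) by (simp add: coeff_bounded_def)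
      then show "\<bar>?c * \<nu> (l + J, k) * (\<Sum>i<n. v i * \<psi> (l + J) k (w i))\<bar>
          \<le> ?c * N * \<bar>\<Sum>i<n. v i * \<psi> (l + J) k (w i)\<bar>"
        unfolding abs_mult by (intro mult_right_mono mult_left_mono) auto
    qed
    also have "\<dots> = N * high_freq \<psi> \<alpha> J n w v l"
      unfolding high_freq_def by (simp add: sum_distrib_left mult_ac)
    finally show ?thesis .
  qed
  have sh: "summable (\<lambda>l. N * high_freq \<psi> \<alpha> J n w v l)"
    using summable_high_freq[OF assms(1,2,5)] by (intro summable_mult) auto
  have sT: "summable (\<lambda>l. \<bar>T l\<bar>)"
    by (rule summable_comparison_test'[OF sh]) (use T_le in auto)
  have "\<bar>\<Sum>l. T l\<bar> \<le> (\<Sum>l. \<bar>T l\<bar>)" using sT by (rule summable_rabs)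
  also have "\<dots> \<le> (\<Sum>l. N * high_freq \<psi> \<alpha> J n w v l)" by (intro suminf_le T_le sT sh)
  also have "\<dots> = N * (\<Sum>l. high_freq \<psi> \<alpha> J n w v l)"
    using summable_high_freq[OF assms(1,2,5)] by (intro suminf_mult) auto
  finally show ?thesis using eq by linarith
qed

section \<open>Hoelder-Zygmund balls as cubes of wavelet coefficients\<close>

lemma finite_measure_lborel01: "finite_measure lborel01"
  by (intro finite_measureI) (simp add: emeasure_restrict_space)

lemma borel_measurable_lborel01_continuous:
  fixes f :: "real \<Rightarrow> real"
  assumes "continuous_on {0..1} f"
  shows "f \<in> borel_measurable lborel01"
proof -
  have "f \<in> borel_measurable (restrict_space borel {0..1})"
    using assms by (rule borel_measurable_continuous_on_restrict)
  then show ?thesis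
    by (simp cong: measurable_cong_sets add: sets_restrict_space)
qed

lemma continuous_on_01_bounded:
  fixes f :: "real \<Rightarrow> real"
  assumes "continuous_on {0..1} f"
  obtains K where "\<And>x. x \<in> {0..1} \<Longrightarrow> \<bar>f x\<bar> \<le> K"
proof -
  have "compact (f ` {0..1})" using assms by (intro compact_continuous_image) auto
  then have "bounded (f ` {0..1})" by (rule compact_imp_bounded)
  then obtain K where "\<forall>x\<in>{0..1}. \<bar>f x\<bar> \<le> K" by (auto simp: bounded_iff)
  then show ?thesis using that by blast
qed

lemma integrable_lborel01_bounded:
  fixes f :: "real \<Rightarrow> real"
  assumes "f \<in> borel_measurable lborel01" "\<And>x. x \<in> {0..1} \<Longrightarrow> \<bar>f x\<bar> \<le> K"
  shows "integrable lborel01 f"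
  using assms by (intro finite_measure.integrable_const_bound[OF finite_measure_lborel01, of _ K])
    (auto simp: space_restrict_space)

lemma L2_01_integrable_mult:
  assumes f: "f \<in> L2_01" and g: "g \<in> borel_measurable lborel01" "\<And>x. x \<in> {0..1} \<Longrightarrow> \<bar>g x\<bar> \<le> K"
  shows "integrable lborel01 (\<lambda>x. f x * g x)"
proof (rule Bochner_Integration.integrable_bound)
  have f': "f \<in> borel_measurable lborel01" "integrable lborel01 (\<lambda>x. (f x)\<^sup>2)"
    using f by (auto simp: L2_01_def)
  show "integrable lborel01 (\<lambda>x. (1 + (f x)\<^sup>2) * \<bar>K\<bar>)"
    using f' finite_measure.integrable_const[OF finite_measure_lborel01, of 1]
    by (intro integrable_mult_left Bochner_Integration.integrable_add) auto
  show "(\<lambda>x. f x * g x) \<in> borel_measurable lborel01" using f' g by measurable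
  show "AE x in lborel01. norm (f x * g x) \<le> norm ((1 + (f x)\<^sup>2) * \<bar>K\<bar>)"
  proof (rule AE_I2)
    fix x assume "x \<in> space lborel01"
    then have "\<bar>g x\<bar> \<le> \<bar>K\<bar>" using g(2)[of x] by (auto simp: space_restrict_space)
    moreover have "\<bar>f x\<bar> \<le> 1 + (f x)\<^sup>2"
      using zero_le_power2[of "\<bar>f x\<bar> - 1"] by (simp add: power2_diff)
    ultimately have "\<bar>f x\<bar> * \<bar>g x\<bar> \<le> (1 + (f x)\<^sup>2) * \<bar>K\<bar>" by (intro mult_mono) auto
    then show "norm (f x * g x) \<le> norm ((1 + (f x)\<^sup>2) * \<bar>K\<bar>)" by (simp add: abs_mult)
  qed
qed

text \<open>Membership in the ball fixes \<open>f\<close> up to null sets, so a canonical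
  representative is produced. Bounded coefficients make the series converge uniformly, hence to a
  continuous function; it has the same wavelet coefficients as \<open>f\<close>, and completeness of
  the basis gives equality almost everywhere. Continuity also makes the representative
  bounded.\<close>

lemma hz_ball_series:
  assumes basis: "wavelet_basis_01 \<psi>" and loc: "localized \<psi> C" and \<alpha>: "0 < \<alpha>" and M: "0 \<le> M"
    and f: "f \<in> hz_ball \<psi> \<alpha> M"
  obtains \<nu> where "coeff_bounded M \<nu>" "AE x in lborel01. f x = wavelet_series \<psi> \<alpha> \<nu> x"
    "continuous_on {0..1} (wavelet_series \<psi> \<alpha> \<nu>)"
proof -
  define \<nu> where "\<nu> = (\<lambda>(l, k). 2 powr (real l * (\<alpha> + 1/2)) * inner_01 f (\<psi> l k))"
  let ?s = "wavelet_series \<psi> \<alpha> \<nu>"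
  let ?S = "\<lambda>J x. \<Sum>l<J. wavelet_level \<psi> \<alpha> \<nu> l x"
  have fL2: "f \<in> L2_01" using f by (simp add: hz_ball_def)
  have cont: "continuous_on {0..1} (\<psi> l k)" if "k < 2^l" for l k
    using basis that by (auto simp: wavelet_basis_01_def)
  have orth: "inner_01 (\<psi> l k) (\<psi> l' k') = (if l = l' \<and> k = k' then 1 else 0)"
    if "k < 2^l" "k' < 2^l'" for l k l' k'
    using basis that by (auto simp: wavelet_basis_01_def)
  have bnd: "coeff_bounded M \<nu>"
    unfolding coeff_bounded_def
  proof (intro allI impI)
    fix l k :: nat assume k: "k < 2^l"
    have "ennreal (2 powr (real l * (\<alpha> + 1/2)) * \<bar>inner_01 f (\<psi> l k)\<bar>)
        \<le> (SUP k\<in>{..<2^l}. ennreal (2 powr (real l * (\<alpha> + 1/2)) * \<bar>inner_01 f (\<psi> l k)\<bar>))"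
      using k by (intro SUP_upper) auto
    also have "\<dots> \<le> wavelet_norm \<psi> \<alpha> f"
      unfolding wavelet_norm_def by (rule SUP_upper) auto
    also have "\<dots> \<le> ennreal M" using f by (simp add: hz_ball_def)
    finally show "\<bar>\<nu> (l, k)\<bar> \<le> M" using M by (simp add: \<nu>_def abs_mult)
  qed
  have coef: "2 powr (- (real l * (\<alpha> + 1/2))) * \<nu> (l, k) = inner_01 f (\<psi> l k)" for l k
  proof -
    have "2 powr (- (real l * (\<alpha> + 1/2))) * 2 powr (real l * (\<alpha> + 1/2)) = 1"
      by (simp only: powr_add[symmetric]) simp
    then show ?thesis by (simp add: \<nu>_def flip: mult.assoc)
  qed
  have level_eq: "wavelet_level \<psi> \<alpha> \<nu> l x = (\<Sum>k<2^l. inner_01 f (\<psi> l k) * \<psi> l k x)" for l x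
    by (simp only: wavelet_level_def coef)
  have cont_S: "continuous_on {0..1} (?S J)" for J
    unfolding level_eq by (intro continuous_intros cont) auto
  have unif: "uniform_limit {0..1} ?S ?s sequentially"
  proof (rule uniform_limitI)
    fix e :: real assume "e > 0"
    have "(\<lambda>J. M * C * (2 powr (- \<alpha>)) ^ J / (1 - 2 powr (- \<alpha>))) \<longlonglongrightarrow> M * C * 0 / (1 - 2 powr (- \<alpha>))"
      using geometric_two_powr(3)[OF \<alpha>] by (intro tendsto_intros LIMSEQ_power_zero) auto
    then have "eventually (\<lambda>J. M * C * (2 powr (- \<alpha>)) ^ J / (1 - 2 powr (- \<alpha>)) < e) sequentially"
      using \<open>e > 0\<close> by (auto dest: order_tendstoD(2)[where a = e])
    then show "\<forall>\<^sub>F J in sequentially. \<forall>x\<in>{0..1}. dist (?S J x) (?s x) < e"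
    proof eventually_elim
      case (elim J)
      have "(2 powr (- \<alpha>)) ^ J = 2 powr (- (real J * \<alpha>))" by (simp add: powr_power)
      then show ?case
        using wavelet_series_tail[OF loc \<alpha> M bnd, of _ J] elim
        by (fastforce simp: dist_real_def abs_minus_commute)
    qed
  qed
  have cont_s: "continuous_on {0..1} ?s"
    by (rule uniform_limit_theorem[OF _ unif]) (use cont_S in auto)
  obtain K where K: "\<And>x. x \<in> {0..1} \<Longrightarrow> \<bar>?s x\<bar> \<le> K" using continuous_on_01_bounded[OF cont_s] by blast
  have ms: "?s \<in> borel_measurable lborel01" by (rule borel_measurable_lborel01_continuous[OF cont_s])
  have sL2: "?s \<in> L2_01"
    unfolding L2_01_def
  proof (intro CollectI conjI ms)
    show "integrable lborel01 (\<lambda>x. (?s x)\<^sup>2)"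
    proof (rule integrable_lborel01_bounded[of _ "K\<^sup>2"])
      show "\<bar>(?s x)\<^sup>2\<bar> \<le> K\<^sup>2" if "x \<in> {0..1}" for x
        using power_mono[OF K[OF that], of 2] by simp
    qed (use ms in measurable)
  qed
  have inner_S: "inner_01 (?S J) (\<psi> l' k') = inner_01 f (\<psi> l' k')" if k': "k' < 2^l'" and "l' < J" for l' k' J
  proof -
    have int: "integrable lborel01 (\<lambda>x. \<psi> l k x * \<psi> l' k' x)" if k: "k < 2^l" for l k
    proof -
      obtain K1 where "\<And>x. x \<in> {0..1} \<Longrightarrow> \<bar>\<psi> l k x * \<psi> l' k' x\<bar> \<le> K1"
        using continuous_on_01_bounded[OF continuous_on_mult[OF cont[OF k] cont[OF k']]] by blast
      then show ?thesis
        using borel_measurable_lborel01_continuous[OF continuous_on_mult[OF cont[OF k] cont[OF k']]]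
        by (intro integrable_lborel01_bounded)
    qed
    have "inner_01 (?S J) (\<psi> l' k')
        = (LINT x|lborel01. (\<Sum>l<J. \<Sum>k<2^l. inner_01 f (\<psi> l k) * (\<psi> l k x * \<psi> l' k' x)))"
      by (subst inner_01_def) (simp add: level_eq sum_distrib_right mult.assoc)
    also have "\<dots> = (\<Sum>l<J. \<Sum>k<2^l. inner_01 f (\<psi> l k) * inner_01 (\<psi> l k) (\<psi> l' k'))"
    proof (subst Bochner_Integration.integral_sum)
      show "(\<Sum>l<J. LINT x|lborel01. (\<Sum>k<2^l. inner_01 f (\<psi> l k) * (\<psi> l k x * \<psi> l' k' x)))
        = (\<Sum>l<J. \<Sum>k<2^l. inner_01 f (\<psi> l k) * inner_01 (\<psi> l k) (\<psi> l' k'))"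
        by (intro sum.cong refl, subst Bochner_Integration.integral_sum)
           (auto simp: inner_01_def[of "\<psi> _ _" "\<psi> _ _"] int)
    qed (auto intro!: Bochner_Integration.integrable_sum int)
    also have "\<dots> = (\<Sum>l<J. \<Sum>k<2^l. if l = l' then (if k = k' then inner_01 f (\<psi> l k) else 0) else 0)"
      by (intro sum.cong refl) (auto simp: orth k')
    also have "\<dots> = (\<Sum>l<J. if l = l' then inner_01 f (\<psi> l' k') else 0)"
      using k' by (intro sum.cong refl) auto
    also have "\<dots> = inner_01 f (\<psi> l' k')" using \<open>l' < J\<close> by simp
    finally show ?thesis .
  qed
  \<comment> \<open>Dominated convergence carries the coefficients of the partial sums to the limit;
    they are constant once \<open>J\<close> exceeds \<open>l\<close>.\<close>
  have inner_s: "inner_01 ?s (\<psi> l k) = inner_01 f (\<psi> l k)" if k: "k < 2^l" for l k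
  proof -
    obtain K1 where K1: "\<And>x. x \<in> {0..1} \<Longrightarrow> \<bar>\<psi> l k x\<bar> \<le> K1"
      using continuous_on_01_bounded[OF cont[OF k]] by blast
    have m\<psi>: "\<psi> l k \<in> borel_measurable lborel01" using cont[OF k] by (rule borel_measurable_lborel01_continuous)
    let ?T = "M * C / (1 - 2 powr (- \<alpha>))"
    have T: "\<bar>?S J x\<bar> \<le> K + ?T" if x: "x \<in> {0..1}" for J x
    proof -
      have "M * C * 2 powr (- (real J * \<alpha>)) / (1 - 2 powr (- \<alpha>)) \<le> M * C * 1 / (1 - 2 powr (- \<alpha>))"
      proof (intro divide_right_mono mult_left_mono)
        have "2 powr (- (real J * \<alpha>)) \<le> 2 powr 0" using \<alpha> by (intro powr_mono) auto
        then show "2 powr (- (real J * \<alpha>)) \<le> 1" by simp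
      qed (use M loc geometric_two_powr(3)[OF \<alpha>] in \<open>auto simp: localized_def\<close>)
      then show ?thesis using wavelet_series_tail[OF loc \<alpha> M bnd x, of J] K[OF x] by (simp add: abs_le_iff)
    qed
    have "(\<lambda>J. inner_01 (?S J) (\<psi> l k)) \<longlonglongrightarrow> inner_01 ?s (\<psi> l k)"
      unfolding inner_01_def
    proof (rule integral_dominated_convergence)
      show "integrable lborel01 (\<lambda>x. (K + ?T) * K1)"
        by (rule finite_measure.integrable_const[OF finite_measure_lborel01])
      show "AE x in lborel01. (\<lambda>J. ?S J x * \<psi> l k x) \<longlonglongrightarrow> ?s x * \<psi> l k x"
        using tendsto_uniform_limitI[OF unif]
        by (intro AE_I2 tendsto_mult tendsto_const) (auto simp: space_restrict_space)
      show "AE x in lborel01. norm (?S J x * \<psi> l k x) \<le> (K + ?T) * K1" for J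
      proof (rule AE_I2)
        fix x assume "x \<in> space lborel01"
        then have x: "x \<in> {0..1}" by (simp add: space_restrict_space)
        show "norm (?S J x * \<psi> l k x) \<le> (K + ?T) * K1"
          unfolding real_norm_def abs_mult using T[OF x, of J] K1[OF x]
          by (intro mult_mono) auto
      qed
    qed (use ms m\<psi> borel_measurable_lborel01_continuous[OF cont_S] in measurable)
    moreover have "eventually (\<lambda>J. inner_01 (?S J) (\<psi> l k) = inner_01 f (\<psi> l k)) sequentially"
      using eventually_gt_at_top[of l] by eventually_elim (rule inner_S[OF k])
    then have "(\<lambda>J. inner_01 (?S J) (\<psi> l k)) \<longlonglongrightarrow> inner_01 f (\<psi> l k)"
      by (rule tendsto_eventually)
    ultimately show ?thesis by (rule LIMSEQ_unique)
  qed
  have "(\<lambda>x. f x - ?s x) \<in> L2_01"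
  proof -
    have "integrable lborel01 (\<lambda>x. (f x)\<^sup>2 - 2 * (f x * ?s x) + (?s x)\<^sup>2)"
      using fL2 sL2 L2_01_integrable_mult[OF fL2 ms K]
      by (intro Bochner_Integration.integrable_add Bochner_Integration.integrable_diff integrable_mult_right)
        (auto simp: L2_01_def)
    also have "(\<lambda>x. (f x)\<^sup>2 - 2 * (f x * ?s x) + (?s x)\<^sup>2) = (\<lambda>x. (f x - ?s x)\<^sup>2)"
      by (simp add: power2_diff fun_eq_iff)
    finally show ?thesis using fL2 sL2 by (auto simp: L2_01_def)
  qed
  moreover have "inner_01 (\<lambda>x. f x - ?s x) (\<psi> l k) = 0" if k: "k < 2^l" for l k
  proof -
    obtain K1 where K1: "\<And>x. x \<in> {0..1} \<Longrightarrow> \<bar>\<psi> l k x\<bar> \<le> K1"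
      using continuous_on_01_bounded[OF cont[OF k]] by blast
    have m\<psi>: "\<psi> l k \<in> borel_measurable lborel01" using cont[OF k] by (rule borel_measurable_lborel01_continuous)
    have "inner_01 (\<lambda>x. f x - ?s x) (\<psi> l k) = inner_01 f (\<psi> l k) - inner_01 ?s (\<psi> l k)"
      unfolding inner_01_def left_diff_distrib
      by (rule Bochner_Integration.integral_diff)
        (rule L2_01_integrable_mult[OF fL2 m\<psi> K1] L2_01_integrable_mult[OF sL2 m\<psi> K1], assumption)+
    then show ?thesis by (simp add: inner_s[OF k])
  qed
  ultimately have "AE x in lborel01. f x - ?s x = 0"
    using basis by (auto simp: wavelet_basis_01_def)
  then show ?thesis using that[OF bnd _ cont_s] by simp
qed

section \<open>The log-likelihood ratio\<close>

definition dotp :: "nat \<Rightarrow> (nat \<Rightarrow> real) \<Rightarrow> (nat \<Rightarrow> real) \<Rightarrow> real" where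
  "dotp n v g = (\<Sum>i<n. v i * g i)"

lemma dotp_diff_right: "dotp n v (\<lambda>i. f i - g i) = dotp n v f - dotp n v g"
  by (simp add: dotp_def right_diff_distrib sum_subtractf)

lemma dotp_add_right: "dotp n v (\<lambda>i. f i + g i) = dotp n v f + dotp n v g"
  by (simp add: dotp_def ring_distribs sum.distrib)

lemma dotp_add_left: "dotp n (\<lambda>i. f i + g i) v = dotp n f v + dotp n g v"
  by (simp add: dotp_def ring_distribs sum.distrib)

lemma dotp_scale_right: "dotp n v (\<lambda>i. c * g i) = c * dotp n v g"
  by (simp add: dotp_def sum_distrib_left mult_ac)

lemma dotp_diff_left: "dotp n (\<lambda>i. f i - g i) v = dotp n f v - dotp n g v"
  by (simp add: dotp_def left_diff_distrib sum_subtractf)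

lemma dotp_scale_left: "dotp n (\<lambda>i. c * g i) v = c * dotp n g v"
  by (simp add: dotp_def sum_distrib_left mult_ac)

lemma dotp_commute: "dotp n v g = dotp n g v"
  by (simp add: dotp_def mult.commute)

lemma dotp_self_nonneg: "0 \<le> dotp n g g"
  unfolding dotp_def by (intro sum_nonneg) auto

lemma dotp_self: "dotp n g g = (\<Sum>i<n. (g i)\<^sup>2)"
  by (simp add: dotp_def power2_eq_square)

lemma dotp_cauchy_schwarz: "\<bar>dotp n v g\<bar> \<le> sqrt (dotp n v v) * sqrt (dotp n g g)"
  using real_sqrt_le_mono[OF Cauchy_Schwarz_ineq_sum[of v g "{..<n}"]]
  by (simp add: dotp_def power2_eq_square real_sqrt_mult)

lemmas dotp_linear = dotp_add_right dotp_add_left dotp_diff_right dotp_scale_right dotp_diff_left dotp_scale_left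

text \<open>
  Log-likelihood ratio of \<open>(\<beta>, m\<^sub>0 + g)\<close> against \<open>(\<beta>\<^sub>0, m\<^sub>0)\<close>, in terms of the residuals \<open>\<xi>, u\<close> under
  the latter.
\<close>

definition log_ratio ::
    "real \<Rightarrow> real \<Rightarrow> real \<Rightarrow> nat \<Rightarrow> (nat \<Rightarrow> real) \<Rightarrow> (nat \<Rightarrow> real) \<Rightarrow> (nat \<Rightarrow> real) \<Rightarrow> (nat \<Rightarrow> real) \<Rightarrow> real \<Rightarrow> real"
  where
  "log_ratio \<sigma>1 \<sigma>2 \<beta>0 n \<xi> u g1 g2 \<beta> =
     - (\<Sum>i<n. (\<xi> i - (\<beta> - \<beta>0) * u i - (g1 i - \<beta> * g2 i))\<^sup>2 - (\<xi> i)\<^sup>2) / (2 * \<sigma>1\<^sup>2)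
     - (\<Sum>i<n. (u i - g2 i)\<^sup>2 - (u i)\<^sup>2) / (2 * \<sigma>2\<^sup>2)"

lemma log_ratio_expand:
  fixes g1 g2 :: "nat \<Rightarrow> real"
  defines "e \<equiv> \<lambda>\<beta> i. g1 i - \<beta> * g2 i"
  shows "log_ratio \<sigma>1 \<sigma>2 \<beta>0 n \<xi> u g1 g2 \<beta> =
     - ((\<beta> - \<beta>0)\<^sup>2 * dotp n u u + dotp n (e \<beta>) (e \<beta>) + 2 * (\<beta> - \<beta>0) * dotp n u (e \<beta>)
         - 2 * (\<beta> - \<beta>0) * dotp n \<xi> u - 2 * dotp n \<xi> (e \<beta>)) / (2 * \<sigma>1\<^sup>2)
     - (dotp n g2 g2 - 2 * dotp n u g2) / (2 * \<sigma>2\<^sup>2)"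
proof -
  have "(\<Sum>i<n. (\<xi> i - (\<beta> - \<beta>0) * u i - e \<beta> i)\<^sup>2 - (\<xi> i)\<^sup>2)
      = (\<Sum>i<n. (\<beta> - \<beta>0)\<^sup>2 * (u i * u i) + e \<beta> i * e \<beta> i + 2 * (\<beta> - \<beta>0) * (u i * e \<beta> i)
         - 2 * (\<beta> - \<beta>0) * (\<xi> i * u i) - 2 * (\<xi> i * e \<beta> i))"
    by (intro sum.cong refl) (simp add: power2_eq_square algebra_simps)
  also have "\<dots> = (\<beta> - \<beta>0)\<^sup>2 * dotp n u u + dotp n (e \<beta>) (e \<beta>) + 2 * (\<beta> - \<beta>0) * dotp n u (e \<beta>)
         - 2 * (\<beta> - \<beta>0) * dotp n \<xi> u - 2 * dotp n \<xi> (e \<beta>)"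
    by (simp add: dotp_def sum.distrib sum_subtractf sum_distrib_left)
  finally have 1: "(\<Sum>i<n. (\<xi> i - (\<beta> - \<beta>0) * u i - e \<beta> i)\<^sup>2 - (\<xi> i)\<^sup>2) = \<dots>" .
  have "(\<Sum>i<n. (u i - g2 i)\<^sup>2 - (u i)\<^sup>2) = (\<Sum>i<n. g2 i * g2 i - 2 * (u i * g2 i))"
    by (intro sum.cong refl) (simp add: power2_eq_square algebra_simps)
  also have "\<dots> = dotp n g2 g2 - 2 * dotp n u g2"
    by (simp add: dotp_def sum_subtractf sum_distrib_left)
  finally have 2: "(\<Sum>i<n. (u i - g2 i)\<^sup>2 - (u i)\<^sup>2) = \<dots>" .
  show ?thesis
    unfolding log_ratio_def 1[unfolded e_def] 2 e_def ..
qed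

text \<open>Since \<open>g1 - \<beta> * g2 = (g1 - \<beta>0 * g2) - (\<beta> - \<beta>0) *
  g2\<close>, the residual at \<open>\<beta>\<close> is \<open>r - (\<beta> - \<beta>0) * v\<close>.
  The log-likelihood is that of least squares regression of \<open>r\<close> on \<open>v\<close>,
  and completing the square gives centre and precision. The part with \<open>\<sigma>2\<close> is
  constant in \<open>\<beta>\<close>.\<close>

lemma log_ratio_gaussian:
  fixes g1 g2 u \<xi> :: "nat \<Rightarrow> real" and \<beta>0 :: real
  defines "v \<equiv> \<lambda>i. u i - g2 i" and "r \<equiv> \<lambda>i. \<xi> i - (g1 i - \<beta>0 * g2 i)"
  assumes pos: "0 < dotp n v v"
  shows "\<exists>c. \<forall>\<beta>. log_ratio \<sigma>1 \<sigma>2 \<beta>0 n \<xi> u g1 g2 \<beta>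
     = c - dotp n v v * (\<beta> - (\<beta>0 + dotp n r v / dotp n v v))\<^sup>2 / (2 * \<sigma>1\<^sup>2)"
proof -
  define p where "p = dotp n v v"
  define q where "q = dotp n r v"
  define K where "K = (\<Sum>i<n. (\<xi> i)\<^sup>2)"
  define L where "L = (\<Sum>i<n. (u i - g2 i)\<^sup>2 - (u i)\<^sup>2) / (2 * \<sigma>2\<^sup>2)"
  have "log_ratio \<sigma>1 \<sigma>2 \<beta>0 n \<xi> u g1 g2 \<beta>
     = - (dotp n r r - q\<^sup>2 / p - K) / (2 * \<sigma>1\<^sup>2) - L - p * (\<beta> - (\<beta>0 + q / p))\<^sup>2 / (2 * \<sigma>1\<^sup>2)" for \<beta>
  proof -
    have "(\<Sum>i<n. (\<xi> i - (\<beta> - \<beta>0) * u i - (g1 i - \<beta> * g2 i))\<^sup>2 - (\<xi> i)\<^sup>2)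
      = (\<Sum>i<n. r i * r i - 2 * (\<beta> - \<beta>0) * (r i * v i) + (\<beta> - \<beta>0)\<^sup>2 * (v i * v i) - (\<xi> i)\<^sup>2)"
      by (intro sum.cong refl) (simp add: v_def r_def power2_eq_square algebra_simps)
    also have "\<dots> = dotp n r r - 2 * (\<beta> - \<beta>0) * q + (\<beta> - \<beta>0)\<^sup>2 * p - K"
      by (simp add: dotp_def p_def q_def K_def sum.distrib sum_subtractf sum_distrib_left)
    also have "\<dots> = (dotp n r r - q\<^sup>2 / p - K) + p * (\<beta> - (\<beta>0 + q / p))\<^sup>2"
      using pos by (simp add: p_def[symmetric] power2_eq_square field_simps)
    finally show ?thesis unfolding log_ratio_def L_def by (simp add: add_divide_distrib diff_divide_distrib)
  qed
  then show ?thesis unfolding p_def q_def by blast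
qed

text \<open>
  The stochastic modulus of the linear functional \<open>v\<close> over the function class: \<open>D\<close> is the dimension
  of the low-frequency space.
\<close>

definition dominated :: "real \<Rightarrow> real \<Rightarrow> nat \<Rightarrow> (nat \<Rightarrow> real) \<Rightarrow> (nat \<Rightarrow> real) \<Rightarrow> bool" where
  "dominated A D n v g \<longleftrightarrow> \<bar>dotp n v g\<bar> \<le> A * (sqrt D * sqrt (dotp n g g) + D)"

lemma dominated_le:
  assumes "dominated A D n v g" "0 \<le> A" "0 \<le> D" "dotp n g g \<le> h"
  shows "\<bar>dotp n v g\<bar> \<le> A * (sqrt D * sqrt h + D)"
proof -
  have "A * (sqrt D * sqrt (dotp n g g) + D) \<le> A * (sqrt D * sqrt h + D)"
    using assms by (intro mult_left_mono add_right_mono) auto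
  then show ?thesis using assms(1) unfolding dominated_def by linarith
qed

lemma log_ratio_terms:
  fixes g1 g2 :: "nat \<Rightarrow> real"
  assumes \<beta>: "\<bar>\<beta>\<bar> \<le> B" "\<bar>\<beta>0\<bar> \<le> B"
    and Z: "\<bar>dotp n \<xi> g1\<bar> \<le> Z" "\<bar>dotp n \<xi> g2\<bar> \<le> Z" "\<bar>dotp n u g1\<bar> \<le> Z" "\<bar>dotp n u g2\<bar> \<le> Z"
  shows "\<bar>2 * (\<beta> - \<beta>0) * dotp n u (\<lambda>i. g1 i - \<beta> * g2 i)\<bar> \<le> 4 * B * (1 + B) * Z"
    "\<bar>2 * dotp n \<xi> (\<lambda>i. g1 i - \<beta> * g2 i)\<bar> \<le> 2 * (1 + B) * Z"
proof -
  have *: "\<bar>dotp n v (\<lambda>i. g1 i - \<beta> * g2 i)\<bar> \<le> (1 + B) * Z"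
    if "\<bar>dotp n v g1\<bar> \<le> Z" "\<bar>dotp n v g2\<bar> \<le> Z" for v
  proof -
    have "\<bar>\<beta> * dotp n v g2\<bar> \<le> B * Z"
      unfolding abs_mult using \<beta> that by (intro mult_mono) auto
    then show ?thesis using that(1) by (simp add: dotp_linear algebra_simps abs_le_iff)
  qed
  have B: "0 \<le> B" "0 \<le> Z" using \<beta> Z(1) by linarith+
  have "\<bar>\<beta> - \<beta>0\<bar> \<le> 2 * B" using \<beta> by linarith
  then have "\<bar>\<beta> - \<beta>0\<bar> * \<bar>dotp n u (\<lambda>i. g1 i - \<beta> * g2 i)\<bar> \<le> (2 * B) * ((1 + B) * Z)"
    using B Z by (intro mult_mono *) auto
  then show "\<bar>2 * (\<beta> - \<beta>0) * dotp n u (\<lambda>i. g1 i - \<beta> * g2 i)\<bar> \<le> 4 * B * (1 + B) * Z"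
    unfolding abs_mult abs_numeral by (simp only: mult.assoc)
  show "\<bar>2 * dotp n \<xi> (\<lambda>i. g1 i - \<beta> * g2 i)\<bar> \<le> 2 * (1 + B) * Z"
    using *[OF Z(1,2)] unfolding abs_mult abs_numeral by (simp only: mult.assoc)
qed

text \<open>A predicate, so that \<open>c\<close> and \<open>C\<close> are visibly fixed before
  \<open>n\<close>, the data, the functions and \<open>\<beta>\<close>; the asymptotics rest on this
  uniformity.\<close>

definition upper_constants :: "real \<Rightarrow> real \<Rightarrow> real \<Rightarrow> real \<Rightarrow> real \<Rightarrow> real \<Rightarrow> bool" where
  "upper_constants \<sigma>1 \<sigma>2 B a c C \<longleftrightarrow> (\<forall>n \<xi> u g1 g2 \<beta> \<beta>0 A D.
     0 < n \<longrightarrow> \<bar>\<beta>\<bar> \<le> B \<longrightarrow> \<bar>\<beta>0\<bar> \<le> B \<longrightarrow> 1 \<le> A \<longrightarrow> 1 \<le> D \<longrightarrow>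
     \<bar>dotp n \<xi> u\<bar> \<le> A * sqrt (real n) \<longrightarrow> a * real n \<le> dotp n u u \<longrightarrow>
     (\<forall>v\<in>{\<xi>, u}. \<forall>g\<in>{g1, g2}. dominated A D n v g) \<longrightarrow>
     log_ratio \<sigma>1 \<sigma>2 \<beta>0 n \<xi> u g1 g2 \<beta> \<le> - c * (dotp n g1 g1 + dotp n g2 g2) + C * A\<^sup>2 * D)"

definition lower_constant :: "real \<Rightarrow> real \<Rightarrow> real \<Rightarrow> real \<Rightarrow> real \<Rightarrow> bool" where
  "lower_constant \<sigma>1 \<sigma>2 B c3 C \<longleftrightarrow> (\<forall>n \<xi> u g1 g2 \<beta> \<beta>0 A D.
     0 < n \<longrightarrow> \<bar>\<beta>\<bar> \<le> B \<longrightarrow> \<bar>\<beta>0\<bar> \<le> B \<longrightarrow> 1 \<le> A \<longrightarrow> 1 \<le> D \<longrightarrow>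
     \<bar>\<beta> - \<beta>0\<bar> \<le> 1 / sqrt (real n) \<longrightarrow>
     \<bar>dotp n \<xi> u\<bar> \<le> A * sqrt (real n) \<longrightarrow> dotp n u u \<le> A * real n \<longrightarrow>
     dotp n g1 g1 \<le> c3 * D \<longrightarrow> dotp n g2 g2 \<le> c3 * D \<longrightarrow>
     (\<forall>v\<in>{\<xi>, u}. \<forall>g\<in>{g1, g2}. dominated A D n v g) \<longrightarrow>
     - C * A * D \<le> log_ratio \<sigma>1 \<sigma>2 \<beta>0 n \<xi> u g1 g2 \<beta>)"

text \<open>The negative quadratic terms control \<open>h = dotp n g1 g1 + dotp n g2 g2\<close>,
  because \<open>g1 = e + \<beta> * g2\<close> with bounded \<open>\<beta>\<close>. The linear terms
  are of size \<open>A * (sqrt (D * h) + D)\<close>; half of the quadratic term absorbs them at the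
  price of a multiple of \<open>A\<^sup>2 * D\<close>. The terms free of \<open>g1\<close> and
  \<open>g2\<close> form a parabola in \<open>\<beta>\<close>, bounded by its maximum.\<close>

lemma log_ratio_upper:
  fixes \<sigma>1 \<sigma>2 B a :: real
  assumes s: "0 < \<sigma>1" "0 < \<sigma>2" and B: "0 < B" and a: "0 < a"
  shows "\<exists>c>0. \<exists>C>0. upper_constants \<sigma>1 \<sigma>2 B a c C"
proof -
  \<comment> \<open>By \<open>dotp n g1 g1 \<le> 2 * dotp n e e + 2 * B\<^sup>2 * dotp n g2
    g2\<close>, the numbers \<open>2 * c\<close> and \<open>c * (2 * B\<^sup>2 + 1)\<close> must not
    exceed the coefficients of \<open>e\<close> and \<open>g2\<close> in the log-likelihood.
    \<open>C2\<close> collects the multiples of \<open>Z\<close>; \<open>C\<close> adds the cost of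
    the absorption and the maximum of the parabola.\<close>
  define c where "c = min (1 / (4 * \<sigma>1\<^sup>2)) (1 / (2 * \<sigma>2\<^sup>2) / (2 * B\<^sup>2 + 1))"
  define C2 where "C2 = (2 * B + 1) * (1 + B) / \<sigma>1\<^sup>2 + 1 / \<sigma>2\<^sup>2"
  define C where "C = C2\<^sup>2 / (2 * c) + C2 + 1 / (2 * a * \<sigma>1\<^sup>2)"
  have dB: "0 < 2 * B\<^sup>2 + 1" by (simp add: add_nonneg_pos)
  have c: "c > 0" unfolding c_def using s dB by simp
  have C2: "C2 > 0" unfolding C2_def using s B by (simp add: add_pos_pos)
  have C: "C > 0" unfolding C_def using c C2 s a by (intro add_pos_pos add_nonneg_pos) auto
  have c1: "2 * c \<le> 1 / (2 * \<sigma>1\<^sup>2)" and c2: "c * (2 * B\<^sup>2 + 1) \<le> 1 / (2 * \<sigma>2\<^sup>2)"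
  proof -
    have "c \<le> 1 / (4 * \<sigma>1\<^sup>2)" by (simp add: c_def)
    then show "2 * c \<le> 1 / (2 * \<sigma>1\<^sup>2)" by simp
    have "c \<le> 1 / (2 * \<sigma>2\<^sup>2) / (2 * B\<^sup>2 + 1)" by (simp add: c_def)
    then show "c * (2 * B\<^sup>2 + 1) \<le> 1 / (2 * \<sigma>2\<^sup>2)" using dB by (simp only: pos_le_divide_eq)
  qed
  have main: "log_ratio \<sigma>1 \<sigma>2 \<beta>0 n \<xi> u g1 g2 \<beta> \<le> - (c / 2) * (dotp n g1 g1 + dotp n g2 g2) + C * A\<^sup>2 * D"
    if n: "0 < n" and \<beta>: "\<bar>\<beta>\<bar> \<le> B" "\<bar>\<beta>0\<bar> \<le> B" and A: "1 \<le> A" and D: "1 \<le> D"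
      and S: "\<bar>dotp n \<xi> u\<bar> \<le> A * sqrt (real n)" and P: "a * real n \<le> dotp n u u"
      and dom: "\<forall>v\<in>{\<xi>, u}. \<forall>g\<in>{g1, g2}. dominated A D n v g"
    for n \<xi> u g1 g2 \<beta> \<beta>0 A D
  proof -
    define t where "t = \<beta> - \<beta>0"
    define e where "e = (\<lambda>i. g1 i - \<beta> * g2 i)"
    define h where "h = dotp n g1 g1 + dotp n g2 g2"
    define Z where "Z = A * (sqrt D * sqrt h + D)"
    have h: "0 \<le> h" "dotp n g1 g1 \<le> h" "dotp n g2 g2 \<le> h"
      using dotp_self_nonneg[of n g1] dotp_self_nonneg[of n g2] by (auto simp: h_def)
    have Zb: "\<bar>dotp n v g\<bar> \<le> Z" if "v \<in> {\<xi>, u}" "g \<in> {g1, g2}" for v g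
      unfolding Z_def using dom that h A D by (intro dominated_le) auto
    have Zt: "\<bar>2 * t * dotp n u e\<bar> \<le> 4 * B * (1 + B) * Z" "\<bar>2 * dotp n \<xi> e\<bar> \<le> 2 * (1 + B) * Z"
      using log_ratio_terms[OF \<beta>, of n \<xi> g1 Z g2 u] Zb by (auto simp: t_def e_def)
    \<comment> \<open>Maximum over \<open>t\<close> of a concave parabola, from the square of
      \<open>a * |t| * sqrt n - A\<close>.\<close>
    have quad: "2 * t * dotp n \<xi> u - t\<^sup>2 * dotp n u u \<le> A\<^sup>2 / a"
    proof -
      have "2 * t * dotp n \<xi> u \<le> 2 * (\<bar>t\<bar> * \<bar>dotp n \<xi> u\<bar>)"
        using abs_ge_self[of "t * dotp n \<xi> u"] by (simp add: abs_mult)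
      also have "\<dots> \<le> 2 * (\<bar>t\<bar> * (A * sqrt n))" using S by (intro mult_left_mono) auto
      finally have "2 * t * dotp n \<xi> u \<le> 2 * \<bar>t\<bar> * A * sqrt n" by simp
      moreover have "t\<^sup>2 * (a * n) \<le> t\<^sup>2 * dotp n u u" using P by (intro mult_left_mono) auto
      moreover have "2 * \<bar>t\<bar> * A * sqrt n - t\<^sup>2 * (a * n) \<le> A\<^sup>2 / a"
      proof -
        have "0 \<le> (a * \<bar>t\<bar> * sqrt n - A)\<^sup>2" by simp
        also have "\<dots> = a * (t\<^sup>2 * (a * n)) - a * (2 * \<bar>t\<bar> * A * sqrt n) + A\<^sup>2"
          by (simp add: power2_diff power_mult_distrib) (simp add: power2_eq_square algebra_simps)
        finally have "a * (2 * \<bar>t\<bar> * A * sqrt n - t\<^sup>2 * (a * n)) \<le> A\<^sup>2"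
          by (simp add: algebra_simps)
        then show ?thesis using a by (simp add: field_simps)
      qed
      ultimately show ?thesis by linarith
    qed
    have ee: "dotp n g1 g1 \<le> 2 * dotp n e e + 2 * B\<^sup>2 * dotp n g2 g2"
    proof -
      have "dotp n g1 g1 \<le> (\<Sum>i<n. 2 * (e i * e i) + 2 * \<beta>\<^sup>2 * (g2 i * g2 i))"
        unfolding dotp_def
      proof (rule sum_mono)
        fix i
        have "0 \<le> (e i - \<beta> * g2 i)\<^sup>2" by simp
        then show "g1 i * g1 i \<le> 2 * (e i * e i) + 2 * \<beta>\<^sup>2 * (g2 i * g2 i)"
          by (simp add: e_def power2_eq_square algebra_simps)
      qed
      also have "\<dots> = 2 * dotp n e e + 2 * \<beta>\<^sup>2 * dotp n g2 g2"
        by (simp add: dotp_def sum.distrib sum_distrib_left)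
      also have "\<dots> \<le> 2 * dotp n e e + 2 * B\<^sup>2 * dotp n g2 g2"
        using \<beta> dotp_self_nonneg[of n g2] by (intro add_left_mono mult_right_mono mult_left_mono) (auto simp: abs_le_square_iff[symmetric])
      finally show ?thesis .
    qed
    have ch: "c * h \<le> dotp n e e / (2 * \<sigma>1\<^sup>2) + dotp n g2 g2 / (2 * \<sigma>2\<^sup>2)"
    proof -
      have "c * h \<le> c * (2 * dotp n e e + 2 * B\<^sup>2 * dotp n g2 g2 + dotp n g2 g2)"
        using ee c by (intro mult_left_mono) (auto simp: h_def)
      also have "\<dots> = (2 * c) * dotp n e e + (c * (2 * B\<^sup>2 + 1)) * dotp n g2 g2"
        by (simp add: algebra_simps)
      also have "\<dots> \<le> 1 / (2 * \<sigma>1\<^sup>2) * dotp n e e + 1 / (2 * \<sigma>2\<^sup>2) * dotp n g2 g2"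
        using c1 c2 dotp_self_nonneg by (intro add_mono mult_right_mono) auto
      finally show ?thesis by simp
    qed
    have "log_ratio \<sigma>1 \<sigma>2 \<beta>0 n \<xi> u g1 g2 \<beta>
      = (2 * t * dotp n \<xi> u - t\<^sup>2 * dotp n u u + (2 * dotp n \<xi> e - 2 * t * dotp n u e)) / (2 * \<sigma>1\<^sup>2)
        + dotp n u g2 / \<sigma>2\<^sup>2 - (dotp n e e / (2 * \<sigma>1\<^sup>2) + dotp n g2 g2 / (2 * \<sigma>2\<^sup>2))"
      unfolding log_ratio_expand t_def e_def by (simp add: add_divide_distrib diff_divide_distrib)
    also have "\<dots> \<le> (A\<^sup>2 / a + (4 * B * (1 + B) * Z + 2 * (1 + B) * Z)) / (2 * \<sigma>1\<^sup>2) + Z / \<sigma>2\<^sup>2 - c * h"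
    proof (intro diff_mono add_mono divide_right_mono ch quad)
      show "2 * dotp n \<xi> e - 2 * t * dotp n u e \<le> 4 * B * (1 + B) * Z + 2 * (1 + B) * Z"
        using Zt unfolding abs_le_iff by linarith
      show "dotp n u g2 \<le> Z" using Zb[of u g2] by (simp add: abs_le_iff)
    qed (use s in auto)
    also have "\<dots> = A\<^sup>2 / (2 * a * \<sigma>1\<^sup>2) + C2 * Z - c * h"
    proof -
      have "4 * B * (1 + B) * Z + 2 * (1 + B) * Z = 2 * ((2 * B + 1) * (1 + B) * Z)"
        by (simp add: algebra_simps)
      then show ?thesis by (simp add: C2_def add_divide_distrib distrib_right[of "_ / _"])
    qed
    also have "\<dots> \<le> - (c / 2) * h + C * A\<^sup>2 * D"
    proof -
      \<comment> \<open>Half of \<open>c * h\<close> absorbs the cross term: the source of the final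
        \<open>c / 2\<close> and of \<open>C2\<^sup>2 / (2 * c)\<close>.\<close>
      have "0 \<le> (c * sqrt h - C2 * A * sqrt D)\<^sup>2" by simp
      also have "\<dots> = c * (c * h) + (C2 * A)\<^sup>2 * D - 2 * c * (C2 * A * sqrt D * sqrt h)"
        using h D by (simp add: power2_diff power_mult_distrib) (simp add: power2_eq_square algebra_simps)
      finally have "2 * c * (C2 * A * (sqrt D * sqrt h)) \<le> c * (c * h) + (C2 * A)\<^sup>2 * D"
        by (simp add: mult.assoc)
      also have "\<dots> = 2 * c * (c / 2 * h + C2\<^sup>2 / (2 * c) * A\<^sup>2 * D)"
        using c by (simp add: power_mult_distrib field_simps)
      finally have 1: "C2 * A * (sqrt D * sqrt h) \<le> c / 2 * h + C2\<^sup>2 / (2 * c) * A\<^sup>2 * D"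
        by (rule mult_left_le_imp_le) (use c in simp)
      have A2: "A \<le> A\<^sup>2" using A by (simp add: power2_eq_square)
      have 2: "C2 * A * D \<le> C2 * A\<^sup>2 * D" using A2 C2 D by (intro mult_right_mono mult_left_mono) auto
      have 3: "A\<^sup>2 / (2 * a * \<sigma>1\<^sup>2) \<le> 1 / (2 * a * \<sigma>1\<^sup>2) * A\<^sup>2 * D"
      proof -
        have "1 / (2 * a * \<sigma>1\<^sup>2) * A\<^sup>2 * 1 \<le> 1 / (2 * a * \<sigma>1\<^sup>2) * A\<^sup>2 * D"
          using D a by (intro mult_left_mono) auto
        then show ?thesis by simp
      qed
      have 4: "C2 * Z = C2 * A * (sqrt D * sqrt h) + C2 * A * D"
        by (simp add: Z_def algebra_simps)
      have 5: "C * A\<^sup>2 * D = C2\<^sup>2 / (2 * c) * A\<^sup>2 * D + C2 * A\<^sup>2 * D + 1 / (2 * a * \<sigma>1\<^sup>2) * A\<^sup>2 * D"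
        by (simp add: C_def distrib_right)
      have 6: "- (c / 2) * h = - (c / 2 * h)" "c * h = c / 2 * h + c / 2 * h" by simp_all
      show ?thesis using 1 2 3 unfolding 4 5 6 by linarith
    qed
    finally show ?thesis by (simp add: h_def)
  qed
  show ?thesis
  proof (rule exI[of _ "c / 2"], rule conjI)
    show "0 < c / 2" using c by simp
  qed (rule exI[of _ C], rule conjI, rule C, unfold upper_constants_def, intro allI impI, rule main)
qed

text \<open>With \<beta> within \<open>1 / sqrt n\<close> of \<open>\<beta>0\<close> and both
  squared empirical norms at most \<open>c3 * D\<close>, every term is a multiple of
  \<open>A * D\<close>; nothing has to be absorbed, so \<open>A\<close> enters linearly.
  \<open>C5 = sqrt c3 + 1\<close> comes from evaluating the stochastic modulus at that norm.\<close>

lemma log_ratio_lower: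
  fixes \<sigma>1 \<sigma>2 B c3 :: real
  assumes s: "0 < \<sigma>1" "0 < \<sigma>2" and B: "0 < B" and c3: "0 < c3"
  shows "\<exists>C>0. lower_constant \<sigma>1 \<sigma>2 B c3 C"
proof -
  define C5 where "C5 = sqrt c3 + 1"
  define C where "C = (1 + (2 + 2 * B\<^sup>2) * c3 + 4 * B * (1 + B) * C5 + 2 + 2 * (1 + B) * C5) / (2 * \<sigma>1\<^sup>2)
     + (c3 + 2 * C5) / (2 * \<sigma>2\<^sup>2)"
  have C5: "C5 > 0" using c3 by (simp add: C5_def add_pos_pos)
  have C: "C > 0"
  proof -
    have X1: "0 < 1 + (2 + 2 * B\<^sup>2) * c3 + 4 * B * (1 + B) * C5 + 2 + 2 * (1 + B) * C5"
      using B c3 C5 by (intro add_pos_nonneg mult_nonneg_nonneg) auto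
    have X2: "0 < c3 + 2 * C5" using c3 C5 by simp
    show ?thesis
      unfolding C_def by (rule add_pos_pos[OF divide_pos_pos[OF X1] divide_pos_pos[OF X2]]) (use s in auto)
  qed
  have main: "- C * A * D \<le> log_ratio \<sigma>1 \<sigma>2 \<beta>0 n \<xi> u g1 g2 \<beta>"
    if n: "0 < n" and \<beta>: "\<bar>\<beta>\<bar> \<le> B" "\<bar>\<beta>0\<bar> \<le> B" and A: "1 \<le> A" and D: "1 \<le> D"
      and t: "\<bar>\<beta> - \<beta>0\<bar> \<le> 1 / sqrt (real n)"
      and S: "\<bar>dotp n \<xi> u\<bar> \<le> A * sqrt (real n)" and P: "dotp n u u \<le> A * real n"
      and Q: "dotp n g1 g1 \<le> c3 * D" "dotp n g2 g2 \<le> c3 * D"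
      and dom: "\<forall>v\<in>{\<xi>, u}. \<forall>g\<in>{g1, g2}. dominated A D n v g"
    for n \<xi> u g1 g2 \<beta> \<beta>0 A D
  proof -
    define t where "t = \<beta> - \<beta>0"
    define e where "e = (\<lambda>i. g1 i - \<beta> * g2 i)"
    define Z where "Z = C5 * (A * D)"
    have Zb: "\<bar>dotp n v g\<bar> \<le> Z" if "v \<in> {\<xi>, u}" "g \<in> {g1, g2}" for v g
    proof -
      have "\<bar>dotp n v g\<bar> \<le> A * (sqrt D * sqrt (c3 * D) + D)"
        using dom that Q A D by (intro dominated_le) auto
      also have "\<dots> = Z" using D by (simp add: Z_def C5_def real_sqrt_mult algebra_simps)
      finally show ?thesis .
    qed
    have Zt: "\<bar>2 * t * dotp n u e\<bar> \<le> 4 * B * (1 + B) * Z" "\<bar>2 * dotp n \<xi> e\<bar> \<le> 2 * (1 + B) * Z"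
      using log_ratio_terms[OF \<beta>, of n \<xi> g1 Z g2 u] Zb by (auto simp: t_def e_def)
    have AD: "A \<le> A * D" "D \<le> A * D" using A D by auto
    have t2: "t\<^sup>2 * dotp n u u \<le> A * D"
    proof -
      have "t\<^sup>2 \<le> (1 / sqrt n)\<^sup>2" using that(6) by (simp add: t_def abs_le_square_iff[symmetric])
      then have "t\<^sup>2 * dotp n u u \<le> (1 / n) * (A * n)"
        using P dotp_self_nonneg by (intro mult_mono) (auto simp: power_divide)
      then show ?thesis using n AD by simp
    qed
    have tS: "\<bar>2 * t * dotp n \<xi> u\<bar> \<le> 2 * (A * D)"
    proof -
      have "\<bar>t\<bar> * \<bar>dotp n \<xi> u\<bar> \<le> (1 / sqrt n) * (A * sqrt n)"
        using that(6) S by (intro mult_mono) (auto simp: t_def)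
      then show ?thesis using n AD by (simp add: abs_mult)
    qed
    have ee: "dotp n e e \<le> (2 + 2 * B\<^sup>2) * c3 * (A * D)"
    proof -
      have "dotp n e e \<le> (\<Sum>i<n. 2 * (g1 i * g1 i) + 2 * \<beta>\<^sup>2 * (g2 i * g2 i))"
        unfolding dotp_def
      proof (rule sum_mono)
        fix i
        have "0 \<le> (g1 i + \<beta> * g2 i)\<^sup>2" by simp
        then show "e i * e i \<le> 2 * (g1 i * g1 i) + 2 * \<beta>\<^sup>2 * (g2 i * g2 i)"
          by (simp add: e_def power2_eq_square algebra_simps)
      qed
      also have "\<dots> = 2 * dotp n g1 g1 + 2 * \<beta>\<^sup>2 * dotp n g2 g2"
        by (simp add: dotp_def sum.distrib sum_distrib_left)
      also have "\<dots> \<le> 2 * (c3 * D) + 2 * B\<^sup>2 * (c3 * D)"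
        using \<beta> Q B
        by (intro add_mono mult_mono dotp_self_nonneg) (auto simp: abs_le_square_iff[symmetric])
      also have "\<dots> = (2 + 2 * B\<^sup>2) * c3 * D" by (simp add: algebra_simps)
      also have "\<dots> \<le> (2 + 2 * B\<^sup>2) * c3 * (A * D)"
        using AD c3 by (intro mult_left_mono) auto
      finally show ?thesis .
    qed
    have gg: "dotp n g2 g2 \<le> c3 * (A * D)"
      using AD c3 by (intro order_trans[OF Q(2)] mult_left_mono) auto
    have neg: "- (- X / c - Y / d) = X / c + Y / d" for X Y c d :: real by simp
    have "- log_ratio \<sigma>1 \<sigma>2 \<beta>0 n \<xi> u g1 g2 \<beta>
      = (t\<^sup>2 * dotp n u u + dotp n e e + 2 * t * dotp n u e - 2 * t * dotp n \<xi> u - 2 * dotp n \<xi> e) / (2 * \<sigma>1\<^sup>2)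
        + (dotp n g2 g2 - 2 * dotp n u g2) / (2 * \<sigma>2\<^sup>2)"
      unfolding log_ratio_expand t_def e_def by (rule neg)
    also have "\<dots> \<le> (A * D + (2 + 2 * B\<^sup>2) * c3 * (A * D) + 4 * B * (1 + B) * Z + 2 * (A * D) + 2 * (1 + B) * Z) / (2 * \<sigma>1\<^sup>2)
        + (c3 * (A * D) + 2 * Z) / (2 * \<sigma>2\<^sup>2)"
    proof (intro add_mono divide_right_mono)
      show "t\<^sup>2 * dotp n u u + dotp n e e + 2 * t * dotp n u e - 2 * t * dotp n \<xi> u - 2 * dotp n \<xi> e
        \<le> A * D + (2 + 2 * B\<^sup>2) * c3 * (A * D) + 4 * B * (1 + B) * Z + 2 * (A * D) + 2 * (1 + B) * Z"
        using t2 ee Zt tS unfolding abs_le_iff by linarith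
      show "dotp n g2 g2 - 2 * dotp n u g2 \<le> c3 * (A * D) + 2 * Z"
        using gg Zb[of u g2] by (simp add: abs_le_iff)
    qed (use s in auto)
    also have "\<dots> = C * (A * D)"
      by (simp add: C_def Z_def distrib_right add_divide_distrib mult.assoc)
    finally show ?thesis by simp
  qed
  show ?thesis
    by (rule exI[of _ C], rule conjI, rule C, unfold lower_constant_def, intro allI impI, rule main)
qed

section \<open>Posterior mixtures\<close>

lemma integral_uniform_measure_interval:
  fixes f :: "real \<Rightarrow> real"
  assumes "0 < B" "f \<in> borel_measurable borel"
  shows "(\<integral>x. f x \<partial>uniform_measure lborel {-B..B}) = (LINT x|lborel. f x * indicator {-B..B} x) / (2 * B)"
proof -
  have "uniform_measure lborel {-B..B} = density lborel (\<lambda>x. ennreal (indicator {-B..B} x / (2 * B)))"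
    unfolding uniform_measure_def
    using assms by (intro density_cong) (auto simp: indicator_def ennreal_1[symmetric] divide_ennreal simp del: ennreal_1)
  then have "(\<integral>x. f x \<partial>uniform_measure lborel {-B..B}) = (LINT x|lborel. (indicator {-B..B} x / (2 * B)) *\<^sub>R f x)"
    using assms by (simp, subst integral_density) auto
  also have "\<dots> = (LINT x|lborel. (f x * indicator {-B..B} x) / (2 * B))"
    by (simp add: mult_ac)
  finally show ?thesis by simp
qed

text \<open>The factor \<open>c'\<close> is the same for all \<open>A\<close>, so a ratio of two
  such integrals is a normal law truncated to \<open>{-B..B}\<close>. It is kept because integration
  over the nuisance functions comes before normalization.\<close>

lemma gaussian_uniform_integral:
  fixes B c p b \<sigma> :: real
  assumes "0 < B" "0 < p" "0 < \<sigma>"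
  shows "\<exists>c'>0. \<forall>A\<in>sets borel.
      (\<integral>x. exp (c - p * (x - b)\<^sup>2 / (2 * \<sigma>\<^sup>2)) * indicator A x \<partial>uniform_measure lborel {-B..B})
      = c' * measure (density lborel (normal_density b (\<sigma> / sqrt p))) (A \<inter> {-B..B})"
proof -
  define s' where "s' = \<sigma> / sqrt p"
  let ?s = s'
  let ?N = "density lborel (normal_density b ?s)"
  define c' where "c' = exp c * sqrt (2 * pi * ?s\<^sup>2) / (2 * B)"
  have s: "?s > 0" using assms by (simp add: s'_def)
  have "c' > 0" using assms s by (simp add: c'_def)
  moreover have "(\<integral>x. exp (c - p * (x - b)\<^sup>2 / (2 * \<sigma>\<^sup>2)) * indicator A x \<partial>uniform_measure lborel {-B..B})
      = c' * measure ?N (A \<inter> {-B..B})" if A: "A \<in> sets borel" for A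
  proof -
    have "measure ?N (A \<inter> {-B..B}) = (LINT x|?N. indicator (A \<inter> {-B..B}) x)"
      using A by simp
    also have "\<dots> = (LINT x|lborel. normal_density b ?s x * indicator (A \<inter> {-B..B}) x)"
      using A by (subst integral_density) auto
    finally have m: "measure ?N (A \<inter> {-B..B}) = \<dots>" .
    have e: "exp (c - p * (x - b)\<^sup>2 / (2 * \<sigma>\<^sup>2)) = 2 * B * c' * normal_density b ?s x" for x
    proof -
      have "(x - b)\<^sup>2 / (2 * ?s\<^sup>2) = p * (x - b)\<^sup>2 / (2 * \<sigma>\<^sup>2)"
        using assms by (simp add: s'_def power_divide)
      then have nd: "normal_density b ?s x = 1 / sqrt (2 * pi * ?s\<^sup>2) * exp (- (p * (x - b)\<^sup>2 / (2 * \<sigma>\<^sup>2)))"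
        unfolding normal_density_def minus_divide_left[symmetric] by (simp only:)
      have q: "sqrt (2 * pi * ?s\<^sup>2) \<noteq> 0" using s by simp
      have c'': "2 * B * c' = exp c * sqrt (2 * pi * ?s\<^sup>2)" using assms by (simp add: c'_def)
      have gen: "C * E = (C * q) * (1 / q * E)" if "q \<noteq> 0" for C q E :: real using that by simp
      have ed: "exp (c - y) = exp c * exp (- y)" for y :: real
        by (simp add: exp_diff exp_minus field_simps)
      show ?thesis unfolding nd c'' ed gen[OF q, symmetric] ..
    qed
    have "(\<integral>x. exp (c - p * (x - b)\<^sup>2 / (2 * \<sigma>\<^sup>2)) * indicator A x \<partial>uniform_measure lborel {-B..B})
        = (LINT x|lborel. (2 * B * c') * (normal_density b ?s x * indicator (A \<inter> {-B..B}) x)) / (2 * B)"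
    proof (subst integral_uniform_measure_interval[OF assms(1)])
      show "(LINT x|lborel. exp (c - p * (x - b)\<^sup>2 / (2 * \<sigma>\<^sup>2)) * indicator A x * indicator {-B..B} x) / (2 * B)
        = (LINT x|lborel. (2 * B * c') * (normal_density b ?s x * indicator (A \<inter> {-B..B}) x)) / (2 * B)"
        unfolding e by (intro arg_cong2[where f = "(/)"] Bochner_Integration.integral_cong refl) (simp add: indicator_def)
    qed (use A in measurable)
    also have "\<dots> = c' * measure ?N (A \<inter> {-B..B})"
      using assms by (simp add: m)
    finally show ?thesis .
  qed
  ultimately show ?thesis unfolding s'_def by blast
qed

text \<open>The comparison of \<open>N\<close> truncated to \<open>I\<close> with \<open>N0\<close>
  is left unnormalized, so that it can be weighted and integrated. The absolute error is
  \<open>2 * \<kappa> + 3 * \<delta>\<close>; since \<open>N\<close> keeps at least half of its mass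
  in \<open>I\<close>, doubling makes it relative to \<open>measure N I\<close>.\<close>

lemma truncation_bound:
  fixes N N0 :: "real measure" and I :: "real set"
  assumes "prob_space N" "prob_space N0" "sets N = sets borel" "sets N0 = sets borel" "I \<in> sets borel"
    and tv: "\<And>A. A \<in> sets borel \<Longrightarrow> \<bar>measure N A - measure N0 A\<bar> \<le> \<delta>"
    and \<kappa>: "measure N0 (UNIV - I) \<le> \<kappa>" and small: "\<kappa> + \<delta> \<le> 1/2" and A: "A \<in> sets borel"
  shows "\<bar>measure N (A \<inter> I) - measure N0 A * measure N I\<bar> \<le> 2 * (2 * \<kappa> + 3 * \<delta>) * measure N I"
proof -
  interpret N: prob_space N by fact
  interpret N0: prob_space N0 by fact
  have sp: "space N = UNIV" "space N0 = UNIV" using assms(3,4)[THEN sets_eq_imp_space_eq] by simp_all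
  note sets = assms(3,4,5) A
  have c: "measure N (UNIV - I) = 1 - measure N I"
    using N.prob_compl[of I] sets by (simp add: sp)
  have nI: "1 - measure N I \<le> \<kappa> + \<delta>"
  proof -
    have "\<bar>measure N (UNIV - I) - measure N0 (UNIV - I)\<bar> \<le> \<delta>" using sets by (intro tv) auto
    then show ?thesis using \<kappa> c by linarith
  qed
  have "measure N A - measure N (A \<inter> I) = measure N (A - I)"
    using sets by (intro N.finite_measure_Diff'[symmetric]) auto
  also have "\<dots> \<le> measure N (UNIV - I)" using sets by (intro N.finite_measure_mono) auto
  finally have 1: "measure N A - measure N (A \<inter> I) \<le> \<kappa> + \<delta>" using nI c by linarith
  have 2: "measure N (A \<inter> I) \<le> measure N A" using sets by (intro N.finite_measure_mono) auto
  have 3: "0 \<le> measure N0 A * (1 - measure N I)" "measure N0 A * (1 - measure N I) \<le> \<kappa> + \<delta>"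
  proof -
    show "0 \<le> measure N0 A * (1 - measure N I)" by simp
    have "measure N0 A * (1 - measure N I) \<le> 1 * (1 - measure N I)"
      by (intro mult_right_mono) auto
    then show "measure N0 A * (1 - measure N I) \<le> \<kappa> + \<delta>" using nI by simp
  qed
  have main: "\<bar>measure N (A \<inter> I) - measure N0 A * measure N I\<bar> \<le> 2 * \<kappa> + 3 * \<delta>"
  proof -
    have "measure N0 A * measure N I = measure N0 A - measure N0 A * (1 - measure N I)"
      by (simp only: right_diff_distrib mult_1_right diff_diff_eq2 add_diff_cancel_left')
    then show ?thesis using 1 2 3 tv[OF A] by linarith
  qed
  have "1 \<le> 2 * measure N I" using nI small by linarith
  moreover have "0 \<le> 2 * \<kappa> + 3 * \<delta>" using main by linarith
  ultimately have "(2 * \<kappa> + 3 * \<delta>) * 1 \<le> (2 * \<kappa> + 3 * \<delta>) * (2 * measure N I)"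
    by (rule mult_left_mono)
  also have "\<dots> = 2 * (2 * \<kappa> + 3 * \<delta>) * measure N I"
    by (simp only: mult_ac)
  finally have "2 * \<kappa> + 3 * \<delta> \<le> 2 * (2 * \<kappa> + 3 * \<delta>) * measure N I"
    by (simp only: mult_1_right)
  with main show ?thesis by (rule order_trans)
qed

lemma mult_sqrt_divide:
  fixes x :: real
  assumes "0 < x"
  shows "c * sqrt x / (a * x) = c / (a * sqrt x)"
proof -
  have "c * sqrt x / (a * x) = c * sqrt x / (a * sqrt x * sqrt x)"
    using assms by (simp add: mult.assoc)
  also have "\<dots> = c / (a * sqrt x)"
    using assms by (intro nonzero_mult_divide_mult_cancel_right) simp
  finally show ?thesis .
qed

lemma sqrt_ratio_diff:
  fixes p q :: real
  assumes "0 < p" "0 < q" and that: "0 < \<sigma>"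
  shows "\<bar>\<sigma> / sqrt p - \<sigma> / sqrt q\<bar> / (\<sigma> / sqrt q) \<le> \<bar>q - p\<bar> / p"
proof -
  have "\<bar>\<sigma> / sqrt p - \<sigma> / sqrt q\<bar> / (\<sigma> / sqrt q) = \<bar>sqrt (q / p) - 1\<bar>"
  proof -
    have "(\<sigma> / sqrt p - \<sigma> / sqrt q) / (\<sigma> / sqrt q) = sqrt (q / p) - 1"
      using assms that by (simp add: real_sqrt_divide field_simps)
    moreover have "\<bar>\<sigma> / sqrt p - \<sigma> / sqrt q\<bar> / (\<sigma> / sqrt q) = \<bar>(\<sigma> / sqrt p - \<sigma> / sqrt q) / (\<sigma> / sqrt q)\<bar>"
      using assms by (simp only: abs_divide[of _ "\<sigma> / sqrt q"] abs_of_pos[of "\<sigma> / sqrt q"] divide_pos_pos real_sqrt_gt_zero)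
    ultimately show ?thesis by simp
  qed
  also have "\<dots> \<le> \<bar>q / p - 1\<bar>"
  proof -
    define r where "r = sqrt (q / p)"
    have r: "r \<ge> 0" "q / p = r * r" using assms by (auto simp: r_def)
    have "r * r - 1 = (r - 1) * (r + 1)" by (simp add: algebra_simps)
    then have "\<bar>q / p - 1\<bar> = \<bar>r - 1\<bar> * (r + 1)" using r by (simp add: abs_mult)
    moreover have "\<bar>r - 1\<bar> * 1 \<le> \<bar>r - 1\<bar> * (r + 1)" using r by (intro mult_left_mono) auto
    ultimately show ?thesis by (simp add: r_def)
  qed
  also have "\<dots> = \<bar>q - p\<bar> / p"
  proof -
    have "q / p - 1 = (q - p) / p" using assms by (simp add: diff_divide_distrib)
    then show ?thesis using assms by (simp only: abs_divide abs_of_pos)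
  qed
  finally show ?thesis .
qed

lemma scaled_abs_diff_le:
  fixes c x y m t :: real
  assumes "0 < c" "\<bar>x - m * y\<bar> \<le> t * y"
  shows "\<bar>c * x - m * (c * y)\<bar> \<le> t * (c * y)"
proof -
  have "c * x - m * (c * y) = c * (x - m * y)" by (simp add: algebra_simps)
  then have "\<bar>c * x - m * (c * y)\<bar> = c * \<bar>x - m * y\<bar>" using assms by (simp add: abs_mult)
  then show ?thesis using mult_left_mono[OF assms(2), of c] assms(1) by (simp add: mult_ac)
qed

text \<open>Passing from the truth to \<open>g1, g2\<close> changes precision and score by bilinear
  expressions in the residuals and the deviations. \<open>E\<close> is twice the stochastic modulus
  \<open>Z\<close> plus the second-order bound \<open>R\<close>: it bounds the change of
  \<open>dotp n u u\<close>, and \<open>(2 + B) * E\<close> that of the score.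
  \<open>\<delta>\<close> adds the total variation costs of moving the centre and of changing the
  scale; \<open>\<kappa>\<close> is Chebyshev's bound for the mass of the limit law outside
  \<open>{-B..B}\<close>.\<close>

lemma conditional_posterior_normal:
  fixes n :: nat and \<xi> u g1 g2 :: "nat \<Rightarrow> real" and \<sigma>1 \<sigma>2 B \<beta>0 a A D R :: real
  defines "E \<equiv> 2 * (A * (sqrt D * sqrt R + D)) + R"
  defines "\<delta> \<equiv> 3 * (E * (2 + B + A / (a * sqrt (real n))) * sqrt 2 / (\<sigma>1 * sqrt a * sqrt (real n)))
      + 3 * (2 * E / (a * real n))"
  defines "\<kappa> \<equiv> 4 * \<sigma>1\<^sup>2 / (a * real n * (B - \<bar>\<beta>0\<bar>)\<^sup>2)"
  defines "N0 \<equiv> density lborel (normal_density (\<beta>0 + dotp n \<xi> u / dotp n u u) (\<sigma>1 / sqrt (dotp n u u)))"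
  defines "F \<equiv> \<lambda>A. \<integral>\<beta>. exp (log_ratio \<sigma>1 \<sigma>2 \<beta>0 n \<xi> u g1 g2 \<beta>) * indicator A \<beta> \<partial>uniform_measure lborel {-B..B}"
  assumes n: "0 < n" and s: "0 < \<sigma>1" and B: "\<bar>\<beta>0\<bar> < B" and a: "0 < a" and A: "0 \<le> A" and D: "0 \<le> D"
    and S: "\<bar>dotp n \<xi> u\<bar> \<le> A * sqrt (real n)" and P: "a * real n \<le> dotp n u u"
    and dom: "\<forall>v\<in>{\<xi>, u}. \<forall>g\<in>{g1, g2}. dominated A D n v g"
    and R: "dotp n g1 g1 + dotp n g2 g2 \<le> R"
    and small: "2 * E \<le> a * real n" "2 * A / (a * sqrt (real n)) \<le> B - \<bar>\<beta>0\<bar>" "\<kappa> + \<delta> \<le> 1/2"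
    and C: "C \<in> sets borel"
  shows "\<bar>F C - measure N0 C * F UNIV\<bar> \<le> 2 * (2 * \<kappa> + 3 * \<delta>) * F UNIV"
proof -
  define v where "v = (\<lambda>i. u i - g2 i)"
  define d where "d = (\<lambda>i. g1 i - \<beta>0 * g2 i)"
  define r where "r = (\<lambda>i. \<xi> i - d i)"
  define P0 where "P0 = dotp n u u"
  define S0 where "S0 = dotp n \<xi> u"
  define p where "p = dotp n v v"
  define q where "q = dotp n r v"
  define b where "b = \<beta>0 + q / p"
  define b0 where "b0 = \<beta>0 + S0 / P0"
  define Z where "Z = A * (sqrt D * sqrt R + D)"
  have Bpos: "0 < B" using B by linarith
  have an: "0 < a * real n" using a n by simp
  have Rg: "0 \<le> R" "dotp n g1 g1 \<le> R" "dotp n g2 g2 \<le> R"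
    using R dotp_self_nonneg[of n g1] dotp_self_nonneg[of n g2] by linarith+
  have Zb: "\<bar>dotp n w g\<bar> \<le> Z" if "w \<in> {\<xi>, u}" "g \<in> {g1, g2}" for w g
    unfolding Z_def using dom that Rg A D by (intro dominated_le) auto
  have E: "E = 2 * Z + R" by (simp add: E_def Z_def)
  have Z0: "0 \<le> Z" using Zb[of u g2] by auto
  have P0: "a * n \<le> P0" "0 < P0" using P an by (auto simp: P0_def)
  have "p = P0 - 2 * dotp n u g2 + dotp n g2 g2"
    by (simp add: p_def v_def P0_def dotp_linear dotp_commute[of n g2 u])
  then have pP: "\<bar>p - P0\<bar> \<le> E"
    using Zb[of u g2] Rg dotp_self_nonneg[of n g2] by (simp add: E abs_le_iff)
  \<comment> \<open>The smallness condition on \<open>E\<close> preserves half of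
    \<open>a * n\<close>, which makes \<open>p\<close> a safe denominator below.\<close>
  have p_half: "a * n / 2 \<le> p"
    using pP P0 small(1) by (simp add: abs_le_iff)
  then have p: "0 < p" using an by linarith
  have cs: "\<bar>dotp n g1 g2\<bar> \<le> R"
  proof -
    have "\<bar>dotp n g1 g2\<bar> \<le> sqrt (dotp n g1 g1) * sqrt (dotp n g2 g2)" by (rule dotp_cauchy_schwarz)
    also have "\<dots> \<le> sqrt R * sqrt R" using Rg by (intro mult_mono) (auto simp: dotp_self_nonneg)
    finally show ?thesis using Rg by simp
  qed
  have qS: "\<bar>q - S0\<bar> \<le> (2 + B) * E"
  proof -
    \<comment> \<open>The products \<open>dotp n g1 g2\<close> and \<open>dotp n g2 g2\<close> gain
      nothing from randomness; they are of order \<open>R\<close>.\<close>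
    have "q - S0 = - dotp n \<xi> g2 - dotp n u g1 + \<beta>0 * dotp n u g2 + dotp n g1 g2 - \<beta>0 * dotp n g2 g2"
      by (simp add: q_def S0_def r_def d_def v_def dotp_linear dotp_commute[of n _ u] algebra_simps)
    moreover have "\<bar>\<beta>0 * dotp n u g2\<bar> \<le> B * Z" "\<bar>\<beta>0 * dotp n g2 g2\<bar> \<le> B * R"
      unfolding abs_mult using B Zb[of u g2] Rg dotp_self_nonneg[of n g2] by (auto intro!: mult_mono)
    ultimately have "\<bar>q - S0\<bar> \<le> Z + Z + B * Z + R + B * R"
      using Zb[of \<xi> g2] Zb[of u g1] cs by (simp add: abs_le_iff)
    also have "\<dots> \<le> (2 + B) * E"
      using Bpos Z0 Rg by (simp add: E algebra_simps)
    finally show ?thesis .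
  qed
  have E0: "0 \<le> E" using pP by linarith
  have bb: "\<bar>b - b0\<bar> \<le> E * (2 + B + A / (a * sqrt n)) / p"
  proof -
    have "b - b0 = (q - S0) / p + S0 * (P0 - p) / (P0 * p)"
      using p P0 by (simp add: b_def b0_def field_simps)
    then have "\<bar>b - b0\<bar> \<le> \<bar>q - S0\<bar> / p + \<bar>S0\<bar> * \<bar>P0 - p\<bar> / (P0 * p)"
      using p P0 abs_triangle_ineq[of "(q - S0) / p" "S0 * (P0 - p) / (P0 * p)"]
      by (simp add: abs_mult abs_divide)
    also have "\<dots> \<le> (2 + B) * E / p + (A * sqrt n) * E / (a * n * p)"
    proof (rule add_mono)
      show "\<bar>q - S0\<bar> / p \<le> (2 + B) * E / p" using qS p by (intro divide_right_mono) auto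
      show "\<bar>S0\<bar> * \<bar>P0 - p\<bar> / (P0 * p) \<le> (A * sqrt n) * E / (a * n * p)"
      proof (rule frac_le)
        show "\<bar>S0\<bar> * \<bar>P0 - p\<bar> \<le> (A * sqrt n) * E"
          using S pP A by (intro mult_mono) (auto simp: S0_def abs_minus_commute)
        show "a * n * p \<le> P0 * p" using P0 p by (intro mult_right_mono) auto
      qed (use A E0 an p in auto)
    qed
    also have "\<dots> = E * (2 + B + A / (a * sqrt n)) / p"
    proof -
      have "(A * sqrt n) * E / (a * n * p) = (A * sqrt n / (a * n)) * E / p" by simp
      also have "A * sqrt n / (a * n) = A / (a * sqrt n)" using n by (intro mult_sqrt_divide) simp
      finally have "(A * sqrt n) * E / (a * n * p) = A / (a * sqrt n) * E / p" .
      then show ?thesis by (simp add: algebra_simps add_divide_distrib)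
    qed
    finally show ?thesis .
  qed
  let ?N = "density lborel (normal_density b (\<sigma>1 / sqrt p))"
  have sp: "0 < \<sigma>1 / sqrt p" "0 < \<sigma>1 / sqrt P0" using s p P0 by auto
  have N0: "N0 = density lborel (normal_density b0 (\<sigma>1 / sqrt P0))"
    by (simp add: N0_def b0_def S0_def P0_def)
  have tv: "\<bar>measure ?N C - measure N0 C\<bar> \<le> \<delta>" if C: "C \<in> sets borel" for C
  proof -
    \<comment> \<open>The intermediate law has the centre of \<open>N0\<close> and the scale of
      \<open>?N\<close>: one shift and one change of scale.\<close>
    let ?M = "density lborel (normal_density b0 (\<sigma>1 / sqrt p))"
    have "\<bar>measure ?N C - measure ?M C\<bar> \<le> 3 * (\<bar>b - b0\<bar> / (\<sigma>1 / sqrt p))"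
      by (rule tv_normal_shift[OF sp(1) C])
    also have "\<bar>b - b0\<bar> / (\<sigma>1 / sqrt p) \<le> (E * (2 + B + A / (a * sqrt n)) / p) / (\<sigma>1 / sqrt p)"
      using bb sp by (intro divide_right_mono) auto
    also have "\<dots> = E * (2 + B + A / (a * sqrt n)) / (\<sigma>1 * sqrt p)"
      using p s by (simp add: field_simps)
    also have "\<dots> \<le> E * (2 + B + A / (a * sqrt n)) / (\<sigma>1 * sqrt (a * n / 2))"
      using p_half E0 Bpos A a s an p
      by (intro divide_left_mono mult_nonneg_nonneg mult_left_mono mult_pos_pos) auto
    also have "\<dots> = E * (2 + B + A / (a * sqrt n)) * sqrt 2 / (\<sigma>1 * sqrt a * sqrt n)"
      by (simp add: real_sqrt_divide real_sqrt_mult)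
    finally have 1: "\<bar>measure ?N C - measure ?M C\<bar> \<le> 3 * \<dots>" by simp
    have "\<bar>measure ?M C - measure N0 C\<bar> \<le> 3 * (\<bar>\<sigma>1 / sqrt p - \<sigma>1 / sqrt P0\<bar> / (\<sigma>1 / sqrt P0))"
      unfolding N0 by (rule tv_normal_scale[OF sp C])
    also have "\<bar>\<sigma>1 / sqrt p - \<sigma>1 / sqrt P0\<bar> / (\<sigma>1 / sqrt P0) \<le> \<bar>P0 - p\<bar> / p"
      by (rule sqrt_ratio_diff[OF p P0(2) s])
    also have "\<dots> \<le> E / (a * n / 2)"
      using pP p_half an E0 by (intro frac_le) (auto simp: abs_minus_commute)
    finally have 2: "\<bar>measure ?M C - measure N0 C\<bar> \<le> 3 * (2 * E / (a * n))" by simp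
    show ?thesis using 1 2 unfolding \<delta>_def by linarith
  qed
  have \<kappa>: "measure N0 (UNIV - {-B..B}) \<le> \<kappa>"
  proof -
    \<comment> \<open>The centre \<open>b0\<close> uses at most half of the gap between
      \<open>\<beta>0\<close> and the boundary, so every point outside \<open>{-B..B}\<close> is at
      least the other half away from it.\<close>
    let ?r = "(B - \<bar>\<beta>0\<bar>) / 2"
    interpret N0: prob_space N0 unfolding N0 by (rule prob_space_normal_density[OF sp(2)])
    have "\<bar>b0 - \<beta>0\<bar> \<le> ?r"
    proof -
      have "\<bar>b0 - \<beta>0\<bar> = \<bar>S0\<bar> / P0" using P0 by (simp add: b0_def)
      also have "\<dots> \<le> A * sqrt n / (a * n)"
        using S P0 an A by (intro frac_le) (auto simp: S0_def)
      also have "\<dots> = A / (a * sqrt n)" using n by (intro mult_sqrt_divide) simp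
      finally show ?thesis using small(2) by simp
    qed
    then have "?r \<le> \<bar>x - b0\<bar>" if "x < - B \<or> B < x" for x
    proof -
      have "B \<le> \<bar>x\<bar>" using that by auto
      moreover have "(B - c) / 2 \<le> f" if "B \<le> a" "e \<le> (B - c) / 2" "a - d \<le> f" "d - c \<le> e"
        for a c d e f :: real
        using that by (simp add: field_simps)
      ultimately show ?thesis
        using \<open>\<bar>b0 - \<beta>0\<bar> \<le> ?r\<close> abs_triangle_ineq2[of x b0] abs_triangle_ineq2[of b0 \<beta>0] by blast
    qed
    then have "UNIV - {-B..B} \<subseteq> {x. ?r \<le> \<bar>x - b0\<bar>}" by auto
    then have "measure N0 (UNIV - {-B..B}) \<le> measure N0 {x. ?r \<le> \<bar>x - b0\<bar>}"
      by (intro N0.finite_measure_mono) (auto simp: N0)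
    also have "\<dots> \<le> (\<sigma>1 / sqrt P0)\<^sup>2 / ?r\<^sup>2"
      unfolding N0 using B by (intro normal_chebyshev sp) auto
    also have "\<dots> = 4 * \<sigma>1\<^sup>2 / (P0 * (B - \<bar>\<beta>0\<bar>)\<^sup>2)"
      using P0 by (simp add: power_divide)
    also have "\<dots> \<le> \<kappa>"
      unfolding \<kappa>_def using B a n by (intro divide_left_mono mult_right_mono mult_pos_pos P0) auto
    finally show ?thesis .
  qed
  have "\<exists>c. \<forall>\<beta>. log_ratio \<sigma>1 \<sigma>2 \<beta>0 n \<xi> u g1 g2 \<beta> = c - p * (\<beta> - b)\<^sup>2 / (2 * \<sigma>1\<^sup>2)"
    unfolding p_def b_def q_def v_def r_def d_def
    by (rule log_ratio_gaussian) (use p in \<open>simp add: p_def v_def\<close>)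
  then obtain c where c: "\<And>\<beta>. log_ratio \<sigma>1 \<sigma>2 \<beta>0 n \<xi> u g1 g2 \<beta> = c - p * (\<beta> - b)\<^sup>2 / (2 * \<sigma>1\<^sup>2)"
    by auto
  obtain c' where c': "c' > 0" "\<forall>A\<in>sets borel. F A = c' * measure ?N (A \<inter> {-B..B})"
    using gaussian_uniform_integral[OF Bpos p s, of c b] unfolding F_def c by auto
  have FC: "F C = c' * measure ?N (C \<inter> {-B..B})" using c'(2) C by (rule bspec)
  have FU: "F UNIV = c' * measure ?N {-B..B}" using bspec[OF c'(2), of UNIV] by simp
  have "\<bar>measure ?N (C \<inter> {-B..B}) - measure N0 C * measure ?N {-B..B}\<bar>
      \<le> 2 * (2 * \<kappa> + 3 * \<delta>) * measure ?N {-B..B}"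
  proof (rule truncation_bound[OF _ _ _ _ _ tv \<kappa> small(3) C])
    show "prob_space ?N" by (rule prob_space_normal_density[OF sp(1)])
    show "prob_space N0" unfolding N0 by (rule prob_space_normal_density[OF sp(2)])
  qed (simp_all add: N0)
  then show ?thesis unfolding FC FU by (rule scaled_abs_diff_le[OF c'(1)])
qed

section \<open>From the law given the nuisance functions to the marginal of \<beta>\<close>

lemma measure_posterior:
  assumes int: "integrable Pr L" and nn: "\<And>\<theta>. 0 \<le> L \<theta>" and pos: "0 < (\<integral>\<theta>. L \<theta> \<partial>Pr)"
    and A: "A \<in> sets Pr"
  shows "measure (posterior Pr L) A = (\<integral>\<theta>. L \<theta> * indicator A \<theta> \<partial>Pr) / (\<integral>\<theta>. L \<theta> \<partial>Pr)"
proof -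
  have mL: "L \<in> borel_measurable Pr" using int by simp
  have Z: "(\<integral>\<^sup>+ \<theta>. ennreal (L \<theta>) \<partial>Pr) = ennreal (\<integral>\<theta>. L \<theta> \<partial>Pr)"
    using int nn by (intro nn_integral_eq_integral) auto
  have intA: "integrable Pr (\<lambda>\<theta>. L \<theta> * indicator A \<theta>)"
    using int A by (rule integrable_real_mult_indicator[rotated])
  have "emeasure (posterior Pr L) A
      = (\<integral>\<^sup>+ \<theta>. ennreal (L \<theta>) / ennreal (\<integral>\<theta>. L \<theta> \<partial>Pr) * indicator A \<theta> \<partial>Pr)"
    unfolding posterior_def Z using A mL by (subst emeasure_density) auto
  also have "\<dots> = (\<integral>\<^sup>+ \<theta>. ennreal (L \<theta> * indicator A \<theta>) / ennreal (\<integral>\<theta>. L \<theta> \<partial>Pr) \<partial>Pr)"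
    by (intro nn_integral_cong) (auto simp: indicator_def)
  also have "\<dots> = (\<integral>\<^sup>+ \<theta>. ennreal (L \<theta> * indicator A \<theta>) \<partial>Pr) / ennreal (\<integral>\<theta>. L \<theta> \<partial>Pr)"
    using intA by (intro nn_integral_divide) auto
  also have "(\<integral>\<^sup>+ \<theta>. ennreal (L \<theta> * indicator A \<theta>) \<partial>Pr) = ennreal (\<integral>\<theta>. L \<theta> * indicator A \<theta> \<partial>Pr)"
    using intA nn by (intro nn_integral_eq_integral) auto
  also have "\<dots> / ennreal (\<integral>\<theta>. L \<theta> \<partial>Pr) = ennreal ((\<integral>\<theta>. L \<theta> * indicator A \<theta> \<partial>Pr) / (\<integral>\<theta>. L \<theta> \<partial>Pr))"
    using pos nn by (intro divide_ennreal) (auto intro!: integral_nonneg_AE)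
  finally show ?thesis
    using pos nn by (simp add: measure_def integral_nonneg_AE)
qed

text \<open>Each \<open>m\<close> either has a conditional law close to \<open>\<phi>\<close> or
  contributes at most \<open>X\<close> to the normalization. In the second case \<open>F A m\<close>
  and \<open>\<phi> * F UNIV m\<close> both lie between 0 and \<open>X\<close>, so
  \<open>\<tau> * F UNIV m + X\<close> covers both cases and can be integrated. Division by the
  normalization, at least \<open>Y\<close>, gives the claim. The factor \<open>c\<close> cancels, so
  the likelihood is used up to a constant.\<close>

lemma posterior_first_marginal_bound:
  fixes U :: "real measure" and Pm :: "'m measure" and f :: "real \<times> 'm \<Rightarrow> real"
  assumes U: "prob_space U" "sets U = sets borel" and Pm: "prob_space Pm"
    and f: "f \<in> borel_measurable (U \<Otimes>\<^sub>M Pm)" "\<And>\<theta>. 0 \<le> f \<theta>" "\<And>\<theta>. f \<theta> \<le> b" and c: "0 < c"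
  defines "F \<equiv> \<lambda>A m. \<integral>\<beta>. f (\<beta>, m) * indicator A \<beta> \<partial>U"
  assumes A: "A \<in> sets borel" and \<phi>: "0 \<le> \<phi>" "\<phi> \<le> 1" and \<tau>: "0 \<le> \<tau>" and X: "0 \<le> X" and Y: "0 < Y"
    and dich: "AE m in Pm. \<bar>F A m - \<phi> * F UNIV m\<bar> \<le> \<tau> * F UNIV m \<or> F UNIV m \<le> X"
    and lower: "Y \<le> (\<integral>m. F UNIV m \<partial>Pm)"
  shows "\<bar>measure (distr (posterior (U \<Otimes>\<^sub>M Pm) (\<lambda>\<theta>. c * f \<theta>)) borel fst) A - \<phi>\<bar> \<le> \<tau> + X / Y"
proof -
  interpret U: prob_space U by fact
  interpret Pm: prob_space Pm by fact
  interpret P: pair_prob_space U Pm ..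
  let ?P = "U \<Otimes>\<^sub>M Pm"
  have int: "integrable ?P f"
    using f by (intro P.integrable_const_bound[of _ b]) auto
  have spU: "space U = UNIV" using sets_eq_imp_space_eq[OF U(2)] by simp
  define A' where "A' = A \<times> space Pm"
  have A': "A' \<in> sets ?P" unfolding A'_def using A U(2) by auto
  have intA: "integrable ?P (\<lambda>\<theta>. f \<theta> * indicator C \<theta>)" if "C \<in> sets ?P" for C
    using int that by (intro integrable_real_mult_indicator)
  have Fub: "(\<integral>\<theta>. f \<theta> * indicator (C \<times> space Pm) \<theta> \<partial>?P) = (\<integral>m. F C m \<partial>Pm)" "integrable Pm (F C)"
    if C: "C \<in> sets borel" for C
  proof -
    have CC: "C \<times> space Pm \<in> sets ?P" using C U(2) by auto
    have eq: "integrable Pm (\<lambda>m. \<integral>\<beta>. f (\<beta>, m) * indicator (C \<times> space Pm) (\<beta>, m) \<partial>U)"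
      "(\<integral>m. (\<integral>\<beta>. f (\<beta>, m) * indicator (C \<times> space Pm) (\<beta>, m) \<partial>U) \<partial>Pm)
        = (\<integral>\<theta>. f \<theta> * indicator (C \<times> space Pm) \<theta> \<partial>?P)"
      using P.integrable_snd[of "\<lambda>\<beta> m. f (\<beta>, m) * indicator (C \<times> space Pm) (\<beta>, m)"]
        P.integral_snd[of "\<lambda>\<beta> m. f (\<beta>, m) * indicator (C \<times> space Pm) (\<beta>, m)"] intA[OF CC]
      by (simp_all add: case_prod_beta')
    have *: "(\<integral>\<beta>. f (\<beta>, m) * indicator (C \<times> space Pm) (\<beta>, m) \<partial>U) = F C m" if "m \<in> space Pm" for m
      unfolding F_def using that by (intro Bochner_Integration.integral_cong refl) (auto simp: indicator_def)
    show "integrable Pm (F C)"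
      using eq(1) * by (subst Bochner_Integration.integrable_cong[OF refl]) auto
    have "(\<integral>m. F C m \<partial>Pm) = (\<integral>m. (\<integral>\<beta>. f (\<beta>, m) * indicator (C \<times> space Pm) (\<beta>, m) \<partial>U) \<partial>Pm)"
      using * by (intro Bochner_Integration.integral_cong refl) auto
    then show "(\<integral>\<theta>. f \<theta> * indicator (C \<times> space Pm) \<theta> \<partial>?P) = (\<integral>m. F C m \<partial>Pm)" using eq(2) by simp
  qed
  have tot: "(\<integral>\<theta>. f \<theta> \<partial>?P) = (\<integral>m. F UNIV m \<partial>Pm)"
  proof -
    have "(\<integral>\<theta>. f \<theta> \<partial>?P) = (\<integral>\<theta>. f \<theta> * indicator (UNIV \<times> space Pm) \<theta> \<partial>?P)"
      by (intro Bochner_Integration.integral_cong refl) (auto simp: space_pair_measure indicator_def)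
    then show ?thesis using Fub(1)[of UNIV] by simp
  qed
  define T where "T = (\<integral>m. F UNIV m \<partial>Pm)"
  have T: "0 < T" using Y lower by (simp add: T_def)
  have sets_post: "sets (posterior ?P L) = sets ?P" "space (posterior ?P L) = space ?P" for L
    by (simp_all add: posterior_def)
  have fstm: "fst \<in> measurable (posterior ?P (\<lambda>\<theta>. c * f \<theta>)) borel"
  proof -
    have "fst \<in> measurable ?P U" by (rule measurable_fst)
    then show ?thesis by (simp cong: measurable_cong_sets add: sets_post U(2))
  qed
  have "measure (distr (posterior ?P (\<lambda>\<theta>. c * f \<theta>)) borel fst) A = measure (posterior ?P (\<lambda>\<theta>. c * f \<theta>)) A'"
    using A by (subst measure_distr[OF fstm]) (auto simp: sets_post space_pair_measure A'_def spU intro!: arg_cong[where f = "measure _"])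
  also have "\<dots> = (\<integral>\<theta>. c * f \<theta> * indicator A' \<theta> \<partial>?P) / (\<integral>\<theta>. c * f \<theta> \<partial>?P)"
    using int c f(2) T by (intro measure_posterior A') (auto simp: tot T_def)
  also have "\<dots> = (\<integral>m. F A m \<partial>Pm) / T"
    using c Fub(1)[OF A] by (simp add: tot T_def A'_def mult.assoc)
  finally have main: "measure (distr (posterior ?P (\<lambda>\<theta>. c * f \<theta>)) borel fst) A = (\<integral>m. F A m \<partial>Pm) / T" .
  have iF: "integrable Pm (F A)" "integrable Pm (F UNIV)" using A by (auto intro!: Fub(2))
  have F_le: "0 \<le> F A m" "F A m \<le> F UNIV m" if m: "m \<in> space Pm" for m
  proof -
    have "(\<lambda>\<beta>. f (\<beta>, m)) \<in> borel_measurable U" using f(1) m by measurable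
    then have i: "integrable U (\<lambda>\<beta>. f (\<beta>, m))" using f(2,3) by (intro U.integrable_const_bound[of _ b]) auto
    show "0 \<le> F A m" unfolding F_def using f(2) by (intro integral_nonneg_AE) auto
    show "F A m \<le> F UNIV m"
      unfolding F_def
    proof (rule integral_mono)
      show "integrable U (\<lambda>\<beta>. f (\<beta>, m) * indicator A \<beta>)"
        using i A U(2) by (intro integrable_real_mult_indicator) auto
      show "integrable U (\<lambda>\<beta>. f (\<beta>, m) * indicator UNIV \<beta>)" using i by simp
    qed (use f(2) in \<open>auto simp: indicator_def\<close>)
  qed
  have bd: "AE m in Pm. \<bar>F A m - \<phi> * F UNIV m\<bar> \<le> \<tau> * F UNIV m + X"
    using dich AE_space
  proof eventually_elim
    case (elim m)
    have F: "0 \<le> F A m" "F A m \<le> F UNIV m" using F_le elim by auto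
    have "0 \<le> \<tau> * F UNIV m" using \<tau> F by auto
    moreover have "\<phi> * F UNIV m \<le> 1 * F UNIV m" using \<phi> F by (intro mult_right_mono) auto
    moreover have "0 \<le> \<phi> * F UNIV m" using \<phi> F by auto
    ultimately show ?case using elim(1) F X by (elim disjE) linarith+
  qed
  have "\<bar>(\<integral>m. F A m \<partial>Pm) - \<phi> * T\<bar> = \<bar>\<integral>m. F A m - \<phi> * F UNIV m \<partial>Pm\<bar>"
    using iF by (simp add: T_def)
  also have "\<dots> \<le> (\<integral>m. \<bar>F A m - \<phi> * F UNIV m\<bar> \<partial>Pm)" by (rule integral_abs_bound)
  also have "\<dots> \<le> (\<integral>m. \<tau> * F UNIV m + X \<partial>Pm)"
    using iF bd by (intro integral_mono_AE) auto
  also have "\<dots> = \<tau> * T + X" using iF by (simp add: T_def Pm.prob_space)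
  finally have "\<bar>(\<integral>m. F A m \<partial>Pm) - \<phi> * T\<bar> \<le> \<tau> * T + X" .
  then have "\<bar>(\<integral>m. F A m \<partial>Pm) - \<phi> * T\<bar> / T \<le> (\<tau> * T + X) / T"
    using T by (intro divide_right_mono) auto
  also have "\<dots> = \<tau> + X / T" using T by (simp add: add_divide_distrib)
  also have "\<dots> \<le> \<tau> + X / Y" using X Y lower T by (intro add_left_mono divide_left_mono) (auto simp: T_def)
  also have "\<bar>(\<integral>m. F A m \<partial>Pm) - \<phi> * T\<bar> / T = \<bar>(\<integral>m. F A m \<partial>Pm) / T - \<phi>\<bar>"
  proof -
    have "(\<integral>m. F A m \<partial>Pm) / T - \<phi> = ((\<integral>m. F A m \<partial>Pm) - \<phi> * T) / T" using T by (simp add: diff_divide_distrib)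
    then show ?thesis using T by (simp only: abs_divide abs_of_pos)
  qed
  finally show ?thesis unfolding main .
qed

text \<open>The factor \<open>c\<close> is the likelihood at \<open>(\<beta>0, m01, m02)\<close>: it
  depends on the data alone and drops out of the posterior.\<close>

lemma likelihood_log_ratio:
  fixes w :: "nat \<Rightarrow> real" and z :: "nat \<Rightarrow> real \<times> real" and m01 m02 :: "real \<Rightarrow> real"
    and \<beta>0 :: real
  defines "u \<equiv> \<lambda>i. snd (z i) - m02 (w i)"
  defines "\<xi> \<equiv> \<lambda>i. fst (z i) - m01 (w i) - \<beta>0 * (snd (z i) - m02 (w i))"
  assumes "0 < \<sigma>1" "0 < \<sigma>2"
  shows "\<exists>c>0. likelihood \<sigma>1 \<sigma>2 n w z = (\<lambda>(\<beta>, m1, m2).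
     c * exp (log_ratio \<sigma>1 \<sigma>2 \<beta>0 n \<xi> u (\<lambda>i. m1 (w i) - m01 (w i)) (\<lambda>i. m2 (w i) - m02 (w i)) \<beta>))"
proof -
  define c0 where "c0 = (\<Sum>i<n. - ((\<xi> i)\<^sup>2 / (2 * \<sigma>1\<^sup>2) + (u i)\<^sup>2 / (2 * \<sigma>2\<^sup>2)))"
  define k where "k = (1 / (2 * pi * \<sigma>1 * \<sigma>2)) ^ n"
  have "likelihood \<sigma>1 \<sigma>2 n w z (\<beta>, m1, m2)
      = (k * exp c0) * exp (log_ratio \<sigma>1 \<sigma>2 \<beta>0 n \<xi> u (\<lambda>i. m1 (w i) - m01 (w i)) (\<lambda>i. m2 (w i) - m02 (w i)) \<beta>)"
    for \<beta> m1 m2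
  proof -
    let ?r = "\<lambda>i. \<xi> i - (\<beta> - \<beta>0) * u i - (m1 (w i) - m01 (w i) - \<beta> * (m2 (w i) - m02 (w i)))"
    let ?s = "\<lambda>i. u i - (m2 (w i) - m02 (w i))"
    let ?E = "\<lambda>i. - ((?r i)\<^sup>2 / (2 * \<sigma>1\<^sup>2) + (?s i)\<^sup>2 / (2 * \<sigma>2\<^sup>2))"
    have "likelihood \<sigma>1 \<sigma>2 n w z (\<beta>, m1, m2) = (\<Prod>i<n. exp (?E i) / (2 * pi * \<sigma>1 * \<sigma>2))"
      unfolding likelihood_def prod.case mvn_density_V_mat[OF assms(3,4)]
    proof (intro prod.cong refl)
      fix i
      have "fst (z i) - m1 (w i) - \<beta> * (snd (z i) - m2 (w i)) = ?r i" "snd (z i) - m2 (w i) = ?s i"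
        by (simp_all add: \<xi>_def u_def algebra_simps)
      then show "exp (- ((fst (z i) - m1 (w i) - \<beta> * (snd (z i) - m2 (w i)))\<^sup>2 / (2 * \<sigma>1\<^sup>2)
          + (snd (z i) - m2 (w i))\<^sup>2 / (2 * \<sigma>2\<^sup>2))) / (2 * pi * \<sigma>1 * \<sigma>2) = exp (?E i) / (2 * pi * \<sigma>1 * \<sigma>2)"
        by (simp only:)
    qed
    also have "\<dots> = k * exp (\<Sum>i<n. ?E i)"
      by (simp add: k_def exp_sum prod_dividef power_one_over)
    also have "(\<Sum>i<n. ?E i) = c0 + log_ratio \<sigma>1 \<sigma>2 \<beta>0 n \<xi> u (\<lambda>i. m1 (w i) - m01 (w i)) (\<lambda>i. m2 (w i) - m02 (w i)) \<beta>"
      unfolding c0_def log_ratio_def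
      by (simp add: sum_subtractf sum.distrib sum_negf sum_divide_distrib diff_divide_distrib)
    finally show ?thesis by (simp add: exp_add)
  qed
  then show ?thesis
    using assms by (intro exI[of _ "k * exp c0"]) (auto simp: k_def fun_eq_iff)
qed

lemma AE_pair_fst:
  assumes "prob_space M2" "AE x in M1. P x"
  shows "AE y in M1 \<Otimes>\<^sub>M M2. P (fst y)"
proof (rule AE_distrD[of fst _ M1])
  show "AE x in distr (M1 \<Otimes>\<^sub>M M2) M1 fst. P x"
    using assms(2) unfolding prob_space.distr_pair_fst[OF assms(1)] .
qed simp

lemma AE_pair_snd:
  assumes "prob_space M1" "prob_space M2" "AE x in M2. P x"
  shows "AE y in M1 \<Otimes>\<^sub>M M2. P (snd y)"
proof -
  interpret M1: prob_space M1 by fact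
  interpret M2: prob_space M2 by fact
  interpret P: pair_sigma_finite M2 M1 ..
  have "AE y in distr (M1 \<Otimes>\<^sub>M M2) (M2 \<Otimes>\<^sub>M M1) (\<lambda>(x, y). (y, x)). P (fst y)"
    using AE_pair_fst[OF assms(1,3)] unfolding P.distr_pair_swap[symmetric] .
  then have "AE y in M1 \<Otimes>\<^sub>M M2. P (fst ((\<lambda>(x, y). (y, x)) y))"
    by (rule AE_distrD[rotated]) simp
  then show ?thesis by (simp add: case_prod_beta')
qed

lemma measure_pair_Times:
  assumes "prob_space M1" "prob_space M2" "A \<in> sets M1" "C \<in> sets M2"
  shows "measure (M1 \<Otimes>\<^sub>M M2) (A \<times> C) = measure M1 A * measure M2 C"
proof -
  interpret M2: prob_space M2 by fact
  show ?thesis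
    using M2.emeasure_pair_measure_Times[OF assms(3,4)] by (simp add: measure_def enn2real_mult)
qed

text \<open>For fixed data the likelihood is bounded in the parameter, which secures integrability
  under the prior.\<close>

lemma log_ratio_le_const:
  "log_ratio \<sigma>1 \<sigma>2 \<beta>0 n \<xi> u g1 g2 \<beta> \<le> (\<Sum>i<n. (\<xi> i)\<^sup>2) / (2 * \<sigma>1\<^sup>2) + (\<Sum>i<n. (u i)\<^sup>2) / (2 * \<sigma>2\<^sup>2)"
proof -
  have "- (\<Sum>i<n. (\<xi> i - (\<beta> - \<beta>0) * u i - (g1 i - \<beta> * g2 i))\<^sup>2 - (\<xi> i)\<^sup>2) \<le> (\<Sum>i<n. (\<xi> i)\<^sup>2)"
    by (simp add: sum_subtractf sum_nonneg)
  then have 1: "- (\<Sum>i<n. (\<xi> i - (\<beta> - \<beta>0) * u i - (g1 i - \<beta> * g2 i))\<^sup>2 - (\<xi> i)\<^sup>2) / (2 * \<sigma>1\<^sup>2) \<le> (\<Sum>i<n. (\<xi> i)\<^sup>2) / (2 * \<sigma>1\<^sup>2)"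
    by (rule divide_right_mono) simp
  have "- (\<Sum>i<n. (u i - g2 i)\<^sup>2 - (u i)\<^sup>2) \<le> (\<Sum>i<n. (u i)\<^sup>2)"
    by (simp add: sum_subtractf sum_nonneg)
  then have 2: "- (\<Sum>i<n. (u i - g2 i)\<^sup>2 - (u i)\<^sup>2) / (2 * \<sigma>2\<^sup>2) \<le> (\<Sum>i<n. (u i)\<^sup>2) / (2 * \<sigma>2\<^sup>2)"
    by (rule divide_right_mono) simp
  show ?thesis using add_mono[OF 1 2] unfolding log_ratio_def by simp
qed

lemma tv_dist_le:
  assumes "\<And>A. A \<in> sets P \<Longrightarrow> \<bar>measure P A - measure Q A\<bar> \<le> t"
  shows "tv_dist P Q \<le> t"
  unfolding tv_dist_def using assms by (intro cSUP_least) (auto intro: sets.empty_sets)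

text \<open>The empty set shows that the supremum is non-negative, once the bound \<open>t\<close>
  guarantees that the real \<open>SUP\<close> is a genuine supremum.\<close>

lemma abs_tv_dist_le:
  assumes "\<And>A. A \<in> sets P \<Longrightarrow> \<bar>measure P A - measure Q A\<bar> \<le> t"
  shows "\<bar>tv_dist P Q\<bar> \<le> t"
proof -
  have "\<bar>measure P {} - measure Q {}\<bar> \<le> tv_dist P Q"
    unfolding tv_dist_def using assms by (intro cSUP_upper) (auto intro!: bdd_aboveI2)
  then show ?thesis using tv_dist_le[OF assms] by simp
qed

lemma uniform_measure_interval:
  assumes "0 < B" "{x - r..x + r} \<subseteq> {-B..B}" "0 \<le> r"
  shows "measure (uniform_measure lborel {-B..B}) {\<beta>::real. \<bar>\<beta> - x\<bar> \<le> r} = r / B"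
proof -
  have "{\<beta>. \<bar>\<beta> - x\<bar> \<le> r} = {x - r..x + r}" by auto
  moreover have "{-B..B} \<inter> {x - r..x + r} = {x - r..x + r}" using assms(2) by auto
  ultimately show ?thesis using assms by simp
qed

lemma prob_space_uniform_interval:
  "0 < B \<Longrightarrow> prob_space (uniform_measure lborel {- B..B::real})"
  by (intro prob_space_uniform_measure) auto

lemma AE_uniform_interval: "AE \<beta> in uniform_measure lborel {-B..B::real}. \<bar>\<beta>\<bar> \<le> B"
  by (rule AE_uniform_measureI) (auto intro!: AE_I2)

lemma upper_constantsD:
  assumes "upper_constants \<sigma>1 \<sigma>2 B a c C" "0 < n" "\<bar>\<beta>\<bar> \<le> B" "\<bar>\<beta>0\<bar> \<le> B" "1 \<le> A" "1 \<le> D"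
    "\<bar>dotp n \<xi> u\<bar> \<le> A * sqrt (real n)" "a * real n \<le> dotp n u u"
    "\<forall>v\<in>{\<xi>, u}. \<forall>g\<in>{g1, g2}. dominated A D n v g"
  shows "log_ratio \<sigma>1 \<sigma>2 \<beta>0 n \<xi> u g1 g2 \<beta> \<le> - c * (dotp n g1 g1 + dotp n g2 g2) + C * A\<^sup>2 * D"
  using assms(1) unfolding upper_constants_def
  by (elim allE[of _ n] allE[of _ \<xi>] allE[of _ u] allE[of _ g1] allE[of _ g2] allE[of _ \<beta>]
      allE[of _ \<beta>0] allE[of _ A] allE[of _ D] impE) (rule assms)+

lemma lower_constantD:
  assumes "lower_constant \<sigma>1 \<sigma>2 B c3 C" "0 < n" "\<bar>\<beta>\<bar> \<le> B" "\<bar>\<beta>0\<bar> \<le> B" "1 \<le> A" "1 \<le> D"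
    "\<bar>\<beta> - \<beta>0\<bar> \<le> 1 / sqrt (real n)"
    "\<bar>dotp n \<xi> u\<bar> \<le> A * sqrt (real n)" "dotp n u u \<le> A * real n"
    "dotp n g1 g1 \<le> c3 * D" "dotp n g2 g2 \<le> c3 * D"
    "\<forall>v\<in>{\<xi>, u}. \<forall>g\<in>{g1, g2}. dominated A D n v g"
  shows "- C * A * D \<le> log_ratio \<sigma>1 \<sigma>2 \<beta>0 n \<xi> u g1 g2 \<beta>"
  using assms(1) unfolding lower_constant_def
  by (elim allE[of _ n] allE[of _ \<xi>] allE[of _ u] allE[of _ g1] allE[of _ g2] allE[of _ \<beta>]
      allE[of _ \<beta>0] allE[of _ A] allE[of _ D] impE) (rule assms)+

text \<open>For one data set in the good event the bound is deterministic. An \<open>m\<close> with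
  summed squared deviations at most \<open>R\<close> has a conditional law close to the limit; any
  other \<open>m\<close> has weight at most \<open>exp (- c * R + C * A\<^sup>2 * D)\<close>, by the
  upper bound on the log-likelihood ratio. The denominator comes from \<beta> within
  \<open>1 / sqrt n\<close> of \<open>\<beta>0\<close>, of prior mass
  \<open>1 / (sqrt n * B)\<close>, and from functions within \<open>\<eta>\<close> of the truth at
  the design points.\<close>

lemma tv_beta_posterior_le:
  fixes n :: nat and w :: "nat \<Rightarrow> real" and z :: "nat \<Rightarrow> real \<times> real" and m01 m02 :: "real \<Rightarrow> real"
    and W1 W2 :: "(real \<Rightarrow> real) measure"
    and \<sigma>1 \<sigma>2 B \<beta>0 a A D R c C c3 C' \<eta> \<pi>1 \<pi>2 :: real
  defines "u \<equiv> \<lambda>i. snd (z i) - m02 (w i)"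
  defines "\<xi> \<equiv> \<lambda>i. fst (z i) - m01 (w i) - \<beta>0 * (snd (z i) - m02 (w i))"
  defines "E \<equiv> 2 * (A * (sqrt D * sqrt R + D)) + R"
  defines "\<delta> \<equiv> 3 * (E * (2 + B + A / (a * sqrt (real n))) * sqrt 2 / (\<sigma>1 * sqrt a * sqrt (real n)))
      + 3 * (2 * E / (a * real n))"
  defines "\<kappa> \<equiv> 4 * \<sigma>1\<^sup>2 / (a * real n * (B - \<bar>\<beta>0\<bar>)\<^sup>2)"
  assumes W: "prob_space W1" "prob_space W2"
    "sets W1 = sets (PiM {0..1} (\<lambda>_. borel))" "sets W2 = sets (PiM {0..1} (\<lambda>_. borel))"
    and w: "\<And>i. i < n \<Longrightarrow> w i \<in> {0..1}"
    and n: "0 < n" and s: "0 < \<sigma>1" "0 < \<sigma>2" and B: "\<bar>\<beta>0\<bar> < B" and a: "0 < a"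
    and A: "1 \<le> A" and D: "1 \<le> D" and R: "0 \<le> R"
    and up: "upper_constants \<sigma>1 \<sigma>2 B a c C" "0 \<le> c" and low: "lower_constant \<sigma>1 \<sigma>2 B c3 C'"
    and S: "\<bar>dotp n \<xi> u\<bar> \<le> A * sqrt (real n)" and P: "a * real n \<le> dotp n u u" "dotp n u u \<le> A * real n"
    and dom: "AE m in W1. \<forall>v\<in>{\<xi>, u}. dominated A D n v (\<lambda>i. m (w i) - m01 (w i))"
      "AE m in W2. \<forall>v\<in>{\<xi>, u}. dominated A D n v (\<lambda>i. m (w i) - m02 (w i))"
    and near: "\<pi>1 \<le> measure W1 {m\<in>space W1. \<forall>i<n. \<bar>m (w i) - m01 (w i)\<bar> \<le> \<eta>}" "0 < \<pi>1"
      "\<pi>2 \<le> measure W2 {m\<in>space W2. \<forall>i<n. \<bar>m (w i) - m02 (w i)\<bar> \<le> \<eta>}" "0 < \<pi>2"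
    and \<eta>: "real n * \<eta>\<^sup>2 \<le> c3 * D"
    and small: "2 * E \<le> a * real n" "2 * A / (a * sqrt (real n)) \<le> B - \<bar>\<beta>0\<bar>" "\<kappa> + \<delta> \<le> 1/2"
      "1 / sqrt (real n) \<le> B - \<bar>\<beta>0\<bar>"
  shows "\<bar>tv_dist (beta_posterior (uniform_measure lborel {-B..B} \<Otimes>\<^sub>M (W1 \<Otimes>\<^sub>M W2)) \<sigma>1 \<sigma>2 n w z)
            (normal_law (\<beta>0 + Delta_n \<sigma>1 \<beta>0 m01 m02 n w z / sqrt (real n))
               ((1 / real n) * inverse (info_n \<sigma>1 m02 n w z)))\<bar>
      \<le> 2 * (2 * \<kappa> + 3 * \<delta>)
        + exp (- c * R + C * A\<^sup>2 * D) / (exp (- C' * A * D) * (1 / sqrt (real n) / B) * (\<pi>1 * \<pi>2))"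
    (is "\<bar>tv_dist ?post ?norm\<bar> \<le> ?bound")
proof -
  let ?U = "uniform_measure lborel {-B..B}"
  let ?Pm = "W1 \<Otimes>\<^sub>M W2"
  let ?g1 = "\<lambda>(m :: (real \<Rightarrow> real) \<times> (real \<Rightarrow> real)) i. fst m (w i) - m01 (w i)"
  let ?g2 = "\<lambda>(m :: (real \<Rightarrow> real) \<times> (real \<Rightarrow> real)) i. snd m (w i) - m02 (w i)"
  have Bpos: "0 < B" using B by linarith
  interpret W1: prob_space W1 by fact
  interpret W2: prob_space W2 by fact
  interpret Pm: pair_prob_space W1 W2 ..
  have Pm: "prob_space ?Pm" by (rule Pm.prob_space_axioms)
  have U: "prob_space ?U" using Bpos by (rule prob_space_uniform_interval)
  interpret U: prob_space ?U by fact
  define f where "f = (\<lambda>(\<beta>, m1, m2). exp (log_ratio \<sigma>1 \<sigma>2 \<beta>0 n \<xi> u (\<lambda>i. m1 (w i) - m01 (w i)) (\<lambda>i. m2 (w i) - m02 (w i)) \<beta>))"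
  have f_eq: "f (\<beta>, m) = exp (log_ratio \<sigma>1 \<sigma>2 \<beta>0 n \<xi> u (?g1 m) (?g2 m) \<beta>)" for \<beta> m
    by (simp add: f_def split: prod.split)
  have "\<exists>k>0. likelihood \<sigma>1 \<sigma>2 n w z = (\<lambda>(\<beta>, m1, m2).
     k * exp (log_ratio \<sigma>1 \<sigma>2 \<beta>0 n \<xi> u (\<lambda>i. m1 (w i) - m01 (w i)) (\<lambda>i. m2 (w i) - m02 (w i)) \<beta>))"
    unfolding \<xi>_def u_def by (rule likelihood_log_ratio[OF s])
  then obtain k where k: "0 < k" and L: "likelihood \<sigma>1 \<sigma>2 n w z = (\<lambda>\<theta>. k * f \<theta>)"
    unfolding f_def by (auto simp: case_prod_beta')
  have cm: "(\<lambda>m. m (w i)) \<in> borel_measurable W1" "(\<lambda>m. m (w i)) \<in> borel_measurable W2" if "i < n" for i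
    using measurable_component_singleton[OF w[OF that], of "\<lambda>_. borel"] W(3,4)
    by (simp_all cong: measurable_cong_sets)
  have cm': "(\<lambda>\<theta>. fst (snd \<theta>) (w i)) \<in> borel_measurable (?U \<Otimes>\<^sub>M ?Pm)"
    "(\<lambda>\<theta>. snd (snd \<theta>) (w i)) \<in> borel_measurable (?U \<Otimes>\<^sub>M ?Pm)" if "i < n" for i
  proof -
    have "(\<lambda>\<theta>. fst (snd \<theta>)) \<in> measurable (?U \<Otimes>\<^sub>M ?Pm) W1" "(\<lambda>\<theta>. snd (snd \<theta>)) \<in> measurable (?U \<Otimes>\<^sub>M ?Pm) W2"
      by measurable
    then show "(\<lambda>\<theta>. fst (snd \<theta>) (w i)) \<in> borel_measurable (?U \<Otimes>\<^sub>M ?Pm)"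
      "(\<lambda>\<theta>. snd (snd \<theta>) (w i)) \<in> borel_measurable (?U \<Otimes>\<^sub>M ?Pm)"
      using measurable_compose cm[OF that] by blast+
  qed
  have fst_m: "(\<lambda>\<theta>. fst \<theta>) \<in> borel_measurable (?U \<Otimes>\<^sub>M ?Pm)"
  proof -
    have "fst \<in> measurable (?U \<Otimes>\<^sub>M ?Pm) ?U" by (rule measurable_fst)
    then show ?thesis by (simp cong: measurable_cong_sets)
  qed
  have f_meas: "f \<in> borel_measurable (?U \<Otimes>\<^sub>M ?Pm)"
    unfolding f_def log_ratio_def case_prod_beta'
    by (intro borel_measurable_exp borel_measurable_diff borel_measurable_divide borel_measurable_uminus
        borel_measurable_sum borel_measurable_power borel_measurable_times borel_measurable_const cm' fst_m
        measurable_compose[OF _ borel_measurable_exp]) auto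
  define b where "b = exp ((\<Sum>i<n. (\<xi> i)\<^sup>2) / (2 * \<sigma>1\<^sup>2) + (\<Sum>i<n. (u i)\<^sup>2) / (2 * \<sigma>2\<^sup>2))"
  have f_le: "f \<theta> \<le> b" for \<theta>
    by (cases \<theta>) (simp add: f_eq b_def log_ratio_le_const)
  have f_nn: "0 \<le> f \<theta>" for \<theta> by (cases \<theta>) (simp add: f_eq)
  have f_int: "integrable ?U (\<lambda>\<beta>. f (\<beta>, m))" if "m \<in> space ?Pm" for m
  proof -
    have "(\<lambda>\<beta>. f (\<beta>, m)) \<in> borel_measurable ?U"
      using f_meas that by (rule measurable_Pair1)
    then show ?thesis using f_le f_nn by (intro U.integrable_const_bound[of _ b]) auto
  qed
  define F where "F = (\<lambda>A' m. \<integral>\<beta>. f (\<beta>, m) * indicator A' \<beta> \<partial>?U)"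
  \<comment> \<open>\<open>X\<close> bounds the weight of a distant \<open>m\<close>,
    \<open>l\<close> is a lower bound for the weight of an \<open>m\<close> near the truth, and
    \<open>Y\<close> multiplies \<open>l\<close> by the prior mass of such \<open>m\<close>.\<close>
  define X where "X = exp (- c * R + C * A\<^sup>2 * D)"
  define l where "l = exp (- C' * A * D) * (1 / sqrt n / B)"
  define Y where "Y = l * (\<pi>1 * \<pi>2)"
  have an: "0 < a * real n" using a n by simp
  have l: "0 < l" using n Bpos by (simp add: l_def)
  have Y: "0 < Y" using l near by (simp add: Y_def)
  have dom2: "AE m in ?Pm. \<forall>v\<in>{\<xi>, u}. \<forall>g\<in>{?g1 m, ?g2 m}. dominated A D n v g"
    using AE_pair_fst[OF W(2) dom(1)] AE_pair_snd[OF W(1,2) dom(2)] by eventually_elim blast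
  define N0 where "N0 = density lborel (normal_density (\<beta>0 + dotp n \<xi> u / dotp n u u) (\<sigma>1 / sqrt (dotp n u u)))"
  have uu: "0 < dotp n u u" using P(1) an by linarith
  interpret N0: prob_space N0
    unfolding N0_def by (rule prob_space_normal_density) (use uu s in simp)
  \<comment> \<open>The factors \<open>n\<close> and \<open>\<sigma>1\<^sup>2\<close> cancel in the
    centre: the limit is centred at the least squares estimate for known nuisance functions and has
    its variance.\<close>
  have norm: "?norm = N0"
  proof -
    have info: "info_n \<sigma>1 m02 n w z = dotp n u u / (real n * \<sigma>1\<^sup>2)"
      by (simp add: info_n_def dotp_self u_def power_divide sum_divide_distrib mult.commute)
    have score: "score_n \<sigma>1 \<beta>0 m01 m02 n w z = dotp n \<xi> u / \<sigma>1\<^sup>2"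
      by (simp add: score_n_def dotp_def \<xi>_def u_def mult_ac)
    have D1: "Delta_n \<sigma>1 \<beta>0 m01 m02 n w z / sqrt n = dotp n \<xi> u / dotp n u u"
    proof -
      have "Delta_n \<sigma>1 \<beta>0 m01 m02 n w z / sqrt n = (n * \<sigma>1\<^sup>2 / dotp n u u) * (dotp n \<xi> u / \<sigma>1\<^sup>2) / (sqrt n * sqrt n)"
      proof -
        have "inverse (p / (x * y)) * (1 / q) * (t / y) / q = (x * y / p) * (t / y) / (q * q)"
          for p x y q t :: real by (simp add: inverse_eq_divide)
        then show ?thesis unfolding Delta_n_def info score .
      qed
      also have "sqrt n * sqrt n = real n" by simp
      finally show ?thesis using n s uu by simp
    qed
    have D2: "(1 / real n) * inverse (info_n \<sigma>1 m02 n w z) = \<sigma>1\<^sup>2 / dotp n u u"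
      unfolding info using n s uu by simp
    have "sqrt (\<sigma>1\<^sup>2 / dotp n u u) = \<sigma>1 / sqrt (dotp n u u)" using s by (simp add: real_sqrt_divide)
    then show ?thesis unfolding normal_law_def D1 D2 N0_def by simp
  qed
  have main: "\<bar>measure (distr (posterior (?U \<Otimes>\<^sub>M ?Pm) (\<lambda>\<theta>. k * f \<theta>)) borel fst) A' - measure N0 A'\<bar>
      \<le> 2 * (2 * \<kappa> + 3 * \<delta>) + X / Y" if A': "A' \<in> sets borel" for A'
  proof (rule posterior_first_marginal_bound[OF U _ Pm f_meas f_nn f_le k A'])
    show "0 \<le> measure N0 A'" "measure N0 A' \<le> 1" by simp_all
    have "0 \<le> E" using A D R by (simp add: E_def)
    then show "0 \<le> 2 * (2 * \<kappa> + 3 * \<delta>)"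
      unfolding \<kappa>_def \<delta>_def using a s Bpos A
      by (intro mult_nonneg_nonneg add_nonneg_nonneg divide_nonneg_nonneg) auto
    show "0 \<le> X" by (simp add: X_def)
    show "0 < Y" by (rule Y)
    show "AE m in ?Pm. \<bar>(\<integral>\<beta>. f (\<beta>, m) * indicator A' \<beta> \<partial>?U) - measure N0 A' * (\<integral>\<beta>. f (\<beta>, m) * indicator UNIV \<beta> \<partial>?U)\<bar>
        \<le> 2 * (2 * \<kappa> + 3 * \<delta>) * (\<integral>\<beta>. f (\<beta>, m) * indicator UNIV \<beta> \<partial>?U)
        \<or> (\<integral>\<beta>. f (\<beta>, m) * indicator UNIV \<beta> \<partial>?U) \<le> X"
      using dom2 AE_space
    proof eventually_elim
      case (elim m)
      show ?case
      proof (cases "dotp n (?g1 m) (?g1 m) + dotp n (?g2 m) (?g2 m) \<le> R")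
        case True
        have "0 \<le> A" "0 \<le> D" using A D by auto
        then show ?thesis
          using conditional_posterior_normal[OF n s(1) B a _ _ S P(1) elim(1) True, folded E_def, folded \<delta>_def, folded \<kappa>_def, OF _ _ small(1-3) A', of \<sigma>2]
          unfolding f_eq N0_def by blast
      next
        case False
        note domm = elim(1)
        have "AE \<beta> in ?U. f (\<beta>, m) * indicator UNIV \<beta> \<le> X"
          using AE_uniform_interval
        proof eventually_elim
          case (elim \<beta>)
          have "log_ratio \<sigma>1 \<sigma>2 \<beta>0 n \<xi> u (?g1 m) (?g2 m) \<beta>
              \<le> - c * (dotp n (?g1 m) (?g1 m) + dotp n (?g2 m) (?g2 m)) + C * A\<^sup>2 * D"
            by (rule upper_constantsD[OF up(1) n elim _ A D S P(1) domm]) (use B in simp)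
          also have "\<dots> \<le> - c * R + C * A\<^sup>2 * D"
            using False up(2) by (intro add_right_mono) (simp add: mult_left_mono)
          finally show ?case by (simp add: f_eq X_def)
        qed
        with f_int[OF elim(2)] have "(\<integral>\<beta>. f (\<beta>, m) * indicator UNIV \<beta> \<partial>?U) \<le> (\<integral>\<beta>. X \<partial>?U)"
          by (intro integral_mono_AE) auto
        also have "(\<integral>\<beta>. X \<partial>?U) = X" using U.prob_space by simp
        finally show ?thesis ..
      qed
    qed
    define N1 where "N1 = {m\<in>space W1. \<forall>i<n. \<bar>m (w i) - m01 (w i)\<bar> \<le> \<eta>}"
    define N2 where "N2 = {m\<in>space W2. \<forall>i<n. \<bar>m (w i) - m02 (w i)\<bar> \<le> \<eta>}"
    have N12: "N1 \<in> sets W1" "N2 \<in> sets W2"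
    proof -
      have "N1 = {m\<in>space W1. \<forall>i\<in>{..<n}. \<bar>m (w i) - m01 (w i)\<bar> \<le> \<eta>}"
        "N2 = {m\<in>space W2. \<forall>i\<in>{..<n}. \<bar>m (w i) - m02 (w i)\<bar> \<le> \<eta>}" by (auto simp: N1_def N2_def)
      moreover have "{m\<in>space W1. \<forall>i\<in>{..<n}. \<bar>m (w i) - m01 (w i)\<bar> \<le> \<eta>} \<in> sets W1"
        by (intro sets.sets_Collect_finite_All borel_measurable_le borel_measurable_abs borel_measurable_diff
            borel_measurable_const cm) auto
      moreover have "{m\<in>space W2. \<forall>i\<in>{..<n}. \<bar>m (w i) - m02 (w i)\<bar> \<le> \<eta>} \<in> sets W2"
        by (intro sets.sets_Collect_finite_All borel_measurable_le borel_measurable_abs borel_measurable_diff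
            borel_measurable_const cm) auto
      ultimately show "N1 \<in> sets W1" "N2 \<in> sets W2" by auto
    qed
    have FU_int: "integrable ?Pm (\<lambda>m. \<integral>\<beta>. f (\<beta>, m) * indicator UNIV \<beta> \<partial>?U)"
    proof -
      interpret UP: pair_prob_space ?U ?Pm ..
      have "integrable (?U \<Otimes>\<^sub>M ?Pm) f"
        using f_meas f_le f_nn by (intro UP.integrable_const_bound[of _ b]) auto
      then show ?thesis
        using UP.integrable_snd[of "\<lambda>\<beta> m. f (\<beta>, m)"] by (simp add: case_prod_beta')
    qed
    have "Y \<le> l * (measure W1 N1 * measure W2 N2)"
      unfolding Y_def N1_def N2_def using l near by (intro mult_left_mono mult_mono) auto
    also have "\<dots> = (\<integral>m. l * indicator (N1 \<times> N2) m \<partial>?Pm)"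
      using N12 by (simp add: measure_pair_Times[OF W(1,2)])
    also have "\<dots> \<le> (\<integral>m. (\<integral>\<beta>. f (\<beta>, m) * indicator UNIV \<beta> \<partial>?U) \<partial>?Pm)"
    proof (rule integral_mono_AE)
      show "integrable ?Pm (\<lambda>m. l * indicator (N1 \<times> N2) m)"
        using N12 Pm.finite_measure_axioms by (intro integrable_mult_right) (auto simp: Pm.emeasure_eq_measure)
      show "AE m in ?Pm. l * indicator (N1 \<times> N2) m \<le> (\<integral>\<beta>. f (\<beta>, m) * indicator UNIV \<beta> \<partial>?U)"
        using dom2 AE_space
      proof eventually_elim
        case (elim m)
        show ?case
        proof (cases "m \<in> N1 \<times> N2")
          case True
          \<comment> \<open>A uniform bound at the design points bounds the empirical norm, and the
            hypothesis on \<open>\<eta>\<close> matches it with \<open>c3 * D\<close>.\<close>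
          have Q: "dotp n g g \<le> c3 * D" if g: "\<And>i. i < n \<Longrightarrow> \<bar>g i\<bar> \<le> \<eta>" for g
          proof -
            have "dotp n g g \<le> (\<Sum>i<n. \<eta>\<^sup>2)"
              unfolding dotp_self
            proof (rule sum_mono)
              fix i assume "i \<in> {..<n}"
              then have "\<bar>g i\<bar>\<^sup>2 \<le> \<eta>\<^sup>2" using g by (intro power_mono) auto
              then show "(g i)\<^sup>2 \<le> \<eta>\<^sup>2" by simp
            qed
            then show ?thesis using \<eta> by simp
          qed
          have Q12: "dotp n (?g1 m) (?g1 m) \<le> c3 * D" "dotp n (?g2 m) (?g2 m) \<le> c3 * D"
            using True by (auto intro!: Q simp: N1_def N2_def)
          have sub: "{\<beta>0 - 1 / sqrt n..\<beta>0 + 1 / sqrt n} \<subseteq> {-B..B}"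
            using small(4) by auto
          let ?I = "{\<beta>. \<bar>\<beta> - \<beta>0\<bar> \<le> 1 / sqrt n}"
          have "l = exp (- C' * A * D) * measure ?U ?I"
            using Bpos by (subst uniform_measure_interval[OF Bpos sub]) (simp_all add: l_def)
          also have "\<dots> = (\<integral>\<beta>. exp (- C' * A * D) * indicator ?I \<beta> \<partial>?U)" by simp
          also have "\<dots> \<le> (\<integral>\<beta>. f (\<beta>, m) * indicator UNIV \<beta> \<partial>?U)"
          proof (rule integral_mono)
            show "exp (- C' * A * D) * indicator ?I \<beta> \<le> f (\<beta>, m) * indicator UNIV \<beta>" for \<beta>
            proof (cases "\<beta> \<in> ?I")
              case True
              then have "\<beta> \<in> {-B..B}" using sub by (auto simp: abs_le_iff)
              then have "\<bar>\<beta>\<bar> \<le> B" by auto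
              then have "- C' * A * D \<le> log_ratio \<sigma>1 \<sigma>2 \<beta>0 n \<xi> u (?g1 m) (?g2 m) \<beta>"
                by (rule lower_constantD[OF low n _ _ A D _ S P(2) Q12 elim(1)]) (use B True in simp_all)
              then show ?thesis using True by (simp add: f_eq)
            qed (simp add: f_nn)
            show "integrable ?U (\<lambda>\<beta>. f (\<beta>, m) * indicator UNIV \<beta>)" using f_int[OF elim(2)] by simp
            show "integrable ?U (\<lambda>\<beta>. exp (- C' * A * D) * indicator ?I \<beta>)"
              by (intro integrable_mult_right) (simp add: U.emeasure_eq_measure)
          qed
          finally show ?thesis using True by simp
        next
          case False
          then show ?thesis using f_nn by (simp add: integral_nonneg_AE)
        qed
      qed
    qed (rule FU_int)
    finally show "Y \<le> (\<integral>m. (\<integral>\<beta>. f (\<beta>, m) * indicator UNIV \<beta> \<partial>?U) \<partial>?Pm)" .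
  qed simp
  have post: "?post = distr (posterior (?U \<Otimes>\<^sub>M ?Pm) (\<lambda>\<theta>. k * f \<theta>)) borel fst"
    by (simp add: beta_posterior_def L)
  show ?thesis
    unfolding norm post using main by (intro abs_tv_dist_le) (simp add: X_def Y_def l_def)
qed

section \<open>Conditional laws\<close>

lemma cond_law_kernel:
  assumes "is_cond_law P U V K"
  shows "K \<in> measurable borel (subprob_algebra borel)" "prob_space (K v)" "sets (K v) = sets borel"
proof -
  have K: "K \<in> measurable borel (prob_algebra borel)" using assms by (simp add: is_cond_law_def)
  then show "K \<in> measurable borel (subprob_algebra borel)" by (rule measurable_prob_algebraD)
  have "K v \<in> space (prob_algebra borel)" using K by (rule measurable_space) simp
  then show "prob_space (K v)" "sets (K v) = sets borel" by (auto simp: space_prob_algebra)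
qed

text \<open>The definition tests rectangles; these are stable under intersection and generate the
  product algebra, so the whole joint law is the mixture of the kernel over the law of
  \<open>V\<close>.\<close>

lemma cond_law_joint:
  fixes U :: "'a \<Rightarrow> 'u::topological_space" and V :: "'a \<Rightarrow> 'v::topological_space"
  assumes P: "prob_space P" and U: "U \<in> measurable P borel" and V: "V \<in> measurable P borel"
    and K: "is_cond_law P U V K"
  shows "distr P (borel \<Otimes>\<^sub>M borel) (\<lambda>\<omega>. (V \<omega>, U \<omega>))
    = distr P borel V \<bind> (\<lambda>v. distr (K v) (borel \<Otimes>\<^sub>M borel) (\<lambda>u. (v, u)))" (is "?L = ?R")
proof -
  interpret prob_space P by fact
  note Km = cond_law_kernel[OF K]
  let ?B = "borel \<Otimes>\<^sub>M borel :: ('v \<times> 'u) measure"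
  let ?k = "\<lambda>v. distr (K v) ?B (\<lambda>u. (v, u))"
  let ?E = "{a \<times> b | a b. a \<in> sets (borel :: 'v measure) \<and> b \<in> sets (borel :: 'u measure)}"
  have k: "?k \<in> measurable (distr P borel V) (subprob_algebra ?B)"
    by (rule measurable_distr2[where M = borel]) (use Km(1) in \<open>auto cong: measurable_cong_sets\<close>)
  have sp: "space (distr P borel V) \<noteq> {}" by simp
  have setsR: "sets ?R = sets ?B" by (rule sets_bind) auto
  have eq: "emeasure ?L X = emeasure ?R X" if XE: "X \<in> ?E" for X
  proof -
    obtain a b where X: "X = a \<times> b" "a \<in> sets borel" "b \<in> sets borel" using XE by auto
    have "emeasure ?L X = emeasure P {\<omega>\<in>space P. U \<omega> \<in> b \<and> V \<omega> \<in> a}"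
      using X U V by (subst emeasure_distr) (auto intro!: arg_cong[where f = "emeasure P"])
    also have "\<dots> = (\<integral>\<^sup>+ v\<in>a. emeasure (K v) b \<partial>distr P borel V)"
      using K X by (simp add: is_cond_law_def)
    also have "\<dots> = (\<integral>\<^sup>+ v. emeasure (?k v) X \<partial>distr P borel V)"
    proof (rule nn_integral_cong)
      fix v
      have "emeasure (?k v) X = emeasure (K v) ((\<lambda>u. (v, u)) -` (a \<times> b) \<inter> space (K v))"
        using X Km(3)[of v] by (subst emeasure_distr) (auto cong: measurable_cong_sets)
      also have "(\<lambda>u. (v, u)) -` (a \<times> b) \<inter> space (K v) = (if v \<in> a then b else {})"
        using sets_eq_imp_space_eq[OF Km(3)[of v]] by auto
      finally show "emeasure (K v) b * indicator a v = emeasure (?k v) X" by (auto simp: indicator_def)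
    qed
    also have "\<dots> = emeasure ?R X"
      using X by (intro emeasure_bind[OF sp k, symmetric]) auto
    finally show ?thesis .
  qed
  show ?thesis
  proof (rule measure_eqI_generator_eq[OF Int_stable_pair_measure_generator[of borel borel]])
    show "?E \<subseteq> Pow (UNIV :: ('v \<times> 'u) set)" by simp
    show "sets ?L = sigma_sets UNIV ?E" by (simp add: sets_pair_measure)
    show "sets ?R = sigma_sets UNIV ?E" unfolding setsR by (simp add: sets_pair_measure)
    show "range (\<lambda>_::nat. UNIV) \<subseteq> ?E" by (auto intro!: exI[of _ UNIV])
    show "(\<Union>i::nat. UNIV) = (UNIV :: ('v \<times> 'u) set)" by simp
    show "emeasure ?L UNIV \<noteq> \<infinity>"
      using U V sets.top[of ?B] by (subst emeasure_distr) (auto simp: emeasure_eq_measure space_pair_measure)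
  qed (rule eq)
qed

text \<open>Disintegration for integrands in both variables, as needed when \<open>U\<close> is
  centred by a function of \<open>V\<close>.\<close>

lemma cond_law_nn_integral:
  fixes U :: "'a \<Rightarrow> 'u::topological_space" and V :: "'a \<Rightarrow> 'v::topological_space"
  assumes P: "prob_space P" and U: "U \<in> measurable P borel" and V: "V \<in> measurable P borel"
    and K: "is_cond_law P U V K"
    and f: "(\<lambda>(v, u). f v u) \<in> borel_measurable (borel \<Otimes>\<^sub>M borel)"
  shows "(\<integral>\<^sup>+ \<omega>. f (V \<omega>) (U \<omega>) \<partial>P) = (\<integral>\<^sup>+ v. \<integral>\<^sup>+ u. f v u \<partial>K v \<partial>distr P borel V)"
    and "(\<lambda>v. \<integral>\<^sup>+ u. f v u \<partial>K v) \<in> borel_measurable borel"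
proof -
  note Km = cond_law_kernel[OF K]
  let ?B = "borel \<Otimes>\<^sub>M borel :: ('v \<times> 'u) measure"
  let ?k = "\<lambda>v. distr (K v) ?B (\<lambda>u. (v, u))"
  have k: "?k \<in> measurable (distr P borel V) (subprob_algebra ?B)"
    by (rule measurable_distr2[where M = borel]) (use Km(1) in \<open>auto cong: measurable_cong_sets\<close>)
  have "(\<integral>\<^sup>+ \<omega>. f (V \<omega>) (U \<omega>) \<partial>P) = (\<integral>\<^sup>+ x. (\<lambda>(v, u). f v u) x \<partial>distr P ?B (\<lambda>\<omega>. (V \<omega>, U \<omega>)))"
    using f U V by (subst nn_integral_distr) auto
  also have "\<dots> = (\<integral>\<^sup>+ v. \<integral>\<^sup>+ x. (\<lambda>(v, u). f v u) x \<partial>?k v \<partial>distr P borel V)"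
    unfolding cond_law_joint[OF P U V K] by (rule nn_integral_bind[OF f k])
  also have "\<dots> = (\<integral>\<^sup>+ v. \<integral>\<^sup>+ u. f v u \<partial>K v \<partial>distr P borel V)"
  proof (rule nn_integral_cong)
    fix v
    have "(\<lambda>u. (v, u)) \<in> measurable (K v) ?B"
      using Km(3)[of v] by (simp cong: measurable_cong_sets)
    then show "(\<integral>\<^sup>+ x. (\<lambda>(v, u). f v u) x \<partial>?k v) = (\<integral>\<^sup>+ u. f v u \<partial>K v)"
      using f by (subst nn_integral_distr) auto
  qed
  finally show "(\<integral>\<^sup>+ \<omega>. f (V \<omega>) (U \<omega>) \<partial>P) = (\<integral>\<^sup>+ v. \<integral>\<^sup>+ u. f v u \<partial>K v \<partial>distr P borel V)" .
  show "(\<lambda>v. \<integral>\<^sup>+ u. f v u \<partial>K v) \<in> borel_measurable borel"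
    by (rule nn_integral_measurable_subprob_algebra2[OF f Km(1)])
qed

lemma measurable_mult_indicator_fst:
  fixes f :: "'v::topological_space \<Rightarrow> 'u::topological_space \<Rightarrow> ennreal"
  assumes "(\<lambda>(v, u). f v u) \<in> borel_measurable (borel \<Otimes>\<^sub>M borel)" "C \<in> sets borel"
  shows "(\<lambda>(v, u). f v u * indicator C v) \<in> borel_measurable (borel \<Otimes>\<^sub>M borel)"
proof -
  have "(\<lambda>x. (\<lambda>(v, u). f v u) x * indicator C (fst x)) \<in> borel_measurable (borel \<Otimes>\<^sub>M borel)"
    using assms by measurable
  then show ?thesis by (simp add: case_prod_beta')
qed

text \<open>Two kernels may describe the conditional laws of different variables of the same experiment,
  so conditional moments can be transported from one to the other without uniqueness of
  conditional laws.\<close>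

lemma cond_law_AE_eq:
  fixes U :: "'a \<Rightarrow> 'u::topological_space" and V :: "'a \<Rightarrow> 'v::topological_space"
    and U' :: "'a \<Rightarrow> 'w::topological_space"
  assumes P: "prob_space P" and V: "V \<in> measurable P borel"
    and U: "U \<in> measurable P borel" and K: "is_cond_law P U V K"
    and U': "U' \<in> measurable P borel" and K': "is_cond_law P U' V K'"
    and f: "(\<lambda>(v, u). f v u) \<in> borel_measurable (borel \<Otimes>\<^sub>M borel)"
    and f': "(\<lambda>(v, u). f' v u) \<in> borel_measurable (borel \<Otimes>\<^sub>M borel)"
    and eq: "\<And>C. C \<in> sets borel \<Longrightarrow>
      (\<integral>\<^sup>+ \<omega>. f (V \<omega>) (U \<omega>) * indicator C (V \<omega>) \<partial>P) = (\<integral>\<^sup>+ \<omega>. f' (V \<omega>) (U' \<omega>) * indicator C (V \<omega>) \<partial>P)"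
  shows "AE v in distr P borel V. (\<integral>\<^sup>+ u. f v u \<partial>K v) = (\<integral>\<^sup>+ u. f' v u \<partial>K' v)"
proof -
  interpret prob_space P by fact
  interpret D: prob_space "distr P borel V" using V by (rule prob_space_distr)
  have sK: "sets (K v) = sets borel" "sets (K' v) = sets borel" for v
    using cond_law_kernel(3)[OF K] cond_law_kernel(3)[OF K'] by auto
  have st: "(\<integral>\<^sup>+ v. (\<integral>\<^sup>+ u. f v u \<partial>K v) * indicator C v \<partial>distr P borel V)
      = (\<integral>\<^sup>+ \<omega>. f (V \<omega>) (U \<omega>) * indicator C (V \<omega>) \<partial>P)" if C: "C \<in> sets borel" for C
  proof -
    have m: "f v \<in> borel_measurable (K v)" for v
      using measurable_Pair2[OF f, of v] sK by (simp cong: measurable_cong_sets)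
    show ?thesis
      unfolding cond_law_nn_integral(1)[OF P U V K measurable_mult_indicator_fst[OF f C]]
      by (intro nn_integral_cong nn_integral_multc[symmetric] m)
  qed
  have st': "(\<integral>\<^sup>+ v. (\<integral>\<^sup>+ u. f' v u \<partial>K' v) * indicator C v \<partial>distr P borel V)
      = (\<integral>\<^sup>+ \<omega>. f' (V \<omega>) (U' \<omega>) * indicator C (V \<omega>) \<partial>P)" if C: "C \<in> sets borel" for C
  proof -
    have m: "f' v \<in> borel_measurable (K' v)" for v
      using measurable_Pair2[OF f', of v] sK by (simp cong: measurable_cong_sets)
    show ?thesis
      unfolding cond_law_nn_integral(1)[OF P U' V K' measurable_mult_indicator_fst[OF f' C]]
      by (intro nn_integral_cong nn_integral_multc[symmetric] m)
  qed
  show ?thesis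
  proof (rule D.density_unique_finite_measure)
    show "(\<lambda>v. \<integral>\<^sup>+ u. f v u \<partial>K v) \<in> borel_measurable (distr P borel V)"
      using cond_law_nn_integral(2)[OF P U V K f] by simp
    show "(\<lambda>v. \<integral>\<^sup>+ u. f' v u \<partial>K' v) \<in> borel_measurable (distr P borel V)"
      using cond_law_nn_integral(2)[OF P U' V K' f'] by simp
  qed (auto simp: st st' eq)
qed

text \<open>Positive and negative parts have the same integral over every event
  \<open>V \<in> C\<close>, so their kernel integrals agree almost everywhere. This trades
  conditional expectations, which are random variables on the sample space, for integrals against
  the kernel at almost every value of \<open>V\<close>.\<close>

lemma cond_law_integral_zero:
  fixes U :: "'a \<Rightarrow> 'u::topological_space" and V :: "'a \<Rightarrow> 'v::topological_space"
    and f :: "'v \<Rightarrow> 'u \<Rightarrow> real"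
  assumes P: "prob_space P" and U: "U \<in> measurable P borel" and V: "V \<in> measurable P borel"
    and K: "is_cond_law P U V K"
    and f: "(\<lambda>(v, u). f v u) \<in> borel_measurable (borel \<Otimes>\<^sub>M borel)"
    and int: "integrable P (\<lambda>\<omega>. f (V \<omega>) (U \<omega>))"
    and zero: "\<And>C. C \<in> sets borel \<Longrightarrow> (\<integral>\<omega>. f (V \<omega>) (U \<omega>) * indicator C (V \<omega>) \<partial>P) = 0"
  shows "AE v in distr P borel V. (\<integral>u. f v u \<partial>K v) = 0"
proof -
  have fp: "(\<lambda>(v, u). ennreal (f v u)) \<in> borel_measurable (borel \<Otimes>\<^sub>M borel)"
    and fm: "(\<lambda>(v, u). ennreal (- f v u)) \<in> borel_measurable (borel \<Otimes>\<^sub>M borel)"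
    using f by (simp_all add: case_prod_beta')
  have "AE v in distr P borel V. (\<integral>\<^sup>+ u. ennreal (f v u) \<partial>K v) = (\<integral>\<^sup>+ u. ennreal (- f v u) \<partial>K v)"
  proof (rule cond_law_AE_eq[OF P V U K U K fp fm])
    fix C :: "'v set" assume C: "C \<in> sets borel"
    define g where "g = (\<lambda>\<omega>. f (V \<omega>) (U \<omega>) * indicator C (V \<omega>))"
    have "(\<lambda>\<omega>. indicator C (V \<omega>) :: real) \<in> borel_measurable P" using V C by measurable
    then have "integrable P g"
      unfolding g_def by (intro Bochner_Integration.integrable_bound[OF int]) (use int in \<open>auto simp: indicator_def\<close>)
    then have g: "(\<integral>\<omega>. g \<omega> \<partial>P) = enn2real (\<integral>\<^sup>+ \<omega>. ennreal (g \<omega>) \<partial>P) - enn2real (\<integral>\<^sup>+ \<omega>. ennreal (- g \<omega>) \<partial>P)"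
      "(\<integral>\<^sup>+ \<omega>. ennreal (g \<omega>) \<partial>P) \<noteq> \<infinity>" "(\<integral>\<^sup>+ \<omega>. ennreal (- g \<omega>) \<partial>P) \<noteq> \<infinity>"
      by (auto simp: real_lebesgue_integral_def real_integrable_def)
    have "enn2real (\<integral>\<^sup>+ \<omega>. ennreal (g \<omega>) \<partial>P) = enn2real (\<integral>\<^sup>+ \<omega>. ennreal (- g \<omega>) \<partial>P)"
      using zero[OF C] g(1) by (simp add: g_def)
    then have "(\<integral>\<^sup>+ \<omega>. ennreal (g \<omega>) \<partial>P) = (\<integral>\<^sup>+ \<omega>. ennreal (- g \<omega>) \<partial>P)"
      using g(2,3) by (metis ennreal_enn2real_if infinity_ennreal_def)
    moreover have "ennreal (g \<omega>) = ennreal (f (V \<omega>) (U \<omega>)) * indicator C (V \<omega>)"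
      "ennreal (- g \<omega>) = ennreal (- f (V \<omega>) (U \<omega>)) * indicator C (V \<omega>)" for \<omega>
      by (auto simp: g_def indicator_def)
    ultimately show "(\<integral>\<^sup>+ \<omega>. ennreal (f (V \<omega>) (U \<omega>)) * indicator C (V \<omega>) \<partial>P)
        = (\<integral>\<^sup>+ \<omega>. ennreal (- f (V \<omega>) (U \<omega>)) * indicator C (V \<omega>) \<partial>P)"
      by simp
  qed
  then show ?thesis
  proof eventually_elim
    case (elim v)
    show ?case
    \<comment> \<open>Both parts may be infinite at this \<open>v\<close>; the Bochner integral of a
      non-integrable function is 0 by convention, so the equation still holds.\<close>
    proof (cases "integrable (K v) (f v)")
      case True
      then show ?thesis using elim by (subst real_lebesgue_integral_def) auto
    qed (rule not_integrable_integral_eq)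
  qed
qed

section \<open>Fourth moments from subgaussianity\<close>

lemma power4_le_exp: "(x::real) ^ 4 \<le> 256 * (exp x + exp (- x))"
proof -
  have *: "y ^ 4 \<le> 256 * exp y" if "0 \<le> y" for y :: real
  proof -
    \<comment> \<open>From \<open>(1 + y / 4) ^ 4 \<le> exp y\<close>; the constant 256 is
      \<open>4 ^ 4\<close>.\<close>
    have "(y / 4) ^ 4 \<le> (1 + y / real 4) ^ 4" using that by (intro power_mono) auto
    also have "\<dots> \<le> exp y" using that by (intro exp_ge_one_plus_x_over_n_power_n) auto
    finally show ?thesis by (simp add: power_divide)
  qed
  show ?thesis
  proof (cases "0 \<le> x")
    case True
    then show ?thesis using *[of x] exp_ge_zero[of "- x"] by (simp add: distrib_left add_increasing2)
  next
    case False
    then show ?thesis using *[of "- x"] exp_ge_zero[of x] by (simp add: distrib_left add_increasing)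
  qed
qed

text \<open>Exponential moments in the directions \<open>t\<close> and \<open>- t\<close>, for the
  two coordinate vectors, dominate the fourth powers. The variance proxy is common to
  \<open>S\<close>, hence so is \<open>c\<close>, which has to serve all design points at
  once.\<close>

lemma subgaussian_fourth_moments:
  assumes "subgaussian_on S \<kappa>" "\<And>w. sets (\<kappa> w) = sets borel"
  obtains c where "0 \<le> c" "\<And>w. w \<in> S \<Longrightarrow> (\<integral>\<^sup>+ e. ennreal (fst e ^ 4) \<partial>\<kappa> w) \<le> ennreal c"
    "\<And>w. w \<in> S \<Longrightarrow> (\<integral>\<^sup>+ e. ennreal (snd e ^ 4) \<partial>\<kappa> w) \<le> ennreal c"
proof -
  obtain s where s: "\<And>w t. w \<in> S \<Longrightarrow> (\<integral>\<^sup>+ e. ennreal (exp (t \<bullet> e)) \<partial>\<kappa> w) \<le> ennreal (exp (s\<^sup>2 * (norm t)\<^sup>2 / 2))"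
    using assms(1) by (auto simp: subgaussian_on_def)
  let ?c = "256 * (2 * exp (s\<^sup>2 / 2))"
  have gen: "(\<integral>\<^sup>+ e. ennreal ((t \<bullet> e) ^ 4) \<partial>\<kappa> w) \<le> ennreal ?c" if w: "w \<in> S" and t: "norm t = 1" for w t
  proof -
    have m: "(\<lambda>e. ennreal (exp (t \<bullet> e))) \<in> borel_measurable (\<kappa> w)" for t
      using assms(2)[of w] by (simp cong: measurable_cong_sets)
    have "(\<integral>\<^sup>+ e. ennreal ((t \<bullet> e) ^ 4) \<partial>\<kappa> w)
        \<le> (\<integral>\<^sup>+ e. 256 * (ennreal (exp (t \<bullet> e)) + ennreal (exp ((- t) \<bullet> e))) \<partial>\<kappa> w)"
    proof (rule nn_integral_mono)
      fix e :: "real \<times> real"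
      have "ennreal ((t \<bullet> e) ^ 4) \<le> ennreal (256 * (exp (t \<bullet> e) + exp ((- t) \<bullet> e)))"
        using power4_le_exp[of "t \<bullet> e"] by (intro ennreal_leI) simp
      also have "\<dots> = 256 * (ennreal (exp (t \<bullet> e)) + ennreal (exp ((- t) \<bullet> e)))"
        by (subst ennreal_mult) auto
      finally show "ennreal ((t \<bullet> e) ^ 4) \<le> \<dots>" .
    qed
    also have "\<dots> = 256 * ((\<integral>\<^sup>+ e. ennreal (exp (t \<bullet> e)) \<partial>\<kappa> w) + (\<integral>\<^sup>+ e. ennreal (exp ((- t) \<bullet> e)) \<partial>\<kappa> w))"
      using m[of t] m[of "- t"] by (simp only: nn_integral_cmult nn_integral_add borel_measurable_add)
    also have "\<dots> \<le> 256 * (ennreal (exp (s\<^sup>2 / 2)) + ennreal (exp (s\<^sup>2 / 2)))"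
      using s[OF w, of t] s[OF w, of "- t"] t by (intro mult_left_mono add_mono) auto
    also have "\<dots> = ennreal ?c"
      by (simp add: ennreal_mult ennreal_plus[symmetric] del: ennreal_plus)
    finally show ?thesis .
  qed
  have "(\<integral>\<^sup>+ e. ennreal (fst e ^ 4) \<partial>\<kappa> w) \<le> ennreal ?c" "(\<integral>\<^sup>+ e. ennreal (snd e ^ 4) \<partial>\<kappa> w) \<le> ennreal ?c"
    if "w \<in> S" for w
    using gen[OF that, of "(1, 0)"] gen[OF that, of "(0, 1)"] by (simp_all add: inner_prod_def norm_Pair)
  then show ?thesis using that[of ?c] by auto
qed

section \<open>Concentration under the product law\<close>

text \<open>Independent centred coordinates have vanishing cross terms. The functions and laws vary
  with \<open>i\<close>, since under a fixed design the observations are independent but not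
  identically distributed.\<close>

lemma product_second_moment:
  fixes N :: "nat \<Rightarrow> 'b measure" and f :: "nat \<Rightarrow> 'b \<Rightarrow> real"
  assumes N: "\<And>i. prob_space (N i)"
    and f: "\<And>i. i < n \<Longrightarrow> f i \<in> borel_measurable (N i)" "\<And>i. i < n \<Longrightarrow> integrable (N i) (\<lambda>x. (f i x)\<^sup>2)"
      "\<And>i. i < n \<Longrightarrow> (\<integral>x. f i x \<partial>N i) = 0" "\<And>i. i < n \<Longrightarrow> (\<integral>x. (f i x)\<^sup>2 \<partial>N i) \<le> s"
  shows "(\<integral>\<^sup>+ z. ennreal ((\<Sum>i<n. c i * f i (z i))\<^sup>2) \<partial>PiM {..<n} N) \<le> ennreal (s * (\<Sum>i<n. (c i)\<^sup>2))"
proof -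
  interpret N: product_prob_space N "{..<n}" by (intro product_prob_spaceI N)
  interpret P: prob_space "PiM {..<n} N" by (intro prob_space_PiM N)
  have fi: "integrable (N i) (f i)" if "i < n" for i
    by (rule finite_measure.square_integrable_imp_integrable[OF prob_space.finite_measure[OF N] f(1)[OF that] f(2)[OF that]])
  have cross: "integrable (PiM {..<n} N) (\<lambda>z. f i (z i) * f j (z j))"
    "(\<integral>z. f i (z i) * f j (z j) \<partial>PiM {..<n} N) = (if i = j then (\<integral>x. (f i x)\<^sup>2 \<partial>N i) else 0)"
    if ij: "i < n" "j < n" for i j
  proof -
    \<comment> \<open>\<open>f i * f j\<close> as a product over all coordinates, with factor 1 at
      the others; for \<open>i = j\<close> both factors fall on the same coordinate and form the
      square.\<close>
    define h where "h = (\<lambda>k x. (if k = i then f i x else 1) * (if k = j then f j x else 1))"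
    have h_int: "integrable (N k) (h k)" if "k \<in> {..<n}" for k
    proof -
      interpret Nk: prob_space "N k" by (rule N)
      show ?thesis
        using fi[OF ij(1)] fi[OF ij(2)] f(2)[OF ij(1)]
        by (cases "k = i"; cases "k = j") (simp_all add: h_def power2_eq_square)
    qed
    have h_prod: "(\<Prod>k\<in>{..<n}. h k (z k)) = f i (z i) * f j (z j)" for z
      using ij by (simp add: h_def prod.distrib)
    have h1: "(\<integral>x. h k x \<partial>N k) = (if i = j then (if k = i then (\<integral>x. (f i x)\<^sup>2 \<partial>N i) else 1)
        else (if k = i \<or> k = j then 0 else 1))" for k
      using ij f(3) prob_space.prob_space[OF N] by (auto simp: h_def power2_eq_square)
    show "integrable (PiM {..<n} N) (\<lambda>z. f i (z i) * f j (z j))"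
      using N.product_integrable_prod[of "{..<n}" h] h_int unfolding h_prod by simp
    have "(\<integral>z. f i (z i) * f j (z j) \<partial>PiM {..<n} N) = (\<Prod>k\<in>{..<n}. \<integral>x. h k x \<partial>N k)"
      using N.product_integral_prod[of "{..<n}" h] h_int unfolding h_prod by simp
    also have "\<dots> = (if i = j then (\<integral>x. (f i x)\<^sup>2 \<partial>N i) else 0)"
    proof (cases "i = j")
      case True
      then show ?thesis using ij by (simp add: h1)
    next
      case False
      then have "(\<integral>x. h i x \<partial>N i) = 0" by (simp add: h1)
      then show ?thesis using False ij by (auto intro!: prod_zero)
    qed
    finally show "(\<integral>z. f i (z i) * f j (z j) \<partial>PiM {..<n} N) = \<dots>" .
  qed
  have sq: "(\<Sum>i<n. c i * f i (z i))\<^sup>2 = (\<Sum>i<n. \<Sum>j<n. c i * c j * (f i (z i) * f j (z j)))" for z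
    by (simp add: power2_eq_square sum_product mult_ac)
  have int: "integrable (PiM {..<n} N) (\<lambda>z. (\<Sum>i<n. c i * f i (z i))\<^sup>2)"
    unfolding sq by (intro Bochner_Integration.integrable_sum integrable_mult_right cross) auto
  have "(\<integral>z. (\<Sum>i<n. c i * f i (z i))\<^sup>2 \<partial>PiM {..<n} N)
      = (\<Sum>i<n. \<Sum>j<n. c i * c j * (\<integral>z. f i (z i) * f j (z j) \<partial>PiM {..<n} N))"
    unfolding sq
  proof (subst Bochner_Integration.integral_sum)
    show "(\<Sum>i<n. \<integral>z. (\<Sum>j<n. c i * c j * (f i (z i) * f j (z j))) \<partial>PiM {..<n} N)
      = (\<Sum>i<n. \<Sum>j<n. c i * c j * (\<integral>z. f i (z i) * f j (z j) \<partial>PiM {..<n} N))"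
    proof (intro sum.cong refl)
      fix i assume "i \<in> {..<n}"
      then show "(\<integral>z. (\<Sum>j<n. c i * c j * (f i (z i) * f j (z j))) \<partial>PiM {..<n} N)
        = (\<Sum>j<n. c i * c j * (\<integral>z. f i (z i) * f j (z j) \<partial>PiM {..<n} N))"
        using cross(1)[of i] by (subst Bochner_Integration.integral_sum) auto
    qed
  qed (intro Bochner_Integration.integrable_sum integrable_mult_right cross; simp)
  also have "\<dots> = (\<Sum>i<n. \<Sum>j<n. if i = j then c i * c i * (\<integral>x. (f i x)\<^sup>2 \<partial>N i) else 0)"
    by (intro sum.cong refl) (auto simp: cross(2))
  also have "\<dots> = (\<Sum>i<n. (c i)\<^sup>2 * (\<integral>x. (f i x)\<^sup>2 \<partial>N i))"
    by (simp add: power2_eq_square)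
  also have "\<dots> \<le> (\<Sum>i<n. (c i)\<^sup>2 * s)"
    using f(4) by (intro sum_mono mult_left_mono) auto
  also have "\<dots> = s * (\<Sum>i<n. (c i)\<^sup>2)" by (simp add: sum_distrib_left mult.commute)
  finally have "(\<integral>z. (\<Sum>i<n. c i * f i (z i))\<^sup>2 \<partial>PiM {..<n} N) \<le> s * (\<Sum>i<n. (c i)\<^sup>2)" .
  then show ?thesis
    using int by (subst nn_integral_eq_integral) (auto intro: ennreal_leI)
qed

lemma markov_prob:
  fixes X :: "'a \<Rightarrow> real"
  assumes M: "prob_space M" and X: "X \<in> borel_measurable M" and e: "(\<integral>\<^sup>+ x. ennreal (X x) \<partial>M) \<le> ennreal e"
    and t: "0 < t" and e0: "0 \<le> e"
  shows "measure M {x\<in>space M. t < X x} \<le> e / t"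
proof -
  interpret prob_space M by fact
  have "ennreal t * emeasure M {x\<in>space M. t < X x} = (\<integral>\<^sup>+ x. ennreal t * indicator {x\<in>space M. t < X x} x \<partial>M)"
    using X by (subst nn_integral_cmult_indicator) auto
  also have "\<dots> \<le> (\<integral>\<^sup>+ x. ennreal (X x) \<partial>M)"
    by (intro nn_integral_mono) (auto simp: indicator_def ennreal_leI)
  also have "\<dots> \<le> ennreal e" by (rule e)
  finally have "ennreal (t * prob {x\<in>space M. t < X x}) \<le> ennreal e"
    using t by (simp add: emeasure_eq_measure ennreal_mult)
  then have "t * prob {x\<in>space M. t < X x} \<le> e" using e0 by simp
  then show ?thesis using t by (simp add: field_simps)
qed

text \<open>At level \<open>l\<close> there are \<open>2 ^ l\<close> sums whose squares have total
  expectation at most \<open>s * n * C\<^sup>2 * 2 ^ l\<close>, by localization, so the expected sum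
  of their absolute values is of order \<open>sqrt n * 2 ^ l\<close>. The coefficient scale turns
  this into a geometric series of ratio \<open>2 powr (- (\<alpha> - 1/2))\<close>, convergent
  because \<alpha> exceeds 1/2. The bound is uniform over designs in the unit interval.\<close>

lemma high_freq_expectation:
  fixes N :: "nat \<Rightarrow> 'b measure" and f :: "nat \<Rightarrow> 'b \<Rightarrow> real"
  assumes N: "\<And>i. prob_space (N i)"
    and f: "\<And>i. i < n \<Longrightarrow> f i \<in> borel_measurable (N i)" "\<And>i. i < n \<Longrightarrow> integrable (N i) (\<lambda>x. (f i x)\<^sup>2)"
      "\<And>i. i < n \<Longrightarrow> (\<integral>x. f i x \<partial>N i) = 0" "\<And>i. i < n \<Longrightarrow> (\<integral>x. (f i x)\<^sup>2 \<partial>N i) \<le> s"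
    and s: "0 < s" and loc: "localized \<psi> C" and C: "0 < C" and \<alpha>: "1/2 < \<alpha>" and n: "0 < n"
    and w: "\<And>i. i < n \<Longrightarrow> w i \<in> {0..1}"
  shows "(\<integral>\<^sup>+ z. ennreal (\<Sum>l. high_freq \<psi> \<alpha> J n w (\<lambda>i. f i (z i)) l) \<partial>PiM {..<n} N)
    \<le> ennreal (sqrt s * C * sqrt (real n) * 2 powr (- (real J * (\<alpha> - 1/2))) / (1 - 2 powr (- (\<alpha> - 1/2))))"
proof -
  let ?P = "PiM {..<n} N"
  define Z where "Z = (\<lambda>l k z. \<Sum>i<n. f i (z i) * \<psi> l k (w i))"
  have Zm: "Z l k \<in> borel_measurable ?P" for l k
  proof -
    have "(\<lambda>z. f i (z i)) \<in> borel_measurable ?P" if "i < n" for i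
    proof -
      have c: "(\<lambda>z. z i) \<in> measurable ?P (N i)" by (rule measurable_component_singleton) (use that in simp)
      show ?thesis by (rule measurable_compose[OF c f(1)[OF that]])
    qed
    then show ?thesis unfolding Z_def by (intro borel_measurable_sum borel_measurable_times borel_measurable_const) auto
  qed
  have level: "(\<integral>\<^sup>+ z. ennreal (\<Sum>k<2^l. \<bar>Z l k z\<bar>) \<partial>?P) \<le> ennreal (sqrt s * C * sqrt n * 2 ^ l)" for l
  proof -
    \<comment> \<open>A bound on the root mean square size of the sums at one level; with it the two
      terms of \<open>|x| \<le> x\<^sup>2 / (2 * lam) + lam / 2\<close> contribute equally to the
      final bound.\<close>
    define lam where "lam = sqrt s * C * sqrt n"
    have lam: "0 < lam" using s C n by (simp add: lam_def)
    have lam2: "lam\<^sup>2 = s * C\<^sup>2 * n" using s by (simp add: lam_def power_mult_distrib)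
    have "(\<integral>\<^sup>+ z. ennreal (\<Sum>k<2^l. \<bar>Z l k z\<bar>) \<partial>?P)
        \<le> (\<integral>\<^sup>+ z. (\<Sum>k<(2::nat)^l. ennreal (1 / (2 * lam)) * ennreal ((Z l k z)\<^sup>2) + ennreal (lam / 2)) \<partial>?P)"
    proof (rule nn_integral_mono)
      fix z
      have "\<bar>x\<bar> \<le> 1 / (2 * lam) * x\<^sup>2 + lam / 2" for x
      proof -
        have "0 \<le> (\<bar>x\<bar> - lam)\<^sup>2" by simp
        then show ?thesis using lam by (simp add: power2_diff field_simps power2_eq_square)
      qed
      then have "(\<Sum>k<2^l. \<bar>Z l k z\<bar>) \<le> (\<Sum>k<(2::nat)^l. 1 / (2 * lam) * (Z l k z)\<^sup>2 + lam / 2)"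
        by (intro sum_mono)
      then have "ennreal (\<Sum>k<2^l. \<bar>Z l k z\<bar>) \<le> ennreal (\<Sum>k<(2::nat)^l. 1 / (2 * lam) * (Z l k z)\<^sup>2 + lam / 2)"
        by (rule ennreal_leI)
      also have "\<dots> = (\<Sum>k<(2::nat)^l. ennreal (1 / (2 * lam) * (Z l k z)\<^sup>2 + lam / 2))"
        using lam by (intro sum_ennreal[symmetric]) simp
      also have "\<dots> = (\<Sum>k<(2::nat)^l. ennreal (1 / (2 * lam)) * ennreal ((Z l k z)\<^sup>2) + ennreal (lam / 2))"
      proof (rule sum.cong[OF refl])
        fix k
        have "ennreal (1 / (2 * lam) * (Z l k z)\<^sup>2 + lam / 2) = ennreal (1 / (2 * lam) * (Z l k z)\<^sup>2) + ennreal (lam / 2)"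
          using lam by (intro ennreal_plus) auto
        also have "ennreal (1 / (2 * lam) * (Z l k z)\<^sup>2) = ennreal (1 / (2 * lam)) * ennreal ((Z l k z)\<^sup>2)"
          using lam by (intro ennreal_mult) auto
        finally show "ennreal (1 / (2 * lam) * (Z l k z)\<^sup>2 + lam / 2)
          = ennreal (1 / (2 * lam)) * ennreal ((Z l k z)\<^sup>2) + ennreal (lam / 2)" .
      qed
      finally show "ennreal (\<Sum>k<2^l. \<bar>Z l k z\<bar>)
        \<le> (\<Sum>k<(2::nat)^l. ennreal (1 / (2 * lam)) * ennreal ((Z l k z)\<^sup>2) + ennreal (lam / 2))" .
    qed
    also have "\<dots> = (\<Sum>k<(2::nat)^l. ennreal (1 / (2 * lam)) * (\<integral>\<^sup>+ z. ennreal ((Z l k z)\<^sup>2) \<partial>?P) + ennreal (lam / 2))"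
    proof -
      interpret P: prob_space ?P by (intro prob_space_PiM N)
      have m: "(\<lambda>z. ennreal ((Z l k z)\<^sup>2)) \<in> borel_measurable ?P" for k using Zm by measurable
      have "(\<integral>\<^sup>+ z. ennreal (1 / (2 * lam)) * ennreal ((Z l k z)\<^sup>2) + ennreal (lam / 2) \<partial>?P)
          = ennreal (1 / (2 * lam)) * (\<integral>\<^sup>+ z. ennreal ((Z l k z)\<^sup>2) \<partial>?P) + ennreal (lam / 2)" for k
        using m[of k] by (subst nn_integral_add) (auto simp: nn_integral_cmult P.emeasure_space_1)
      then show ?thesis
        using m by (subst nn_integral_sum) auto
    qed
    also have "\<dots> \<le> (\<Sum>k<(2::nat)^l. ennreal (1 / (2 * lam)) * ennreal (s * (\<Sum>i<n. (\<psi> l k (w i))\<^sup>2)) + ennreal (lam / 2))"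
    proof (intro sum_mono add_right_mono mult_left_mono)
      fix k
      show "(\<integral>\<^sup>+ z. ennreal ((Z l k z)\<^sup>2) \<partial>?P) \<le> ennreal (s * (\<Sum>i<n. (\<psi> l k (w i))\<^sup>2))"
        using product_second_moment[of N n f s "\<lambda>i. \<psi> l k (w i)", OF N f] by (simp add: Z_def mult.commute)
    qed simp
    also have "\<dots> = (\<Sum>k<(2::nat)^l. ennreal (1 / (2 * lam) * (s * (\<Sum>i<n. (\<psi> l k (w i))\<^sup>2)) + lam / 2))"
    proof (rule sum.cong[OF refl])
      fix k
      have S: "0 \<le> s * (\<Sum>i<n. (\<psi> l k (w i))\<^sup>2)" using s by (intro mult_nonneg_nonneg sum_nonneg) auto
      have "ennreal (1 / (2 * lam) * (s * (\<Sum>i<n. (\<psi> l k (w i))\<^sup>2)) + lam / 2)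
          = ennreal (1 / (2 * lam) * (s * (\<Sum>i<n. (\<psi> l k (w i))\<^sup>2))) + ennreal (lam / 2)"
        using lam S by (intro ennreal_plus) auto
      also have "ennreal (1 / (2 * lam) * (s * (\<Sum>i<n. (\<psi> l k (w i))\<^sup>2)))
          = ennreal (1 / (2 * lam)) * ennreal (s * (\<Sum>i<n. (\<psi> l k (w i))\<^sup>2))"
        using lam S by (intro ennreal_mult) auto
      finally show "ennreal (1 / (2 * lam)) * ennreal (s * (\<Sum>i<n. (\<psi> l k (w i))\<^sup>2)) + ennreal (lam / 2)
          = ennreal (1 / (2 * lam) * (s * (\<Sum>i<n. (\<psi> l k (w i))\<^sup>2)) + lam / 2)" by simp
    qed
    also have "\<dots> = ennreal (\<Sum>k<(2::nat)^l. 1 / (2 * lam) * (s * (\<Sum>i<n. (\<psi> l k (w i))\<^sup>2)) + lam / 2)"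
      using lam s by (intro sum_ennreal add_nonneg_nonneg mult_nonneg_nonneg sum_nonneg) auto
    also have "\<dots> \<le> ennreal (lam * 2 ^ l)"
    proof (rule ennreal_leI)
      have "(\<Sum>k<(2::nat)^l. \<Sum>i<n. (\<psi> l k (w i))\<^sup>2) = (\<Sum>i<n. \<Sum>k<(2::nat)^l. (\<psi> l k (w i))\<^sup>2)"
        by (rule sum.swap)
      also have "\<dots> \<le> (\<Sum>i<n. C\<^sup>2 * 2 ^ l)"
      proof (rule sum_mono)
        fix i assume i: "i \<in> {..<n}"
        \<comment> \<open>A sum of squares is at most the square of the sum of absolute values,
          which localization bounds.\<close>
        have "(\<Sum>k<(2::nat)^l. (\<psi> l k (w i))\<^sup>2) \<le> (\<Sum>k<(2::nat)^l. \<bar>\<psi> l k (w i)\<bar> * (\<Sum>k<2^l. \<bar>\<psi> l k (w i)\<bar>))"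
        proof (rule sum_mono)
          fix k :: nat assume "k \<in> {..<2^l}"
          then have "\<bar>\<psi> l k (w i)\<bar> \<le> (\<Sum>k<2^l. \<bar>\<psi> l k (w i)\<bar>)"
            by (intro member_le_sum) auto
          then have "\<bar>\<psi> l k (w i)\<bar> * \<bar>\<psi> l k (w i)\<bar> \<le> \<bar>\<psi> l k (w i)\<bar> * (\<Sum>k<2^l. \<bar>\<psi> l k (w i)\<bar>)"
            by (intro mult_left_mono) auto
          then show "(\<psi> l k (w i))\<^sup>2 \<le> \<bar>\<psi> l k (w i)\<bar> * (\<Sum>k<2^l. \<bar>\<psi> l k (w i)\<bar>)"
            by (simp add: power2_eq_square)
        qed
        also have "\<dots> = (\<Sum>k<2^l. \<bar>\<psi> l k (w i)\<bar>)\<^sup>2"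
          by (simp add: power2_eq_square sum_distrib_right)
        also have "\<dots> \<le> (C * 2 powr (real l / 2))\<^sup>2"
          using loc w[of i] i by (intro power_mono sum_nonneg) (auto simp: localized_def)
        also have "\<dots> = C\<^sup>2 * 2 ^ l"
          by (simp add: power_mult_distrib powr_power powr_realpow)
        finally show "(\<Sum>k<(2::nat)^l. (\<psi> l k (w i))\<^sup>2) \<le> C\<^sup>2 * 2 ^ l" .
      qed
      finally have b: "(\<Sum>k<(2::nat)^l. \<Sum>i<n. (\<psi> l k (w i))\<^sup>2) \<le> n * (C\<^sup>2 * 2 ^ l)" by simp
      have "(\<Sum>k<(2::nat)^l. 1 / (2 * lam) * (s * (\<Sum>i<n. (\<psi> l k (w i))\<^sup>2)) + lam / 2)
          = s / (2 * lam) * (\<Sum>k<(2::nat)^l. \<Sum>i<n. (\<psi> l k (w i))\<^sup>2) + 2 ^ l * (lam / 2)"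
        by (simp add: sum.distrib sum_distrib_left)
      also have "\<dots> \<le> s / (2 * lam) * (n * (C\<^sup>2 * 2 ^ l)) + 2 ^ l * (lam / 2)"
        using b s lam by (intro add_right_mono mult_left_mono) auto
      also have "s / (2 * lam) * (n * (C\<^sup>2 * 2 ^ l)) = lam\<^sup>2 / (2 * lam) * 2 ^ l" by (simp add: lam2)
      also have "lam\<^sup>2 / (2 * lam) * 2 ^ l + 2 ^ l * (lam / 2) = lam * 2 ^ l"
        using lam by (simp add: power2_eq_square)
      finally show "(\<Sum>k<(2::nat)^l. 1 / (2 * lam) * (s * (\<Sum>i<n. (\<psi> l k (w i))\<^sup>2)) + lam / 2) \<le> lam * 2 ^ l" .
    qed
    finally show ?thesis by (simp add: lam_def)
  qed
  let ?q = "2 powr (- (\<alpha> - 1/2))"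
  have q: "0 < ?q" "?q < 1" using geometric_two_powr(3)[of "\<alpha> - 1/2"] \<alpha> by auto
  have hf: "high_freq \<psi> \<alpha> J n w (\<lambda>i. f i (z i)) l = 2 powr (- (real (l + J) * (\<alpha> + 1/2))) * (\<Sum>k<2^(l + J). \<bar>Z (l + J) k z\<bar>)" for z l
    by (simp add: high_freq_def Z_def)
  have hfm: "(\<lambda>z. ennreal (high_freq \<psi> \<alpha> J n w (\<lambda>i. f i (z i)) l)) \<in> borel_measurable ?P" for l
    unfolding hf using Zm by measurable
  have term_le: "(\<integral>\<^sup>+ z. ennreal (high_freq \<psi> \<alpha> J n w (\<lambda>i. f i (z i)) l) \<partial>?P)
      \<le> ennreal (sqrt s * C * sqrt n * ?q ^ J * ?q ^ l)" for l
  proof -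
    let ?c = "2 powr (- (real (l + J) * (\<alpha> + 1/2)))"
    have "(\<integral>\<^sup>+ z. ennreal (high_freq \<psi> \<alpha> J n w (\<lambda>i. f i (z i)) l) \<partial>?P)
        = (\<integral>\<^sup>+ z. ennreal ?c * ennreal (\<Sum>k<2^(l + J). \<bar>Z (l + J) k z\<bar>) \<partial>?P)"
      unfolding hf by (intro nn_integral_cong ennreal_mult sum_nonneg) auto
    also have "\<dots> = ennreal ?c * (\<integral>\<^sup>+ z. ennreal (\<Sum>k<2^(l + J). \<bar>Z (l + J) k z\<bar>) \<partial>?P)"
      using Zm by (intro nn_integral_cmult) measurable
    also have "\<dots> \<le> ennreal ?c * ennreal (sqrt s * C * sqrt n * 2 ^ (l + J))"
      by (intro mult_left_mono level) simp
    also have "\<dots> = ennreal (?c * (sqrt s * C * sqrt n * 2 ^ (l + J)))"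
      using s C by (intro ennreal_mult[symmetric]) auto
    also have "?c * (sqrt s * C * sqrt n * 2 ^ (l + J)) = sqrt s * C * sqrt n * (?c * 2 powr (real (l + J)))"
      by (simp only: powr_realpow[of 2 "l + J", OF zero_less_numeral] mult_ac)
    also have "?c * 2 powr (real (l + J)) = ?q ^ (l + J)"
    proof -
      have "?c * 2 powr (real (l + J)) = 2 powr (- (real (l + J) * (\<alpha> + 1/2)) + real (l + J))"
        by (simp only: powr_add)
      also have "- (real (l + J) * (\<alpha> + 1/2)) + real (l + J) = real (l + J) * (- (\<alpha> - 1/2))"
        by (simp add: field_simps)
      also have "2 powr \<dots> = ?q ^ (l + J)"
        by (rule powr_power[symmetric]) simp
      finally show ?thesis .
    qed
    finally show ?thesis by (simp add: power_add mult_ac)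
  qed
  have "(\<integral>\<^sup>+ z. ennreal (\<Sum>l. high_freq \<psi> \<alpha> J n w (\<lambda>i. f i (z i)) l) \<partial>?P)
      = (\<integral>\<^sup>+ z. (\<Sum>l. ennreal (high_freq \<psi> \<alpha> J n w (\<lambda>i. f i (z i)) l)) \<partial>?P)"
    using summable_high_freq[OF loc _ w] \<alpha> high_freq_nonneg
    by (intro nn_integral_cong suminf_ennreal2[symmetric]) auto
  also have "\<dots> = (\<Sum>l. \<integral>\<^sup>+ z. ennreal (high_freq \<psi> \<alpha> J n w (\<lambda>i. f i (z i)) l) \<partial>?P)"
    by (rule nn_integral_suminf[OF hfm])
  also have "\<dots> \<le> (\<Sum>l. ennreal (sqrt s * C * sqrt n * ?q ^ J * ?q ^ l))"
    by (intro suminf_le term_le summableI)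
  also have "\<dots> = ennreal (\<Sum>l. sqrt s * C * sqrt n * ?q ^ J * ?q ^ l)"
    using s C q by (intro suminf_ennreal2 summable_mult summable_geometric) auto
  also have "(\<Sum>l. sqrt s * C * sqrt n * ?q ^ J * ?q ^ l) = sqrt s * C * sqrt n * ?q ^ J * (1 / (1 - ?q))"
    using q by (subst suminf_mult) (auto intro!: summable_geometric simp: suminf_geometric)
  also have "?q ^ J = 2 powr (- (real J * (\<alpha> - 1/2)))"
    by (subst powr_power) (simp_all add: minus_mult_right)
  finally show ?thesis by simp
qed

section \<open>The uniform series prior\<close>

abbreviation coeff_prior :: "real \<Rightarrow> (nat \<times> nat \<Rightarrow> real) measure" where
  "coeff_prior M \<equiv> PiM wavelet_index (\<lambda>_. uniform_measure lborel {-M..M})"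

abbreviation wavelet_path :: "(nat \<Rightarrow> nat \<Rightarrow> real \<Rightarrow> real) \<Rightarrow> real \<Rightarrow> (nat \<times> nat \<Rightarrow> real) \<Rightarrow> real \<Rightarrow> real" where
  "wavelet_path \<psi> \<alpha> \<nu> \<equiv> \<lambda>x\<in>{0..1}. wavelet_series \<psi> \<alpha> \<nu> x"

lemma prior_eq_distr:
  "wavelet_series_prior \<psi> \<alpha> M = distr (coeff_prior M) (PiM {0..1} (\<lambda>_. borel)) (wavelet_path \<psi> \<alpha>)"
  by (simp add: wavelet_series_prior_def wavelet_series_def[abs_def] wavelet_level_def[abs_def])

lemma measurable_wavelet_path [measurable]:
  "wavelet_path \<psi> \<alpha> \<in> measurable (coeff_prior M) (PiM {0..1} (\<lambda>_. borel))"
proof (rule measurable_restrict)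
  fix x :: real
  have c: "(\<lambda>\<nu>. \<nu> (l, k)) \<in> borel_measurable (coeff_prior M)" if "k < 2^l" for l k
  proof -
    have "(\<lambda>\<nu>. \<nu> (l, k)) \<in> measurable (coeff_prior M) (uniform_measure lborel {-M..M})"
      using that by (intro measurable_component_singleton) auto
    then show ?thesis by (simp cong: measurable_cong_sets)
  qed
  show "(\<lambda>\<nu>. wavelet_series \<psi> \<alpha> \<nu> x) \<in> borel_measurable (coeff_prior M)"
    unfolding wavelet_series_def wavelet_level_def
    by (intro borel_measurable_suminf borel_measurable_sum borel_measurable_times borel_measurable_const c) auto
qed

lemma prob_space_coeff_prior: "0 < M \<Longrightarrow> prob_space (coeff_prior M)"
  by (intro prob_space_PiM prob_space_uniform_interval)

lemma prob_space_wavelet_series_prior: "0 < M \<Longrightarrow> prob_space (wavelet_series_prior \<psi> \<alpha> M)"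
  unfolding prior_eq_distr
  by (intro prob_space.prob_space_distr prob_space_coeff_prior measurable_wavelet_path)

lemma sets_wavelet_series_prior: "sets (wavelet_series_prior \<psi> \<alpha> M) = sets (PiM {0..1} (\<lambda>_. borel))"
  unfolding prior_eq_distr by simp

lemma AE_coeff_bounded:
  assumes "0 < M"
  shows "AE \<nu> in coeff_prior M. coeff_bounded M \<nu>"
proof -
  have "AE \<nu> in coeff_prior M. \<bar>\<nu> i\<bar> \<le> M" if "i \<in> wavelet_index" for i
    using that assms by (intro AE_PiM_component prob_space_uniform_interval AE_uniform_interval)
  moreover have "countable wavelet_index" by (rule countable_subset[OF subset_UNIV]) auto
  ultimately have "AE \<nu> in coeff_prior M. \<forall>i\<in>wavelet_index. \<bar>\<nu> i\<bar> \<le> M"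
    by (subst AE_ball_countable) auto
  then show ?thesis by eventually_elim (auto simp: coeff_bounded_def)
qed

text \<open>The prior is a law on paths, while its support is described by coefficients;
  measurability of the event in path space lets it be pulled back along the series map.\<close>

lemma AE_wavelet_series_prior:
  assumes "0 < M" "{m \<in> space (PiM {0..1} (\<lambda>_. borel)). P m} \<in> sets (PiM {0..1} (\<lambda>_. borel))"
    and "\<And>\<nu>. coeff_bounded M \<nu> \<Longrightarrow> P (wavelet_path \<psi> \<alpha> \<nu>)"
  shows "AE m in wavelet_series_prior \<psi> \<alpha> M. P m"
  unfolding prior_eq_distr
  using AE_coeff_bounded[OF assms(1)] assms(3)
  by (subst AE_distr_iff[OF measurable_wavelet_path assms(2)]) auto

text \<open>The centre may lie on the boundary of \<open>{-M..M}\<close>. The one-sided interval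
  pointing towards 0 stays inside, at the cost of half of the ball.\<close>

lemma uniform_measure_ball_ge:
  fixes M r x :: real
  assumes "0 < M" "\<bar>x\<bar> \<le> M" "0 \<le> r" "r \<le> M"
  shows "r / (2 * M) \<le> measure (uniform_measure lborel {-M..M}) {y. \<bar>y - x\<bar> \<le> r}"
proof -
  interpret prob_space "uniform_measure lborel {-M..M}" using assms(1) by (rule prob_space_uniform_interval)
  define I where "I = (if 0 \<le> x then {x - r..x} else {x..x + r})"
  have "r / (2 * M) = measure (uniform_measure lborel {-M..M}) I"
  proof -
    have "{-M..M} \<inter> I = I" using assms by (auto simp: I_def)
    then show ?thesis using assms by (simp add: I_def)
  qed
  also have "\<dots> \<le> measure (uniform_measure lborel {-M..M}) {y. \<bar>y - x\<bar> \<le> r}"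
    using assms by (intro finite_measure_mono) (auto simp: I_def split: if_splits)
  finally show ?thesis .
qed

definition low_freq_index :: "nat \<Rightarrow> (nat \<times> nat) set" where
  "low_freq_index J = (SIGMA l:{..<J}. {..<2^l})"

lemma finite_low_freq_index: "finite (low_freq_index J)"
  by (simp add: low_freq_index_def)

lemma card_low_freq_index: "card (low_freq_index J) \<le> 2 ^ J"
proof -
  have "card (low_freq_index J) = (\<Sum>l<J. 2 ^ l)"
    unfolding low_freq_index_def by (subst card_SigmaI) auto
  also have "\<dots> \<le> 2 ^ J" by (induction J) auto
  finally show ?thesis .
qed

text \<open>Independence gives a product over fewer than \<open>2 ^ J\<close> coordinates; the
  exponent may be rounded up to \<open>2 ^ J\<close> because the bound for each factor is at most
  1.\<close>

lemma coeff_prior_ball_ge: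
  assumes M: "0 < M" and \<nu>0: "coeff_bounded M \<nu>0" and r: "0 \<le> r" "r \<le> M"
  shows "(r / (2 * M)) ^ (2^J) \<le> measure (coeff_prior M)
     {\<nu>\<in>space (coeff_prior M). \<forall>l<J. \<forall>k<2^l. \<bar>\<nu> (l, k) - \<nu>0 (l, k)\<bar> \<le> r}"
proof -
  interpret product_prob_space "\<lambda>_. uniform_measure lborel {-M..M}" wavelet_index
    by (intro product_prob_spaceI prob_space_uniform_interval M)
  let ?S = "low_freq_index J"
  have eq: "{\<nu>\<in>space (coeff_prior M). \<forall>l<J. \<forall>k<2^l. \<bar>\<nu> (l, k) - \<nu>0 (l, k)\<bar> \<le> r}
     = {\<nu>\<in>space (coeff_prior M). \<forall>i\<in>?S. \<nu> i \<in> {y. \<bar>y - \<nu>0 i\<bar> \<le> r}}" by (auto simp: low_freq_index_def)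
  have "emeasure (coeff_prior M) {\<nu>\<in>space (coeff_prior M). \<forall>i\<in>?S. \<nu> i \<in> {y. \<bar>y - \<nu>0 i\<bar> \<le> r}}
     = (\<Prod>i\<in>?S. emeasure (uniform_measure lborel {-M..M}) {y. \<bar>y - \<nu>0 i\<bar> \<le> r})"
    by (rule emeasure_PiM_Collect) (auto simp: low_freq_index_def)
  then have m: "measure (coeff_prior M) {\<nu>\<in>space (coeff_prior M). \<forall>i\<in>?S. \<nu> i \<in> {y. \<bar>y - \<nu>0 i\<bar> \<le> r}}
     = (\<Prod>i\<in>?S. measure (uniform_measure lborel {-M..M}) {y. \<bar>y - \<nu>0 i\<bar> \<le> r})"
    unfolding emeasure_eq_measure M.emeasure_eq_measure
    by (simp add: prod_ennreal prod_nonneg)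
  have "(r / (2 * M)) ^ (2^J) \<le> (r / (2 * M)) ^ card ?S"
    using M r card_low_freq_index by (intro power_decreasing) auto
  also have "(r / (2 * M)) ^ card ?S = (\<Prod>i\<in>?S. r / (2 * M))" by simp
  also have "\<dots> \<le> (\<Prod>i\<in>?S. measure (uniform_measure lborel {-M..M}) {y. \<bar>y - \<nu>0 i\<bar> \<le> r})"
    using M r \<nu>0 by (intro prod_mono conjI uniform_measure_ball_ge) (auto simp: coeff_bounded_def low_freq_index_def)
  finally show ?thesis unfolding eq m .
qed

text \<open>Coefficients below level \<open>J\<close> within
  \<open>M * 2 powr (- (J * \<alpha>'))\<close> of those of the truth give the mass; higher levels
  are left free. Differences of two points of the cube are bounded by \<open>2 * M\<close>, whence
  the 4 in the sup-norm radius. The radius uses the smaller exponent \<open>\<alpha>\<close>, so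
  that both priors can share one \<open>\<eta>\<close>.\<close>

lemma prior_small_ball:
  fixes w :: "nat \<Rightarrow> real" and m0 :: "real \<Rightarrow> real"
  assumes M: "0 < M" and loc: "localized \<psi> C" and \<alpha>: "0 < \<alpha>" "\<alpha> \<le> \<alpha>'" and \<nu>0: "coeff_bounded M \<nu>0"
    and w: "\<And>i. i < n \<Longrightarrow> w i \<in> {0..1}"
    and m0: "\<And>i. i < n \<Longrightarrow> m0 (w i) = wavelet_series \<psi> \<alpha>' \<nu>0 (w i)"
  shows "(2 powr (- (real J * \<alpha>')) / 2) ^ (2^J)
     \<le> measure (wavelet_series_prior \<psi> \<alpha>' M) {m\<in>space (wavelet_series_prior \<psi> \<alpha>' M).
         \<forall>i<n. \<bar>m (w i) - m0 (w i)\<bar> \<le> 4 * M * C * 2 powr (- (real J * \<alpha>)) / (1 - 2 powr (- \<alpha>))}"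
proof -
  let ?r = "M * 2 powr (- (real J * \<alpha>'))"
  let ?\<eta> = "4 * M * C * 2 powr (- (real J * \<alpha>)) / (1 - 2 powr (- \<alpha>))"
  have \<alpha>': "0 < \<alpha>'" using \<alpha> by linarith
  let ?Pm = "PiM {0..1} (\<lambda>_. borel) :: (real \<Rightarrow> real) measure"
  let ?T = "{m\<in>space ?Pm. \<forall>i<n. \<bar>m (w i) - m0 (w i)\<bar> \<le> ?\<eta>}"
  have T: "?T \<in> sets ?Pm"
  proof -
    have "?T = {m\<in>space ?Pm. \<forall>i\<in>{..<n}. \<bar>m (w i) - m0 (w i)\<bar> \<le> ?\<eta>}" by auto
    also have "\<dots> \<in> sets ?Pm"
      using w by (intro sets.sets_Collect_finite_All borel_measurable_le borel_measurable_abs borel_measurable_diff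
          borel_measurable_const measurable_component_singleton) auto
    finally show ?thesis .
  qed
  interpret prob_space "coeff_prior M" using M by (rule prob_space_coeff_prior)
  let ?Near = "{\<nu>\<in>space (coeff_prior M). \<forall>l<J. \<forall>k<2^l. \<bar>\<nu> (l, k) - \<nu>0 (l, k)\<bar> \<le> ?r}"
  have "2 powr (- (real J * \<alpha>')) \<le> 2 powr 0" using \<alpha>' by (intro powr_mono) auto
  then have r1: "?r \<le> M" using M by (simp add: mult_left_le)
  have "(2 powr (- (real J * \<alpha>')) / 2) ^ (2^J) = (?r / (2 * M)) ^ (2^J)" using M by simp
  also have "\<dots> \<le> prob ?Near"
    using M r1 by (intro coeff_prior_ball_ge \<nu>0) auto
  also have "\<dots> \<le> prob (wavelet_path \<psi> \<alpha>' -` ?T \<inter> space (coeff_prior M))"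
  proof (rule finite_measure_mono_AE)
    show "AE \<nu> in coeff_prior M. \<nu> \<in> ?Near \<longrightarrow> \<nu> \<in> wavelet_path \<psi> \<alpha>' -` ?T \<inter> space (coeff_prior M)"
      using AE_coeff_bounded[OF M]
    proof eventually_elim
      case (elim \<nu>)
      show ?case
      proof
        assume near: "\<nu> \<in> ?Near"
        have cb: "coeff_bounded (2 * M) (\<lambda>j. \<nu> j - \<nu>0 j)"
          unfolding coeff_bounded_def
        proof (intro allI impI)
          fix l k :: nat assume "k < 2^l"
          then have "\<bar>\<nu> (l, k)\<bar> \<le> M" "\<bar>\<nu>0 (l, k)\<bar> \<le> M" using elim \<nu>0 by (auto simp: coeff_bounded_def)
          then show "\<bar>\<nu> (l, k) - \<nu>0 (l, k)\<bar> \<le> 2 * M" by linarith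
        qed
        have "\<bar>wavelet_series \<psi> \<alpha>' \<nu> (w i) - m0 (w i)\<bar> \<le> ?\<eta>" if i: "i < n" for i
        proof -
          have "wavelet_series \<psi> \<alpha>' \<nu> (w i) - m0 (w i) = wavelet_series \<psi> \<alpha>' (\<lambda>j. \<nu> j - \<nu>0 j) (w i)"
            using m0[OF i] wavelet_series_diff[OF loc \<alpha>' elim \<nu>0 _ w[OF i]] M by simp
          also have "\<bar>\<dots>\<bar> \<le> 2 * (2 * M) * C * 2 powr (- (real J * \<alpha>')) / (1 - 2 powr (- \<alpha>'))"
          proof (rule wavelet_series_small[OF loc \<alpha>' _ cb w[OF i]])
            fix l k :: nat assume lk: "l < J" "k < 2^l"
            then have "\<bar>\<nu> (l, k) - \<nu>0 (l, k)\<bar> \<le> ?r" using near by auto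
            also have "\<dots> \<le> 2 * M * 2 powr (- (real J * \<alpha>'))" using M by simp
            finally show "\<bar>\<nu> (l, k) - \<nu>0 (l, k)\<bar> \<le> 2 * M * 2 powr (- (real J * \<alpha>'))" .
          qed (use M in simp)
          also have "\<dots> \<le> ?\<eta>"
          proof (rule frac_le)
            show "2 * (2 * M) * C * 2 powr (- (real J * \<alpha>')) \<le> 4 * M * C * 2 powr (- (real J * \<alpha>))"
            proof -
              have "2 powr (- (real J * \<alpha>')) \<le> 2 powr (- (real J * \<alpha>))"
                using \<alpha> by (intro powr_mono) (auto intro: mult_left_mono)
              moreover have "0 \<le> 4 * M * C" using M loc by (simp add: localized_def)
              ultimately show ?thesis by (simp add: mult_left_mono)
            qed
            show "0 < 1 - 2 powr (- \<alpha>)" using geometric_two_powr(3)[OF \<alpha>(1)] by simp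
            have "2 powr (- \<alpha>') \<le> 2 powr (- \<alpha>)" using \<alpha> by (intro powr_mono) auto
            then show "1 - 2 powr (- \<alpha>) \<le> 1 - 2 powr (- \<alpha>')" by simp
            show "0 \<le> 4 * M * C * 2 powr (- (real J * \<alpha>))" using M loc by (auto simp: localized_def)
          qed
          finally show ?thesis .
        qed
        then have "\<forall>i<n. \<bar>wavelet_path \<psi> \<alpha>' \<nu> (w i) - m0 (w i)\<bar> \<le> ?\<eta>" using w by simp
        moreover have sp: "\<nu> \<in> space (coeff_prior M)" using near by blast
        moreover have "wavelet_path \<psi> \<alpha>' \<nu> \<in> space ?Pm"
          by (rule measurable_space[OF measurable_wavelet_path sp])
        ultimately show "\<nu> \<in> wavelet_path \<psi> \<alpha>' -` ?T \<inter> space (coeff_prior M)" by blast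
      qed
    qed
    show "wavelet_path \<psi> \<alpha>' -` ?T \<inter> space (coeff_prior M) \<in> events"
      using T by (rule measurable_sets[OF measurable_wavelet_path])
  qed
  also have "\<dots> = measure (wavelet_series_prior \<psi> \<alpha>' M) ?T"
    unfolding prior_eq_distr by (rule measure_distr[OF measurable_wavelet_path T, symmetric])
  finally show ?thesis unfolding prior_eq_distr by simp
qed

text \<open>The low-frequency part is bounded through the chi-square statistic and its own empirical
  norm, the rest by the \<open>l^1\<close> bound. Truncation changes the function by at most
  \<open>\<tau>\<close> at each point, so the norm of \<open>gJ\<close> is at most twice that of
  \<open>g\<close> plus a term of order \<open>sqrt n * \<tau>\<close>. The hypothesis on
  \<open>c4\<close> compares this term with \<open>sqrt D\<close>: it is the balance between
  approximation error and dimension.\<close>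

lemma dominated_wavelet_series:
  fixes w :: "nat \<Rightarrow> real"
  assumes loc: "localized \<psi> C" and \<alpha>: "0 < \<alpha>" and \<nu>: "coeff_bounded N \<nu>" and N: "0 \<le> N"
    and w: "\<And>i. i < n \<Longrightarrow> w i \<in> {0..1}"
    and bas: "\<And>x a. (\<Sum>i<n. x i * (\<Sum>j\<in>low_freq_index J. a j * \<psi> (fst j) (snd j) (w i)))\<^sup>2
         \<le> (\<Sum>b\<in>bs. (\<Sum>i<n. x i * b i)\<^sup>2) * (\<Sum>i<n. (\<Sum>j\<in>low_freq_index J. a j * \<psi> (fst j) (snd j) (w i))\<^sup>2)"
    and A: "1 \<le> A" and D: "0 < D" and c4: "sqrt (real n) * 2 powr (- (real J * \<alpha>)) \<le> c4 * sqrt D"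
    and chi: "(\<Sum>b\<in>bs. (\<Sum>i<n. v i * b i)\<^sup>2) \<le> A * D"
    and hf: "(\<Sum>l. high_freq \<psi> \<alpha> J n w v l) \<le> A * D"
  shows "dominated ((2 + 2 * N * C * c4 / (1 - 2 powr (- \<alpha>)) + N) * A) D n v (\<lambda>i. wavelet_series \<psi> \<alpha> \<nu> (w i))"
proof -
  define g where "g = (\<lambda>i. wavelet_series \<psi> \<alpha> \<nu> (w i))"
  define gJ where "gJ = (\<lambda>i. \<Sum>l<J. wavelet_level \<psi> \<alpha> \<nu> l (w i))"
  define T1 where "T1 = N * C * c4 / (1 - 2 powr (- \<alpha>))"
  define \<tau> where "\<tau> = N * C * 2 powr (- (real J * \<alpha>)) / (1 - 2 powr (- \<alpha>))"
  have C: "0 \<le> C" using loc by (simp add: localized_def)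
  have q: "0 < 1 - 2 powr (- \<alpha>)" using geometric_two_powr(3)[OF \<alpha>] by simp
  have \<tau>: "0 \<le> \<tau>" using N C q by (simp add: \<tau>_def)
  have \<tau>n: "sqrt n * \<tau> \<le> T1 * sqrt D"
  proof -
    have "sqrt n * \<tau> = N * C / (1 - 2 powr (- \<alpha>)) * (sqrt n * 2 powr (- (real J * \<alpha>)))" by (simp add: \<tau>_def)
    also have "\<dots> \<le> N * C / (1 - 2 powr (- \<alpha>)) * (c4 * sqrt D)"
      using c4 N C q by (intro mult_left_mono) auto
    finally show ?thesis by (simp add: T1_def mult_ac)
  qed
  have tail: "\<bar>g i - gJ i\<bar> \<le> \<tau>" if "i < n" for i
    unfolding g_def gJ_def \<tau>_def by (rule wavelet_series_tail[OF loc \<alpha> N \<nu> w[OF that]])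
  have gJ_eq: "gJ i = (\<Sum>j\<in>low_freq_index J. (2 powr (- (real (fst j) * (\<alpha> + 1/2))) * \<nu> j) * \<psi> (fst j) (snd j) (w i))" for i
    unfolding gJ_def wavelet_level_def low_freq_index_def
    by (subst sum.Sigma) (auto simp: case_prod_beta')
  have QJ: "dotp n gJ gJ \<le> 2 * dotp n g g + 2 * (n * \<tau>\<^sup>2)"
  proof -
    have "dotp n gJ gJ \<le> (\<Sum>i<n. 2 * (g i)\<^sup>2 + 2 * \<tau>\<^sup>2)"
      unfolding dotp_self
    proof (rule sum_mono)
      fix i assume "i \<in> {..<n}"
      then have "\<bar>g i - gJ i\<bar>\<^sup>2 \<le> \<tau>\<^sup>2" using tail by (intro power_mono) auto
      then have "(g i - gJ i)\<^sup>2 \<le> \<tau>\<^sup>2" by simp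
      moreover have "0 \<le> (g i + (g i - gJ i))\<^sup>2" by simp
      ultimately show "(gJ i)\<^sup>2 \<le> 2 * (g i)\<^sup>2 + 2 * \<tau>\<^sup>2" by (simp add: power2_eq_square algebra_simps)
    qed
    also have "\<dots> = 2 * dotp n g g + 2 * (n * \<tau>\<^sup>2)"
      by (simp add: dotp_self sum.distrib sum_distrib_left)
    finally show ?thesis .
  qed
  have sQJ: "sqrt (dotp n gJ gJ) \<le> 2 * sqrt (dotp n g g) + 2 * (T1 * sqrt D)"
  proof -
    have "sqrt (dotp n gJ gJ) \<le> sqrt (2 * dotp n g g + 2 * (n * \<tau>\<^sup>2))" using QJ by simp
    also have "\<dots> \<le> sqrt (2 * dotp n g g) + sqrt (2 * (n * \<tau>\<^sup>2))"
      by (rule sqrt_add_le_add_sqrt) (auto simp: dotp_self_nonneg)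
    also have "\<dots> = sqrt 2 * sqrt (dotp n g g) + sqrt 2 * (sqrt n * \<tau>)"
      using \<tau> by (simp add: real_sqrt_mult)
    also have "\<dots> \<le> 2 * sqrt (dotp n g g) + 2 * (T1 * sqrt D)"
    proof (rule add_mono)
      show "sqrt 2 * sqrt (dotp n g g) \<le> 2 * sqrt (dotp n g g)"
        using sqrt2_less_2 by (intro mult_right_mono) (auto simp: dotp_self_nonneg)
      have "sqrt 2 * (sqrt n * \<tau>) \<le> 2 * (sqrt n * \<tau>)"
        using sqrt2_less_2 \<tau> by (intro mult_right_mono) auto
      then show "sqrt 2 * (sqrt n * \<tau>) \<le> 2 * (T1 * sqrt D)" using \<tau>n by linarith
    qed
    finally show ?thesis .
  qed
  have low: "\<bar>\<Sum>i<n. v i * gJ i\<bar> \<le> A * sqrt D * sqrt (dotp n gJ gJ)"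
  proof -
    have "(\<Sum>i<n. v i * gJ i)\<^sup>2 \<le> (\<Sum>b\<in>bs. (\<Sum>i<n. v i * b i)\<^sup>2) * dotp n gJ gJ"
      using bas[of v "\<lambda>j. 2 powr (- (real (fst j) * (\<alpha> + 1/2))) * \<nu> j"] unfolding gJ_eq dotp_self .
    also have "\<dots> \<le> (A * D) * dotp n gJ gJ"
      using chi by (intro mult_right_mono) (auto simp: dotp_self_nonneg)
    \<comment> \<open>Rounding \<open>A\<close> up to \<open>A\<^sup>2\<close> lets the square root
      come out as \<open>A * sqrt D\<close>.\<close>
    also have "\<dots> \<le> (A\<^sup>2 * D) * dotp n gJ gJ"
    proof -
      have "A \<le> A\<^sup>2" using A by (simp add: power2_eq_square)
      then show ?thesis using D by (intro mult_right_mono) (auto simp: dotp_self_nonneg)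
    qed
    also have "\<dots> = (A * sqrt D * sqrt (dotp n gJ gJ))\<^sup>2"
      using D by (simp add: power_mult_distrib dotp_self_nonneg)
    finally have "\<bar>\<Sum>i<n. v i * gJ i\<bar> \<le> \<bar>A * sqrt D * sqrt (dotp n gJ gJ)\<bar>"
      by (simp only: abs_le_square_iff)
    then show ?thesis using A D dotp_self_nonneg[of n gJ] by simp
  qed
  have "\<bar>dotp n v g\<bar> \<le> \<bar>\<Sum>i<n. v i * gJ i\<bar> + N * (\<Sum>l. high_freq \<psi> \<alpha> J n w v l)"
    unfolding dotp_def g_def gJ_def by (rule abs_inner_wavelet_series_le[OF loc \<alpha> \<nu> N w])
  also have "\<dots> \<le> A * sqrt D * (2 * sqrt (dotp n g g) + 2 * (T1 * sqrt D)) + N * (A * D)"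
  proof (rule add_mono)
    have "A * sqrt D * sqrt (dotp n gJ gJ) \<le> A * sqrt D * (2 * sqrt (dotp n g g) + 2 * (T1 * sqrt D))"
      using sQJ A D by (intro mult_left_mono) auto
    then show "\<bar>\<Sum>i<n. v i * gJ i\<bar> \<le> A * sqrt D * (2 * sqrt (dotp n g g) + 2 * (T1 * sqrt D))"
      using low by linarith
    show "N * (\<Sum>l. high_freq \<psi> \<alpha> J n w v l) \<le> N * (A * D)" using hf N by (rule mult_left_mono)
  qed
  also have "\<dots> = A * (2 * (sqrt D * sqrt (dotp n g g)) + (2 * T1 + N) * D)"
  proof -
    have "A * sqrt D * (2 * (T1 * sqrt D)) = A * (2 * T1 * (sqrt D * sqrt D))"
      by (simp only: mult_ac)
    also have "sqrt D * sqrt D = D" using D by simp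
    finally have "A * sqrt D * (2 * (T1 * sqrt D)) = A * (2 * T1 * D)" .
    then show ?thesis by (simp add: algebra_simps)
  qed
  also have "\<dots> \<le> A * ((2 + 2 * T1 + N) * (sqrt D * sqrt (dotp n g g)) + (2 + 2 * T1 + N) * D)"
  proof -
    have "0 \<le> sqrt n * \<tau>" using \<tau> by simp
    then have "0 \<le> T1 * sqrt D" using \<tau>n by (rule order_trans)
    then have T1: "0 \<le> T1" using D by (simp add: zero_le_mult_iff)
    show ?thesis
      using A D N T1 by (intro mult_left_mono add_mono mult_right_mono) (auto simp: dotp_self_nonneg)
  qed
  also have "\<dots> = (2 + 2 * N * C * c4 / (1 - 2 powr (- \<alpha>)) + N) * A * (sqrt D * sqrt (dotp n g g) + D)"
  proof -
    have T: "2 * N * C * c4 / (1 - 2 powr (- \<alpha>)) = 2 * T1" by (simp add: T1_def)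
    show ?thesis unfolding T by (simp add: distrib_left mult_ac)
  qed
  finally show ?thesis unfolding dominated_def g_def .
qed

section \<open>Residuals\<close>

lemma (in product_prob_space) indep_vars_coordinates:
  assumes "finite J" "J \<noteq> {}" "J \<subseteq> I"
  shows "indep_vars M (\<lambda>i \<omega>. \<omega> i) J"
proof (subst indep_vars_iff_distr_eq_PiM'[OF assms(2)])
  show "(\<lambda>\<omega>. \<omega> i) \<in> measurable (PiM I M) (M i)" if "i \<in> J" for i
    using that assms by (intro measurable_component_singleton) auto
  have "distr (PiM I M) (PiM J M) (\<lambda>x. \<lambda>i\<in>J. x i) = PiM J M"
    using distr_PiM_restrict_finite[OF assms(1,3)] by (simp add: restrict_def)
  also have "\<dots> = PiM J (\<lambda>i. distr (PiM I M) (M i) (\<lambda>\<omega>. \<omega> i))"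
    using assms by (intro PiM_cong) (auto simp: PiM_component)
  finally show "distr (PiM I M) (PiM J M) (\<lambda>x. \<lambda>i\<in>J. x i) = PiM J (\<lambda>i. distr (PiM I M) (M i) (\<lambda>\<omega>. \<omega> i))" .
qed

text \<open>Hoeffding's inequality makes the failure probabilities geometric in \<open>n\<close>,
  and Borel-Cantelli leaves finitely many failures. The bound is one-sided because it will keep the
  conditional variances away from zero on average.\<close>

lemma eventually_sum_iid_gt:
  fixes Q :: "'a measure" and h :: "'a \<Rightarrow> real"
  assumes Q: "prob_space Q" and h: "h \<in> borel_measurable Q" and b: "AE x in Q. h x \<in> {0..b}" "0 < b" and e: "0 < e"
  shows "AE \<omega> in PiM (UNIV :: nat set) (\<lambda>_. Q). eventually (\<lambda>n. real n * ((\<integral>x. h x \<partial>Q) - e) < (\<Sum>i<n. h (\<omega> i))) sequentially"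
proof -
  interpret PP: product_prob_space "\<lambda>_. Q" "UNIV :: nat set" by (intro product_prob_spaceI Q)
  let ?P = "PiM (UNIV :: nat set) (\<lambda>_. Q)"
  define \<mu> where "\<mu> = (\<integral>x. h x \<partial>Q)"
  define Bad where "Bad n = {\<omega> \<in> space ?P. (\<Sum>i<n. h (\<omega> i)) \<le> real n * \<mu> - real n * e}" for n
  have hm: "(\<lambda>\<omega>. h (\<omega> i)) \<in> borel_measurable ?P" for i
  proof -
    have c: "(\<lambda>\<omega>. \<omega> i) \<in> measurable ?P Q" by (rule measurable_component_singleton) simp
    show ?thesis by (rule measurable_compose[OF c h])
  qed
  have Bad_sets: "Bad n \<in> sets ?P" for n
    unfolding Bad_def by (intro borel_measurable_le borel_measurable_sum borel_measurable_const hm)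
  have mean: "(\<integral>\<omega>. h (\<omega> i) \<partial>?P) = \<mu>" for i
  proof -
    have "(\<integral>\<omega>. h (\<omega> i) \<partial>?P) = (\<integral>x. h x \<partial>distr ?P Q (\<lambda>\<omega>. \<omega> i))"
      by (rule integral_distr[symmetric]) (auto intro: h measurable_component_singleton)
    then show ?thesis using PP.PiM_component[of i] by (simp add: \<mu>_def)
  qed
  have bound: "PP.prob (Bad n) \<le> exp (- 2 * e\<^sup>2 / b\<^sup>2) ^ n" for n
  proof (cases "n = 0")
    case True
    then show ?thesis by simp
  next
    case False
    interpret H: Hoeffding_ineq ?P "{..<n}" "\<lambda>i \<omega>. h (\<omega> i)" "\<lambda>_. 0" "\<lambda>_. b" "real n * \<mu>"
    proof unfold_locales
      show "PP.indep_vars (\<lambda>_. borel) (\<lambda>i \<omega>. h (\<omega> i)) {..<n}"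
      proof -
        have iv: "PP.indep_vars (\<lambda>_. Q) (\<lambda>i \<omega>. \<omega> i) {..<n}"
          by (rule PP.indep_vars_coordinates) (use False in auto)
        show ?thesis by (rule PP.indep_vars_compose2[OF iv h])
      qed
      show "AE \<omega> in ?P. h (\<omega> i) \<in> {0..b}" for i
        by (rule PP.AE_component[OF _ b(1)]) simp
    qed (simp_all add: mean)
    have "PP.prob (Bad n) \<le> exp (- 2 * (real n * e)\<^sup>2 / (\<Sum>i\<in>{..<n}. (b - 0)\<^sup>2))"
      unfolding Bad_def using False b e by (intro H.Hoeffding_ineq_le) auto
    also have "- 2 * (real n * e)\<^sup>2 / (\<Sum>i\<in>{..<n}. (b - 0)\<^sup>2) = real n * (- 2 * e\<^sup>2 / b\<^sup>2)"
      using False b by (simp add: power2_eq_square)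
    also have "exp \<dots> = exp (- 2 * e\<^sup>2 / b\<^sup>2) ^ n" by (rule exp_of_nat_mult)
    finally show ?thesis .
  qed
  have "summable (\<lambda>n. PP.prob (Bad n))"
  proof (rule summable_comparison_test')
    show "summable (\<lambda>n. exp (- 2 * e\<^sup>2 / b\<^sup>2) ^ n)"
      using b e by (intro summable_geometric) simp
  qed (use bound in simp)
  then have "AE \<omega> in ?P. eventually (\<lambda>n. \<omega> \<in> space ?P - Bad n) sequentially"
    using Bad_sets by (intro borel_cantelli_AE1) (auto simp: PP.emeasure_eq_measure)
  then show ?thesis
  proof (eventually_elim)
    case (elim \<omega>)
    then show ?case
      by eventually_elim (auto simp: Bad_def \<mu>_def right_diff_distrib not_le)
  qed
qed

text \<open>What the fixed-design argument takes from the model, \<open>Q\<close> being the law of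
  the data at one design point: centred residuals for the linear sums, mean zero of
  \<open>\<xi> * u\<close> for the score, and one bound \<open>s\<close> on the second moments of
  \<open>\<xi>\<close>, \<open>u\<close>, \<open>\<xi> * u\<close> and on the fourth moment of
  \<open>u\<close>, which governs the fluctuation of \<open>dotp n u u\<close>.\<close>

definition residual_law :: "real \<Rightarrow> 'b measure \<Rightarrow> ('b \<Rightarrow> real) \<Rightarrow> ('b \<Rightarrow> real) \<Rightarrow> bool" where
  "residual_law s Q \<xi> u \<longleftrightarrow> prob_space Q \<and>
     \<xi> \<in> borel_measurable Q \<and> u \<in> borel_measurable Q \<and>
     (\<integral>x. \<xi> x \<partial>Q) = 0 \<and> (\<integral>x. u x \<partial>Q) = 0 \<and> (\<integral>x. \<xi> x * u x \<partial>Q) = 0 \<and>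
     (\<forall>h\<in>{\<lambda>x. (\<xi> x)\<^sup>2, \<lambda>x. (u x)\<^sup>2, \<lambda>x. (\<xi> x * u x)\<^sup>2, \<lambda>x. (u x) ^ 4}. integrable Q h \<and> (\<integral>x. h x \<partial>Q) \<le> s)"

text \<open>One integrable function, \<open>1 + 8 * e1 ^ 4 + (8 * \<beta> ^ 4 + 1) * e2 ^ 4\<close>,
  dominates all four, through \<open>(a - b) ^ 4 \<le> 8 * a ^ 4 + 8 * b ^ 4\<close>,
  \<open>t\<^sup>2 \<le> 1 + t ^ 4\<close> and
  \<open>(p * q)\<^sup>2 \<le> p ^ 4 + q ^ 4\<close>.\<close>

lemma residual_moments:
  fixes e1 e2 :: "'b \<Rightarrow> real"
  assumes Q: "prob_space Q" and e: "e1 \<in> borel_measurable Q" "e2 \<in> borel_measurable Q" and c: "0 \<le> c"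
    and m: "(\<integral>\<^sup>+ x. ennreal (e1 x ^ 4) \<partial>Q) \<le> ennreal c" "(\<integral>\<^sup>+ x. ennreal (e2 x ^ 4) \<partial>Q) \<le> ennreal c"
    and h: "h \<in> {\<lambda>x. (e1 x - \<beta> * e2 x)\<^sup>2, \<lambda>x. (e2 x)\<^sup>2, \<lambda>x. ((e1 x - \<beta> * e2 x) * e2 x)\<^sup>2, \<lambda>x. (e2 x) ^ 4}"
  shows "integrable Q h \<and> (\<integral>x. h x \<partial>Q) \<le> 1 + 8 * c + (8 * \<beta> ^ 4 + 1) * c"
proof -
  interpret prob_space Q by fact
  have i: "integrable Q (\<lambda>x. e1 x ^ 4)" "integrable Q (\<lambda>x. e2 x ^ 4)"
  proof -
    show "integrable Q (\<lambda>x. e1 x ^ 4)"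
      by (rule integrableI_nonneg) (use e le_less_trans[OF m(1) ennreal_less_top] in auto)
    show "integrable Q (\<lambda>x. e2 x ^ 4)"
      by (rule integrableI_nonneg) (use e le_less_trans[OF m(2) ennreal_less_top] in auto)
  qed
  have le: "(\<integral>x. e1 x ^ 4 \<partial>Q) \<le> c" "(\<integral>x. e2 x ^ 4 \<partial>Q) \<le> c"
    using m c nn_integral_eq_integral[OF i(1)] nn_integral_eq_integral[OF i(2)] by simp_all
  let ?g = "\<lambda>x. 1 + 8 * e1 x ^ 4 + (8 * \<beta> ^ 4 + 1) * e2 x ^ 4"
  have gi: "integrable Q ?g" using i by simp
  have sq4: "(a - b) ^ 4 \<le> 8 * a ^ 4 + 8 * b ^ 4" for a b :: real
  proof -
    have "(a - b)\<^sup>2 \<le> 2 * (a\<^sup>2 + b\<^sup>2)" using zero_le_power2[of "a + b"] by (simp add: power2_eq_square algebra_simps)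
    then have "((a - b)\<^sup>2)\<^sup>2 \<le> (2 * (a\<^sup>2 + b\<^sup>2))\<^sup>2" by (intro power_mono) auto
    also have "\<dots> \<le> 8 * (a\<^sup>2)\<^sup>2 + 8 * (b\<^sup>2)\<^sup>2"
      using zero_le_power2[of "a\<^sup>2 - b\<^sup>2"] by (simp add: power2_eq_square algebra_simps)
    finally show ?thesis by (simp flip: power_mult)
  qed
  have sq2: "t\<^sup>2 \<le> 1 + t ^ 4" for t :: real
  proof -
    have "0 \<le> (t\<^sup>2 - 1)\<^sup>2" by simp
    then have "2 * t\<^sup>2 \<le> 1 + t ^ 4" by (simp add: power2_diff flip: power_mult)
    then show ?thesis using zero_le_power2[of t] by linarith
  qed
  have prod4: "(p * q)\<^sup>2 \<le> p ^ 4 + q ^ 4" for p q :: real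
  proof -
    have "0 \<le> (p\<^sup>2 - q\<^sup>2)\<^sup>2" by simp
    then have "2 * (p * q)\<^sup>2 \<le> p ^ 4 + q ^ 4"
      by (simp add: power2_diff power_mult_distrib mult.assoc flip: power_mult)
    then show ?thesis using zero_le_power2[of "p * q"] by linarith
  qed
  have bound: "0 \<le> h x \<and> h x \<le> ?g x" for x
  proof -
    let ?\<xi> = "e1 x - \<beta> * e2 x"
    have x4: "?\<xi> ^ 4 \<le> 8 * e1 x ^ 4 + 8 * \<beta> ^ 4 * e2 x ^ 4"
      using sq4[of "e1 x" "\<beta> * e2 x"] by (simp add: power_mult_distrib)
    have p: "0 \<le> ?\<xi> ^ 4" "0 \<le> e2 x ^ 4" "0 \<le> 8 * \<beta> ^ 4 * e2 x ^ 4" "0 \<le> 8 * e1 x ^ 4" by simp_all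
    have prod: "(?\<xi> * e2 x)\<^sup>2 \<le> ?\<xi> ^ 4 + e2 x ^ 4" by (rule prod4)
    have g: "?g x = 1 + 8 * e1 x ^ 4 + 8 * \<beta> ^ 4 * e2 x ^ 4 + e2 x ^ 4" by (simp add: algebra_simps)
    consider "h = (\<lambda>x. (e1 x - \<beta> * e2 x)\<^sup>2)" | "h = (\<lambda>x. (e2 x)\<^sup>2)"
      | "h = (\<lambda>x. ((e1 x - \<beta> * e2 x) * e2 x)\<^sup>2)" | "h = (\<lambda>x. (e2 x) ^ 4)"
      using h by blast
    then show ?thesis
    proof cases
      case 1
      have "h x \<le> ?g x" using sq2[of ?\<xi>] x4 p unfolding g 1 by linarith
      then show ?thesis by (simp add: 1)
    next
      case 2
      have "h x \<le> ?g x" using sq2[of "e2 x"] p unfolding g 2 by linarith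
      then show ?thesis by (simp add: 2)
    next
      case 3
      have "h x \<le> ?g x" using prod x4 p unfolding g 3 by linarith
      then show ?thesis by (simp add: 3)
    next
      case 4
      have "h x \<le> ?g x" using p unfolding g 4 by linarith
      then show ?thesis by (simp add: 4)
    qed
  qed
  have hm: "h \<in> borel_measurable Q" using h e by auto
  have hi: "integrable Q h"
  proof (rule Bochner_Integration.integrable_bound[OF gi hm], rule AE_I2)
    fix x
    show "norm (h x) \<le> norm (?g x)"
      using bound[of x] unfolding real_norm_def by linarith
  qed
  have "(\<integral>x. h x \<partial>Q) \<le> (\<integral>x. ?g x \<partial>Q)" using hi gi bound by (intro integral_mono) auto
  also have "\<dots> = 1 + 8 * (\<integral>x. e1 x ^ 4 \<partial>Q) + (8 * \<beta> ^ 4 + 1) * (\<integral>x. e2 x ^ 4 \<partial>Q)"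
    using i by (simp add: prob_space)
  also have "\<dots> \<le> 1 + 8 * c + (8 * \<beta> ^ 4 + 1) * c"
    using le by (intro add_mono mult_left_mono) auto
  finally show ?thesis using hi by simp
qed

text \<open>Six exceptional events are removed by Markov's inequality: chi-square statistic and
  high-frequency sum for either residual, the score, and the deviation of \<open>dotp n u u\<close>
  from its mean. All but the last have a probability bound that requires large \<open>A\<close>, so
  \<open>A\<close> must tend to infinity. The mean is at least \<open>2 * a * n\<close>, which
  leaves \<open>a * n\<close> after a deviation of \<open>a * n\<close>.\<close>

lemma good_event:
  fixes N :: "nat \<Rightarrow> 'b measure" and \<xi> u :: "nat \<Rightarrow> 'b \<Rightarrow> real"
  assumes N: "\<And>i. prob_space (N i)" and res: "\<And>i. i < n \<Longrightarrow> residual_law s (N i) (\<xi> i) (u i)"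
    and s: "0 < s" and a: "0 < a" and loc: "localized \<psi> C" "0 < C" and \<alpha>: "1/2 < \<alpha>" and n: "0 < n"
    and w: "\<And>i. i < n \<Longrightarrow> w i \<in> {0..1}"
    and bs: "finite bs" "card bs \<le> 2 ^ J" "\<And>b. b \<in> bs \<Longrightarrow> (\<Sum>i<n. (b i)\<^sup>2) = 1"
    and A: "0 < A" and D: "D = 2 ^ J" and c5: "0 \<le> c5"
    and hfb: "sqrt s * C * sqrt (real n) * 2 powr (- (real J * (\<alpha> - 1/2))) / (1 - 2 powr (- (\<alpha> - 1/2))) \<le> c5 * D"
    and var: "2 * a * real n \<le> (\<Sum>i<n. \<integral>x. (u i x)\<^sup>2 \<partial>N i)"
  shows "\<exists>G\<in>sets (PiM {..<n} N). measure (PiM {..<n} N) (space (PiM {..<n} N) - G)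
       \<le> 2 * (s / A) + 2 * (c5 / A) + s / A\<^sup>2 + s / (a\<^sup>2 * real n) \<and>
     (\<forall>z\<in>G. (\<forall>v\<in>{\<lambda>i. \<xi> i (z i), \<lambda>i. u i (z i)}.
          (\<Sum>b\<in>bs. (\<Sum>i<n. v i * b i)\<^sup>2) \<le> A * D \<and> (\<Sum>l. high_freq \<psi> \<alpha> J n w v l) \<le> A * D) \<and>
        \<bar>dotp n (\<lambda>i. \<xi> i (z i)) (\<lambda>i. u i (z i))\<bar> \<le> A * sqrt (real n) \<and>
        a * real n \<le> dotp n (\<lambda>i. u i (z i)) (\<lambda>i. u i (z i)) \<and>
        dotp n (\<lambda>i. u i (z i)) (\<lambda>i. u i (z i)) \<le> (s + a) * real n)"
proof -
  let ?P = "PiM {..<n} N"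
  interpret P: prob_space ?P by (intro prob_space_PiM N)
  have Dp: "0 < D" by (simp add: D)
  define ch where "ch f z = (\<Sum>b\<in>bs. (\<Sum>i<n. f i (z i) * b i)\<^sup>2)" for f :: "nat \<Rightarrow> 'b \<Rightarrow> real" and z
  define hf where "hf f z = (\<Sum>l. high_freq \<psi> \<alpha> J n w (\<lambda>i. f i (z i)) l)" for f :: "nat \<Rightarrow> 'b \<Rightarrow> real" and z
  have comp: "(\<lambda>z. f i (z i)) \<in> borel_measurable ?P" if "f i \<in> borel_measurable (N i)" "i < n" for f :: "nat \<Rightarrow> 'b \<Rightarrow> real" and i
  proof -
    have c: "(\<lambda>z. z i) \<in> measurable ?P (N i)" by (rule measurable_component_singleton) (use that in simp)
    show ?thesis by (rule measurable_compose[OF c that(1)])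
  qed
  have prp: "f i \<in> borel_measurable (N i)" "integrable (N i) (\<lambda>x. (f i x)\<^sup>2)" "(\<integral>x. f i x \<partial>N i) = 0" "(\<integral>x. (f i x)\<^sup>2 \<partial>N i) \<le> s"
    if "f \<in> {\<xi>, u}" "i < n" for f i
    using that res[OF that(2)] unfolding residual_law_def by auto
  have ch_m: "ch f \<in> borel_measurable ?P" if "f \<in> {\<xi>, u}" for f
    unfolding ch_def by (intro borel_measurable_sum borel_measurable_power borel_measurable_times borel_measurable_const comp prp that) auto
  have hf_m: "hf f \<in> borel_measurable ?P" if "f \<in> {\<xi>, u}" for f
    unfolding hf_def high_freq_def
    by (intro borel_measurable_suminf borel_measurable_sum borel_measurable_abs borel_measurable_times borel_measurable_const comp prp that) auto
  have ch_p: "P.prob {z\<in>space ?P. A * D < ch f z} \<le> s / A" if f: "f \<in> {\<xi>, u}" for f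
  proof -
    have m: "(\<lambda>z. ennreal ((\<Sum>i<n. f i (z i) * b i)\<^sup>2)) \<in> borel_measurable ?P" for b
      by (intro measurable_compose[OF _ measurable_ennreal] borel_measurable_sum borel_measurable_power borel_measurable_times borel_measurable_const comp prp f) auto
    have "(\<integral>\<^sup>+ z. ennreal (ch f z) \<partial>?P) = (\<integral>\<^sup>+ z. (\<Sum>b\<in>bs. ennreal ((\<Sum>i<n. f i (z i) * b i)\<^sup>2)) \<partial>?P)"
      unfolding ch_def by (intro nn_integral_cong sum_ennreal[symmetric]) simp
    also have "\<dots> = (\<Sum>b\<in>bs. \<integral>\<^sup>+ z. ennreal ((\<Sum>i<n. f i (z i) * b i)\<^sup>2) \<partial>?P)"
      using m by (intro nn_integral_sum) auto
    also have "\<dots> \<le> (\<Sum>b\<in>bs. ennreal s)"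
    proof (rule sum_mono)
      fix b assume b: "b \<in> bs"
      have "(\<integral>\<^sup>+ z. ennreal ((\<Sum>i<n. b i * f i (z i))\<^sup>2) \<partial>?P) \<le> ennreal (s * (\<Sum>i<n. (b i)\<^sup>2))"
        by (rule product_second_moment[OF N]) (use prp[OF f] in auto)
      then show "(\<integral>\<^sup>+ z. ennreal ((\<Sum>i<n. f i (z i) * b i)\<^sup>2) \<partial>?P) \<le> ennreal s"
        using bs(3)[OF b] by (simp add: mult.commute)
    qed
    also have "\<dots> = ennreal (real (card bs) * s)"
      using s by (simp add: ennreal_mult ennreal_of_nat_eq_real_of_nat)
    also have "\<dots> \<le> ennreal (D * s)"
    proof (intro ennreal_leI mult_right_mono)
      have "real (card bs) \<le> real (2 ^ J)" using bs(2) by (simp only: of_nat_le_iff)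
      then show "real (card bs) \<le> D" by (simp add: D)
    qed (use s in simp)
    finally have "(\<integral>\<^sup>+ z. ennreal (ch f z) \<partial>?P) \<le> ennreal (D * s)" .
    then have "P.prob {z\<in>space ?P. A * D < ch f z} \<le> D * s / (A * D)"
      using A Dp s by (intro markov_prob ch_m f P.prob_space_axioms) auto
    then show ?thesis using Dp by simp
  qed
  have hf_p: "P.prob {z\<in>space ?P. A * D < hf f z} \<le> c5 / A" if f: "f \<in> {\<xi>, u}" for f
  proof -
    have "(\<integral>\<^sup>+ z. ennreal (hf f z) \<partial>?P)
        \<le> ennreal (sqrt s * C * sqrt (real n) * 2 powr (- (real J * (\<alpha> - 1/2))) / (1 - 2 powr (- (\<alpha> - 1/2))))"
      unfolding hf_def by (rule high_freq_expectation[OF N _ _ _ _ s loc \<alpha> n w]) (use prp[OF f] in auto)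
    also have "\<dots> \<le> ennreal (c5 * D)" by (rule ennreal_leI[OF hfb])
    finally have "(\<integral>\<^sup>+ z. ennreal (hf f z) \<partial>?P) \<le> ennreal (c5 * D)" .
    then have "P.prob {z\<in>space ?P. A * D < hf f z} \<le> c5 * D / (A * D)"
      using A Dp c5 by (intro markov_prob hf_m f P.prob_space_axioms) auto
    then show ?thesis using Dp by simp
  qed
  define S where "S z = (\<Sum>i<n. \<xi> i (z i) * u i (z i))" for z
  \<comment> \<open>Centred squares; their second moments are at most the fourth moments of
    \<open>u\<close>.\<close>
  define g where "g i x = (u i x)\<^sup>2 - (\<integral>x. (u i x)\<^sup>2 \<partial>N i)" for i x
  define T where "T z = (\<Sum>i<n. g i (z i))" for z
  have um: "u i \<in> borel_measurable (N i)" "\<xi> i \<in> borel_measurable (N i)" if "i < n" for i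
    using prp that by auto
  have S_m: "S \<in> borel_measurable ?P"
    unfolding S_def by (intro borel_measurable_sum borel_measurable_times comp um) auto
  have gm: "g i \<in> borel_measurable (N i)" if "i < n" for i
    unfolding g_def by (intro borel_measurable_diff borel_measurable_power borel_measurable_const um that)
  have T_m: "T \<in> borel_measurable ?P"
    unfolding T_def by (intro borel_measurable_sum comp gm) auto
  have S_p: "P.prob {z\<in>space ?P. A\<^sup>2 * n < (S z)\<^sup>2} \<le> s / A\<^sup>2"
  proof -
    have "(\<integral>\<^sup>+ z. ennreal ((\<Sum>i<n. 1 * (\<lambda>i x. \<xi> i x * u i x) i (z i))\<^sup>2) \<partial>?P) \<le> ennreal (s * (\<Sum>i<n. 1\<^sup>2))"
      by (rule product_second_moment[OF N]) (use res um in \<open>auto simp: residual_law_def\<close>)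
    then have "(\<integral>\<^sup>+ z. ennreal ((S z)\<^sup>2) \<partial>?P) \<le> ennreal (s * n)" by (simp add: S_def)
    then have "P.prob {z\<in>space ?P. A\<^sup>2 * n < (S z)\<^sup>2} \<le> s * n / (A\<^sup>2 * n)"
      using A n s S_m by (intro markov_prob P.prob_space_axioms) auto
    then show ?thesis using n by simp
  qed
  have g2: "integrable (N i) (\<lambda>x. (g i x)\<^sup>2) \<and> (\<integral>x. g i x \<partial>N i) = 0 \<and> (\<integral>x. (g i x)\<^sup>2 \<partial>N i) \<le> s" if i: "i < n" for i
  proof -
    interpret Ni: prob_space "N i" by (rule N)
    let ?m = "\<integral>x. (u i x)\<^sup>2 \<partial>N i"
    have iu: "integrable (N i) (\<lambda>x. (u i x)\<^sup>2)" "integrable (N i) (\<lambda>x. (u i x) ^ 4)" "(\<integral>x. (u i x) ^ 4 \<partial>N i) \<le> s"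
      using res[OF i] by (auto simp: residual_law_def)
    have eq: "(g i x)\<^sup>2 = (u i x) ^ 4 - 2 * ?m * (u i x)\<^sup>2 + ?m\<^sup>2" for x
      unfolding g_def by (simp add: power2_diff flip: power_mult)
    have "(\<integral>x. (g i x)\<^sup>2 \<partial>N i) = (\<integral>x. (u i x) ^ 4 \<partial>N i) - 2 * ?m * ?m + ?m\<^sup>2"
      unfolding eq using iu by (simp add: Ni.prob_space)
    also have "2 * ?m * ?m = 2 * ?m\<^sup>2" by (simp add: power2_eq_square)
    also have "(\<integral>x. (u i x) ^ 4 \<partial>N i) - 2 * ?m\<^sup>2 + ?m\<^sup>2 \<le> s"
      using iu(3) zero_le_power2[of ?m] by linarith
    finally have 1: "(\<integral>x. (g i x)\<^sup>2 \<partial>N i) \<le> s" .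
    have 2: "integrable (N i) (\<lambda>x. (g i x)\<^sup>2)" unfolding eq using iu by simp
    have 3: "(\<integral>x. g i x \<partial>N i) = 0" unfolding g_def using iu by (simp add: Ni.prob_space)
    show ?thesis using 1 2 3 by blast
  qed
  have T_p: "P.prob {z\<in>space ?P. (a * n)\<^sup>2 < (T z)\<^sup>2} \<le> s / (a\<^sup>2 * n)"
  proof -
    have "(\<integral>\<^sup>+ z. ennreal ((\<Sum>i<n. 1 * g i (z i))\<^sup>2) \<partial>?P) \<le> ennreal (s * (\<Sum>i<n. 1\<^sup>2))"
      by (rule product_second_moment[OF N]) (use g2 gm in auto)
    then have "(\<integral>\<^sup>+ z. ennreal ((T z)\<^sup>2) \<partial>?P) \<le> ennreal (s * n)" by (simp add: T_def)
    then have "P.prob {z\<in>space ?P. (a * n)\<^sup>2 < (T z)\<^sup>2} \<le> s * n / (a * n)\<^sup>2"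
      using a n s T_m by (intro markov_prob P.prob_space_axioms) auto
    then show ?thesis using n by (simp add: power2_eq_square)
  qed
  define B1 where "B1 = {z\<in>space ?P. A * D < ch \<xi> z}"
  define B2 where "B2 = {z\<in>space ?P. A * D < ch u z}"
  define B3 where "B3 = {z\<in>space ?P. A * D < hf \<xi> z}"
  define B4 where "B4 = {z\<in>space ?P. A * D < hf u z}"
  define B5 where "B5 = {z\<in>space ?P. A\<^sup>2 * n < (S z)\<^sup>2}"
  define B6 where "B6 = {z\<in>space ?P. (a * n)\<^sup>2 < (T z)\<^sup>2}"
  have Bm: "B1 \<in> sets ?P" "B2 \<in> sets ?P" "B3 \<in> sets ?P" "B4 \<in> sets ?P" "B5 \<in> sets ?P" "B6 \<in> sets ?P"
    unfolding B1_def B2_def B3_def B4_def B5_def B6_def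
    using ch_m hf_m S_m T_m by (auto intro!: borel_measurable_less borel_measurable_power)
  let ?bad = "B1 \<union> B2 \<union> B3 \<union> B4 \<union> B5 \<union> B6"
  have "P.prob ?bad \<le> P.prob B1 + P.prob B2 + P.prob B3 + P.prob B4 + P.prob B5 + P.prob B6"
    using Bm by (intro order_trans[OF measure_Un_le] add_right_mono order_refl sets.Un)
  also have "\<dots> \<le> s / A + s / A + c5 / A + c5 / A + s / A\<^sup>2 + s / (a\<^sup>2 * n)"
    unfolding B1_def B2_def B3_def B4_def B5_def B6_def
    by (intro add_mono ch_p hf_p S_p T_p) auto
  finally have bad: "P.prob ?bad \<le> 2 * (s / A) + 2 * (c5 / A) + s / A\<^sup>2 + s / (a\<^sup>2 * n)" by simp
  show ?thesis
  proof (intro bexI[of _ "space ?P - ?bad"] conjI ballI)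
    show "space ?P - ?bad \<in> sets ?P" using Bm by auto
    have "space ?P - (space ?P - ?bad) = ?bad" using Bm by (auto dest: sets.sets_into_space)
    then show "P.prob (space ?P - (space ?P - ?bad)) \<le> 2 * (s / A) + 2 * (c5 / A) + s / A\<^sup>2 + s / (a\<^sup>2 * n)"
      using bad by simp
    fix z assume z: "z \<in> space ?P - ?bad"
    have nb: "ch \<xi> z \<le> A * D" "ch u z \<le> A * D" "hf \<xi> z \<le> A * D" "hf u z \<le> A * D"
      "(S z)\<^sup>2 \<le> A\<^sup>2 * n" "(T z)\<^sup>2 \<le> (a * n)\<^sup>2"
      using z unfolding B1_def B2_def B3_def B4_def B5_def B6_def by (auto simp: not_less)
    fix v assume "v \<in> {\<lambda>i. \<xi> i (z i), \<lambda>i. u i (z i)}"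
    then show "(\<Sum>b\<in>bs. (\<Sum>i<n. v i * b i)\<^sup>2) \<le> A * D" "(\<Sum>l. high_freq \<psi> \<alpha> J n w v l) \<le> A * D"
      using nb by (auto simp: ch_def hf_def)
  next
    fix z assume z: "z \<in> space ?P - ?bad"
    have nb: "(S z)\<^sup>2 \<le> A\<^sup>2 * n" "(T z)\<^sup>2 \<le> (a * n)\<^sup>2"
      using z unfolding B5_def B6_def by (auto simp: not_less)
    have "(S z)\<^sup>2 \<le> (A * sqrt n)\<^sup>2" using nb(1) by (simp add: power_mult_distrib)
    then have "\<bar>S z\<bar> \<le> \<bar>A * sqrt n\<bar>" by (simp only: abs_le_square_iff)
    then show "\<bar>dotp n (\<lambda>i. \<xi> i (z i)) (\<lambda>i. u i (z i))\<bar> \<le> A * sqrt n"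
      using A by (simp add: S_def dotp_def)
    have "\<bar>T z\<bar> \<le> \<bar>a * n\<bar>" using nb(2) by (simp only: abs_le_square_iff)
    then have Tz: "\<bar>T z\<bar> \<le> a * n" using a by simp
    have eq: "dotp n (\<lambda>i. u i (z i)) (\<lambda>i. u i (z i)) = T z + (\<Sum>i<n. \<integral>x. (u i x)\<^sup>2 \<partial>N i)"
      by (simp add: dotp_self T_def g_def sum_subtractf)
    show "a * n \<le> dotp n (\<lambda>i. u i (z i)) (\<lambda>i. u i (z i))"
      unfolding eq using Tz var by (simp add: abs_le_iff)
    have "(\<Sum>i<n. \<integral>x. (u i x)\<^sup>2 \<partial>N i) \<le> (\<Sum>i<n. s)"
      using prp(4)[of u] by (intro sum_mono) auto
    then show "dotp n (\<lambda>i. u i (z i)) (\<lambda>i. u i (z i)) \<le> (s + a) * n"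
      unfolding eq using Tz by (simp add: algebra_simps abs_le_iff)
  qed
qed

section \<open>Moment conditions of the model given W\<close>

lemma cond_exp_given_integral:
  fixes V :: "'a \<Rightarrow> 'v::topological_space" and U :: "'a \<Rightarrow> real" and g :: "'v \<Rightarrow> real"
  assumes P: "prob_space P" and V: "V \<in> measurable P borel" and U: "U \<in> borel_measurable P"
    and g: "g \<in> borel_measurable borel" and int: "integrable P (\<lambda>\<omega>. g (V \<omega>) * U \<omega>)"
    and m: "AE \<omega> in P. cond_exp_given P U V \<omega> = m \<omega>" and mm: "m \<in> borel_measurable P"
  shows "integrable P (\<lambda>\<omega>. g (V \<omega>) * m \<omega>)" "(\<integral>\<omega>. g (V \<omega>) * (U \<omega> - m \<omega>) \<partial>P) = 0"
proof -
  interpret prob_space P by fact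
  let ?F = "vimage_algebra (space P) V borel"
  have sub: "subalgebra P ?F"
    using measurable_sets[OF V] by (auto simp: subalgebra_def sets_vimage_algebra2 space_vimage_algebra)
  interpret F: finite_measure_subalgebra P ?F
    by unfold_locales (rule sub)
  \<comment> \<open>\<open>g (V \<omega>)\<close> is measurable for the algebra generated by
    \<open>V\<close>, hence an admissible test function for the conditional expectation.\<close>
  have gV: "(\<lambda>\<omega>. g (V \<omega>)) \<in> borel_measurable ?F"
    by (rule measurable_compose[OF measurable_vimage_algebra1 g]) auto
  have gP: "(\<lambda>\<omega>. g (V \<omega>)) \<in> borel_measurable P" by (rule measurable_compose[OF V g])
  note c = F.real_cond_exp_intg[OF int gV U, folded cond_exp_given_def]
  have ae: "AE \<omega> in P. g (V \<omega>) * cond_exp_given P U V \<omega> = g (V \<omega>) * m \<omega>"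
    using m by eventually_elim simp
  have meas: "(\<lambda>\<omega>. g (V \<omega>) * cond_exp_given P U V \<omega>) \<in> borel_measurable P" using c(1) by simp
  show i: "integrable P (\<lambda>\<omega>. g (V \<omega>) * m \<omega>)"
    using c(1) integrable_cong_AE[OF meas _ ae] gP mm by auto
  have "(\<integral>\<omega>. g (V \<omega>) * m \<omega> \<partial>P) = (\<integral>\<omega>. g (V \<omega>) * U \<omega> \<partial>P)"
    using c(2) integral_cong_AE[OF meas _ ae] gP mm by auto
  then show "(\<integral>\<omega>. g (V \<omega>) * (U \<omega> - m \<omega>) \<partial>P) = 0"
    using int i by (simp add: right_diff_distrib)
qed

lemma integrable_mult_L2:
  fixes f g :: "'a \<Rightarrow> real"
  assumes "f \<in> borel_measurable M" "g \<in> borel_measurable M"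
    "integrable M (\<lambda>x. (f x)\<^sup>2)" "integrable M (\<lambda>x. (g x)\<^sup>2)"
  shows "integrable M (\<lambda>x. f x * g x)"
proof (rule Bochner_Integration.integrable_bound)
  show "integrable M (\<lambda>x. (f x)\<^sup>2 + (g x)\<^sup>2)" using assms by simp
  show "(\<lambda>x. f x * g x) \<in> borel_measurable M" using assms by measurable
  show "AE x in M. norm (f x * g x) \<le> norm ((f x)\<^sup>2 + (g x)\<^sup>2)"
  proof (rule AE_I2)
    fix x
    have "0 \<le> (\<bar>f x\<bar> - \<bar>g x\<bar>)\<^sup>2" by simp
    then have "2 * (\<bar>f x\<bar> * \<bar>g x\<bar>) \<le> (f x)\<^sup>2 + (g x)\<^sup>2" by (simp add: power2_diff)
    moreover have "0 \<le> \<bar>f x\<bar> * \<bar>g x\<bar>" by simp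
    ultimately have "\<bar>f x\<bar> * \<bar>g x\<bar> \<le> (f x)\<^sup>2 + (g x)\<^sup>2" by linarith
    then show "norm (f x * g x) \<le> norm ((f x)\<^sup>2 + (g x)\<^sup>2)" by (simp add: abs_mult)
  qed
qed

lemma integrable_mult_bounded:
  fixes f g :: "'a \<Rightarrow> real"
  assumes "integrable M f" "g \<in> borel_measurable M" "AE x in M. \<bar>g x\<bar> \<le> k"
  shows "integrable M (\<lambda>x. f x * g x)"
proof (rule Bochner_Integration.integrable_bound)
  show "integrable M (\<lambda>x. k * f x)" using assms by simp
  show "(\<lambda>x. f x * g x) \<in> borel_measurable M" using assms by measurable
  show "AE x in M. norm (f x * g x) \<le> norm (k * f x)"
    using assms(3)
  proof eventually_elim
    case (elim x)
    then have "\<bar>f x\<bar> * \<bar>g x\<bar> \<le> \<bar>f x\<bar> * \<bar>k\<bar>" by (intro mult_left_mono) auto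
    then show ?case by (simp add: abs_mult mult.commute)
  qed
qed

text \<open>Conditional expectations are first used as integrals over events
  \<open>W \<in> C\<close> and then transferred to the kernel \<open>K\<close> at almost every
  \<open>w\<close>. The regression condition is given on \<open>(X, W)\<close>; testing it with the
  residual of \<open>X\<close> times an indicator of \<open>W\<close> gives orthogonality given
  \<open>W\<close>. Fourth moments come from the kernel \<open>\<kappa>\<close> of the centred
  variables. Boundedness of \<open>m01\<close> and \<open>m02\<close> makes the products
  integrable.\<close>

lemma AE_residual_law:
  fixes P0 :: "(real \<times> real \<times> real) measure" and K \<kappa> :: "real \<Rightarrow> (real \<times> real) measure"
    and m01 m02 \<eta>0 :: "real \<Rightarrow> real" and \<beta>0 c_lo k :: real
  defines "PW \<equiv> distr P0 borel W_of"
  assumes P0: "prob_space P0" "sets P0 = sets borel"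
    and K: "is_cond_law P0 (\<lambda>z. (Y_of z, X_of z)) W_of K"
    and m01: "m01 \<in> borel_measurable borel" "AE z in P0. cond_exp_given P0 Y_of W_of z = m01 (W_of z)"
    and m02: "m02 \<in> borel_measurable borel" "AE z in P0. cond_exp_given P0 X_of W_of z = m02 (W_of z)"
    and reg: "AE z in P0. cond_exp_given P0 Y_of (\<lambda>z. (X_of z, W_of z)) z = X_of z * \<beta>0 + \<eta>0 (W_of z)"
    and \<eta>0: "\<eta>0 \<in> L2_W P0"
    and c_lo: "c_lo \<le> (\<integral>z. (X_of z - m02 (W_of z))\<^sup>2 \<partial>P0)"
    and int: "integrable P0 (\<lambda>z. (Y_of z - m01 (W_of z))\<^sup>2)" "integrable P0 (\<lambda>z. (X_of z - m02 (W_of z)) ^ 4)"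
    and \<kappa>: "is_cond_law P0 (\<lambda>z. (Y_of z - m01 (W_of z), X_of z - m02 (W_of z))) W_of \<kappa>"
      "subgaussian_on {0..1} \<kappa>"
    and W01: "AE w in PW. w \<in> {0..1}" and bd: "AE w in PW. \<bar>m01 w\<bar> \<le> k \<and> \<bar>m02 w\<bar> \<le> k"
  obtains s where "0 < s"
    "AE w in PW. residual_law s (K w) (\<lambda>z. fst z - m01 w - \<beta>0 * (snd z - m02 w)) (\<lambda>z. snd z - m02 w)"
    "(\<lambda>w. \<integral>z. (snd z - m02 w)\<^sup>2 \<partial>K w) \<in> borel_measurable borel"
    "c_lo \<le> (\<integral>w. (\<integral>z. (snd z - m02 w)\<^sup>2 \<partial>K w) \<partial>PW)"
proof -
  interpret P0: prob_space P0 by fact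
  have bm: "f \<in> borel_measurable P0" if "f \<in> borel_measurable borel" for f :: "real \<times> real \<times> real \<Rightarrow> real"
    using that P0(2) by (simp cong: measurable_cong_sets)
  have Y: "fst \<in> borel_measurable P0" and X: "(\<lambda>z. fst (snd z)) \<in> borel_measurable P0"
    and W: "(\<lambda>z. snd (snd z)) \<in> borel_measurable P0"
    by (intro bm; simp add: borel_prod[symmetric])+
  have U: "(\<lambda>z. (fst z, fst (snd z))) \<in> measurable P0 borel"
    unfolding borel_prod[symmetric] using Y X by measurable
  have XW: "(\<lambda>z. (fst (snd z), snd (snd z))) \<in> measurable P0 borel"
    unfolding borel_prod[symmetric] using X W by measurable
  have mW: "(\<lambda>z. h (snd (snd z))) \<in> borel_measurable P0" if "h \<in> borel_measurable borel" for h :: "real \<Rightarrow> real"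
    by (rule measurable_compose[OF W that])
  have U': "(\<lambda>z. (fst z - m01 (snd (snd z)), fst (snd z) - m02 (snd (snd z)))) \<in> measurable P0 borel"
    unfolding borel_prod[symmetric] using Y X mW[OF m01(1)] mW[OF m02(1)] by measurable
  define e1 where "e1 z = fst z - m01 (snd (snd z))" for z :: "real \<times> real \<times> real"
  define e2 where "e2 z = fst (snd z) - m02 (snd (snd z))" for z :: "real \<times> real \<times> real"
  have em: "e1 \<in> borel_measurable P0" "e2 \<in> borel_measurable P0"
    unfolding e1_def e2_def using Y X mW[OF m01(1)] mW[OF m02(1)] by measurable
  have \<eta>0m: "\<eta>0 \<in> borel_measurable borel" "integrable P0 (\<lambda>z. (\<eta>0 (snd (snd z)))\<^sup>2)"
    using \<eta>0 by (auto simp: L2_W_def)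
  have AEW: "AE z in P0. Q (snd (snd z))" if "AE w in PW. Q w" for Q
    using that unfolding PW_def by (rule AE_distrD[OF W])
  have bdP: "AE z in P0. \<bar>m01 (snd (snd z))\<bar> \<le> k" "AE z in P0. \<bar>m02 (snd (snd z))\<bar> \<le> k"
    using AEW[OF bd] by auto
  have e1sq: "integrable P0 (\<lambda>z. (e1 z)\<^sup>2)" using int(1) by (simp add: e1_def)
  have e2sq: "integrable P0 (\<lambda>z. (e2 z)\<^sup>2)"
  proof (rule P0.square_integrable_imp_integrable)
    show "integrable P0 (\<lambda>z. ((e2 z)\<^sup>2)\<^sup>2)" using int(2) by (simp add: e2_def flip: power_mult)
  qed (use em in measurable)
  have e1i: "integrable P0 e1" and e2i: "integrable P0 e2"
    using em e1sq e2sq by (auto intro: P0.square_integrable_imp_integrable)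
  have bi: "integrable P0 (\<lambda>z. m01 (snd (snd z)))" "integrable P0 (\<lambda>z. m02 (snd (snd z)))"
    using bdP mW m01(1) m02(1) by (auto intro!: P0.integrable_const_bound[of _ k])
  have ind: "(\<lambda>z. indicator C (snd (snd z)) :: real) \<in> borel_measurable P0" if "C \<in> sets borel" for C :: "real set"
    by (rule mW) (use that in simp)
  have bind: "AE z in P0. \<bar>indicator C (snd (snd z)) :: real\<bar> \<le> 1" for C :: "real set"
    by (rule AE_I2) (simp add: indicator_def)
  have z1: "(\<integral>z. e1 z * indicator C (snd (snd z)) \<partial>P0) = 0" if C: "C \<in> sets borel" for C
  proof -
    have "integrable P0 (\<lambda>z. (e1 z + m01 (snd (snd z))) * indicator C (snd (snd z)))"
      using e1i bi by (intro integrable_mult_bounded[OF _ ind[OF C] bind]) simp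
    then have "integrable P0 (\<lambda>z. indicator C (snd (snd z)) * fst z)" by (simp add: e1_def mult.commute)
    from cond_exp_given_integral(2)[OF P0(1) W Y _ this m01(2) mW[OF m01(1)]] C
    show ?thesis by (simp add: e1_def mult.commute)
  qed
  have z2: "(\<integral>z. h (snd (snd z)) * e2 z \<partial>P0) = 0"
    if h: "h \<in> borel_measurable borel" "integrable P0 (\<lambda>z. h (snd (snd z)) * e2 z)" "integrable P0 (\<lambda>z. h (snd (snd z)))" for h
  proof -
    have "integrable P0 (\<lambda>z. h (snd (snd z)) * e2 z + h (snd (snd z)) * m02 (snd (snd z)))"
      using h(2) integrable_mult_bounded[OF h(3) mW[OF m02(1)] bdP(2)] by simp
    then have "integrable P0 (\<lambda>z. h (snd (snd z)) * fst (snd z))" by (simp add: e2_def algebra_simps)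
    from cond_exp_given_integral(2)[OF P0(1) W X h(1) this m02(2) mW[OF m02(1)]]
    show ?thesis by (simp add: e2_def)
  qed
  have z2C: "(\<integral>z. e2 z * indicator C (snd (snd z)) \<partial>P0) = 0" if C: "C \<in> sets borel" for C
  proof -
    have "integrable P0 (\<lambda>z. indicator C (snd (snd z)) * e2 z)"
      using integrable_mult_bounded[OF e2i ind[OF C] bind] by (simp add: mult.commute)
    moreover have "integrable P0 (\<lambda>z. indicator C (snd (snd z)) :: real)"
      using ind[OF C] bind by (intro P0.integrable_const_bound[of _ 1]) auto
    ultimately show ?thesis using z2[of "indicator C"] C by (simp add: mult.commute)
  qed
  \<comment> \<open>The residual \<open>\<xi>\<close> is the regression error plus
    \<open>\<delta>\<close> at \<open>W\<close>. Instead of showing that \<open>\<delta>\<close>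
    vanishes, it is enough that its product with \<open>e2\<close> integrates to zero over events of
    \<open>W\<close>.\<close>
  define \<delta> where "\<delta> w = \<eta>0 w - m01 w + \<beta>0 * m02 w" for w
  have \<delta>m: "\<delta> \<in> borel_measurable borel" unfolding \<delta>_def using \<eta>0m m01 m02 by measurable
  have \<delta>e2: "integrable P0 (\<lambda>z. \<delta> (snd (snd z)) * e2 z)" and \<delta>i: "integrable P0 (\<lambda>z. \<delta> (snd (snd z)))"
  proof -
    have 1: "integrable P0 (\<lambda>z. \<eta>0 (snd (snd z)) * e2 z)"
      by (intro integrable_mult_L2 mW em \<eta>0m e2sq)
    have 2: "integrable P0 (\<lambda>z. e2 z * m01 (snd (snd z)))" "integrable P0 (\<lambda>z. e2 z * m02 (snd (snd z)))"
      by (rule integrable_mult_bounded[OF e2i mW[OF m01(1)] bdP(1)])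
        (rule integrable_mult_bounded[OF e2i mW[OF m02(1)] bdP(2)])
    have "(\<lambda>z. \<delta> (snd (snd z)) * e2 z)
        = (\<lambda>z. \<eta>0 (snd (snd z)) * e2 z - e2 z * m01 (snd (snd z)) + \<beta>0 * (e2 z * m02 (snd (snd z))))"
      by (auto simp: \<delta>_def algebra_simps)
    then show "integrable P0 (\<lambda>z. \<delta> (snd (snd z)) * e2 z)" using 1 2 by simp
    have "integrable P0 (\<lambda>z. \<eta>0 (snd (snd z)))"
      by (rule P0.square_integrable_imp_integrable[OF mW[OF \<eta>0m(1)] \<eta>0m(2)])
    then show "integrable P0 (\<lambda>z. \<delta> (snd (snd z)))" unfolding \<delta>_def using bi by simp
  qed
  define \<xi> where "\<xi> z = e1 z - \<beta>0 * e2 z" for z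
  have \<xi>i: "integrable P0 \<xi>" unfolding \<xi>_def using e1i e2i by simp
  have \<xi>e2i: "integrable P0 (\<lambda>z. \<xi> z * e2 z)"
  proof -
    have "integrable P0 (\<lambda>z. e1 z * e2 z)" by (intro integrable_mult_L2 em e1sq e2sq)
    moreover have "integrable P0 (\<lambda>z. e2 z * e2 z)" by (intro integrable_mult_L2 em e2sq)
    moreover have "(\<lambda>z. \<xi> z * e2 z) = (\<lambda>z. e1 z * e2 z - \<beta>0 * (e2 z * e2 z))" by (auto simp: \<xi>_def algebra_simps)
    ultimately show ?thesis by simp
  qed
  have z\<xi>: "(\<integral>z. \<xi> z * indicator C (snd (snd z)) \<partial>P0) = 0" if C: "C \<in> sets borel" for C
  proof -
    have i: "integrable P0 (\<lambda>z. e1 z * indicator C (snd (snd z)))" "integrable P0 (\<lambda>z. e2 z * indicator C (snd (snd z)))"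
      by (intro integrable_mult_bounded[OF _ ind[OF C] bind] e1i e2i)+
    have "(\<lambda>z. \<xi> z * indicator C (snd (snd z)))
        = (\<lambda>z. e1 z * indicator C (snd (snd z)) - \<beta>0 * (e2 z * indicator C (snd (snd z))))"
      by (auto simp: \<xi>_def algebra_simps)
    then show ?thesis using i z1[OF C] z2C[OF C] by simp
  qed
  have z\<xi>e2: "(\<integral>z. \<xi> z * e2 z * indicator C (snd (snd z)) \<partial>P0) = 0" if C: "C \<in> sets borel" for C
  proof -
    define g where "g p = (fst p - m02 (snd p)) * indicator C (snd p)" for p :: "real \<times> real"
    define m where "m z = fst (snd z) * \<beta>0 + \<eta>0 (snd (snd z))" for z :: "real \<times> real \<times> real"
    have gm: "g \<in> borel_measurable borel"
      unfolding g_def borel_prod[symmetric] using m02(1) C by measurable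
    have mm: "m \<in> borel_measurable P0" unfolding m_def using X mW[OF \<eta>0m(1)] by measurable
    have gXW: "g (fst (snd z), snd (snd z)) = e2 z * indicator C (snd (snd z))" for z :: "real \<times> real \<times> real"
      by (simp add: g_def e2_def)
    have "integrable P0 (\<lambda>z. (\<xi> z * e2 z + \<beta>0 * (e2 z * e2 z) + e2 z * m01 (snd (snd z))) * indicator C (snd (snd z)))"
    proof (rule integrable_mult_bounded[OF _ ind[OF C] bind])
      have "integrable P0 (\<lambda>z. e2 z * e2 z)" by (intro integrable_mult_L2 em e2sq)
      then show "integrable P0 (\<lambda>z. \<xi> z * e2 z + \<beta>0 * (e2 z * e2 z) + e2 z * m01 (snd (snd z)))"
        using \<xi>e2i integrable_mult_bounded[OF e2i mW[OF m01(1)] bdP(1)] by simp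
    qed
    also have "(\<lambda>z. (\<xi> z * e2 z + \<beta>0 * (e2 z * e2 z) + e2 z * m01 (snd (snd z))) * indicator C (snd (snd z)))
        = (\<lambda>z. g (fst (snd z), snd (snd z)) * fst z)"
      unfolding gXW by (auto simp: \<xi>_def e1_def algebra_simps)
    finally have gi: "integrable P0 (\<lambda>z. g (fst (snd z), snd (snd z)) * fst z)" .
    have reg': "AE z in P0. cond_exp_given P0 Y_of (\<lambda>z. (X_of z, W_of z)) z = m z" using reg by (simp add: m_def)
    note r = cond_exp_given_integral[OF P0(1) XW Y gm gi reg' mm]
    have 1: "(\<integral>z. g (fst (snd z), snd (snd z)) * (fst z - m z) \<partial>P0) = 0" by (rule r(2))
    define h where "h w = \<delta> w * indicator C w" for w
    have hi: "integrable P0 (\<lambda>z. h (snd (snd z)) * e2 z)" "integrable P0 (\<lambda>z. h (snd (snd z)))"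
      using integrable_mult_bounded[OF \<delta>e2 ind[OF C] bind] integrable_mult_bounded[OF \<delta>i ind[OF C] bind]
      by (simp_all add: h_def mult_ac)
    have hm: "h \<in> borel_measurable borel" unfolding h_def using \<delta>m C by measurable
    have 2: "(\<integral>z. h (snd (snd z)) * e2 z \<partial>P0) = 0" by (rule z2[OF hm hi])
    have i1: "integrable P0 (\<lambda>z. g (fst (snd z), snd (snd z)) * (fst z - m z))"
      using gi r(1) by (simp add: right_diff_distrib)
    have eq: "(\<lambda>z. \<xi> z * e2 z * indicator C (snd (snd z)))
        = (\<lambda>z. g (fst (snd z), snd (snd z)) * (fst z - m z) + h (snd (snd z)) * e2 z)"
      unfolding gXW by (auto simp: \<xi>_def e1_def e2_def m_def h_def \<delta>_def indicator_def algebra_simps)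
    show ?thesis unfolding eq using i1 hi(1) 1 2 by simp
  qed

  have pm: "f \<in> borel_measurable (borel \<Otimes>\<^sub>M borel)"
    if "f \<in> borel_measurable (borel \<Otimes>\<^sub>M (borel \<Otimes>\<^sub>M borel))" for f :: "real \<times> real \<times> real \<Rightarrow> real"
    using that unfolding borel_prod .
  have fm': "(\<lambda>p :: real \<times> real \<times> real. fst (snd p) - m01 (fst p)) \<in> borel_measurable (borel \<Otimes>\<^sub>M borel)"
    by (rule pm) (use m01(1) in measurable)
  have fm'': "(\<lambda>p :: real \<times> real \<times> real. snd (snd p) - m02 (fst p)) \<in> borel_measurable (borel \<Otimes>\<^sub>M borel)"
    by (rule pm) (use m02(1) in measurable)
  note fm' = fm' fm''
  have e2': "e2 = (\<lambda>z. fst (snd z) - m02 (snd (snd z)))"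
    and \<xi>': "\<xi> = (\<lambda>z. fst z - m01 (snd (snd z)) - \<beta>0 * (fst (snd z) - m02 (snd (snd z))))"
    by (auto simp: e1_def e2_def \<xi>_def)
  note zero = cond_law_integral_zero[OF P0(1) U W K, folded PW_def]
  have Z2: "AE w in PW. (\<integral>q. snd q - m02 w \<partial>K w) = 0"
  proof (rule zero)
    show "(\<lambda>(w, q :: real \<times> real). snd q - m02 w) \<in> borel_measurable (borel \<Otimes>\<^sub>M borel)"
      unfolding case_prod_beta' by (rule fm'(2))
  qed (use e2i z2C in \<open>simp_all add: e2'\<close>)
  have Z1: "AE w in PW. (\<integral>q. fst q - m01 w - \<beta>0 * (snd q - m02 w) \<partial>K w) = 0"
  proof (rule zero)
    show "(\<lambda>(w, q). fst q - m01 w - \<beta>0 * (snd q - m02 w)) \<in> borel_measurable (borel \<Otimes>\<^sub>M borel)"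
      unfolding case_prod_beta' using fm' by measurable
  qed (use \<xi>i z\<xi> in \<open>simp_all add: \<xi>'\<close>)
  have Z3: "AE w in PW. (\<integral>q. (fst q - m01 w - \<beta>0 * (snd q - m02 w)) * (snd q - m02 w) \<partial>K w) = 0"
  proof (rule zero)
    show "(\<lambda>(w, q). (fst q - m01 w - \<beta>0 * (snd q - m02 w)) * (snd q - m02 w)) \<in> borel_measurable (borel \<Otimes>\<^sub>M borel)"
      unfolding case_prod_beta' using fm' by measurable
  qed (use \<xi>e2i z\<xi>e2 in \<open>simp_all add: \<xi>' e2'\<close>)
  note Km = cond_law_kernel[OF K]
  obtain c where c: "0 \<le> c" "\<And>w. w \<in> {0..1} \<Longrightarrow> (\<integral>\<^sup>+ e. ennreal (fst e ^ 4) \<partial>\<kappa> w) \<le> ennreal c"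
    "\<And>w. w \<in> {0..1} \<Longrightarrow> (\<integral>\<^sup>+ e. ennreal (snd e ^ 4) \<partial>\<kappa> w) \<le> ennreal c"
    using subgaussian_fourth_moments[OF \<kappa>(2) cond_law_kernel(3)[OF \<kappa>(1)]] by blast
  have fs: "fst \<in> borel_measurable (borel :: (real \<times> real) measure)" "snd \<in> borel_measurable (borel :: (real \<times> real) measure)"
    unfolding borel_prod[symmetric] by measurable
  \<comment> \<open>The fourth power of \<open>Y - m01 W\<close> seen through \<open>K\<close> after
    centring, and through \<open>\<kappa>\<close> directly.\<close>
  have M1: "AE w in PW. (\<integral>\<^sup>+ q. ennreal ((fst q - m01 w) ^ 4) \<partial>K w) \<le> ennreal c"
  proof -
    have "AE w in PW. (\<integral>\<^sup>+ q. ennreal ((fst q - m01 w) ^ 4) \<partial>K w) = (\<integral>\<^sup>+ e. ennreal (fst e ^ 4) \<partial>\<kappa> w)"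
      unfolding PW_def
    proof (rule cond_law_AE_eq[OF P0(1) W U K U' \<kappa>(1)])
      show "(\<lambda>(w, q :: real \<times> real). ennreal ((fst q - m01 w) ^ 4)) \<in> borel_measurable (borel \<Otimes>\<^sub>M borel)"
        unfolding case_prod_beta' by (intro measurable_compose[OF _ measurable_ennreal] borel_measurable_power fm'(1))
      show "(\<lambda>(w :: real, e :: real \<times> real). ennreal (fst e ^ 4)) \<in> borel_measurable (borel \<Otimes>\<^sub>M borel)"
        unfolding case_prod_beta' using fs by measurable
    qed simp
    then show ?thesis using W01 by eventually_elim (use c(2) in simp)
  qed
  have M2: "AE w in PW. (\<integral>\<^sup>+ q. ennreal ((snd q - m02 w) ^ 4) \<partial>K w) \<le> ennreal c"
  proof -
    have "AE w in PW. (\<integral>\<^sup>+ q. ennreal ((snd q - m02 w) ^ 4) \<partial>K w) = (\<integral>\<^sup>+ e. ennreal (snd e ^ 4) \<partial>\<kappa> w)"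
      unfolding PW_def
    proof (rule cond_law_AE_eq[OF P0(1) W U K U' \<kappa>(1)])
      show "(\<lambda>(w, q :: real \<times> real). ennreal ((snd q - m02 w) ^ 4)) \<in> borel_measurable (borel \<Otimes>\<^sub>M borel)"
        unfolding case_prod_beta' by (intro measurable_compose[OF _ measurable_ennreal] borel_measurable_power fm'(2))
      show "(\<lambda>(w :: real, e :: real \<times> real). ennreal (snd e ^ 4)) \<in> borel_measurable (borel \<Otimes>\<^sub>M borel)"
        unfolding case_prod_beta' using fs by measurable
    qed simp
    then show ?thesis using W01 by eventually_elim (use c(3) in simp)
  qed
  define s where "s = 1 + 8 * c + (8 * \<beta>0 ^ 4 + 1) * c"
  have s: "0 < s" unfolding s_def using c(1) by (intro add_pos_nonneg mult_nonneg_nonneg) auto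
  have res: "AE w in PW. residual_law s (K w) (\<lambda>z. fst z - m01 w - \<beta>0 * (snd z - m02 w)) (\<lambda>z. snd z - m02 w)"
    using Z1 Z2 Z3 M1 M2
  proof eventually_elim
    case (elim w)
    have em: "(\<lambda>z. fst z - m01 w) \<in> borel_measurable (K w)" "(\<lambda>z. snd z - m02 w) \<in> borel_measurable (K w)"
      using fs Km(3)[of w] by (simp_all cong: measurable_cong_sets)
    note rm = residual_moments[OF Km(2) em c(1) elim(4,5), of _ \<beta>0, folded s_def]
    show ?case
      unfolding residual_law_def
    proof (intro conjI ballI)
      show "(\<lambda>z. fst z - m01 w - \<beta>0 * (snd z - m02 w)) \<in> borel_measurable (K w)" using em by measurable
      fix h assume h: "h \<in> {\<lambda>z. (fst z - m01 w - \<beta>0 * (snd z - m02 w))\<^sup>2, \<lambda>z. (snd z - m02 w)\<^sup>2,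
          \<lambda>z. ((fst z - m01 w - \<beta>0 * (snd z - m02 w)) * (snd z - m02 w))\<^sup>2, \<lambda>z. (snd z - m02 w) ^ 4}"
      show "integrable (K w) h" "(\<integral>x. h x \<partial>K w) \<le> s" using rm[OF h] by auto
    qed (use em elim Km(2) in auto)
  qed
  have vm: "(\<lambda>(w, q :: real \<times> real). ennreal ((snd q - m02 w)\<^sup>2)) \<in> borel_measurable (borel \<Otimes>\<^sub>M borel)"
    unfolding case_prod_beta' by (intro measurable_compose[OF _ measurable_ennreal] borel_measurable_power fm'(2))
  have v_eq: "(\<integral>q. (snd q - m02 w)\<^sup>2 \<partial>K w) = enn2real (\<integral>\<^sup>+ q. ennreal ((snd q - m02 w)\<^sup>2) \<partial>K w)" for w
    using fs Km(3)[of w] by (intro integral_eq_nn_integral) (auto cong: measurable_cong_sets)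
  note dis = cond_law_nn_integral[OF P0(1) U W K vm]
  have vmeas: "(\<lambda>w. \<integral>q. (snd q - m02 w)\<^sup>2 \<partial>K w) \<in> borel_measurable borel"
    unfolding v_eq using dis(2) by measurable
  \<comment> \<open>Averaging the conditional variances over the law of \<open>W\<close> recovers
    the second moment of \<open>X - m02 W\<close>.\<close>
  have "c_lo \<le> (\<integral>w. (\<integral>q. (snd q - m02 w)\<^sup>2 \<partial>K w) \<partial>PW)"
  proof -
    have "(\<integral>\<^sup>+ w. ennreal (\<integral>q. (snd q - m02 w)\<^sup>2 \<partial>K w) \<partial>PW) = (\<integral>\<^sup>+ w. \<integral>\<^sup>+ q. ennreal ((snd q - m02 w)\<^sup>2) \<partial>K w \<partial>PW)"
    proof (rule nn_integral_cong_AE)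
      show "AE w in PW. ennreal (\<integral>q. (snd q - m02 w)\<^sup>2 \<partial>K w) = (\<integral>\<^sup>+ q. ennreal ((snd q - m02 w)\<^sup>2) \<partial>K w)"
        using res
      proof eventually_elim
        case (elim w)
        then have "integrable (K w) (\<lambda>q. (snd q - m02 w)\<^sup>2)" by (simp add: residual_law_def)
        then show ?case by (intro nn_integral_eq_integral[symmetric]) auto
      qed
    qed
    also have "\<dots> = (\<integral>\<^sup>+ z. ennreal ((e2 z)\<^sup>2) \<partial>P0)"
      unfolding PW_def using dis(1) by (simp add: e2_def)
    also have "\<dots> = ennreal (\<integral>z. (e2 z)\<^sup>2 \<partial>P0)"
      using e2sq by (intro nn_integral_eq_integral) auto
    finally have "(\<integral>w. (\<integral>q. (snd q - m02 w)\<^sup>2 \<partial>K w) \<partial>PW) = (\<integral>z. (e2 z)\<^sup>2 \<partial>P0)"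
      using vmeas by (subst integral_eq_nn_integral) (auto simp: PW_def)
    then show ?thesis using c_lo by (simp add: e2_def)
  qed
  then show ?thesis using that[OF s res vmeas] by blast
qed

section \<open>Rates\<close>

text \<open>For positive \<open>n\<close>, the largest \<open>J\<close> with
  \<open>2 powr (J * (2 * \<alpha> + 1)) \<le> n\<close>: the cut-off that balances the squared bias
  \<open>n * 2 powr (- (2 * J * \<alpha>))\<close> against the dimension
  \<open>2 ^ J\<close>.\<close>

definition level :: "real \<Rightarrow> nat \<Rightarrow> nat" where
  "level \<alpha> n = nat \<lfloor>log 2 (real n) / (2 * \<alpha> + 1)\<rfloor>"

lemma level_bounds:
  assumes "0 < \<alpha>" "0 < n"
  shows "2 powr (real (level \<alpha> n) * (\<alpha> + 1/2)) \<le> sqrt (real n)"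
    "sqrt (real n) \<le> 2 powr ((real (level \<alpha> n) + 1) * (\<alpha> + 1/2))"
proof -
  define x where "x = log 2 (real n) / (2 * \<alpha> + 1)"
  have "0 \<le> x" using assms by (simp add: x_def)
  then have J: "real (level \<alpha> n) \<le> x" "x \<le> real (level \<alpha> n) + 1"
    unfolding level_def x_def[symmetric] by (simp_all add: of_nat_nat)
  have sq: "sqrt (real n) = 2 powr (x * (\<alpha> + 1/2))"
  proof -
    have xe: "x * (\<alpha> + 1/2) = log 2 (real n) * (1/2)" using assms by (simp add: x_def field_simps)
    have "2 powr (x * (\<alpha> + 1/2)) = (2 powr log 2 (real n)) powr (1/2)"
      unfolding xe powr_powr ..
    then show ?thesis using assms by (simp add: powr_half_sqrt)
  qed
  show "2 powr (real (level \<alpha> n) * (\<alpha> + 1/2)) \<le> sqrt (real n)"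
    "sqrt (real n) \<le> 2 powr ((real (level \<alpha> n) + 1) * (\<alpha> + 1/2))"
    unfolding sq using J assms(1) by (auto intro!: powr_mono mult_right_mono)
qed

lemma level_at_top:
  assumes "0 < \<alpha>"
  shows "filterlim (level \<alpha>) at_top sequentially"
  unfolding level_def
proof (rule filterlim_compose[OF filterlim_nat_sequentially])
  have "filterlim (\<lambda>n. ln (real n) * (1 / (ln 2 * (2 * \<alpha> + 1)))) at_top sequentially"
    using assms
    by (intro filterlim_at_top_mult_tendsto_pos[OF tendsto_const] filterlim_compose[OF ln_at_top] filterlim_real_sequentially) auto
  then show "filterlim (\<lambda>n. \<lfloor>log 2 (real n) / (2 * \<alpha> + 1)\<rfloor>) at_top sequentially"
    by (intro filterlim_compose[OF filterlim_floor_sequentially]) (simp add: log_def)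
qed

text \<open>By the choice of the level,
  \<open>2 ^ J / sqrt n \<le> 2 powr (- (J * (\<alpha> - 1/2)))\<close>, and this exponential decay
  in \<open>J\<close> beats \<open>J ^ 3\<close>. With \<open>r\<close> the cube root of the decay
  factor, the expression is at most the cube of \<open>J * r ^ J\<close>.\<close>

lemma level_rate:
  assumes "1/2 < \<alpha>"
  shows "(\<lambda>n. real (level \<alpha> n) ^ 3 * 2 ^ level \<alpha> n / sqrt (real n)) \<longlonglongrightarrow> 0"
proof -
  have \<alpha>: "0 < \<alpha>" using assms by linarith
  define r where "r = 2 powr (- ((\<alpha> - 1/2) / 3))"
  have r: "0 < r" "r < 1" using assms by (auto simp: r_def powr_less_one)
  have "(\<lambda>j. real j * r ^ j) \<longlonglongrightarrow> 0" using r by (intro powser_times_n_limit_0) simp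
  then have "(\<lambda>j. (real j * r ^ j) ^ 3) \<longlonglongrightarrow> 0 ^ 3" by (intro tendsto_power)
  then have l0: "(\<lambda>j. (real j * r ^ j) ^ 3) \<longlonglongrightarrow> 0" by simp
  have lim: "(\<lambda>n. (real (level \<alpha> n) * r ^ level \<alpha> n) ^ 3) \<longlonglongrightarrow> 0"
    by (rule filterlim_compose[OF l0 level_at_top[OF \<alpha>]])
  show ?thesis
  proof (rule tendsto_sandwich[OF _ _ tendsto_const lim])
    show "eventually (\<lambda>n. 0 \<le> real (level \<alpha> n) ^ 3 * 2 ^ level \<alpha> n / sqrt (real n)) sequentially" by simp
    show "eventually (\<lambda>n. real (level \<alpha> n) ^ 3 * 2 ^ level \<alpha> n / sqrt (real n) \<le> (real (level \<alpha> n) * r ^ level \<alpha> n) ^ 3) sequentially"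
      using eventually_gt_at_top[of 0]
    proof eventually_elim
      case (elim n)
      let ?J = "level \<alpha> n"
      have "2 ^ ?J / sqrt (real n) \<le> 2 ^ ?J / 2 powr (real ?J * (\<alpha> + 1/2))"
        using level_bounds(1)[OF \<alpha> elim] elim by (intro divide_left_mono mult_pos_pos) auto
      also have "\<dots> = 2 powr (real ?J - real ?J * (\<alpha> + 1/2))" by (simp add: powr_diff powr_realpow)
      also have "real ?J - real ?J * (\<alpha> + 1/2) = real (3 * ?J) * (- ((\<alpha> - 1/2) / 3))" by (simp add: field_simps)
      also have "2 powr \<dots> = r ^ (3 * ?J)" unfolding r_def by (rule powr_power[symmetric]) simp
      finally have "2 ^ ?J / sqrt (real n) \<le> (r ^ ?J) ^ 3" by (simp add: power_mult[symmetric] mult.commute)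
      then have "real ?J ^ 3 * (2 ^ ?J / sqrt (real n)) \<le> real ?J ^ 3 * (r ^ ?J) ^ 3" by (rule mult_left_mono) simp
      then show ?case by (simp add: power_mult_distrib)
    qed
  qed
qed

lemma inverse_sqrt_tendsto: "(\<lambda>n. 1 / sqrt (real n)) \<longlonglongrightarrow> 0"
proof -
  have "filterlim (\<lambda>n. sqrt (real n)) at_top sequentially"
    by (rule filterlim_compose[OF sqrt_at_top filterlim_real_sequentially])
  then show ?thesis by (rule tendsto_divide_0[OF tendsto_const filterlim_at_top_imp_at_infinity])
qed

lemma level_over_sqrt_tendsto:
  assumes "1/2 < \<alpha>"
  shows "(\<lambda>n. real (level \<alpha> n) / sqrt (real n)) \<longlonglongrightarrow> 0"
proof (rule tendsto_sandwich[OF _ _ tendsto_const level_rate[OF assms]])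
  show "eventually (\<lambda>n. 0 \<le> real (level \<alpha> n) / sqrt (real n)) sequentially" by simp
  have "real j \<le> real j ^ 3 * 2 ^ j" for j :: nat
  proof (cases "j = 0")
    case False
    then have "real j ^ 1 * 1 \<le> real j ^ 3 * 2 ^ j" by (intro mult_mono power_increasing) auto
    then show ?thesis by simp
  qed simp
  then show "eventually (\<lambda>n. real (level \<alpha> n) / sqrt (real n) \<le> real (level \<alpha> n) ^ 3 * 2 ^ level \<alpha> n / sqrt (real n)) sequentially"
    by (intro always_eventually allI divide_right_mono) auto
qed

text \<open>The quotient is, up to constants, the displacement of the centre in units of the
  limiting standard deviation. As \<open>J\<close> is 0 or at least 1,
  \<open>sqrt (J ^ 3) \<le> J\<^sup>2\<close>, so all terms are multiples of
  \<open>J ^ 3 * D\<close> at most.\<close>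

lemma center_rate:
  fixes \<alpha> k :: real
  assumes \<alpha>: "1/2 < \<alpha>" and k: "0 \<le> k"
  defines "A \<equiv> \<lambda>n. k * real (level \<alpha> n)" and "D \<equiv> \<lambda>n. 2 ^ level \<alpha> n :: real"
  defines "R \<equiv> \<lambda>n. real (level \<alpha> n) ^ 3 * D n"
  shows "(\<lambda>n. (2 * (A n * (sqrt (D n) * sqrt (R n) + D n)) + R n) / sqrt (real n)) \<longlonglongrightarrow> 0"
proof -
  have lim: "(\<lambda>n. (4 * k + 1) * (real (level \<alpha> n) ^ 3 * 2 ^ level \<alpha> n / sqrt (real n))) \<longlonglongrightarrow> (4 * k + 1) * 0"
    by (intro tendsto_mult tendsto_const level_rate \<alpha>)
  have le: "2 * (A n * (sqrt (D n) * sqrt (R n) + D n)) + R n \<le> (4 * k + 1) * (real (level \<alpha> n) ^ 3 * D n)" for n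
  proof -
    define j where "j = real (level \<alpha> n)"
    have jj: "j = 0 \<or> 1 \<le> j" by (auto simp: j_def)
    have D: "0 < D n" by (simp add: D_def)
    have "sqrt (j ^ 3) \<le> j\<^sup>2"
    proof (rule real_le_lsqrt)
      have "j ^ 3 \<le> j ^ 4" using jj power_increasing[of 3 4 j] by auto
      then show "j ^ 3 \<le> (j\<^sup>2)\<^sup>2" by (simp flip: power_mult)
    qed (use jj in auto)
    then have "sqrt (D n) * sqrt (R n) \<le> j\<^sup>2 * D n"
    proof -
      have "sqrt (D n) * sqrt (R n) = sqrt (j ^ 3) * (sqrt (D n) * sqrt (D n))"
        by (simp add: R_def j_def real_sqrt_mult)
      also have "sqrt (D n) * sqrt (D n) = D n" using D by simp
      also have "sqrt (j ^ 3) * D n \<le> j\<^sup>2 * D n" using \<open>sqrt (j ^ 3) \<le> j\<^sup>2\<close> D by (intro mult_right_mono) auto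
      finally show ?thesis .
    qed
    then have "A n * (sqrt (D n) * sqrt (R n) + D n) \<le> (k * j) * (j\<^sup>2 * D n + D n)"
      unfolding A_def j_def[symmetric] using k jj by (intro mult_left_mono add_right_mono) auto
    also have "\<dots> = k * (j ^ 3 * D n) + k * (j * D n)" by (simp add: power3_eq_cube power2_eq_square algebra_simps)
    also have "\<dots> \<le> k * (j ^ 3 * D n) + k * (j ^ 3 * D n)"
    proof (intro add_left_mono mult_left_mono mult_right_mono)
      show "j \<le> j ^ 3" using jj power_increasing[of 1 3 j] by auto
    qed (use k D in auto)
    finally have "A n * (sqrt (D n) * sqrt (R n) + D n) \<le> k * (j ^ 3 * D n) + k * (j ^ 3 * D n)" .
    then have "2 * (A n * (sqrt (D n) * sqrt (R n) + D n)) + R n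
        \<le> 2 * (k * (j ^ 3 * D n) + k * (j ^ 3 * D n)) + R n"
      by (intro add_right_mono mult_left_mono) auto
    also have "\<dots> = (4 * k + 1) * (real (level \<alpha> n) ^ 3 * D n)"
      by (simp add: R_def j_def algebra_simps)
    finally show ?thesis .
  qed
  show ?thesis
  proof (rule tendsto_sandwich[OF _ _ tendsto_const])
    show "eventually (\<lambda>n. 0 \<le> (2 * (A n * (sqrt (D n) * sqrt (R n) + D n)) + R n) / sqrt (real n)) sequentially"
      using k by (intro always_eventually allI) (simp add: A_def D_def R_def)
    show "eventually (\<lambda>n. (2 * (A n * (sqrt (D n) * sqrt (R n) + D n)) + R n) / sqrt (real n)
        \<le> (4 * k + 1) * (real (level \<alpha> n) ^ 3 * 2 ^ level \<alpha> n / sqrt (real n))) sequentially"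
    proof (intro always_eventually allI)
      fix n
      have "(2 * (A n * (sqrt (D n) * sqrt (R n) + D n)) + R n) / sqrt (real n) \<le> (4 * k + 1) * (real (level \<alpha> n) ^ 3 * D n) / sqrt (real n)"
        by (intro divide_right_mono le) simp
      then show "(2 * (A n * (sqrt (D n) * sqrt (R n) + D n)) + R n) / sqrt (real n)
        \<le> (4 * k + 1) * (real (level \<alpha> n) ^ 3 * 2 ^ level \<alpha> n / sqrt (real n))" by (simp add: D_def)
    qed
    show "(\<lambda>n. (4 * k + 1) * (real (level \<alpha> n) ^ 3 * 2 ^ level \<alpha> n / sqrt (real n))) \<longlonglongrightarrow> 0" using lim by simp
  qed
qed

lemma two_powr_le_exp:
  assumes "0 \<le> (x::real)"
  shows "2 powr x \<le> exp x"
proof -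
  have "x * ln 2 \<le> x" by (rule mult_left_le) (use assms ln_2_less_1 in auto)
  then show ?thesis by (simp add: powr_def)
qed

text \<open>In the exponent, everything except \<open>- c * R\<close> is at most of order
  \<open>J\<^sup>2 * D\<close>: the excess \<open>A\<^sup>2 * D\<close>, the loss
  \<open>A * D\<close> near the truth, the two small-ball masses of order \<open>J * D\<close>, and
  \<open>sqrt n\<close>, exponential in \<open>J\<close>. The term \<open>R = J ^ 3 * D\<close>
  overtakes them once \<open>c * J \<ge> C8 + 1\<close>.\<close>

lemma mass_ratio_rate:
  fixes \<alpha> \<alpha>1 \<alpha>2 k c C C' B :: real
  assumes \<alpha>: "0 < \<alpha>" "0 < \<alpha>1" "0 < \<alpha>2" and k: "0 \<le> k" and c: "0 < c" and C: "0 \<le> C" "0 \<le> C'" and B: "0 < B"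
  defines "J \<equiv> level \<alpha>"
  defines "A \<equiv> \<lambda>n. k * real (J n)" and "D \<equiv> \<lambda>n. 2 ^ J n :: real"
  defines "R \<equiv> \<lambda>n. real (J n) ^ 3 * D n"
  shows "(\<lambda>n. exp (- c * R n + C * (A n)\<^sup>2 * D n) / (exp (- C' * A n * D n) * (1 / sqrt (real n) / B) *
      ((2 powr (- (real (J n) * \<alpha>1)) / 2) ^ (2 ^ J n) * (2 powr (- (real (J n) * \<alpha>2)) / 2) ^ (2 ^ J n)))) \<longlonglongrightarrow> 0"
    (is "?\<rho> \<longlonglongrightarrow> 0")
proof -
  \<comment> \<open>Sum of the coefficients of the positive terms in the exponent, after rounding
    \<open>J * D\<close> up to \<open>J\<^sup>2 * D\<close>.\<close>
  define C8 where "C8 = C * k\<^sup>2 + C' * k + (\<alpha>1 + 1) + (\<alpha>2 + 1) + (2 * \<alpha> + 1)"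
  have top: "filterlim (\<lambda>n. real (J n)) at_top sequentially"
    unfolding J_def by (rule filterlim_compose[OF filterlim_real_sequentially level_at_top[OF \<alpha>(1)]])
  have lim: "(\<lambda>n. B * exp (- real (J n))) \<longlonglongrightarrow> 0"
  proof -
    have "filterlim (\<lambda>n. - real (J n)) at_bot sequentially"
      using top by (simp add: filterlim_uminus_at_top)
    then have "(\<lambda>n. exp (- real (J n))) \<longlonglongrightarrow> 0" by (rule filterlim_compose[OF exp_at_bot])
    then show ?thesis using tendsto_mult_right_zero by blast
  qed
  show ?thesis
  proof (rule tendsto_sandwich[OF _ _ tendsto_const lim])
    show "eventually (\<lambda>n. 0 \<le> ?\<rho> n) sequentially"
      using B by (intro always_eventually allI divide_nonneg_nonneg mult_nonneg_nonneg) auto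
    show "eventually (\<lambda>n. ?\<rho> n \<le> B * exp (- real (J n))) sequentially"
      using filterlim_at_top[THEN iffD1, OF top, rule_format, of "(C8 + 1) / c"]
        filterlim_at_top[THEN iffD1, OF top, rule_format, of 1] eventually_gt_at_top[of 0]
    proof eventually_elim
      case (elim n)
      define j where "j = real (J n)"
      define d where "d = D n"
      have j: "1 \<le> j" "(C8 + 1) / c \<le> j" using elim by (auto simp: j_def)
      have d: "1 \<le> d" by (simp add: d_def D_def)
      have jd: "j \<le> j * d" using j d by simp
      \<comment> \<open>Each of the \<open>2 ^ J\<close> factors contributes at most
        \<open>exp (1 + J * a)\<close> to the inverse of the mass.\<close>
      have mass: "1 / (2 powr (- (real (J n) * a)) / 2) ^ (2 ^ J n) \<le> exp ((a + 1) * j * d)" if a: "0 < a" for a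
      proof -
        have "1 / (2 powr (- (real (J n) * a)) / 2) ^ (2 ^ J n) = (2 * 2 powr (j * a)) ^ (2 ^ J n)"
        proof -
          have y: "2 powr (- (real (J n) * a)) = 1 / 2 powr (j * a)" by (simp only: powr_minus_divide j_def)
          have gen: "1 / (1 / y / 2) ^ N = (2 * y) ^ N" for y :: real and N :: nat
            by (simp add: power_divide power_mult_distrib)
          show ?thesis unfolding y by (rule gen)
        qed
        also have "2 * 2 powr (j * a) = 2 powr (1 + j * a)" by (simp add: powr_add)
        also have "(2 powr (1 + j * a)) ^ (2 ^ J n) \<le> exp (1 + j * a) ^ (2 ^ J n)"
          using a j by (intro power_mono two_powr_le_exp) auto
        also have "\<dots> = exp (d * (1 + j * a))"
          by (simp add: d_def D_def flip: exp_of_nat_mult)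
        also have "\<dots> \<le> exp ((a + 1) * j * d)"
        proof -
          have "d * (1 + j * a) \<le> d * (j + j * a)" using j d by (intro mult_left_mono) auto
          then show ?thesis by (simp add: algebra_simps)
        qed
        finally show ?thesis .
      qed
      have sq: "sqrt (real n) \<le> exp ((2 * \<alpha> + 1) * j * d)"
      proof -
        have "sqrt (real n) \<le> 2 powr ((j + 1) * (\<alpha> + 1/2))"
          using level_bounds(2)[OF \<alpha>(1) elim(3)] by (simp add: j_def J_def)
        also have "\<dots> \<le> exp ((j + 1) * (\<alpha> + 1/2))" using j \<alpha> by (intro two_powr_le_exp) auto
        also have "\<dots> \<le> exp ((2 * \<alpha> + 1) * j * d)"
        proof -
          have "(j + 1) * (\<alpha> + 1/2) \<le> (2 * j) * (\<alpha> + 1/2)" using j \<alpha> by (intro mult_right_mono) auto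
          also have "\<dots> = (2 * \<alpha> + 1) * j" by (simp add: algebra_simps)
          also have "\<dots> \<le> (2 * \<alpha> + 1) * (j * d)" using jd \<alpha> by (intro mult_left_mono) auto
          finally show ?thesis by (simp add: mult.assoc)
        qed
        finally show ?thesis .
      qed
      have "?\<rho> n = B * (exp (- c * R n + C * (A n)\<^sup>2 * D n) * exp (C' * A n * D n) * sqrt (real n) *
          (1 / (2 powr (- (real (J n) * \<alpha>1)) / 2) ^ (2 ^ J n)) * (1 / (2 powr (- (real (J n) * \<alpha>2)) / 2) ^ (2 ^ J n)))"
      proof -
        have "x / (exp (- y) * (1 / q / B) * (p1 * p2)) = B * (x * exp y * q * (1 / p1) * (1 / p2))"
          for x y q p1 p2 :: real
          by (simp add: exp_minus divide_inverse mult_ac)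
        from this[of _ "C' * A n * D n"] show ?thesis by (simp only: mult_minus_left)
      qed
      also have "\<dots> \<le> B * (exp (- c * R n + C * (A n)\<^sup>2 * D n) * exp (C' * A n * D n) * exp ((2 * \<alpha> + 1) * j * d) *
          exp ((\<alpha>1 + 1) * j * d) * exp ((\<alpha>2 + 1) * j * d))"
        using B by (intro mult_left_mono mult_mono sq mass \<alpha> mult_nonneg_nonneg) auto
      also have "\<dots> = B * exp (- c * R n + C * (A n)\<^sup>2 * D n + C' * A n * D n + (2 * \<alpha> + 1) * j * d + (\<alpha>1 + 1) * j * d + (\<alpha>2 + 1) * j * d)"
        by (simp only: exp_add)
      also have "- c * R n + C * (A n)\<^sup>2 * D n + C' * A n * D n + (2 * \<alpha> + 1) * j * d + (\<alpha>1 + 1) * j * d + (\<alpha>2 + 1) * j * d \<le> - j"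
      proof -
        have e1: "- c * R n = - (c * j) * (j\<^sup>2 * d)" "C * (A n)\<^sup>2 * D n = C * k\<^sup>2 * (j\<^sup>2 * d)" "C' * A n * D n = C' * k * (j * d)"
          by (simp_all add: R_def A_def j_def d_def power2_eq_square power3_eq_cube)
        have jd2: "j * d \<le> j\<^sup>2 * d" using j d by (intro mult_right_mono) (auto simp: power2_eq_square)
        have "C' * k * (j * d) + (2 * \<alpha> + 1) * (j * d) + (\<alpha>1 + 1) * (j * d) + (\<alpha>2 + 1) * (j * d)
            = (C8 - C * k\<^sup>2) * (j * d)" by (simp add: C8_def algebra_simps)
        also have "\<dots> \<le> (C8 - C * k\<^sup>2) * (j\<^sup>2 * d)"
          using jd2 C k \<alpha> by (intro mult_left_mono) (auto simp: C8_def)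
        finally have 1: "- c * R n + C * (A n)\<^sup>2 * D n + C' * A n * D n + (2 * \<alpha> + 1) * j * d + (\<alpha>1 + 1) * j * d + (\<alpha>2 + 1) * j * d
            \<le> - (c * j) * (j\<^sup>2 * d) + C * k\<^sup>2 * (j\<^sup>2 * d) + (C8 - C * k\<^sup>2) * (j\<^sup>2 * d)"
          unfolding e1 unfolding mult.assoc by linarith
        have "\<dots> = (C8 - c * j) * (j\<^sup>2 * d)" by (simp add: algebra_simps)
        also have "\<dots> \<le> (- 1) * (j\<^sup>2 * d)"
        proof (rule mult_right_mono)
          show "C8 - c * j \<le> - 1" using j(2) c by (simp add: field_simps)
        qed (use d in simp)
        finally show ?thesis using 1 jd jd2 by linarith
      qed
      finally show ?case using B by (simp add: j_def)
    qed
  qed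
qed

section \<open>Linear sums over the support of the prior, and the fixed design\<close>

lemma dominated_cong:
  "(\<And>i. i < n \<Longrightarrow> g i = g' i) \<Longrightarrow> dominated A D n v g \<longleftrightarrow> dominated A D n v g'"
  by (simp add: dominated_def dotp_def)

lemma dominated_mono:
  assumes "dominated A D n v g" "A \<le> A'" "0 \<le> D"
  shows "dominated A' D n v g"
proof -
  have "A * (sqrt D * sqrt (dotp n g g) + D) \<le> A' * (sqrt D * sqrt (dotp n g g) + D)"
    using assms dotp_self_nonneg[of n g] by (intro mult_right_mono) auto
  then show ?thesis using assms(1) unfolding dominated_def by linarith
qed

text \<open>A draw from the prior lies almost surely in the same coefficient cube as the truth, so
  the difference has coefficients bounded by \<open>2 * M\<close>; reading it with the smaller
  exponent brings it into the class of the modulus bound. The conditions on \<open>V\<close> do not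
  involve \<open>m\<close>, which is why one event serves all functions. Finiteness of
  \<open>V\<close> gives measurability.\<close>

lemma AE_prior_dominated:
  fixes w :: "nat \<Rightarrow> real" and m0 :: "real \<Rightarrow> real"
  assumes M: "0 < M" and loc: "localized \<psi> C" and \<alpha>: "0 < \<alpha>" "\<alpha> \<le> \<alpha>'" and \<nu>0: "coeff_bounded M \<nu>0"
    and w: "\<And>i. i < n \<Longrightarrow> w i \<in> {0..1}"
    and m0: "\<And>i. i < n \<Longrightarrow> m0 (w i) = wavelet_series \<psi> \<alpha>' \<nu>0 (w i)"
    and bas: "\<And>x a. (\<Sum>i<n. x i * (\<Sum>j\<in>low_freq_index J. a j * \<psi> (fst j) (snd j) (w i)))\<^sup>2
         \<le> (\<Sum>b\<in>bs. (\<Sum>i<n. x i * b i)\<^sup>2) * (\<Sum>i<n. (\<Sum>j\<in>low_freq_index J. a j * \<psi> (fst j) (snd j) (w i))\<^sup>2)"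
    and A: "1 \<le> A" and D: "0 < D" and c4: "sqrt (real n) * 2 powr (- (real J * \<alpha>)) \<le> c4 * sqrt D"
    and V: "finite V" "\<And>v. v \<in> V \<Longrightarrow> (\<Sum>b\<in>bs. (\<Sum>i<n. v i * b i)\<^sup>2) \<le> A * D"
      "\<And>v. v \<in> V \<Longrightarrow> (\<Sum>l. high_freq \<psi> \<alpha> J n w v l) \<le> A * D"
  shows "AE m in wavelet_series_prior \<psi> \<alpha>' M.
    \<forall>v\<in>V. dominated ((2 + 2 * (2 * M) * C * c4 / (1 - 2 powr (- \<alpha>)) + 2 * M) * A) D n v (\<lambda>i. m (w i) - m0 (w i))"
proof (rule AE_wavelet_series_prior[OF M])
  let ?Pm = "PiM {0..1} (\<lambda>_. borel) :: (real \<Rightarrow> real) measure"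
  have cm: "(\<lambda>m. m (w i)) \<in> borel_measurable ?Pm" if "i < n" for i
    using w[OF that] by (intro measurable_component_singleton) auto
  show "{m \<in> space ?Pm. \<forall>v\<in>V. dominated ((2 + 2 * (2 * M) * C * c4 / (1 - 2 powr (- \<alpha>)) + 2 * M) * A) D n v (\<lambda>i. m (w i) - m0 (w i))} \<in> sets ?Pm"
  proof (rule sets.sets_Collect_finite_All[OF _ V(1)])
    fix v
    have [measurable]: "(\<lambda>m. dotp n v (\<lambda>i. m (w i) - m0 (w i))) \<in> borel_measurable ?Pm"
      "(\<lambda>m. dotp n (\<lambda>i. m (w i) - m0 (w i)) (\<lambda>i. m (w i) - m0 (w i))) \<in> borel_measurable ?Pm"
      unfolding dotp_def by (intro borel_measurable_sum borel_measurable_times borel_measurable_diff borel_measurable_const cm; simp)+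
    show "{m \<in> space ?Pm. dominated ((2 + 2 * (2 * M) * C * c4 / (1 - 2 powr (- \<alpha>)) + 2 * M) * A) D n v (\<lambda>i. m (w i) - m0 (w i))} \<in> sets ?Pm"
      unfolding dominated_def by measurable
  qed
  fix \<nu> assume \<nu>: "coeff_bounded M \<nu>"
  have \<alpha>': "0 < \<alpha>'" using \<alpha> by linarith
  have "coeff_bounded (2 * M) (\<lambda>j. \<nu> j - \<nu>0 j)"
    unfolding coeff_bounded_def
  proof (intro allI impI)
    fix l k :: nat assume "k < 2^l"
    then have "\<bar>\<nu> (l, k)\<bar> \<le> M" "\<bar>\<nu>0 (l, k)\<bar> \<le> M" using \<nu> \<nu>0 by (auto simp: coeff_bounded_def)
    then show "\<bar>\<nu> (l, k) - \<nu>0 (l, k)\<bar> \<le> 2 * M" by linarith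
  qed
  from wavelet_series_coarsen[OF \<alpha>(2) this, of \<psi>] obtain \<nu>' where \<nu>': "coeff_bounded (2 * M) \<nu>'"
    "wavelet_series \<psi> \<alpha>' (\<lambda>j. \<nu> j - \<nu>0 j) = wavelet_series \<psi> \<alpha> \<nu>'" by metis
  have eq: "wavelet_path \<psi> \<alpha>' \<nu> (w i) - m0 (w i) = wavelet_series \<psi> \<alpha> \<nu>' (w i)" if i: "i < n" for i
    using w[OF i] m0[OF i] wavelet_series_diff[OF loc \<alpha>' \<nu> \<nu>0 _ w[OF i]] M \<nu>'(2) by simp
  show "\<forall>v\<in>V. dominated ((2 + 2 * (2 * M) * C * c4 / (1 - 2 powr (- \<alpha>)) + 2 * M) * A) D n v
      (\<lambda>i. wavelet_path \<psi> \<alpha>' \<nu> (w i) - m0 (w i))"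
  proof
    fix v assume v: "v \<in> V"
    have "dominated ((2 + 2 * (2 * M) * C * c4 / (1 - 2 powr (- \<alpha>)) + 2 * M) * A) D n v (\<lambda>i. wavelet_series \<psi> \<alpha> \<nu>' (w i))"
      using M by (intro dominated_wavelet_series[OF loc \<alpha>(1) \<nu>'(1) _ w bas A D c4 V(2,3)[OF v]]) auto
    then show "dominated ((2 + 2 * (2 * M) * C * c4 / (1 - 2 powr (- \<alpha>)) + 2 * M) * A) D n v
      (\<lambda>i. wavelet_path \<psi> \<alpha>' \<nu> (w i) - m0 (w i))"
      using dominated_cong[of n "\<lambda>i. wavelet_path \<psi> \<alpha>' \<nu> (w i) - m0 (w i)" "\<lambda>i. wavelet_series \<psi> \<alpha> \<nu>' (w i)"] eq
      by blast
  qed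
qed

text \<open>The deviation set lies in the complement of a measurable \<open>G\<close>, which bounds
  its outer measure without measurability of \<open>f n\<close>. This suits total variation, a
  supremum over uncountably many events.\<close>

lemma tendsto_zero_in_probI:
  fixes P :: "nat \<Rightarrow> 'a measure"
  assumes P: "\<And>n. prob_space (P n)" and \<tau>: "\<tau> \<longlonglongrightarrow> 0" and b: "b \<longlonglongrightarrow> 0"
    and G: "eventually (\<lambda>n. \<exists>G\<in>sets (P n). measure (P n) (space (P n) - G) \<le> b n \<and> (\<forall>z\<in>G. \<bar>f n z\<bar> \<le> \<tau> n)) sequentially"
  shows "tendsto_zero_in_prob P f"
  unfolding tendsto_zero_in_prob_def
proof (intro allI impI)
  fix \<delta> :: real assume \<delta>: "0 < \<delta>"
  have lim: "(\<lambda>n. ennreal (b n)) \<longlonglongrightarrow> 0" using tendsto_ennrealI[OF b] by simp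
  show "(\<lambda>n. outer_measure_of (P n) {z\<in>space (P n). \<bar>f n z\<bar> > \<delta>}) \<longlonglongrightarrow> 0"
  proof (rule tendsto_sandwich[OF _ _ tendsto_const lim])
    show "eventually (\<lambda>n. 0 \<le> outer_measure_of (P n) {z\<in>space (P n). \<bar>f n z\<bar> > \<delta>}) sequentially" by simp
    show "eventually (\<lambda>n. outer_measure_of (P n) {z\<in>space (P n). \<bar>f n z\<bar> > \<delta>} \<le> ennreal (b n)) sequentially"
      using G order_tendstoD(2)[OF \<tau> \<delta>]
    proof eventually_elim
      case (elim n)
      then obtain G where G: "G \<in> sets (P n)" "measure (P n) (space (P n) - G) \<le> b n" "\<And>z. z \<in> G \<Longrightarrow> \<bar>f n z\<bar> \<le> \<tau> n"
        by blast
      interpret prob_space "P n" by (rule P)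
      have "{z\<in>space (P n). \<bar>f n z\<bar> > \<delta>} \<subseteq> space (P n) - G" using G(3) elim(2) by fastforce
      then have "outer_measure_of (P n) {z\<in>space (P n). \<bar>f n z\<bar> > \<delta>} \<le> outer_measure_of (P n) (space (P n) - G)"
        by (rule outer_measure_of_mono)
      also have "\<dots> = emeasure (P n) (space (P n) - G)"
        using G(1) by (intro outer_measure_of_eq) auto
      also have "\<dots> \<le> ennreal (b n)" using G(2) by (simp add: emeasure_eq_measure ennreal_leI)
      finally show ?case .
    qed
  qed
qed

text \<open>The moment conditions hold at every design point, so the argument concerns one sequence
  of product laws; a random design is reduced to this by discarding a null set of sequences. The
  multiplier is \<open>J n\<close> in the good event and \<open>A n = k * J n\<close> in the
  likelihood bounds.\<close>

lemma bernstein_von_mises_fixed_design: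
  fixes K :: "real \<Rightarrow> (real \<times> real) measure" and m01 m02 :: "real \<Rightarrow> real" and w :: "nat \<Rightarrow> real"
    and B M \<alpha>1 \<alpha>2 \<beta>0 \<sigma>1 \<sigma>2 s a C :: real
  assumes B: "\<bar>\<beta>0\<bar> < B" and M: "0 < M" and \<alpha>12: "1/2 < \<alpha>1" "1/2 < \<alpha>2" and \<sigma>: "0 < \<sigma>1" "0 < \<sigma>2"
    and loc: "localized \<psi> C" "0 < C" and s: "0 < s" and a: "0 < a"
    and K: "\<And>v. prob_space (K v)"
    and \<nu>: "coeff_bounded M \<nu>1" "coeff_bounded M \<nu>2"
    and w: "\<And>i. w i \<in> {0..1}"
    and m0: "\<And>i. m01 (w i) = wavelet_series \<psi> \<alpha>1 \<nu>1 (w i)" "\<And>i. m02 (w i) = wavelet_series \<psi> \<alpha>2 \<nu>2 (w i)"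
    and res: "\<And>i. residual_law s (K (w i)) (\<lambda>z. fst z - m01 (w i) - \<beta>0 * (snd z - m02 (w i))) (\<lambda>z. snd z - m02 (w i))"
    and var: "eventually (\<lambda>n. 2 * a * real n \<le> (\<Sum>i<n. \<integral>z. (snd z - m02 (w i))\<^sup>2 \<partial>K (w i))) sequentially"
  shows "tendsto_zero_in_prob (\<lambda>n. PiM {..<n} (\<lambda>i. K (w i)))
             (\<lambda>n z. tv_dist
                (beta_posterior (prior \<psi> \<alpha>1 \<alpha>2 M B) \<sigma>1 \<sigma>2 n w z)
                (normal_law (\<beta>0 + Delta_n \<sigma>1 \<beta>0 m01 m02 n w z / sqrt (real n))
                            ((1 / real n) * inverse (info_n \<sigma>1 m02 n w z))))"
proof -
  define \<alpha> where "\<alpha> = min \<alpha>1 \<alpha>2"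
  have \<alpha>: "1/2 < \<alpha>" "0 < \<alpha>" "\<alpha> \<le> \<alpha>1" "\<alpha> \<le> \<alpha>2" using \<alpha>12 by (auto simp: \<alpha>_def)
  define J where "J = level \<alpha>"
  define D where "D n = (2 ^ J n :: real)" for n
  \<comment> \<open>The loss from rounding the level down:
    \<open>sqrt n \<le> c4 * 2 powr (J * (\<alpha> + 1/2))\<close>.\<close>
  define c4 where "c4 = 2 powr (\<alpha> + 1/2)"
  define Kc where "Kc = 2 + 2 * (2 * M) * C * c4 / (1 - 2 powr (- \<alpha>)) + 2 * M"
  \<comment> \<open>Large enough for \<open>k * J\<close> to dominate the modulus constant
    \<open>Kc * J\<close>, the score bound \<open>J\<close> and, once \<open>J \<ge> 1\<close>, the
    bound \<open>s + a\<close> on the mean square of \<open>u\<close>.\<close>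
  define k where "k = Kc + s + a + 1"
  define A where "A n = k * real (J n)" for n
  define R where "R n = real (J n) ^ 3 * D n" for n
  define E where "E n = 2 * (A n * (sqrt (D n) * sqrt (R n) + D n)) + R n" for n
  define \<delta> where "\<delta> n = 3 * (E n * (2 + B + A n / (a * sqrt (real n))) * sqrt 2 / (\<sigma>1 * sqrt a * sqrt (real n)))
      + 3 * (2 * E n / (a * real n))" for n
  define \<kappa> where "\<kappa> n = 4 * \<sigma>1\<^sup>2 / (a * real n * (B - \<bar>\<beta>0\<bar>)\<^sup>2)" for n
  define \<eta> where "\<eta> n = 4 * M * C * 2 powr (- (real (J n) * \<alpha>)) / (1 - 2 powr (- \<alpha>))" for n
  \<comment> \<open>Makes \<open>n * (\<eta> n)\<^sup>2 \<le> c3 * D n\<close> for all relevant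
    \<open>n\<close>, so that the constant of the lower likelihood bound can be fixed
    beforehand.\<close>
  define c3 where "c3 = (4 * M * C * c4 / (1 - 2 powr (- \<alpha>)))\<^sup>2"
  define c5 where "c5 = sqrt s * C * c4 / (1 - 2 powr (- (\<alpha> - 1/2)))"
  have q: "0 < 1 - 2 powr (- \<alpha>)" "0 < 1 - 2 powr (- (\<alpha> - 1/2))"
    using geometric_two_powr(3)[of \<alpha>] geometric_two_powr(3)[of "\<alpha> - 1/2"] \<alpha> by auto
  have c4: "0 < c4" by (simp add: c4_def)
  have c3: "0 < c3" unfolding c3_def using M loc(2) c4 q by (intro zero_less_power divide_pos_pos mult_pos_pos) auto
  have c5: "0 \<le> c5" unfolding c5_def using s loc(2) c4 q by (intro divide_nonneg_nonneg mult_nonneg_nonneg) auto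
  have Kc: "0 \<le> Kc" unfolding Kc_def using M loc(2) c4 q
    by (intro add_nonneg_nonneg divide_nonneg_nonneg mult_nonneg_nonneg) auto
  have k: "1 \<le> k" "Kc \<le> k" "s + a \<le> k" using Kc s a by (auto simp: k_def)
  have Bpos: "0 < B" using B by linarith
  obtain c Cu where c: "0 < c" "0 < Cu" and up: "upper_constants \<sigma>1 \<sigma>2 B a c Cu"
    using log_ratio_upper[OF \<sigma> Bpos a] by blast
  obtain Cl where Cl: "0 < Cl" and low: "lower_constant \<sigma>1 \<sigma>2 B c3 Cl"
    using log_ratio_lower[OF \<sigma> Bpos c3] by blast
  define \<rho> where "\<rho> n = exp (- c * R n + Cu * (A n)\<^sup>2 * D n) / (exp (- Cl * A n * D n) * (1 / sqrt (real n) / B) *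
      ((2 powr (- (real (J n) * \<alpha>1)) / 2) ^ (2 ^ J n) * (2 powr (- (real (J n) * \<alpha>2)) / 2) ^ (2 ^ J n)))" for n
  define \<tau> where "\<tau> n = 2 * (2 * \<kappa> n + 3 * \<delta> n) + \<rho> n" for n
  \<comment> \<open>Failure probability of the good event with \<open>J n\<close> as multiplier; it
    vanishes because \<open>J n\<close> tends to infinity.\<close>
  define b where "b n = 2 * (s / real (J n)) + 2 * (c5 / real (J n)) + s / (real (J n))\<^sup>2 + s / (a\<^sup>2 * real n)" for n
  have Jtop: "filterlim (\<lambda>n. real (J n)) at_top sequentially"
    unfolding J_def by (rule filterlim_compose[OF filterlim_real_sequentially level_at_top[OF \<alpha>(2)]])
  have inv_n: "(\<lambda>n. 1 / real n) \<longlonglongrightarrow> 0" by (rule lim_1_over_n)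
  have inv_s: "(\<lambda>n. 1 / sqrt (real n)) \<longlonglongrightarrow> 0" by (rule inverse_sqrt_tendsto)
  have inv_J: "(\<lambda>n. 1 / real (J n)) \<longlonglongrightarrow> 0"
    by (rule tendsto_divide_0[OF tendsto_const filterlim_at_top_imp_at_infinity[OF Jtop]])
  have A_s: "(\<lambda>n. A n / sqrt (real n)) \<longlonglongrightarrow> 0"
    using tendsto_mult[OF tendsto_const[of k] level_over_sqrt_tendsto[OF \<alpha>(1)]] by (simp add: A_def J_def)
  have E_s: "(\<lambda>n. E n / sqrt (real n)) \<longlonglongrightarrow> 0"
    using center_rate[OF \<alpha>(1), of k] k(1) unfolding E_def A_def R_def D_def J_def by simp
  have E_n: "(\<lambda>n. E n / real n) \<longlonglongrightarrow> 0"
  proof -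
    have "(\<lambda>n. (E n / sqrt (real n)) * (1 / sqrt (real n))) \<longlonglongrightarrow> 0 * 0" by (intro tendsto_mult E_s inv_s)
    then show ?thesis by simp
  qed
  have \<delta>0: "\<delta> \<longlonglongrightarrow> 0"
  proof -
    have "(\<lambda>n. 3 * ((E n / sqrt (real n)) * (2 + B + (A n / sqrt (real n)) / a) * (sqrt 2 / (\<sigma>1 * sqrt a)))
        + 3 * (2 / a * (E n / real n))) \<longlonglongrightarrow> 3 * (0 * (2 + B + 0 / a) * (sqrt 2 / (\<sigma>1 * sqrt a))) + 3 * (2 / a * 0)"
      using a by (intro tendsto_intros E_s A_s E_n) auto
    moreover have "3 * ((E n / sqrt (real n)) * (2 + B + (A n / sqrt (real n)) / a) * (sqrt 2 / (\<sigma>1 * sqrt a)))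
        + 3 * (2 / a * (E n / real n)) = \<delta> n" for n unfolding \<delta>_def by (simp add: mult_ac)
    ultimately show ?thesis by simp
  qed
  have \<kappa>0: "\<kappa> \<longlonglongrightarrow> 0"
  proof -
    have "(\<lambda>n. 4 * \<sigma>1\<^sup>2 / (a * (B - \<bar>\<beta>0\<bar>)\<^sup>2) * (1 / real n)) \<longlonglongrightarrow> 4 * \<sigma>1\<^sup>2 / (a * (B - \<bar>\<beta>0\<bar>)\<^sup>2) * 0"
      by (intro tendsto_mult tendsto_const inv_n)
    then show ?thesis unfolding \<kappa>_def by (simp add: mult_ac)
  qed
  have \<rho>0: "\<rho> \<longlonglongrightarrow> 0"
    unfolding \<rho>_def[abs_def] A_def R_def D_def J_def
    by (rule mass_ratio_rate) (use \<alpha> \<alpha>12 k c Cl Bpos in auto)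
  have \<tau>0: "\<tau> \<longlonglongrightarrow> 0"
  proof -
    have "\<tau> \<longlonglongrightarrow> 2 * (2 * 0 + 3 * 0) + 0" unfolding \<tau>_def[abs_def] by (intro tendsto_intros \<kappa>0 \<delta>0 \<rho>0)
    then show ?thesis by simp
  qed
  have b0: "b \<longlonglongrightarrow> 0"
  proof -
    have "(\<lambda>n. 2 * (s * (1 / real (J n))) + 2 * (c5 * (1 / real (J n))) + s * (1 / real (J n))\<^sup>2 + s / a\<^sup>2 * (1 / real n))
        \<longlonglongrightarrow> 2 * (s * 0) + 2 * (c5 * 0) + s * 0\<^sup>2 + s / a\<^sup>2 * 0"
      by (intro tendsto_intros inv_J inv_n)
    then show ?thesis unfolding b_def by (simp add: power_divide)
  qed
  have ev1: "eventually (\<lambda>n. E n / real n < a / 2) sequentially" using order_tendstoD(2)[OF E_n, of "a / 2"] a by simp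
  have ev2: "eventually (\<lambda>n. A n / sqrt (real n) < a * (B - \<bar>\<beta>0\<bar>) / 2) sequentially"
    using order_tendstoD(2)[OF A_s, of "a * (B - \<bar>\<beta>0\<bar>) / 2"] a B by simp
  have ev3: "eventually (\<lambda>n. \<kappa> n + \<delta> n < 1/2) sequentially"
    using order_tendstoD(2)[OF tendsto_add[OF \<kappa>0 \<delta>0], of "1/2"] by simp
  have ev4: "eventually (\<lambda>n. 1 / sqrt (real n) < B - \<bar>\<beta>0\<bar>) sequentially"
    using order_tendstoD(2)[OF inv_s, of "B - \<bar>\<beta>0\<bar>"] B by simp
  have ev5: "eventually (\<lambda>n. 1 \<le> real (J n)) sequentially"
    by (rule filterlim_at_top[THEN iffD1, OF Jtop, rule_format])
  define u where "u i z = snd z - m02 (w i)" for i and z :: "real \<times> real"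
  define \<xi> where "\<xi> i z = fst z - m01 (w i) - \<beta>0 * (snd z - m02 (w i))" for i and z :: "real \<times> real"
  show ?thesis
  proof (rule tendsto_zero_in_probI[OF _ \<tau>0 b0])
    show "prob_space (PiM {..<n} (\<lambda>i. K (w i)))" for n by (intro prob_space_PiM K)
    show "eventually (\<lambda>n. \<exists>G\<in>sets (PiM {..<n} (\<lambda>i. K (w i))).
        measure (PiM {..<n} (\<lambda>i. K (w i))) (space (PiM {..<n} (\<lambda>i. K (w i))) - G) \<le> b n \<and>
        (\<forall>z\<in>G. \<bar>tv_dist (beta_posterior (prior \<psi> \<alpha>1 \<alpha>2 M B) \<sigma>1 \<sigma>2 n w z)
                (normal_law (\<beta>0 + Delta_n \<sigma>1 \<beta>0 m01 m02 n w z / sqrt (real n))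
                            ((1 / real n) * inverse (info_n \<sigma>1 m02 n w z)))\<bar> \<le> \<tau> n)) sequentially"
      using var eventually_gt_at_top[of 0] ev1 ev2 ev3 ev4 ev5
    proof eventually_elim
      case (elim n)
      note var_n = elim(1) and n = elim(2) and J1 = elim(7)
      have sn: "0 < sqrt (real n)" using n by simp
      have Dn: "1 \<le> D n" by (simp add: D_def)
      have sD: "sqrt (D n) = 2 powr (real (J n) / 2)"
        by (simp add: D_def powr_half_sqrt[symmetric] powr_realpow[symmetric] powr_powr)
      have sq_le: "sqrt (real n) \<le> c4 * 2 powr (real (J n) * (\<alpha> + 1/2))"
      proof -
        have "sqrt (real n) \<le> 2 powr ((real (J n) + 1) * (\<alpha> + 1/2))"
          using level_bounds(2)[OF \<alpha>(2) n] by (simp add: J_def)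
        also have "(real (J n) + 1) * (\<alpha> + 1/2) = (\<alpha> + 1/2) + real (J n) * (\<alpha> + 1/2)" by (simp add: algebra_simps)
        finally show ?thesis unfolding c4_def powr_add .
      qed
      have c4n: "sqrt (real n) * 2 powr (- (real (J n) * \<alpha>)) \<le> c4 * sqrt (D n)"
      proof -
        have "sqrt (real n) * 2 powr (- (real (J n) * \<alpha>)) \<le> c4 * 2 powr (real (J n) * (\<alpha> + 1/2)) * 2 powr (- (real (J n) * \<alpha>))"
          by (rule mult_right_mono[OF sq_le]) simp
        also have "\<dots> = c4 * 2 powr (real (J n) * (\<alpha> + 1/2) + - (real (J n) * \<alpha>))" by (simp only: powr_add mult.assoc)
        also have "real (J n) * (\<alpha> + 1/2) + - (real (J n) * \<alpha>) = real (J n) / 2" by (simp add: algebra_simps)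
        finally show ?thesis unfolding sD .
      qed
      have hfb: "sqrt s * C * sqrt (real n) * 2 powr (- (real (J n) * (\<alpha> - 1/2))) / (1 - 2 powr (- (\<alpha> - 1/2))) \<le> c5 * D n"
      proof -
        have "sqrt (real n) * 2 powr (- (real (J n) * (\<alpha> - 1/2)))
            \<le> c4 * 2 powr (real (J n) * (\<alpha> + 1/2)) * 2 powr (- (real (J n) * (\<alpha> - 1/2)))"
          by (rule mult_right_mono[OF sq_le]) simp
        also have "\<dots> = c4 * 2 powr (real (J n) * (\<alpha> + 1/2) + - (real (J n) * (\<alpha> - 1/2)))" by (simp only: powr_add mult.assoc)
        also have "real (J n) * (\<alpha> + 1/2) + - (real (J n) * (\<alpha> - 1/2)) = real (J n)" by (simp add: algebra_simps)
        also have "2 powr real (J n) = D n" by (simp add: D_def powr_realpow)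
        finally have h: "sqrt (real n) * 2 powr (- (real (J n) * (\<alpha> - 1/2))) \<le> c4 * D n" .
        have "sqrt s * C / (1 - 2 powr (- (\<alpha> - 1/2))) * (sqrt (real n) * 2 powr (- (real (J n) * (\<alpha> - 1/2))))
            \<le> sqrt s * C / (1 - 2 powr (- (\<alpha> - 1/2))) * (c4 * D n)"
          using q s loc(2) by (intro mult_left_mono[OF h]) auto
        then show ?thesis by (simp add: c5_def mult_ac)
      qed
      obtain bs where bs: "finite bs" "card bs \<le> card (low_freq_index (J n))" "\<And>b. b \<in> bs \<Longrightarrow> (\<Sum>i<n. (b i)\<^sup>2) = 1"
        and bas: "\<And>x a. (\<Sum>i<n. x i * (\<Sum>j\<in>low_freq_index (J n). a j * \<psi> (fst j) (snd j) (w i)))\<^sup>2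
         \<le> (\<Sum>b\<in>bs. (\<Sum>i<n. x i * b i)\<^sup>2) * (\<Sum>i<n. (\<Sum>j\<in>low_freq_index (J n). a j * \<psi> (fst j) (snd j) (w i))\<^sup>2)"
        using inner_linear_span_bound[of "{..<n}" "low_freq_index (J n)" "\<lambda>j i. \<psi> (fst j) (snd j) (w i)"]
          finite_low_freq_index by blast
      have bsc: "card bs \<le> 2 ^ J n" using bs(2) card_low_freq_index[of "J n"] by linarith
      have J0: "0 < real (J n)" using J1 by linarith
      have res': "residual_law s (K (w i)) (\<xi> i) (u i)" for i
        using res[of i] by (simp add: \<xi>_def[abs_def] u_def[abs_def])
      have var': "2 * a * real n \<le> (\<Sum>i<n. \<integral>x. (u i x)\<^sup>2 \<partial>K (w i))" using var_n by (simp add: u_def)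
      obtain G where G: "G \<in> sets (PiM {..<n} (\<lambda>i. K (w i)))"
        "measure (PiM {..<n} (\<lambda>i. K (w i))) (space (PiM {..<n} (\<lambda>i. K (w i))) - G) \<le> b n"
        and Gz: "\<forall>z\<in>G. (\<forall>v\<in>{\<lambda>i. \<xi> i (z i), \<lambda>i. u i (z i)}.
            (\<Sum>b\<in>bs. (\<Sum>i<n. v i * b i)\<^sup>2) \<le> real (J n) * D n \<and> (\<Sum>l. high_freq \<psi> \<alpha> (J n) n w v l) \<le> real (J n) * D n) \<and>
          \<bar>dotp n (\<lambda>i. \<xi> i (z i)) (\<lambda>i. u i (z i))\<bar> \<le> real (J n) * sqrt (real n) \<and>
          a * real n \<le> dotp n (\<lambda>i. u i (z i)) (\<lambda>i. u i (z i)) \<and>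
          dotp n (\<lambda>i. u i (z i)) (\<lambda>i. u i (z i)) \<le> (s + a) * real n"
        using good_event[where w = w and n = n, OF K res' s a loc \<alpha>(1) n w bs(1) bsc bs(3) J0 D_def c5 hfb var', folded b_def]
        by - (drule meta_mp, assumption, elim bexE conjE, (rule that; assumption))
      have A1: "1 \<le> A n" and JA: "real (J n) \<le> A n" and KA: "Kc * real (J n) \<le> A n" and sA: "s + a \<le> A n"
      proof -
        have "1 * real (J n) \<le> k * real (J n)" using k J1 by (intro mult_right_mono) auto
        then show "real (J n) \<le> A n" by (simp add: A_def)
        then show "1 \<le> A n" using J1 by linarith
        show "Kc * real (J n) \<le> A n" unfolding A_def using k J1 by (intro mult_right_mono) auto
        have "k * 1 \<le> k * real (J n)" using k J1 by (intro mult_left_mono) auto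
        then show "s + a \<le> A n" using k unfolding A_def by linarith
      qed
      have R0: "0 \<le> R n" using Dn by (simp add: R_def)
      have \<eta>n: "real n * (\<eta> n)\<^sup>2 \<le> c3 * D n"
      proof -
        have "sqrt (real n) * \<eta> n = 4 * M * C / (1 - 2 powr (- \<alpha>)) * (sqrt (real n) * 2 powr (- (real (J n) * \<alpha>)))"
          by (simp add: \<eta>_def)
        also have "\<dots> \<le> 4 * M * C / (1 - 2 powr (- \<alpha>)) * (c4 * sqrt (D n))"
          using M loc(2) q by (intro mult_left_mono[OF c4n]) auto
        finally have le: "sqrt (real n) * \<eta> n \<le> 4 * M * C * c4 / (1 - 2 powr (- \<alpha>)) * sqrt (D n)" by simp
        have "0 \<le> sqrt (real n) * \<eta> n" unfolding \<eta>_def using M loc(2) q by (intro mult_nonneg_nonneg divide_nonneg_nonneg) auto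
        then have "(sqrt (real n) * \<eta> n)\<^sup>2 \<le> (4 * M * C * c4 / (1 - 2 powr (- \<alpha>)) * sqrt (D n))\<^sup>2"
          by (intro power_mono le)
        also have "\<dots> = c3 * D n" unfolding c3_def power_mult_distrib using Dn by simp
        finally show ?thesis by (simp add: power_mult_distrib)
      qed
      have small1: "2 * E n \<le> a * real n" using elim(3) n by (simp add: field_simps)
      have small2: "2 * A n / (a * sqrt (real n)) \<le> B - \<bar>\<beta>0\<bar>"
        using elim(4) sn a by (simp add: field_simps)
      have tv: "\<bar>tv_dist (beta_posterior (prior \<psi> \<alpha>1 \<alpha>2 M B) \<sigma>1 \<sigma>2 n w z)
                (normal_law (\<beta>0 + Delta_n \<sigma>1 \<beta>0 m01 m02 n w z / sqrt (real n))
                            ((1 / real n) * inverse (info_n \<sigma>1 m02 n w z)))\<bar> \<le> \<tau> n" if z: "z \<in> G" for z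
      proof -
        define u' where "u' = (\<lambda>i. snd (z i) - m02 (w i))"
        define \<xi>' where "\<xi>' = (\<lambda>i. fst (z i) - m01 (w i) - \<beta>0 * (snd (z i) - m02 (w i)))"
        have uu: "(\<lambda>i. u i (z i)) = u'" "(\<lambda>i. \<xi> i (z i)) = \<xi>'" by (simp_all add: u_def u'_def \<xi>_def \<xi>'_def)
        note Gz' = bspec[OF Gz z, unfolded uu]
        have dom: "AE m in wavelet_series_prior \<psi> \<alpha>' M. \<forall>v\<in>{\<xi>', u'}. dominated (A n) (D n) n v (\<lambda>i. m (w i) - m0 (w i))"
          if "\<alpha> \<le> \<alpha>'" "coeff_bounded M \<nu>0" "\<And>i. m0 (w i) = wavelet_series \<psi> \<alpha>' \<nu>0 (w i)" for \<alpha>' m0 \<nu>0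
        proof -
          have "AE m in wavelet_series_prior \<psi> \<alpha>' M.
              \<forall>v\<in>{\<xi>', u'}. dominated (Kc * real (J n)) (D n) n v (\<lambda>i. m (w i) - m0 (w i))"
            unfolding Kc_def
            by (rule AE_prior_dominated[OF M loc(1) \<alpha>(2) that(1,2) w that(3) bas J1 _ c4n]) (use Dn Gz' in auto)
          then show ?thesis by eventually_elim (use dominated_mono[OF _ KA] Dn in auto)
        qed
        have near: "(2 powr (- (real (J n) * \<alpha>')) / 2) ^ (2 ^ J n)
           \<le> measure (wavelet_series_prior \<psi> \<alpha>' M) {m\<in>space (wavelet_series_prior \<psi> \<alpha>' M). \<forall>i<n. \<bar>m (w i) - m0 (w i)\<bar> \<le> \<eta> n}"
          if "\<alpha> \<le> \<alpha>'" "coeff_bounded M \<nu>0" "\<And>i. m0 (w i) = wavelet_series \<psi> \<alpha>' \<nu>0 (w i)" for \<alpha>' m0 \<nu>0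
          unfolding \<eta>_def by (rule prior_small_ball[OF M loc(1) \<alpha>(2) that(1,2)]) (rule w that(3))+
        have S: "\<bar>dotp n \<xi>' u'\<bar> \<le> A n * sqrt (real n)"
        proof -
          have "real (J n) * sqrt (real n) \<le> A n * sqrt (real n)" using JA by (intro mult_right_mono) auto
          then show ?thesis using Gz' by linarith
        qed
        have P: "a * real n \<le> dotp n u' u'" "dotp n u' u' \<le> A n * real n"
        proof -
          have "(s + a) * real n \<le> A n * real n" using sA by (intro mult_right_mono) auto
          then show "a * real n \<le> dotp n u' u'" "dotp n u' u' \<le> A n * real n" using Gz' by linarith+
        qed
        show ?thesis
          unfolding \<tau>_def \<rho>_def prior_def
          unfolding \<kappa>_def \<delta>_def E_def
        proof (rule tv_beta_posterior_le[where a = a and ?c3.0 = c3 and \<eta> = "\<eta> n"], unfold u'_def[symmetric] \<xi>'_def[symmetric])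
          show "prob_space (wavelet_series_prior \<psi> \<alpha>1 M)" "prob_space (wavelet_series_prior \<psi> \<alpha>2 M)"
            by (rule prob_space_wavelet_series_prior[OF M])+
          show "0 \<le> c" using c by simp
          show "2 * (2 * (A n * (sqrt (D n) * sqrt (R n) + D n)) + R n) \<le> a * real n" using small1 by (simp only: E_def)
          show "4 * \<sigma>1\<^sup>2 / (a * real n * (B - \<bar>\<beta>0\<bar>)\<^sup>2)
              + (3 * ((2 * (A n * (sqrt (D n) * sqrt (R n) + D n)) + R n) * (2 + B + A n / (a * sqrt (real n))) * sqrt 2 / (\<sigma>1 * sqrt a * sqrt (real n)))
               + 3 * (2 * (2 * (A n * (sqrt (D n) * sqrt (R n) + D n)) + R n) / (a * real n))) \<le> 1 / 2"
            using elim(5) by (simp only: E_def \<delta>_def \<kappa>_def)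
          show "1 / sqrt (real n) \<le> B - \<bar>\<beta>0\<bar>" using elim(6) by simp
        qed (rule sets_wavelet_series_prior w n \<sigma> B a A1 Dn R0 up low S P small2 \<eta>n
            dom[OF \<alpha>(3) \<nu>(1) m0(1)] dom[OF \<alpha>(4) \<nu>(2) m0(2)] near[OF \<alpha>(3) \<nu>(1) m0(1)] near[OF \<alpha>(4) \<nu>(2) m0(2)] | simp)+
      qed
      show ?case using G tv by blast
    qed
  qed
qed

section \<open>Almost every design\<close>

theorem proposition3:
  fixes P0 :: "(real \<times> real \<times> real) measure"
    and K \<kappa> :: "real \<Rightarrow> (real \<times> real) measure"
    and m01 m02 \<eta>0 q :: "real \<Rightarrow> real"
    and p :: "real \<Rightarrow> real \<times> real \<Rightarrow> real"
    and H :: "(real \<Rightarrow> real) set"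
    and B M \<alpha>1 \<alpha>2 \<beta>0 \<sigma>01 \<sigma>02 c_lo c_hi q_lo q_hi :: real
    and \<psi> :: "nat \<Rightarrow> nat \<Rightarrow> real \<Rightarrow> real"
  assumes "prob_space P0" and "sets P0 = sets borel"
    and "0 < B" and "0 < M" and "1/2 < \<alpha>1" and "1/2 < \<alpha>2"
    and "0 < \<sigma>01" and "0 < \<sigma>02"
    and wavelets: "wavelet_basis_01 \<psi>" "characterizes_hz \<psi> \<alpha>1" "characterizes_hz \<psi> \<alpha>2"
    and cond_law: "is_cond_law P0 (\<lambda>z. (Y_of z, X_of z)) W_of K"
    and m01: "m01 \<in> borel_measurable borel"
      "AE z in P0. cond_exp_given P0 Y_of W_of z = m01 (W_of z)"
    and m02: "m02 \<in> borel_measurable borel"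
      "AE z in P0. cond_exp_given P0 X_of W_of z = m02 (W_of z)"
    and i: "AE z in P0. cond_exp_given P0 Y_of (\<lambda>z. (X_of z, W_of z)) z
              = X_of z * \<beta>0 + \<eta>0 (W_of z)"
      "AE z in P0. cond_var_given P0 Y_of (\<lambda>z. (X_of z, W_of z)) z = \<sigma>01\<^sup>2"
      "H \<subseteq> L2_W P0" "\<eta>0 \<in> H" "\<beta>0 \<in> {-B<..<B}"
    and ii: "0 < c_lo" "c_lo < c_hi"
      "(\<integral>z. (X_of z - m02 (W_of z))\<^sup>2 \<partial>P0) \<in> {c_lo..c_hi}"
    and iii: "(\<lambda>(w, u). p w u) \<in> borel_measurable borel" "\<And>w u. 0 \<le> p w u"
      "AE w in distr P0 borel W_of. K w = density lborel (\<lambda>u. ennreal (p w u))"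
      "integrable P0 (\<lambda>z. ln (p (W_of z) (Y_of z, X_of z)))"
      "0 < (\<integral>z. \<bar>ln (p (W_of z) (Y_of z, X_of z))\<bar> \<partial>P0)"
    and iv: "integrable P0 (\<lambda>z. (Y_of z - m01 (W_of z))\<^sup>2)"
      "0 < (\<integral>z. (Y_of z - m01 (W_of z))\<^sup>2 \<partial>P0)"
      "integrable P0 (\<lambda>z. (X_of z - m02 (W_of z)) ^ 4)"
      "0 < (\<integral>z. (X_of z - m02 (W_of z)) ^ 4 \<partial>P0)"
    and v: "is_cond_law P0 (\<lambda>z. (Y_of z - m01 (W_of z), X_of z - m02 (W_of z))) W_of \<kappa>"
      "subgaussian_on {0..1} \<kappa>" "weakly_continuous_on {0..1} \<kappa>"
    and vi: "q \<in> borel_measurable borel" "0 < q_lo" "\<And>w. w \<in> {0..1} \<Longrightarrow> q w \<in> {q_lo..q_hi}"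
      "distr P0 borel W_of = density lborel (\<lambda>w. ennreal (q w * indicator {0..1} w))"
    and vii: "m01 \<in> hz_ball \<psi> \<alpha>1 M" "m02 \<in> hz_ball \<psi> \<alpha>2 M"
  shows "AE w in PiM UNIV (\<lambda>i::nat. distr P0 borel W_of).
           tendsto_zero_in_prob (\<lambda>n. PiM {..<n} (\<lambda>i. K (w i)))
             (\<lambda>n z. tv_dist
                (beta_posterior (prior \<psi> \<alpha>1 \<alpha>2 M B) \<sigma>01 \<sigma>02 n w z)
                (normal_law (\<beta>0 + Delta_n \<sigma>01 \<beta>0 m01 m02 n w z / sqrt (real n))
                            ((1 / real n) * inverse (info_n \<sigma>01 m02 n w z))))"
proof -
  interpret P0: prob_space P0 by fact
  define PW where "PW = distr P0 borel W_of"
  have W: "W_of \<in> borel_measurable P0"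
    using assms(2) by (simp add: borel_prod[symmetric] cong: measurable_cong_sets)
  have PW: "prob_space PW" unfolding PW_def by (rule P0.prob_space_distr[OF W])
  have qm: "(\<lambda>w. ennreal (q w * indicator {0..1} w)) \<in> borel_measurable lborel"
    using vi(1) by measurable
  \<comment> \<open>The law of \<open>W\<close> has a density supported on the unit interval, so
    Lebesgue null sets there are null for \<open>W\<close>; equality with the series representatives
    thus passes to design points.\<close>
  have AE01: "AE w in PW. w \<in> {0..1} \<and> Q w" if "AE w in lborel01. Q w" for Q
  proof -
    have "AE w in lborel. w \<in> {0..1} \<longrightarrow> Q w"
      using that by (simp add: AE_restrict_space_iff)
    then have "AE w in lborel. 0 < ennreal (q w * indicator {0..1} w) \<longrightarrow> w \<in> {0..1} \<and> Q w"
      by eventually_elim (auto simp: indicator_def split: if_splits)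
    then show ?thesis unfolding PW_def vi(4) by (simp only: AE_density[OF qm])
  qed
  have \<alpha>: "0 < \<alpha>1" "0 < \<alpha>2" using \<open>1/2 < \<alpha>1\<close> \<open>1/2 < \<alpha>2\<close> by auto
  obtain C where "localized \<psi> C" by (rule wavelet_basis_localized[OF wavelets(1)])
  \<comment> \<open>Adding 1 makes the localization constant strictly positive.\<close>
  then have loc: "localized \<psi> (C + 1)" "0 < C + 1"
    by (auto simp: localized_def distrib_right intro: add_increasing2)
  note M0 = less_imp_le[OF \<open>0 < M\<close>]
  obtain \<nu>1 where \<nu>1: "coeff_bounded M \<nu>1" "AE x in lborel01. m01 x = wavelet_series \<psi> \<alpha>1 \<nu>1 x"
    "continuous_on {0..1} (wavelet_series \<psi> \<alpha>1 \<nu>1)"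
    by (rule hz_ball_series[OF wavelets(1) loc(1) \<alpha>(1) M0 vii(1)])
  obtain \<nu>2 where \<nu>2: "coeff_bounded M \<nu>2" "AE x in lborel01. m02 x = wavelet_series \<psi> \<alpha>2 \<nu>2 x"
    "continuous_on {0..1} (wavelet_series \<psi> \<alpha>2 \<nu>2)"
    by (rule hz_ball_series[OF wavelets(1) loc(1) \<alpha>(2) M0 vii(2)])
  obtain k1 where k1: "\<And>x. x \<in> {0..1} \<Longrightarrow> \<bar>wavelet_series \<psi> \<alpha>1 \<nu>1 x\<bar> \<le> k1"
    using continuous_on_01_bounded[OF \<nu>1(3)] by metis
  obtain k2 where k2: "\<And>x. x \<in> {0..1} \<Longrightarrow> \<bar>wavelet_series \<psi> \<alpha>2 \<nu>2 x\<bar> \<le> k2"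
    using continuous_on_01_bounded[OF \<nu>2(3)] by metis
  have series: "AE w in PW. w \<in> {0..1} \<and> m01 w = wavelet_series \<psi> \<alpha>1 \<nu>1 w"
    "AE w in PW. w \<in> {0..1} \<and> m02 w = wavelet_series \<psi> \<alpha>2 \<nu>2 w"
    by (rule AE01[OF \<nu>1(2)] AE01[OF \<nu>2(2)])+
  have bd: "AE w in PW. \<bar>m01 w\<bar> \<le> max k1 k2 \<and> \<bar>m02 w\<bar> \<le> max k1 k2"
    using series
  proof eventually_elim
    case (elim w)
    then have "\<bar>m01 w\<bar> \<le> k1" "\<bar>m02 w\<bar> \<le> k2" using k1[of w] k2[of w] by auto
    then show ?case by auto
  qed
  have W01: "AE w in PW. w \<in> {0..1}" using series(1) by eventually_elim simp
  have \<eta>0: "\<eta>0 \<in> L2_W P0" using i(3,4) by blast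
  have c_le: "c_lo \<le> (\<integral>z. (X_of z - m02 (W_of z))\<^sup>2 \<partial>P0)" using ii(3) by simp
  obtain s where s: "0 < s"
    "AE w in PW. residual_law s (K w) (\<lambda>z. fst z - m01 w - \<beta>0 * (snd z - m02 w)) (\<lambda>z. snd z - m02 w)"
    "(\<lambda>w. \<integral>z. (snd z - m02 w)\<^sup>2 \<partial>K w) \<in> borel_measurable borel"
    "c_lo \<le> (\<integral>w. (\<integral>z. (snd z - m02 w)\<^sup>2 \<partial>K w) \<partial>PW)"
    by (rule AE_residual_law[OF assms(1,2) cond_law m01 m02 i(1) \<eta>0 c_le iv(1,3) v(1,2)
          W01[unfolded PW_def] bd[unfolded PW_def], folded PW_def])
  define h where "h w = (\<integral>z. (snd z - m02 w)\<^sup>2 \<partial>K w)" for w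
  have hm: "h \<in> borel_measurable PW" using s(3) by (simp add: h_def[abs_def] PW_def)
  \<comment> \<open>The uniform moment bound makes the conditional variance bounded, as Hoeffding's
    inequality requires.\<close>
  have hb: "AE w in PW. h w \<in> {0..s}"
    using s(2) by eventually_elim (auto simp: residual_law_def h_def)
  have "AE \<omega> in PiM UNIV (\<lambda>_::nat. PW). eventually (\<lambda>n. real n * ((\<integral>x. h x \<partial>PW) - c_lo / 2) < (\<Sum>i<n. h (\<omega> i))) sequentially"
    by (rule eventually_sum_iid_gt[OF PW hm hb s(1)]) (use ii(1) in simp)
  \<comment> \<open>Half of \<open>c_lo\<close> is given up to the deviation; the other half has to
    be \<open>2 * a\<close>, hence \<open>a = c_lo / 4\<close>.\<close>
  then have var: "AE w in PiM UNIV (\<lambda>_::nat. PW). eventually (\<lambda>n. 2 * (c_lo / 4) * real n \<le> (\<Sum>i<n. h (w i))) sequentially"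
  proof eventually_elim
    case (elim w)
    have le: "c_lo / 2 \<le> (\<integral>x. h x \<partial>PW) - c_lo / 2" using s(4) by (simp add: h_def)
    from elim show ?case
    proof eventually_elim
      case (elim n)
      have "real n * (c_lo / 2) \<le> real n * ((\<integral>x. h x \<partial>PW) - c_lo / 2)" by (intro mult_left_mono[OF le]) simp
      moreover have "2 * (c_lo / 4) * real n = real n * (c_lo / 2)" by simp
      ultimately show ?case using elim by linarith
    qed
  qed
  \<comment> \<open>There are countably many coordinates, so a property of almost every point holds
    along almost every whole sequence.\<close>
  have AEi: "AE w in PiM UNIV (\<lambda>_::nat. PW). \<forall>i. Q (w i)" if "AE x in PW. Q x" for Q
    unfolding AE_all_countable by (intro allI AE_PiM_component that PW) auto
  have "AE w in PiM UNIV (\<lambda>_::nat. PW).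
      tendsto_zero_in_prob (\<lambda>n. PiM {..<n} (\<lambda>i. K (w i)))
             (\<lambda>n z. tv_dist
                (beta_posterior (prior \<psi> \<alpha>1 \<alpha>2 M B) \<sigma>01 \<sigma>02 n w z)
                (normal_law (\<beta>0 + Delta_n \<sigma>01 \<beta>0 m01 m02 n w z / sqrt (real n))
                            ((1 / real n) * inverse (info_n \<sigma>01 m02 n w z))))"
    using var AEi[OF series(1)] AEi[OF series(2)] AEi[OF s(2)]
  proof eventually_elim
    case (elim w)
    show ?case
    proof (rule bernstein_von_mises_fixed_design[OF _ \<open>0 < M\<close> \<open>1/2 < \<alpha>1\<close> \<open>1/2 < \<alpha>2\<close> \<open>0 < \<sigma>01\<close> \<open>0 < \<sigma>02\<close> loc s(1) _ _ \<nu>1(1) \<nu>2(1)])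
      show "\<bar>\<beta>0\<bar> < B" using i(5) by auto
      show "0 < c_lo / 4" using ii(1) by simp
      show "prob_space (K x)" for x by (rule cond_law_kernel(2)[OF cond_law])
      show "eventually (\<lambda>n. 2 * (c_lo / 4) * real n \<le> (\<Sum>i<n. \<integral>z. (snd z - m02 (w i))\<^sup>2 \<partial>K (w i))) sequentially"
        using elim(1) by (simp add: h_def)
    qed (use elim in auto)
  qed
  then show ?thesis unfolding PW_def .
qed

end
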